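(* Let $q$ be a prime number, and let $\mathbb{Q}_q$ and $\mathbb{Z}_q$ denote respectively the field of $q$-adic numbers and the ring of $q$-adic integers. For the Hecke pair $(G,\Gamma):=(PSL_2(\mathbb{Q}_q),PSL_2(\mathbb{Z}_q))$ we have $$C^*(L^1(G,\Gamma))\ncong pC^*(G)p ,$$ i.e. the canonical surjection $C^*(L^1(G,\Gamma))\to pC^*(G)p$ is not an isomorphism.
   Context: $PSL_2(\mathbb{Q}_q)=SL_2(\mathbb{Q}_q)/\{\pm1\}$ carries its usual ($q$-adic) totally disconnected locally compact topology, and $\Gamma=PSL_2(\mathbb{Z}_q)$, the image of $SL_2(\mathbb{Z}_q)$, is a compact open subgroup. This pair is a Hecke pair (every double coset $\Gamma g\Gamma$ is a finite union of left cosets of $\Gamma$), and it coincides with its own Schlichting completion. Let $\mu$ be the Haar measure on $G$ with $\mu(\Gamma)=1$, let $L^1(G)$ be the usual Banach $^*$-algebra, and let $p=\chi_\Gamma\in C_c(G)$, a projection. The Hecke algebra $\mathcal{H}(G,\Gamma)$ is the $^*$-algebra of finitely supported functions on $\Gamma\backslash G/\Gamma$, identified with $pC_c(G)p$; $L^1(G,\Gamma)$ is its $L^1$-completion, identified with $pL^1(G)p$. $C^*(L^1(G,\Gamma))$ is the enveloping $C^*$-algebra of the Banach $^*$-algebra $L^1(G,\Gamma)$, and $pC^*(G)p$ is the corner of the full group $C^*$-algebra $C^*(G)$. The inclusion $pL^1(G)p\subseteq pC^*(G)p$ induces the canonical surjection $C^*(L^1(G,\Gamma))\to pC^*(G)p$.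 *)

theory Defs
  imports "HOL-Analysis.Analysis" "HOL-Algebra.QuotRing"
    "HOL-Computational_Algebra.Computational_Algebra"
begin

section \<open>The field of \<open>q\<close>-adic numbers\<close>

definition padic_abs :: "nat \<Rightarrow> rat \<Rightarrow> real" where
  "padic_abs q x =
     (if x = 0 then 0
      else real q powi (int (multiplicity (int q) (snd (quotient_of x)))
                        - int (multiplicity (int q) (fst (quotient_of x)))))"

definition padic_cauchy :: "nat \<Rightarrow> (nat \<Rightarrow> rat) set" where
  "padic_cauchy q =
     {s. \<forall>e>0. \<exists>N. \<forall>m\<ge>N. \<forall>n\<ge>N. padic_abs q (s m - s n) < e}"

definition padic_null :: "nat \<Rightarrow> (nat \<Rightarrow> rat) set" where
  "padic_null q = {s. (\<lambda>n. padic_abs q (s n)) \<longlonglongrightarrow> 0}"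

definition padic_cauchy_ring :: "nat \<Rightarrow> (nat \<Rightarrow> rat) ring" where
  "padic_cauchy_ring q =
     \<lparr>carrier = padic_cauchy q,
      mult = (\<lambda>s t n. s n * t n), one = (\<lambda>n. 1),
      zero = (\<lambda>n. 0), add = (\<lambda>s t n. s n + t n)\<rparr>"

text \<open>\<open>\<rat>\<^sub>q\<close> is the completion of \<open>\<rat>\<close>: Cauchy sequences modulo null sequences.\<close>

definition Qp :: "nat \<Rightarrow> (nat \<Rightarrow> rat) set ring" where
  "Qp q = padic_cauchy_ring q Quot padic_null q"

definition Qp_abs :: "nat \<Rightarrow> (nat \<Rightarrow> rat) set \<Rightarrow> real" where
  "Qp_abs q x = (THE r. \<forall>s\<in>x. (\<lambda>n. padic_abs q (s n)) \<longlonglongrightarrow> r)"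

definition Zp :: "nat \<Rightarrow> (nat \<Rightarrow> rat) set set" where
  "Zp q = {x \<in> carrier (Qp q). Qp_abs q x \<le> 1}"

definition Qp_top :: "nat \<Rightarrow> (nat \<Rightarrow> rat) set topology" where
  "Qp_top q =
     Metric_space.mtopology (carrier (Qp q)) (\<lambda>x y. Qp_abs q (x \<ominus>\<^bsub>Qp q\<^esub> y))"


section \<open>\<open>SL\<^sub>2\<close> and \<open>PSL\<^sub>2\<close>\<close>

text \<open>The quadruple \<open>(a, b, c, d)\<close> is the matrix with rows \<open>(a, b)\<close> and \<open>(c, d)\<close>.\<close>

type_synonym 'a mat2 = "'a \<times> 'a \<times> 'a \<times> 'a"

definition SL2 :: "('a, 'r) ring_scheme \<Rightarrow> 'a mat2 monoid" where
  "SL2 R =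
     \<lparr>carrier = {(a, b, c, d). a \<in> carrier R \<and> b \<in> carrier R \<and> c \<in> carrier R \<and> d \<in> carrier R
                    \<and> a \<otimes>\<^bsub>R\<^esub> d \<ominus>\<^bsub>R\<^esub> b \<otimes>\<^bsub>R\<^esub> c = \<one>\<^bsub>R\<^esub>},
      mult = (\<lambda>(a, b, c, d) (a', b', c', d').
        (a \<otimes>\<^bsub>R\<^esub> a' \<oplus>\<^bsub>R\<^esub> b \<otimes>\<^bsub>R\<^esub> c', a \<otimes>\<^bsub>R\<^esub> b' \<oplus>\<^bsub>R\<^esub> b \<otimes>\<^bsub>R\<^esub> d',
         c \<otimes>\<^bsub>R\<^esub> a' \<oplus>\<^bsub>R\<^esub> d \<otimes>\<^bsub>R\<^esub> c', c \<otimes>\<^bsub>R\<^esub> b' \<oplus>\<^bsub>R\<^esub> d \<otimes>\<^bsub>R\<^esub> d')),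
      one = (\<one>\<^bsub>R\<^esub>, \<zero>\<^bsub>R\<^esub>, \<zero>\<^bsub>R\<^esub>, \<one>\<^bsub>R\<^esub>)\<rparr>"

definition pm_one :: "('a, 'r) ring_scheme \<Rightarrow> 'a mat2 set" where
  "pm_one R = {(\<one>\<^bsub>R\<^esub>, \<zero>\<^bsub>R\<^esub>, \<zero>\<^bsub>R\<^esub>, \<one>\<^bsub>R\<^esub>), (\<ominus>\<^bsub>R\<^esub> \<one>\<^bsub>R\<^esub>, \<zero>\<^bsub>R\<^esub>, \<zero>\<^bsub>R\<^esub>, \<ominus>\<^bsub>R\<^esub> \<one>\<^bsub>R\<^esub>)}"

definition PSL2 :: "('a, 'r) ring_scheme \<Rightarrow> 'a mat2 set monoid" where
  "PSL2 R = SL2 R Mod pm_one R"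

definition SL2_top :: "('a, 'r) ring_scheme \<Rightarrow> 'a topology \<Rightarrow> 'a mat2 topology" where
  "SL2_top R T =
     subtopology (prod_topology T (prod_topology T (prod_topology T T))) (carrier (SL2 R))"

text \<open>The quotient topology: the preimage of a set \<open>U\<close> of cosets is \<open>\<Union>U\<close>.\<close>

definition PSL2_top :: "('a, 'r) ring_scheme \<Rightarrow> 'a topology \<Rightarrow> 'a mat2 set topology" where
  "PSL2_top R T =
     topology (\<lambda>U. U \<subseteq> carrier (PSL2 R) \<and> openin (SL2_top R T) (\<Union>U))"

abbreviation PSL2_Qp :: "nat \<Rightarrow> (nat \<Rightarrow> rat) set mat2 set monoid" where
  "PSL2_Qp q \<equiv> PSL2 (Qp q)"

abbreviation PSL2_Qp_top :: "nat \<Rightarrow> (nat \<Rightarrow> rat) set mat2 set topology" where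
  "PSL2_Qp_top q \<equiv> PSL2_top (Qp q) (Qp_top q)"

definition SL2_Zp :: "nat \<Rightarrow> (nat \<Rightarrow> rat) set mat2 set" where
  "SL2_Zp q = carrier (SL2 (Qp q)) \<inter> (Zp q \<times> Zp q \<times> Zp q \<times> Zp q)"

definition PSL2_Zp :: "nat \<Rightarrow> (nat \<Rightarrow> rat) set mat2 set set" where
  "PSL2_Zp q = (\<lambda>g. pm_one (Qp q) #>\<^bsub>SL2 (Qp q)\<^esub> g) ` SL2_Zp q"


section \<open>Haar measure\<close>

definition haar_measure ::
    "('g, 'm) monoid_scheme \<Rightarrow> 'g topology \<Rightarrow> 'g measure \<Rightarrow> bool" where
  "haar_measure G T \<mu> \<longleftrightarrow>
     space \<mu> = carrier G \<and>
     sets \<mu> = sigma_sets (carrier G) {U. openin T U} \<and>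
     emeasure \<mu> (carrier G) \<noteq> 0 \<and>
     (\<forall>x\<in>carrier G. \<forall>E\<in>sets \<mu>. emeasure \<mu> (x <#\<^bsub>G\<^esub> E) = emeasure \<mu> E) \<and>
     (\<forall>K. compactin T K \<longrightarrow> emeasure \<mu> K < \<infinity>) \<and>
     (\<forall>E\<in>sets \<mu>. emeasure \<mu> E = (INF U\<in>{U. openin T U \<and> E \<subseteq> U}. emeasure \<mu> U)) \<and>
     (\<forall>U. openin T U \<longrightarrow> emeasure \<mu> U = (SUP K\<in>{K. compactin T K \<and> K \<subseteq> U}. emeasure \<mu> K))"

definition modular_function ::
    "('g, 'm) monoid_scheme \<Rightarrow> 'g measure \<Rightarrow> 'g \<Rightarrow> real" where
  "modular_function G \<mu> x =
     (THE r. \<forall>E\<in>sets \<mu>. emeasure \<mu> (E #>\<^bsub>G\<^esub> x) = ennreal r * emeasure \<mu> E)"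


section \<open>Complex \<open>*\<close>-algebras and enveloping \<open>C\<^sup>*\<close>-algebras\<close>

text \<open>The algebras need not have a unit.\<close>

record 'a star_algebra = "'a partial_object" +
  sadd :: "'a \<Rightarrow> 'a \<Rightarrow> 'a"
  smult :: "'a \<Rightarrow> 'a \<Rightarrow> 'a"
  sscale :: "complex \<Rightarrow> 'a \<Rightarrow> 'a"
  sstar :: "'a \<Rightarrow> 'a"

text \<open>An isomorphism of \<open>C\<^sup>*\<close>-algebras is a bijective \<open>*\<close>-homomorphism; it is
  automatically isometric.\<close>

definition star_iso ::
    "'a star_algebra \<Rightarrow> 'b star_algebra \<Rightarrow> ('a \<Rightarrow> 'b) \<Rightarrow> bool" where
  "star_iso A B \<phi> \<longleftrightarrow>
     bij_betw \<phi> (carrier A) (carrier B) \<and>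
     (\<forall>x\<in>carrier A. \<forall>y\<in>carrier A. \<phi> (sadd A x y) = sadd B (\<phi> x) (\<phi> y)) \<and>
     (\<forall>x\<in>carrier A. \<forall>y\<in>carrier A. \<phi> (smult A x y) = smult B (\<phi> x) (\<phi> y)) \<and>
     (\<forall>c. \<forall>x\<in>carrier A. \<phi> (sscale A c x) = sscale B c (\<phi> x)) \<and>
     (\<forall>x\<in>carrier A. \<phi> (sstar A x) = sstar B (\<phi> x))"

definition corner :: "'a star_algebra \<Rightarrow> 'a \<Rightarrow> 'a star_algebra" where
  "corner A p = A\<lparr>carrier := (\<lambda>a. smult A (smult A p a) p) ` carrier A\<rparr>"

definition cstar_seminorm :: "'a star_algebra \<Rightarrow> ('a \<Rightarrow> real) \<Rightarrow> bool" where
  "cstar_seminorm A \<sigma> \<longleftrightarrow>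
     (\<forall>x\<in>carrier A. 0 \<le> \<sigma> x) \<and>
     (\<forall>x\<in>carrier A. \<forall>y\<in>carrier A. \<sigma> (sadd A x y) \<le> \<sigma> x + \<sigma> y) \<and>
     (\<forall>c. \<forall>x\<in>carrier A. \<sigma> (sscale A c x) = cmod c * \<sigma> x) \<and>
     (\<forall>x\<in>carrier A. \<forall>y\<in>carrier A. \<sigma> (smult A x y) \<le> \<sigma> x * \<sigma> y) \<and>
     (\<forall>x\<in>carrier A. \<sigma> (smult A (sstar A x) x) = (\<sigma> x)\<^sup>2)"

text \<open>The \<open>C\<^sup>*\<close>-seminorms are exactly the functions \<open>x \<mapsto> \<parallel>\<pi> x\<parallel>\<close> for \<open>\<pi>\<close> a
  \<open>*\<close>-homomorphism into a \<open>C\<^sup>*\<close>-algebra, equivalently a \<open>*\<close>-representation on a Hilbert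
  space. On a Banach \<open>*\<close>-algebra with isometric involution they are all dominated by the
  given norm, so the supremum below is a supremum of a bounded set and the enveloping
  \<open>C\<^sup>*\<close>-algebra depends on the algebraic structure only.\<close>

definition env_norm :: "'a star_algebra \<Rightarrow> 'a \<Rightarrow> real" where
  "env_norm A x = (SUP \<sigma>\<in>{\<sigma>. cstar_seminorm A \<sigma>}. \<sigma> x)"

definition env_dist :: "'a star_algebra \<Rightarrow> 'a \<Rightarrow> 'a \<Rightarrow> real" where
  "env_dist A x y = env_norm A (sadd A x (sscale A (-1) y))"

definition env_cauchy :: "'a star_algebra \<Rightarrow> (nat \<Rightarrow> 'a) set" where
  "env_cauchy A =
     {s. range s \<subseteq> carrier A \<and>
         (\<forall>e>0. \<exists>N. \<forall>m\<ge>N. \<forall>n\<ge>N. env_dist A (s m) (s n) < e)}"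

definition env_class :: "'a star_algebra \<Rightarrow> (nat \<Rightarrow> 'a) \<Rightarrow> (nat \<Rightarrow> 'a) set" where
  "env_class A s = {t \<in> env_cauchy A. (\<lambda>n. env_dist A (s n) (t n)) \<longlonglongrightarrow> 0}"

definition env_rep :: "(nat \<Rightarrow> 'a) set \<Rightarrow> nat \<Rightarrow> 'a" where
  "env_rep X = (SOME s. s \<in> X)"

text \<open>The Hausdorff completion of \<open>A\<close> with respect to \<open>env_norm A\<close>; elements \<open>x\<close> with
  \<open>env_norm A x = 0\<close> are thereby identified with \<open>0\<close>.\<close>

definition env_cstar :: "'a star_algebra \<Rightarrow> (nat \<Rightarrow> 'a) set star_algebra" where
  "env_cstar A =
     \<lparr>carrier = env_class A ` env_cauchy A,
      sadd = (\<lambda>X Y. env_class A (\<lambda>n. sadd A (env_rep X n) (env_rep Y n))),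
      smult = (\<lambda>X Y. env_class A (\<lambda>n. smult A (env_rep X n) (env_rep Y n))),
      sscale = (\<lambda>c X. env_class A (\<lambda>n. sscale A c (env_rep X n))),
      sstar = (\<lambda>X. env_class A (\<lambda>n. sstar A (env_rep X n)))\<rparr>"

definition env_embed :: "'a star_algebra \<Rightarrow> 'a \<Rightarrow> (nat \<Rightarrow> 'a) set" where
  "env_embed A x = env_class A (\<lambda>n. x)"

text \<open>For a \<open>*\<close>-subalgebra \<open>A\<close> of \<open>B\<close>, the map of enveloping \<open>C\<^sup>*\<close>-algebras induced by
  the inclusion, that is, its continuous extension. It is well defined since
  \<open>C\<^sup>*\<close>-seminorms on \<open>B\<close> restrict to \<open>C\<^sup>*\<close>-seminorms on \<open>A\<close>.\<close>

definition env_incl ::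
    "'a star_algebra \<Rightarrow> 'a star_algebra \<Rightarrow> (nat \<Rightarrow> 'a) set \<Rightarrow> (nat \<Rightarrow> 'a) set" where
  "env_incl A B X = env_class B (env_rep X)"


section \<open>Group and Hecke algebras\<close>

text \<open>Elements of \<open>L\<^sup>1(G)\<close> are classes of integrable functions modulo equality
  \<open>\<mu>\<close>-almost everywhere.\<close>

definition L1_class :: "'g measure \<Rightarrow> ('g \<Rightarrow> complex) \<Rightarrow> ('g \<Rightarrow> complex) set" where
  "L1_class \<mu> f = {g. integrable \<mu> g \<and> (AE x in \<mu>. f x = g x)}"

definition L1_rep :: "('g \<Rightarrow> complex) set \<Rightarrow> 'g \<Rightarrow> complex" where
  "L1_rep F = (SOME f. f \<in> F)"

definition convolution ::
    "('g, 'm) monoid_scheme \<Rightarrow> 'g measure \<Rightarrow> ('g \<Rightarrow> complex) \<Rightarrow> ('g \<Rightarrow> complex) \<Rightarrow> 'g \<Rightarrow> complex" where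
  "convolution G \<mu> f g x = (\<integral>y. f y * g (inv\<^bsub>G\<^esub> y \<otimes>\<^bsub>G\<^esub> x) \<partial>\<mu>)"

definition L1_algebra ::
    "('g, 'm) monoid_scheme \<Rightarrow> 'g measure \<Rightarrow> ('g \<Rightarrow> complex) set star_algebra" where
  "L1_algebra G \<mu> =
     \<lparr>carrier = L1_class \<mu> ` {f. integrable \<mu> f},
      sadd = (\<lambda>F H. L1_class \<mu> (\<lambda>x. L1_rep F x + L1_rep H x)),
      smult = (\<lambda>F H. L1_class \<mu> (convolution G \<mu> (L1_rep F) (L1_rep H))),
      sscale = (\<lambda>c F. L1_class \<mu> (\<lambda>x. c * L1_rep F x)),
      sstar = (\<lambda>F. L1_class \<mu>
        (\<lambda>x. complex_of_real (modular_function G \<mu> (inv\<^bsub>G\<^esub> x)) * cnj (L1_rep F (inv\<^bsub>G\<^esub> x))))\<rparr>"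

text \<open>The projection \<open>p = \<chi>\<^sub>\<Gamma>\<close>, for \<open>\<mu>\<close> normalised by \<open>\<mu> \<Gamma> = 1\<close>.\<close>

definition hecke_proj :: "'g set \<Rightarrow> 'g measure \<Rightarrow> ('g \<Rightarrow> complex) set" where
  "hecke_proj \<Gamma> \<mu> = L1_class \<mu> (indicator \<Gamma>)"

text \<open>\<open>L\<^sup>1(G, \<Gamma>) = p L\<^sup>1(G) p\<close>.\<close>

definition hecke_L1 ::
    "('g, 'm) monoid_scheme \<Rightarrow> 'g set \<Rightarrow> 'g measure \<Rightarrow> ('g \<Rightarrow> complex) set star_algebra" where
  "hecke_L1 G \<Gamma> \<mu> = corner (L1_algebra G \<mu>) (hecke_proj \<Gamma> \<mu>)"

definition group_cstar ::
    "('g, 'm) monoid_scheme \<Rightarrow> 'g measure \<Rightarrow> (nat \<Rightarrow> ('g \<Rightarrow> complex) set) set star_algebra" where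
  "group_cstar G \<mu> = env_cstar (L1_algebra G \<mu>)"

text \<open>\<open>p C\<^sup>*(G) p\<close>.\<close>

definition cstar_corner ::
    "('g, 'm) monoid_scheme \<Rightarrow> 'g set \<Rightarrow> 'g measure \<Rightarrow>
       (nat \<Rightarrow> ('g \<Rightarrow> complex) set) set star_algebra" where
  "cstar_corner G \<Gamma> \<mu> =
     corner (group_cstar G \<mu>) (env_embed (L1_algebra G \<mu>) (hecke_proj \<Gamma> \<mu>))"

definition canonical_surjection ::
    "('g, 'm) monoid_scheme \<Rightarrow> 'g set \<Rightarrow> 'g measure \<Rightarrow>
       (nat \<Rightarrow> ('g \<Rightarrow> complex) set) set \<Rightarrow> (nat \<Rightarrow> ('g \<Rightarrow> complex) set) set" where
  "canonical_surjection G \<Gamma> \<mu> = env_incl (hecke_L1 G \<Gamma> \<mu>) (L1_algebra G \<mu>)"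

end

theory Submission imports Defs begin

text \<open>Let \<open>\<epsilon>(g) = (-1)\<^sup>m\<close>, where \<open>q\<^sup>m\<close> is the maximum norm of the first column of \<open>g\<close>. By the Iwasawa
  decomposition, \<open>\<chi>(f) = \<integral> f \<epsilon>\<close> is multiplicative on \<open>L\<^sup>1(G, \<Gamma>)\<close>, and since \<open>g\<^sup>-\<^sup>1 \<in> \<Gamma>g\<Gamma>\<close> it is a
  star-character, so it extends to the enveloping \<open>C\<^sup>*\<close>-algebra. Let \<open>e\<close> be the projection of the other
  maximal compact subgroup \<open>\<Gamma>'\<close>. Then \<open>\<chi>(pep) < 0\<close>, although \<open>pep\<close> is positive in \<open>pC\<^sup>*(G)p\<close>: the
  character does not factor through \<open>pC\<^sup>*(G)p\<close>.\<close>

section \<open>Banach star-algebras and their \<open>C\<^sup>*\<close>-seminorms\<close>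

text \<open>The element pep is (ep)* (ep) with ep in L^1(G) but outside the Hecke algebra, so
  positivity of pep is visible to representations of G and not inside L^1(G, \<Gamma>); this is the
  gap that the character exploits. Its value there is B (2 M(I) - 1) / M(\<Gamma>'), where I is the
  intersection of \<Gamma> and \<Gamma>' and B is the integral of \<epsilon> over \<Gamma>'. In the
  q-adic case I has index q + 1 in both groups; index at least 3 already makes B positive and the
  bracket negative, whereas index 2 would give 0. The enveloping norm is a supremum over all
  C*-seminorms, so each of them has to be bounded by the L^1 norm. The algebras need not have a
  unit, and the bound rests on a square root obtained by fixed point iteration and used only in
  products that stay in the algebra.\<close>

locale star_alg =
  fixes A :: "'a star_algebra"
  assumes add_closed [simp, intro]: "\<And>x y. x \<in> carrier A \<Longrightarrow> y \<in> carrier A \<Longrightarrow> sadd A x y \<in> carrier A"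
    and mult_closed [simp, intro]: "\<And>x y. x \<in> carrier A \<Longrightarrow> y \<in> carrier A \<Longrightarrow> smult A x y \<in> carrier A"
    and scale_closed [simp, intro]: "\<And>c x. x \<in> carrier A \<Longrightarrow> sscale A c x \<in> carrier A"
    and star_closed [simp, intro]: "\<And>x. x \<in> carrier A \<Longrightarrow> sstar A x \<in> carrier A"
    and add_assoc: "\<And>x y z. x \<in> carrier A \<Longrightarrow> y \<in> carrier A \<Longrightarrow> z \<in> carrier A \<Longrightarrow>
          sadd A (sadd A x y) z = sadd A x (sadd A y z)"
    and add_comm: "\<And>x y. x \<in> carrier A \<Longrightarrow> y \<in> carrier A \<Longrightarrow> sadd A x y = sadd A y x"
    and scale_add: "\<And>c x y. x \<in> carrier A \<Longrightarrow> y \<in> carrier A \<Longrightarrow>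
          sscale A c (sadd A x y) = sadd A (sscale A c x) (sscale A c y)"
    and add_scale: "\<And>c d x. x \<in> carrier A \<Longrightarrow>
          sscale A (c + d) x = sadd A (sscale A c x) (sscale A d x)"
    and scale_scale: "\<And>c d x. x \<in> carrier A \<Longrightarrow> sscale A c (sscale A d x) = sscale A (c * d) x"
    and scale_one [simp]: "\<And>x. x \<in> carrier A \<Longrightarrow> sscale A 1 x = x"
    and zero_scale: "\<And>x y. x \<in> carrier A \<Longrightarrow> y \<in> carrier A \<Longrightarrow> sadd A (sscale A 0 x) y = y"
    and mult_assoc: "\<And>x y z. x \<in> carrier A \<Longrightarrow> y \<in> carrier A \<Longrightarrow> z \<in> carrier A \<Longrightarrow>
          smult A (smult A x y) z = smult A x (smult A y z)"
    and mult_add: "\<And>x y z. x \<in> carrier A \<Longrightarrow> y \<in> carrier A \<Longrightarrow> z \<in> carrier A \<Longrightarrow>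
          smult A x (sadd A y z) = sadd A (smult A x y) (smult A x z)"
    and add_mult: "\<And>x y z. x \<in> carrier A \<Longrightarrow> y \<in> carrier A \<Longrightarrow> z \<in> carrier A \<Longrightarrow>
          smult A (sadd A x y) z = sadd A (smult A x z) (smult A y z)"
    and scale_mult: "\<And>c x y. x \<in> carrier A \<Longrightarrow> y \<in> carrier A \<Longrightarrow>
          smult A (sscale A c x) y = sscale A c (smult A x y)"
    and mult_scale: "\<And>c x y. x \<in> carrier A \<Longrightarrow> y \<in> carrier A \<Longrightarrow>
          smult A x (sscale A c y) = sscale A c (smult A x y)"
    and star_star [simp]: "\<And>x. x \<in> carrier A \<Longrightarrow> sstar A (sstar A x) = x"
    and star_add: "\<And>x y. x \<in> carrier A \<Longrightarrow> y \<in> carrier A \<Longrightarrow>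
          sstar A (sadd A x y) = sadd A (sstar A x) (sstar A y)"
    and star_scale: "\<And>c x. x \<in> carrier A \<Longrightarrow> sstar A (sscale A c x) = sscale A (cnj c) (sstar A x)"
    and star_mult: "\<And>x y. x \<in> carrier A \<Longrightarrow> y \<in> carrier A \<Longrightarrow>
          sstar A (smult A x y) = smult A (sstar A y) (sstar A x)"
begin

abbreviation add (infixl "\<boxplus>" 65) where "x \<boxplus> y \<equiv> sadd A x y"
abbreviation mul (infixl "\<boxtimes>" 70) where "x \<boxtimes> y \<equiv> smult A x y"
abbreviation scl (infixr "\<odot>" 75) where "c \<odot> x \<equiv> sscale A c x"
abbreviation sub (infixl "\<boxminus>" 65) where "x \<boxminus> y \<equiv> x \<boxplus> (-1) \<odot> y"

lemma add_left_comm: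
  assumes "x \<in> carrier A" "y \<in> carrier A" "z \<in> carrier A"
  shows "x \<boxplus> (y \<boxplus> z) = y \<boxplus> (x \<boxplus> z)"
  using assms by (metis add_assoc add_comm)

text \<open>The record carries no zero element. Its role is played by \<open>0 \<odot> x\<close>,
  which therefore must not depend on x.\<close>

lemma zero_eq: "x \<in> carrier A \<Longrightarrow> y \<in> carrier A \<Longrightarrow> 0 \<odot> x = 0 \<odot> y"
  by (metis add_comm scale_closed zero_scale)

text \<open>A linear identity between elements of the carrier is proved by writing all of them as
  values of one linear map \<open>L\<close> on coordinate vectors.\<close>

lemma linear_coordinates:
  assumes "x1 \<in> carrier A" "x2 \<in> carrier A" "x3 \<in> carrier A" "x4 \<in> carrier A"
    "x5 \<in> carrier A" "x6 \<in> carrier A"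
  obtains L :: "complex \<times> complex \<times> complex \<times> complex \<times> complex \<times> complex \<Rightarrow> 'a" where
    "\<And>a b c d e f a' b' c' d' e' f'. L (a, b, c, d, e, f) \<boxplus> L (a', b', c', d', e', f') =
       L (a + a', b + b', c + c', d + d', e + e', f + f')"
    "\<And>s a b c d e f. s \<odot> L (a, b, c, d, e, f) = L (s * a, s * b, s * c, s * d, s * e, s * f)"
    "x1 = L (1, 0, 0, 0, 0, 0)" "x2 = L (0, 1, 0, 0, 0, 0)" "x3 = L (0, 0, 1, 0, 0, 0)"
    "x4 = L (0, 0, 0, 1, 0, 0)" "x5 = L (0, 0, 0, 0, 1, 0)" "x6 = L (0, 0, 0, 0, 0, 1)"
proof -
  define L where "L = (\<lambda>(a, b, c, d, e, f).
    a \<odot> x1 \<boxplus> (b \<odot> x2 \<boxplus> (c \<odot> x3 \<boxplus> (d \<odot> x4 \<boxplus> (e \<odot> x5 \<boxplus> f \<odot> x6)))))"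
  have z: "0 \<odot> x \<boxplus> y = y" "y \<boxplus> 0 \<odot> x = y" if "x \<in> carrier A" "y \<in> carrier A" for x y
    using that by (auto simp: zero_scale add_comm[of y "0 \<odot> x"])
  have zz: "0 \<odot> x2 = 0 \<odot> x1" "0 \<odot> x3 = 0 \<odot> x1" "0 \<odot> x4 = 0 \<odot> x1" "0 \<odot> x5 = 0 \<odot> x1"
     "0 \<odot> x6 = 0 \<odot> x1"
    using assms by (auto intro: zero_eq)
  show thesis
  proof (rule that[of L])
    show "L (a, b, c, d, e, f) \<boxplus> L (a', b', c', d', e', f') =
       L (a + a', b + b', c + c', d + d', e + e', f + f')" for a b c d e f a' b' c' d' e' f'
      using assms by (simp add: L_def add_scale add_assoc add_comm add_left_comm)
    show "s \<odot> L (a, b, c, d, e, f) = L (s * a, s * b, s * c, s * d, s * e, s * f)" for s a b c d e f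
      using assms by (simp add: L_def scale_add scale_scale)
  qed (use assms in \<open>simp_all add: L_def zz z\<close>)
qed

text \<open>\<open>h + s (1 - k)\<close> is unitary in the unitisation, since \<open>h\<^sup>2 + (1 - k)\<^sup>2 = 1\<close>.\<close>

lemma unitary_identity:
  assumes c: "h \<in> carrier A" "k \<in> carrier A" "b \<in> carrier A"
    and h: "sstar A h = h" and k: "sstar A k = k" and hk: "h \<boxtimes> k = k \<boxtimes> h"
    and kk: "2 \<odot> k = h \<boxtimes> h \<boxplus> k \<boxtimes> k" and s: "s * s = -1" "cnj s = - s"
  defines "x \<equiv> h \<boxtimes> b \<boxplus> s \<odot> (b \<boxminus> k \<boxtimes> b)"
  shows "sstar A x \<boxtimes> x = sstar A b \<boxtimes> b"
proof -
  define B where "B = sstar A b"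
  have B: "B \<in> carrier A" using c by (simp add: B_def)
  define P Q R S T W where "P = B \<boxtimes> b" and "Q = B \<boxtimes> (k \<boxtimes> b)" and "R = B \<boxtimes> (h \<boxtimes> (h \<boxtimes> b))"
    and "S = B \<boxtimes> (k \<boxtimes> (k \<boxtimes> b))" and "T = B \<boxtimes> (h \<boxtimes> b)" and "W = B \<boxtimes> (h \<boxtimes> (k \<boxtimes> b))"
  note defs = P_def Q_def R_def S_def T_def W_def
  have cl: "P \<in> carrier A" "Q \<in> carrier A" "R \<in> carrier A" "S \<in> carrier A" "T \<in> carrier A" "W \<in> carrier A"
    using B c by (simp_all add: defs)
  have W': "B \<boxtimes> (k \<boxtimes> (h \<boxtimes> b)) = W"
    using c B by (simp add: W_def hk flip: mult_assoc)
  \<comment> \<open>\<open>kk\<close> trades the word containing k k for those with k and h h; the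
    claim then becomes a linear identity in the remaining words, regarded as free symbols.\<close>
  have RS: "S = 2 \<odot> Q \<boxminus> R"
  proof -
    have e: "2 \<odot> Q = R \<boxplus> S"
    proof -
      have "2 \<odot> Q = B \<boxtimes> ((2 \<odot> k) \<boxtimes> b)" using c B by (simp add: Q_def mult_scale scale_mult)
      also have "\<dots> = R \<boxplus> S" unfolding kk using c B by (simp add: R_def S_def mult_add add_mult mult_assoc)
      finally show ?thesis .
    qed
    obtain L where L: "\<And>a b c d e f a' b' c' d' e' f'. L (a, b, c, d, e, f) \<boxplus> L (a', b', c', d', e', f') =
       L (a + a', b + b', c + c', d + d', e + e', f + f')"
      "\<And>s a b c d e f. s \<odot> L (a, b, c, d, e, f) = L (s * a, s * b, s * c, s * d, s * e, s * f)"
      "R = L (1, 0, 0, 0, 0, 0)" "S = L (0, 1, 0, 0, 0, 0)"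
      by (rule linear_coordinates[OF cl(3,4,3,3,3,3)]) (rule that)
    show ?thesis unfolding e L(3,4) by (simp add: L(1,2))
  qed
  have sx: "sstar A x = B \<boxtimes> h \<boxplus> (- s) \<odot> (B \<boxminus> B \<boxtimes> k)"
    using c B by (simp add: x_def B_def star_add star_scale star_mult h k s)
  obtain L where L: "\<And>a b c d e f a' b' c' d' e' f'. L (a, b, c, d, e, f) \<boxplus> L (a', b', c', d', e', f') =
       L (a + a', b + b', c + c', d + d', e + e', f + f')"
      "\<And>s a b c d e f. s \<odot> L (a, b, c, d, e, f) = L (s * a, s * b, s * c, s * d, s * e, s * f)"
      "P = L (1, 0, 0, 0, 0, 0)" "Q = L (0, 1, 0, 0, 0, 0)" "R = L (0, 0, 1, 0, 0, 0)"
      "T = L (0, 0, 0, 1, 0, 0)" "W = L (0, 0, 0, 0, 1, 0)"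
    by (rule linear_coordinates[OF cl(1,2,3,5,6,6)]) (rule that)
  have "sstar A x \<boxtimes> x = P"
    unfolding sx using c B
    by (simp add: x_def mult_add add_mult scale_mult mult_scale mult_assoc scale_add scale_scale s
        W' flip: defs) (simp add: RS L(3-7), simp add: L(1,2) s)
  then show ?thesis by (simp add: P_def B_def)
qed

text \<open>For s = \<i> and s = -\<i> the formal unitaries h + s (1 - k) have mean h. Applied to h
  itself they stay in the algebra, which need not have a unit, and keep \<sigma> h unchanged;
  averaging gives (\<sigma> h)^2 = \<sigma> (h h) \<le> \<sigma> h.\<close>

lemma cstar_seminorm_fix_bound:
  assumes \<sigma>: "cstar_seminorm A \<sigma>"
    and c: "h \<in> carrier A" "k \<in> carrier A"
    and h: "sstar A h = h" and k: "sstar A k = k" and hk: "h \<boxtimes> k = k \<boxtimes> h"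
    and kk: "2 \<odot> k = h \<boxtimes> h \<boxplus> k \<boxtimes> k"
  shows "\<sigma> h \<le> 1"
proof -
  note \<sigma>' = \<sigma>[unfolded cstar_seminorm_def]
  define x where "x = (\<lambda>s. h \<boxtimes> h \<boxplus> s \<odot> (h \<boxminus> k \<boxtimes> h))"
  have xc: "x s \<in> carrier A" for s using c by (simp add: x_def)
  have \<sigma>x: "\<sigma> (x s) = \<sigma> h" if "s * s = -1" "cnj s = - s" for s
  proof -
    have "(\<sigma> (x s))\<^sup>2 = \<sigma> (sstar A (x s) \<boxtimes> x s)" using \<sigma>' xc by simp
    also have "\<dots> = \<sigma> (sstar A h \<boxtimes> h)" using unitary_identity[OF c c(1) h k hk kk that] by (simp add: x_def)
    also have "\<dots> = (\<sigma> h)\<^sup>2" using \<sigma>' c by simp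
    finally show ?thesis using \<sigma>' c xc by (simp add: power2_eq_iff_nonneg)
  qed
  have "h \<boxtimes> h = (1/2) \<odot> (x \<i> \<boxplus> x (-\<i>))"
  proof -
    define u v w where "u = h \<boxtimes> h" and "v = h" and "w = k \<boxtimes> h"
    have cl: "u \<in> carrier A" "v \<in> carrier A" "w \<in> carrier A" using c by (simp_all add: u_def v_def w_def)
    obtain L where L: "\<And>a b c d e f a' b' c' d' e' f'. L (a, b, c, d, e, f) \<boxplus> L (a', b', c', d', e', f') =
       L (a + a', b + b', c + c', d + d', e + e', f + f')"
      "\<And>s a b c d e f. s \<odot> L (a, b, c, d, e, f) = L (s * a, s * b, s * c, s * d, s * e, s * f)"
      "u = L (1, 0, 0, 0, 0, 0)" "v = L (0, 1, 0, 0, 0, 0)" "w = L (0, 0, 1, 0, 0, 0)"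
      by (rule linear_coordinates[OF cl(1,2,3,3,3,3)]) (rule that)
    have "u = (1/2) \<odot> ((u \<boxplus> \<i> \<odot> (v \<boxminus> w)) \<boxplus> (u \<boxplus> (-\<i>) \<odot> (v \<boxminus> w)))"
      unfolding L(3-5) by (simp add: L(1,2))
    then show ?thesis by (simp add: x_def u_def v_def w_def)
  qed
  then have "\<sigma> (h \<boxtimes> h) = 1/2 * \<sigma> (x \<i> \<boxplus> x (-\<i>))" using \<sigma>' xc by simp
  also have "\<dots> \<le> 1/2 * (\<sigma> (x \<i>) + \<sigma> (x (-\<i>)))" using \<sigma>' xc by (intro mult_left_mono) auto
  also have "\<dots> = \<sigma> h" using \<sigma>x[of \<i>] \<sigma>x[of "-\<i>"] by simp
  finally have "(\<sigma> h)\<^sup>2 \<le> \<sigma> h" using \<sigma>' c h by metis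
  then show ?thesis
    by (metis less_eq_real_def linorder_not_le mult_cancel_right2 mult_le_cancel_right2 order_trans
        power2_eq_square zero_le_one)
qed

end

text \<open>Completeness is asked for sequences with summable increments: the fixed point iteration
  produces such sequences, and for L^1 this is the form given by Riesz-Fischer.
  \<open>nrm_eq\<close> expresses definiteness through differences, as there is no zero to compare
  with.\<close>

locale banach_star_alg = star_alg +
  fixes nrm :: "'a \<Rightarrow> real"
  assumes nrm_nonneg [simp]: "\<And>x. x \<in> carrier A \<Longrightarrow> 0 \<le> nrm x"
    and nrm_add: "\<And>x y. x \<in> carrier A \<Longrightarrow> y \<in> carrier A \<Longrightarrow> nrm (x \<boxplus> y) \<le> nrm x + nrm y"
    and nrm_scale: "\<And>c x. x \<in> carrier A \<Longrightarrow> nrm (c \<odot> x) = cmod c * nrm x"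
    and nrm_mult: "\<And>x y. x \<in> carrier A \<Longrightarrow> y \<in> carrier A \<Longrightarrow> nrm (x \<boxtimes> y) \<le> nrm x * nrm y"
    and nrm_star: "\<And>x. x \<in> carrier A \<Longrightarrow> nrm (sstar A x) = nrm x"
    and nrm_eq: "\<And>x y. x \<in> carrier A \<Longrightarrow> y \<in> carrier A \<Longrightarrow> nrm (x \<boxminus> y) = 0 \<Longrightarrow> x = y"
    and complete: "\<And>s. (\<And>n. s n \<in> carrier A) \<Longrightarrow> summable (\<lambda>n. nrm (s (Suc n) \<boxminus> s n)) \<Longrightarrow>
          \<exists>l\<in>carrier A. (\<lambda>n. nrm (s n \<boxminus> l)) \<longlonglongrightarrow> 0"
begin

lemma sub_triangle:
  assumes "x \<in> carrier A" "y \<in> carrier A" "z \<in> carrier A"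
  shows "x \<boxminus> z = (x \<boxminus> y) \<boxplus> (y \<boxminus> z)"
proof -
  obtain L where L: "\<And>a b c d e f a' b' c' d' e' f'. L (a, b, c, d, e, f) \<boxplus> L (a', b', c', d', e', f') =
       L (a + a', b + b', c + c', d + d', e + e', f + f')"
      "\<And>s a b c d e f. s \<odot> L (a, b, c, d, e, f) = L (s * a, s * b, s * c, s * d, s * e, s * f)"
      "x = L (1, 0, 0, 0, 0, 0)" "y = L (0, 1, 0, 0, 0, 0)" "z = L (0, 0, 1, 0, 0, 0)"
    by (rule linear_coordinates[OF assms(1,2,3,3,3,3)]) (rule that)
  show ?thesis unfolding L(3-5) by (simp add: L(1,2))
qed

lemma sub_commute:
  assumes "x \<in> carrier A" "y \<in> carrier A"
  shows "x \<boxminus> y = (-1) \<odot> (y \<boxminus> x)"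
  using assms by (simp add: scale_add scale_scale add_comm)

lemma sub_self:
  assumes "x \<in> carrier A"
  shows "x \<boxminus> x = 0 \<odot> x"
  using add_scale[of x 1 "-1"] assms by simp

lemma mult_sub:
  assumes "x \<in> carrier A" "y \<in> carrier A" "z \<in> carrier A"
  shows "x \<boxtimes> y \<boxminus> x \<boxtimes> z = x \<boxtimes> (y \<boxminus> z)" "y \<boxtimes> x \<boxminus> z \<boxtimes> x = (y \<boxminus> z) \<boxtimes> x"
  using assms by (simp_all add: mult_add add_mult mult_scale scale_mult)

lemma limit_unique:
  assumes c: "\<And>n. s n \<in> carrier A" "x \<in> carrier A" "y \<in> carrier A"
    and x: "(\<lambda>n. nrm (s n \<boxminus> x)) \<longlonglongrightarrow> 0" and y: "(\<lambda>n. nrm (s n \<boxminus> y)) \<longlonglongrightarrow> 0"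
  shows "x = y"
proof -
  have "nrm (x \<boxminus> y) \<le> nrm (s n \<boxminus> x) + nrm (s n \<boxminus> y)" for n
  proof -
    have "nrm (x \<boxminus> y) \<le> nrm (x \<boxminus> s n) + nrm (s n \<boxminus> y)"
      using sub_triangle[of x "s n" y] nrm_add[of "x \<boxminus> s n" "s n \<boxminus> y"] c by simp
    moreover have "nrm (x \<boxminus> s n) = nrm (s n \<boxminus> x)"
      using sub_commute[of x "s n"] nrm_scale[of "s n \<boxminus> x" "-1"] c by simp
    ultimately show ?thesis by simp
  qed
  moreover have "(\<lambda>n. nrm (s n \<boxminus> x) + nrm (s n \<boxminus> y)) \<longlonglongrightarrow> 0"
    using tendsto_add[OF x y] by simp
  ultimately have "nrm (x \<boxminus> y) \<le> 0"
    by (intro LIMSEQ_le_const) auto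
  then show ?thesis using nrm_eq[of x y] nrm_nonneg[of "x \<boxminus> y"] c by fastforce
qed

text \<open>The equation says (1 - k)^2 = 1 - h^2, so k stands for 1 - sqrt (1 - h^2). It is the
  fixed point of x \<mapsto> (h^2 + x^2) / 2, a contraction on the ball of radius
  \<parallel>h\<parallel> < 1; self-adjointness and commutation with h pass from the iterates to the
  limit.\<close>

lemma square_fixpoint:
  assumes h: "h \<in> carrier A" "sstar A h = h" "nrm h < 1"
  obtains k where "k \<in> carrier A" "sstar A k = k" "h \<boxtimes> k = k \<boxtimes> h" "2 \<odot> k = h \<boxtimes> h \<boxplus> k \<boxtimes> k"
proof -
  define c where "c = nrm h"
  have c: "0 \<le> c" "c < 1" using h by (auto simp: c_def)
  define K where "K = rec_nat (0 \<odot> h) (\<lambda>_ x. (1/2) \<odot> (h \<boxtimes> h \<boxplus> x \<boxtimes> x))"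
  have K0: "K 0 = 0 \<odot> h" and KS: "K (Suc n) = (1/2) \<odot> (h \<boxtimes> h \<boxplus> K n \<boxtimes> K n)" for n
    by (simp_all add: K_def)
  have Kc: "K n \<in> carrier A" for n by (induction n) (auto simp: K0 KS h)
  have Kstar: "sstar A (K n) = K n" for n
    by (induction n) (simp_all add: K0 KS h Kc star_scale star_add star_mult)
  have Kcomm: "h \<boxtimes> K n = K n \<boxtimes> h" for n
  proof (induction n)
    case 0
    then show ?case using h by (simp add: K0 mult_scale scale_mult)
  next
    case (Suc n)
    have "h \<boxtimes> (K n \<boxtimes> K n) = (K n \<boxtimes> K n) \<boxtimes> h"
      using h Kc Suc by (metis mult_assoc)
    then show ?case using h Kc by (simp add: KS mult_scale scale_mult mult_add add_mult mult_assoc)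
  qed
  have half: "nrm ((1/2) \<odot> x) = nrm x / 2" if "x \<in> carrier A" for x
    using that by (simp add: nrm_scale norm_divide)
  have Kn: "nrm (K n) \<le> c" for n
  proof (induction n)
    case 0
    then show ?case using h c by (simp add: K0 nrm_scale)
  next
    case (Suc n)
    have "nrm (h \<boxtimes> h \<boxplus> K n \<boxtimes> K n) \<le> nrm h * nrm h + nrm (K n) * nrm (K n)"
      using nrm_add[of "h \<boxtimes> h" "K n \<boxtimes> K n"] nrm_mult[of h h] nrm_mult[of "K n" "K n"] h Kc
      by (smt (verit) mult_closed)
    also have "\<dots> \<le> c * 1 + c * 1"
      using Suc c h Kc unfolding c_def by (intro add_mono mult_mono) auto
    finally show ?case using h Kc by (simp add: KS half)
  qed
  \<comment> \<open>Splitting x x - y y as x (x - y) + (x - y) y avoids commutativity; halved, it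
    gives the Lipschitz constant (\<parallel>x\<parallel> + \<parallel>y\<parallel>) / 2, which is
    at most c on the ball.\<close>
  have sq: "nrm (x \<boxtimes> x \<boxminus> y \<boxtimes> y) \<le> (nrm x + nrm y) * nrm (x \<boxminus> y)"
    if "x \<in> carrier A" "y \<in> carrier A" for x y
  proof -
    have "x \<boxtimes> x \<boxminus> y \<boxtimes> y = (x \<boxtimes> x \<boxminus> x \<boxtimes> y) \<boxplus> (x \<boxtimes> y \<boxminus> y \<boxtimes> y)"
      using that by (intro sub_triangle) auto
    also have "\<dots> = x \<boxtimes> (x \<boxminus> y) \<boxplus> (x \<boxminus> y) \<boxtimes> y"
      using that by (simp only: mult_sub)
    finally have "nrm (x \<boxtimes> x \<boxminus> y \<boxtimes> y) \<le> nrm (x \<boxtimes> (x \<boxminus> y)) + nrm ((x \<boxminus> y) \<boxtimes> y)"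
      using that nrm_add by simp
    also have "\<dots> \<le> nrm x * nrm (x \<boxminus> y) + nrm (x \<boxminus> y) * nrm y"
      using that by (intro add_mono nrm_mult) auto
    finally show ?thesis by (simp add: algebra_simps)
  qed
  have affine: "(1/2) \<odot> (a \<boxplus> x) \<boxminus> (1/2) \<odot> (a \<boxplus> y) = (1/2) \<odot> (x \<boxminus> y)"
    if axy: "a \<in> carrier A" "x \<in> carrier A" "y \<in> carrier A" for a x y
  proof -
    obtain L where L: "\<And>a b c d e f a' b' c' d' e' f'. L (a, b, c, d, e, f) \<boxplus> L (a', b', c', d', e', f') =
       L (a + a', b + b', c + c', d + d', e + e', f + f')"
      "\<And>s a b c d e f. s \<odot> L (a, b, c, d, e, f) = L (s * a, s * b, s * c, s * d, s * e, s * f)"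
      "a = L (1, 0, 0, 0, 0, 0)" "x = L (0, 1, 0, 0, 0, 0)" "y = L (0, 0, 1, 0, 0, 0)"
      by (rule linear_coordinates[OF axy(1,2,3,3,3,3)]) (rule that)
    show ?thesis unfolding L(3-5) by (simp add: L(1,2))
  qed
  have step: "nrm ((1/2) \<odot> (h \<boxtimes> h \<boxplus> x \<boxtimes> x) \<boxminus> (1/2) \<odot> (h \<boxtimes> h \<boxplus> y \<boxtimes> y)) \<le> (nrm x + nrm y) / 2 * nrm (x \<boxminus> y)"
    if "x \<in> carrier A" "y \<in> carrier A" for x y
  proof -
    have "nrm ((1/2) \<odot> (x \<boxtimes> x \<boxminus> y \<boxtimes> y)) = nrm (x \<boxtimes> x \<boxminus> y \<boxtimes> y) / 2"
      using that by (intro half) auto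
    then show ?thesis
      using that affine[of "h \<boxtimes> h" "x \<boxtimes> x" "y \<boxtimes> y"] sq[OF that] h by (simp add: field_simps)
  qed
  have geo: "nrm (K (Suc n) \<boxminus> K n) \<le> nrm (K 1 \<boxminus> K 0) * c ^ n" for n
  proof (induction n)
    case (Suc n)
    have "nrm (K (Suc (Suc n)) \<boxminus> K (Suc n)) \<le> (nrm (K (Suc n)) + nrm (K n)) / 2 * nrm (K (Suc n) \<boxminus> K n)"
      using step[OF Kc Kc, of "Suc n" n] by (simp only: KS[symmetric])
    also have "\<dots> \<le> c * (nrm (K 1 \<boxminus> K 0) * c ^ n)"
      using Suc Kn[of n] Kn[of "Suc n"] c Kc by (intro mult_mono) auto
    finally show ?case by (simp add: algebra_simps)
  qed simp
  have "summable (\<lambda>n. nrm (K (Suc n) \<boxminus> K n))"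
  proof (rule summable_comparison_test')
    show "summable (\<lambda>n. nrm (K 1 \<boxminus> K 0) * c ^ n)" using c by (intro summable_mult summable_geometric) auto
    show "norm (nrm (K (Suc n) \<boxminus> K n)) \<le> nrm (K 1 \<boxminus> K 0) * c ^ n" for n
      using geo[of n] Kc by simp
  qed
  then obtain k where k: "k \<in> carrier A" and lim: "(\<lambda>n. nrm (K n \<boxminus> k)) \<longlonglongrightarrow> 0"
    using complete[of K] Kc by blast
  show thesis
  proof (rule that[OF k])
    have "(\<lambda>n. nrm (K n \<boxminus> sstar A k)) \<longlonglongrightarrow> 0"
    proof -
      have "nrm (K n \<boxminus> sstar A k) = nrm (K n \<boxminus> k)" for n
      proof -
        have "sstar A (K n \<boxminus> k) = K n \<boxminus> sstar A k" using Kc k by (simp add: star_add star_scale Kstar)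
        then show ?thesis using nrm_star[of "K n \<boxminus> k"] Kc k by simp
      qed
      then show ?thesis using lim by simp
    qed
    then show "sstar A k = k" using limit_unique[OF Kc _ _ _ lim] k by simp
    have "(\<lambda>n. nrm (h \<boxtimes> K n \<boxminus> h \<boxtimes> k)) \<longlonglongrightarrow> 0"
    proof (rule tendsto_sandwich[of "\<lambda>_. 0" _ _ "\<lambda>n. nrm h * nrm (K n \<boxminus> k)"])
      show "(\<lambda>n. nrm h * nrm (K n \<boxminus> k)) \<longlonglongrightarrow> 0" using tendsto_mult_left[OF lim] by simp
    qed (use h Kc k in \<open>auto simp: mult_sub nrm_mult\<close>)
    moreover have "(\<lambda>n. nrm (h \<boxtimes> K n \<boxminus> k \<boxtimes> h)) \<longlonglongrightarrow> 0"
    proof (rule tendsto_sandwich[of "\<lambda>_. 0" _ _ "\<lambda>n. nrm (K n \<boxminus> k) * nrm h"])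
      show "(\<lambda>n. nrm (K n \<boxminus> k) * nrm h) \<longlonglongrightarrow> 0" using tendsto_mult_right[OF lim] by simp
    qed (use h Kc k in \<open>auto simp: mult_sub Kcomm nrm_mult\<close>)
    ultimately show "h \<boxtimes> k = k \<boxtimes> h"
      using limit_unique[of "\<lambda>n. h \<boxtimes> K n"] h Kc k by blast
    have "(\<lambda>n. nrm (K (Suc n) \<boxminus> (1/2) \<odot> (h \<boxtimes> h \<boxplus> k \<boxtimes> k))) \<longlonglongrightarrow> 0"
    proof (rule tendsto_sandwich[of "\<lambda>_. 0" _ _ "\<lambda>n. (c + nrm k) / 2 * nrm (K n \<boxminus> k)"])
      show "\<forall>\<^sub>F n in sequentially. nrm (K (Suc n) \<boxminus> (1/2) \<odot> (h \<boxtimes> h \<boxplus> k \<boxtimes> k)) \<le> (c + nrm k) / 2 * nrm (K n \<boxminus> k)"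
      proof (intro always_eventually allI)
        fix n
        have "nrm (K (Suc n) \<boxminus> (1/2) \<odot> (h \<boxtimes> h \<boxplus> k \<boxtimes> k)) \<le> (nrm (K n) + nrm k) / 2 * nrm (K n \<boxminus> k)"
          unfolding KS using Kc k by (intro step) auto
        also have "\<dots> \<le> (c + nrm k) / 2 * nrm (K n \<boxminus> k)"
          using Kn[of n] Kc k by (intro mult_right_mono) auto
        finally show "nrm (K (Suc n) \<boxminus> (1/2) \<odot> (h \<boxtimes> h \<boxplus> k \<boxtimes> k)) \<le> (c + nrm k) / 2 * nrm (K n \<boxminus> k)" .
      qed
      show "(\<lambda>n. (c + nrm k) / 2 * nrm (K n \<boxminus> k)) \<longlonglongrightarrow> 0" using tendsto_mult_left[OF lim] by simp
    qed (use h Kc k in auto)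
    moreover have "(\<lambda>n. nrm (K (Suc n) \<boxminus> k)) \<longlonglongrightarrow> 0" using LIMSEQ_Suc[OF lim] .
    ultimately have "k = (1/2) \<odot> (h \<boxtimes> h \<boxplus> k \<boxtimes> k)"
      using limit_unique[of "\<lambda>n. K (Suc n)"] h Kc k by (meson add_closed mult_closed scale_closed)
    then have "2 \<odot> k = 2 \<odot> ((1/2) \<odot> (h \<boxtimes> h \<boxplus> k \<boxtimes> k))" by simp
    then show "2 \<odot> k = h \<boxtimes> h \<boxplus> k \<boxtimes> k" using h k by (simp add: scale_scale)
  qed
qed

text \<open>This bound makes the supremum in \<open>env_norm\<close> one over a bounded set. The
  C*-identity for x* x reduces it to self-adjoint elements, which are rescaled so that the fixed
  point exists.\<close>

lemma cstar_seminorm_le: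
  assumes \<sigma>: "cstar_seminorm A \<sigma>" and x: "x \<in> carrier A"
  shows "\<sigma> x \<le> nrm x"
proof -
  note \<sigma>' = \<sigma>[unfolded cstar_seminorm_def]
  have sa: "\<sigma> h \<le> nrm h" if h: "h \<in> carrier A" "sstar A h = h" for h
  proof (rule field_le_epsilon)
    fix e :: real assume e: "0 < e"
    \<comment> \<open>Any r above the norm will do: h / r has norm below 1, so \<sigma> (h / r)
      \<le> 1, and e may then tend to 0.\<close>
    define r where "r = nrm h + e"
    have r: "0 < r" "nrm h < r" using e h by (auto simp: r_def add_nonneg_pos)
    define g where "g = complex_of_real (1 / r) \<odot> h"
    have g: "g \<in> carrier A" "sstar A g = g" using h by (simp_all add: g_def star_scale)
    have "nrm g < 1" using r h by (simp add: g_def nrm_scale norm_divide)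
    then obtain k where "k \<in> carrier A" "sstar A k = k" "g \<boxtimes> k = k \<boxtimes> g" "2 \<odot> k = g \<boxtimes> g \<boxplus> k \<boxtimes> k"
      using square_fixpoint[OF g] by blast
    then have "\<sigma> g \<le> 1" using cstar_seminorm_fix_bound[OF \<sigma>] g by blast
    moreover have "\<sigma> g = \<sigma> h / r" using \<sigma>' h r by (simp add: g_def norm_divide)
    ultimately show "\<sigma> h \<le> nrm h + e" using r by (simp add: r_def)
  qed
  have "(\<sigma> x)\<^sup>2 = \<sigma> (sstar A x \<boxtimes> x)" using \<sigma>' x by simp
  also have "\<dots> \<le> nrm (sstar A x \<boxtimes> x)" using x by (intro sa) (simp_all add: star_mult)
  also have "\<dots> \<le> (nrm x)\<^sup>2" using nrm_mult[of "sstar A x" x] x by (simp add: nrm_star power2_eq_square)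
  finally show ?thesis using x by (intro power2_le_imp_le[of "\<sigma> x" "nrm x"]) simp_all
qed

end

context banach_star_alg begin

subsection \<open>The enveloping \<open>C\<^sup>*\<close>-algebra\<close>

text \<open>Keeps the set of seminorms nonempty, so that a common upper bound of all of them bounds
  the supremum.\<close>

lemma zero_seminorm: "cstar_seminorm A (\<lambda>_. 0)"
  by (simp add: cstar_seminorm_def)

lemma env_norm_upper: "cstar_seminorm A \<sigma> \<Longrightarrow> x \<in> carrier A \<Longrightarrow> \<sigma> x \<le> env_norm A x"
  unfolding env_norm_def by (rule cSUP_upper) (auto intro!: bdd_aboveI[of _ "nrm x"] cstar_seminorm_le)

lemma env_norm_least: "(\<And>\<sigma>. cstar_seminorm A \<sigma> \<Longrightarrow> \<sigma> x \<le> b) \<Longrightarrow> env_norm A x \<le> b"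
  unfolding env_norm_def using zero_seminorm by (intro cSUP_least) auto

lemma env_norm_nonneg [simp]: "x \<in> carrier A \<Longrightarrow> 0 \<le> env_norm A x"
  using env_norm_upper[OF zero_seminorm] by simp

lemma env_norm_add:
  assumes "x \<in> carrier A" "y \<in> carrier A"
  shows "env_norm A (x \<boxplus> y) \<le> env_norm A x + env_norm A y"
proof (rule env_norm_least)
  fix \<sigma> assume \<sigma>: "cstar_seminorm A \<sigma>"
  then have "\<sigma> (x \<boxplus> y) \<le> \<sigma> x + \<sigma> y" using assms by (simp add: cstar_seminorm_def)
  also have "\<dots> \<le> env_norm A x + env_norm A y" using env_norm_upper[OF \<sigma>] assms by (intro add_mono)
  finally show "\<sigma> (x \<boxplus> y) \<le> env_norm A x + env_norm A y" .
qed

lemma env_norm_mult: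
  assumes "x \<in> carrier A" "y \<in> carrier A"
  shows "env_norm A (x \<boxtimes> y) \<le> env_norm A x * env_norm A y"
proof (rule env_norm_least)
  fix \<sigma> assume \<sigma>: "cstar_seminorm A \<sigma>"
  have "\<sigma> (x \<boxtimes> y) \<le> \<sigma> x * \<sigma> y" using \<sigma> assms by (simp add: cstar_seminorm_def)
  also have "\<dots> \<le> env_norm A x * env_norm A y"
    using \<sigma> assms by (intro mult_mono env_norm_upper) (auto simp: cstar_seminorm_def)
  finally show "\<sigma> (x \<boxtimes> y) \<le> env_norm A x * env_norm A y" .
qed

lemma env_norm_scale:
  assumes "x \<in> carrier A"
  shows "env_norm A (c \<odot> x) \<le> cmod c * env_norm A x"
proof (rule env_norm_least)
  fix \<sigma> assume \<sigma>: "cstar_seminorm A \<sigma>"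
  then have "\<sigma> (c \<odot> x) = cmod c * \<sigma> x" using assms by (simp add: cstar_seminorm_def)
  also have "\<dots> \<le> cmod c * env_norm A x" using env_norm_upper[OF \<sigma> assms] by (intro mult_left_mono) auto
  finally show "\<sigma> (c \<odot> x) \<le> cmod c * env_norm A x" .
qed

lemma env_dist_nonneg [simp]: "x \<in> carrier A \<Longrightarrow> y \<in> carrier A \<Longrightarrow> 0 \<le> env_dist A x y"
  by (simp add: env_dist_def)

lemma env_dist_triangle:
  assumes "x \<in> carrier A" "y \<in> carrier A" "z \<in> carrier A"
  shows "env_dist A x z \<le> env_dist A x y + env_dist A y z"
  unfolding env_dist_def using sub_triangle[OF assms] env_norm_add[of "x \<boxminus> y" "y \<boxminus> z"] assms by simp

lemma env_dist_commute:
  assumes "x \<in> carrier A" "y \<in> carrier A"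
  shows "env_dist A x y = env_dist A y x"
proof (rule antisym)
  have "env_dist A x y \<le> env_dist A y x" if "x \<in> carrier A" "y \<in> carrier A" for x y
    unfolding env_dist_def using sub_commute[OF that] env_norm_scale[of "y \<boxminus> x" "-1"] that by simp
  then show "env_dist A x y \<le> env_dist A y x" "env_dist A y x \<le> env_dist A x y" using assms by blast+
qed

lemma env_dist_self [simp]: "x \<in> carrier A \<Longrightarrow> env_dist A x x = 0"
  unfolding env_dist_def using sub_self[of x] env_norm_scale[of x 0] env_norm_nonneg[of "0 \<odot> x"] by (simp add: order_antisym)

lemma env_cauchy_carrier: "s \<in> env_cauchy A \<Longrightarrow> s n \<in> carrier A"
  by (auto simp: env_cauchy_def)

lemma env_cauchyD:
  "s \<in> env_cauchy A \<Longrightarrow> 0 < e \<Longrightarrow> \<exists>N. \<forall>m\<ge>N. \<forall>n\<ge>N. env_dist A (s m) (s n) < e"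
  by (simp add: env_cauchy_def)

lemma env_class_self: "s \<in> env_cauchy A \<Longrightarrow> s \<in> env_class A s"
  by (simp add: env_class_def env_cauchy_carrier)

lemma env_rep_class:
  assumes "s \<in> env_cauchy A"
  shows "env_rep (env_class A s) \<in> env_cauchy A"
    "(\<lambda>n. env_dist A (s n) (env_rep (env_class A s) n)) \<longlonglongrightarrow> 0"
proof -
  have "env_rep (env_class A s) \<in> env_class A s"
    unfolding env_rep_def by (rule someI[where P = "\<lambda>t. t \<in> env_class A s"]) (rule env_class_self[OF assms])
  then show "env_rep (env_class A s) \<in> env_cauchy A"
    "(\<lambda>n. env_dist A (s n) (env_rep (env_class A s) n)) \<longlonglongrightarrow> 0" by (auto simp: env_class_def)
qed

lemma env_dist_limit_trans:
  assumes "\<And>n. s n \<in> carrier A" "\<And>n. t n \<in> carrier A" "\<And>n. u n \<in> carrier A"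
    and "(\<lambda>n. env_dist A (s n) (t n)) \<longlonglongrightarrow> 0" "(\<lambda>n. env_dist A (t n) (u n)) \<longlonglongrightarrow> 0"
  shows "(\<lambda>n. env_dist A (s n) (u n)) \<longlonglongrightarrow> 0"
proof (rule tendsto_sandwich[of "\<lambda>_. 0" _ _ "\<lambda>n. env_dist A (s n) (t n) + env_dist A (t n) (u n)"])
  show "(\<lambda>n. env_dist A (s n) (t n) + env_dist A (t n) (u n)) \<longlonglongrightarrow> 0"
    using tendsto_add[OF assms(4,5)] by simp
qed (use assms in \<open>auto intro!: always_eventually env_dist_triangle\<close>)

lemma env_class_eq_iff:
  assumes s: "s \<in> env_cauchy A" and t: "t \<in> env_cauchy A"
  shows "env_class A s = env_class A t \<longleftrightarrow> (\<lambda>n. env_dist A (s n) (t n)) \<longlonglongrightarrow> 0"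
proof
  assume "env_class A s = env_class A t"
  then show "(\<lambda>n. env_dist A (s n) (t n)) \<longlonglongrightarrow> 0" using env_class_self[OF t] by (auto simp: env_class_def)
next
  assume st: "(\<lambda>n. env_dist A (s n) (t n)) \<longlonglongrightarrow> 0"
  then have ts: "(\<lambda>n. env_dist A (t n) (s n)) \<longlonglongrightarrow> 0"
    using env_dist_commute[OF env_cauchy_carrier[OF s] env_cauchy_carrier[OF t]] by simp
  show "env_class A s = env_class A t"
    unfolding env_class_def
    using env_dist_limit_trans[OF _ _ _ st] env_dist_limit_trans[OF _ _ _ ts] s t env_cauchy_carrier by blast
qed

lemma env_cauchy_const [simp]: "x \<in> carrier A \<Longrightarrow> (\<lambda>n. x) \<in> env_cauchy A"
  by (auto simp: env_cauchy_def)

lemma env_norm_diff: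
  assumes "x \<in> carrier A" "y \<in> carrier A"
  shows "env_norm A x \<le> env_norm A y + env_dist A x y"
proof -
  have "x = y \<boxplus> (x \<boxminus> y)"
  proof -
    obtain L where L: "\<And>a b c d e f a' b' c' d' e' f'. L (a, b, c, d, e, f) \<boxplus> L (a', b', c', d', e', f') =
       L (a + a', b + b', c + c', d + d', e + e', f + f')"
      "\<And>s a b c d e f. s \<odot> L (a, b, c, d, e, f) = L (s * a, s * b, s * c, s * d, s * e, s * f)"
      "x = L (1, 0, 0, 0, 0, 0)" "y = L (0, 1, 0, 0, 0, 0)"
      by (rule linear_coordinates[OF assms(1,2,2,2,2,2)]) (rule that)
    show ?thesis unfolding L(3-4) by (simp add: L(1,2))
  qed
  then show ?thesis unfolding env_dist_def using env_norm_add[of y "x \<boxminus> y"] assms by simp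
qed

lemma env_cauchy_bounded:
  assumes s: "s \<in> env_cauchy A"
  obtains B where "0 < B" "\<And>n. env_norm A (s n) \<le> B"
proof -
  obtain N where N: "\<And>m n. m \<ge> N \<Longrightarrow> n \<ge> N \<Longrightarrow> env_dist A (s m) (s n) < 1"
    using env_cauchyD[OF s zero_less_one] by blast
  define B where "B = 1 + (\<Sum>i\<le>N. env_norm A (s i))"
  have c: "s n \<in> carrier A" for n using s by (rule env_cauchy_carrier)
  have le: "env_norm A (s i) \<le> B - 1" if "i \<le> N" for i
    using that c unfolding B_def by (auto intro: member_le_sum)
  show thesis
  proof (rule that[of B])
    show "0 < B" unfolding B_def using c by (intro add_pos_nonneg sum_nonneg) auto
    fix n
    show "env_norm A (s n) \<le> B"
    proof (cases "n \<le> N")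
      case False
      then have "env_norm A (s n) \<le> env_norm A (s N) + 1"
        using env_norm_diff[OF c c, of n N] N[of n N] by simp
      then show ?thesis using le[of N] by simp
    qed (use le in force)
  qed
qed

lemma env_dist_mult:
  assumes "x \<in> carrier A" "y \<in> carrier A" "x' \<in> carrier A" "y' \<in> carrier A"
  shows "env_dist A (x \<boxtimes> y) (x' \<boxtimes> y') \<le> env_norm A x * env_dist A y y' + env_dist A x x' * env_norm A y'"
proof -
  have "env_dist A (x \<boxtimes> y) (x' \<boxtimes> y') \<le> env_dist A (x \<boxtimes> y) (x \<boxtimes> y') + env_dist A (x \<boxtimes> y') (x' \<boxtimes> y')"
    using assms by (intro env_dist_triangle) auto
  also have "\<dots> \<le> env_norm A x * env_dist A y y' + env_dist A x x' * env_norm A y'"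
    unfolding env_dist_def using assms by (intro add_mono) (simp_all add: mult_sub env_norm_mult)
  finally show ?thesis .
qed

lemma env_cauchy_mult:
  assumes s: "s \<in> env_cauchy A" and t: "t \<in> env_cauchy A"
  shows "(\<lambda>n. s n \<boxtimes> t n) \<in> env_cauchy A"
proof -
  have c: "s n \<in> carrier A" "t n \<in> carrier A" for n using s t by (simp_all add: env_cauchy_carrier)
  obtain B where B: "0 < B" "\<And>n. env_norm A (s n) \<le> B" by (rule env_cauchy_bounded[OF s]) (rule that)
  obtain C where C: "0 < C" "\<And>n. env_norm A (t n) \<le> C" by (rule env_cauchy_bounded[OF t]) (rule that)
  have "\<exists>N. \<forall>m\<ge>N. \<forall>n\<ge>N. env_dist A (s m \<boxtimes> t m) (s n \<boxtimes> t n) < e" if e: "0 < e" for e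
  proof -
    have eC: "0 < e / 2 / C" and eB: "0 < e / 2 / B" using e B C by simp_all
    obtain M where M: "\<And>m n. m \<ge> M \<Longrightarrow> n \<ge> M \<Longrightarrow> env_dist A (s m) (s n) < e / 2 / C"
      using env_cauchyD[OF s eC] by blast
    obtain N where N: "\<And>m n. m \<ge> N \<Longrightarrow> n \<ge> N \<Longrightarrow> env_dist A (t m) (t n) < e / 2 / B"
      using env_cauchyD[OF t eB] by blast
    have "env_dist A (s m \<boxtimes> t m) (s n \<boxtimes> t n) < e" if "m \<ge> max M N" "n \<ge> max M N" for m n
    proof -
      have "env_dist A (s m \<boxtimes> t m) (s n \<boxtimes> t n)
        \<le> env_norm A (s m) * env_dist A (t m) (t n) + env_dist A (s m) (s n) * env_norm A (t n)"
        using c by (intro env_dist_mult) auto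
      also have "\<dots> \<le> B * env_dist A (t m) (t n) + env_dist A (s m) (s n) * C"
        using B C c by (intro add_mono mult_mono) (auto simp: less_imp_le)
      also have "\<dots> < e"
        using N[of m n] M[of m n] that B(1) C(1) by (simp add: field_simps)
      finally show ?thesis .
    qed
    then show ?thesis by blast
  qed
  then show ?thesis using c by (auto simp: env_cauchy_def)
qed

text \<open>\<open>env_cstar\<close> multiplies representatives picked by choice; their product is
  compared with that of arbitrary Cauchy representatives, one factor being bounded while the
  difference in the other tends to 0.\<close>

lemma env_cstar_mult:
  assumes s: "s \<in> env_cauchy A" and t: "t \<in> env_cauchy A"
  shows "smult (env_cstar A) (env_class A s) (env_class A t) = env_class A (\<lambda>n. s n \<boxtimes> t n)"
proof -
  define s' t' where "s' = env_rep (env_class A s)" and "t' = env_rep (env_class A t)"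
  have s': "s' \<in> env_cauchy A" "(\<lambda>n. env_dist A (s n) (s' n)) \<longlonglongrightarrow> 0"
    using env_rep_class[OF s] by (simp_all add: s'_def)
  have t': "t' \<in> env_cauchy A" "(\<lambda>n. env_dist A (t n) (t' n)) \<longlonglongrightarrow> 0"
    using env_rep_class[OF t] by (simp_all add: t'_def)
  obtain B where B: "0 < B" "\<And>n. env_norm A (s n) \<le> B" by (rule env_cauchy_bounded[OF s]) (rule that)
  obtain C where C: "0 < C" "\<And>n. env_norm A (t' n) \<le> C" by (rule env_cauchy_bounded[OF t'(1)]) (rule that)
  have "(\<lambda>n. env_dist A (s n \<boxtimes> t n) (s' n \<boxtimes> t' n)) \<longlonglongrightarrow> 0"
  proof (rule tendsto_sandwich[of "\<lambda>_. 0" _ _ "\<lambda>n. B * env_dist A (t n) (t' n) + env_dist A (s n) (s' n) * C"])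
    show "(\<lambda>n. B * env_dist A (t n) (t' n) + env_dist A (s n) (s' n) * C) \<longlonglongrightarrow> 0"
      using tendsto_add[OF tendsto_mult_left[OF t'(2), of B] tendsto_mult_right[OF s'(2), of C]] by simp
    show "\<forall>\<^sub>F n in sequentially. env_dist A (s n \<boxtimes> t n) (s' n \<boxtimes> t' n)
        \<le> B * env_dist A (t n) (t' n) + env_dist A (s n) (s' n) * C"
    proof (intro always_eventually allI)
      fix n
      have "env_dist A (s n \<boxtimes> t n) (s' n \<boxtimes> t' n)
        \<le> env_norm A (s n) * env_dist A (t n) (t' n) + env_dist A (s n) (s' n) * env_norm A (t' n)"
        using s t s' t' by (intro env_dist_mult env_cauchy_carrier)
      also have "\<dots> \<le> B * env_dist A (t n) (t' n) + env_dist A (s n) (s' n) * C"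
        using B C s t s' t' by (intro add_mono mult_mono) (auto simp: less_imp_le env_cauchy_carrier)
      finally show "env_dist A (s n \<boxtimes> t n) (s' n \<boxtimes> t' n)
        \<le> B * env_dist A (t n) (t' n) + env_dist A (s n) (s' n) * C" .
    qed
  qed (use s t s' t' in \<open>auto simp: env_cauchy_carrier\<close>)
  then show ?thesis
    using env_class_eq_iff[OF env_cauchy_mult[OF s t] env_cauchy_mult[OF s'(1) t'(1)]]
    by (simp add: env_cstar_def s'_def t'_def)
qed

lemma env_class_in_carrier: "s \<in> env_cauchy A \<Longrightarrow> env_class A s \<in> carrier (env_cstar A)"
  by (simp add: env_cstar_def)

text \<open>Applied below to the partial sums of a Neumann series.\<close>

lemma env_cauchy_geometric:
  assumes c: "\<And>n. s n \<in> carrier A" and r: "0 \<le> r" "r < 1"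
    and d: "\<And>n. env_dist A (s (Suc n)) (s n) \<le> r ^ n"
  shows "s \<in> env_cauchy A"
proof -
  have bound: "env_dist A (s (n + k)) (s n) \<le> r ^ n / (1 - r)" for n k
  proof -
    have "env_dist A (s (n + k)) (s n) \<le> (\<Sum>i<k. r ^ (n + i))"
    proof (induction k)
      case (Suc k)
      have "env_dist A (s (n + Suc k)) (s n) \<le> env_dist A (s (Suc (n + k))) (s (n + k)) + env_dist A (s (n + k)) (s n)"
        using env_dist_triangle c by simp
      then show ?case using Suc d[of "n + k"] by simp
    qed (use c in simp)
    also have "\<dots> = r ^ n * (\<Sum>i<k. r ^ i)" by (simp add: power_add sum_distrib_left)
    also have "\<dots> \<le> r ^ n * (1 / (1 - r))"
      using r by (intro mult_left_mono) (simp_all add: sum_gp_strict divide_right_mono)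
    finally show ?thesis by simp
  qed
  have lim: "(\<lambda>n. r ^ n / (1 - r)) \<longlonglongrightarrow> 0"
    using r by (intro tendsto_divide_zero LIMSEQ_power_zero) auto
  have "\<exists>N. \<forall>m\<ge>N. \<forall>n\<ge>N. env_dist A (s m) (s n) < e" if e: "0 < e" for e
  proof -
    from LIMSEQ_D[OF lim e] obtain N where N: "\<And>n. n \<ge> N \<Longrightarrow> \<bar>r ^ n / (1 - r)\<bar> < e" unfolding real_norm_def by auto
    have key: "env_dist A (s m) (s n) < e" if "n \<ge> N" "m \<ge> n" for m n
      using bound[of n "m - n"] N[of n] that by (simp del: abs_divide)
    have "env_dist A (s m) (s n) < e" if "m \<ge> N" "n \<ge> N" for m n
      using key[of n m] key[of m n] env_dist_commute[OF c c, of m n] that by (cases "m \<le> n") auto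
    then show ?thesis by blast
  qed
  then show ?thesis using c by (auto simp: env_cauchy_def)
qed

section \<open>Corners of Banach star-algebras\<close>

lemma corner_carrier:
  assumes p: "p \<in> carrier A" "p \<boxtimes> p = p"
  shows "x \<in> carrier (corner A p) \<longleftrightarrow> x \<in> carrier A \<and> p \<boxtimes> x = x \<and> x \<boxtimes> p = x"
proof
  assume "x \<in> carrier (corner A p)"
  then obtain a where "a \<in> carrier A" "x = p \<boxtimes> a \<boxtimes> p" by (auto simp: corner_def)
  then show "x \<in> carrier A \<and> p \<boxtimes> x = x \<and> x \<boxtimes> p = x"
    using p by (metis mult_assoc mult_closed)
next
  assume "x \<in> carrier A \<and> p \<boxtimes> x = x \<and> x \<boxtimes> p = x"
  then show "x \<in> carrier (corner A p)" by (auto simp: corner_def image_iff intro!: bexI[of _ x])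
qed

lemma corner_simps [simp]:
  "sadd (corner B p) = sadd B" "smult (corner B p) = smult B" "sscale (corner B p) = sscale B"
  "sstar (corner B p) = sstar B"
  by (simp_all add: corner_def)

text \<open>The corner is closed because it is cut out by p x = x = x p, and both conditions pass to
  limits by continuity of multiplication with p.\<close>

lemma corner_banach:
  assumes p: "p \<in> carrier A" "p \<boxtimes> p = p" "sstar A p = p"
  shows "banach_star_alg (corner A p) nrm"
proof -
  note cc = corner_carrier[OF p(1,2)]
  have star: "sstar A x \<in> carrier (corner A p)" if "x \<in> carrier (corner A p)" for x
    using that p star_mult[of p x] star_mult[of x p] by (simp add: cc)
  have mult: "x \<boxtimes> y \<in> carrier (corner A p)"
    if "x \<in> carrier (corner A p)" "y \<in> carrier (corner A p)" for x y
    using that p unfolding cc by (metis mult_assoc mult_closed)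
  have "\<exists>l\<in>carrier (corner A p). (\<lambda>n. nrm (s n \<boxminus> l)) \<longlonglongrightarrow> 0"
    if s: "\<And>n. s n \<in> carrier (corner A p)" and sum: "summable (\<lambda>n. nrm (s (Suc n) \<boxminus> s n))" for s
  proof -
    have sc: "s n \<in> carrier A" "p \<boxtimes> s n = s n" "s n \<boxtimes> p = s n" for n using s cc by auto
    obtain l where l: "l \<in> carrier A" and lim: "(\<lambda>n. nrm (s n \<boxminus> l)) \<longlonglongrightarrow> 0"
      using complete[OF sc(1) sum] by blast
    have "(\<lambda>n. nrm (s n \<boxminus> p \<boxtimes> l)) \<longlonglongrightarrow> 0"
    proof (rule tendsto_sandwich[of "\<lambda>_. 0" _ _ "\<lambda>n. nrm p * nrm (s n \<boxminus> l)"])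
      have "nrm (s n \<boxminus> p \<boxtimes> l) \<le> nrm p * nrm (s n \<boxminus> l)" for n
        using mult_sub(1)[OF p(1) sc(1) l, of n] nrm_mult[of p "s n \<boxminus> l"] p l sc by simp
      then show "\<forall>\<^sub>F n in sequentially. nrm (s n \<boxminus> p \<boxtimes> l) \<le> nrm p * nrm (s n \<boxminus> l)" by simp
      show "(\<lambda>n. nrm p * nrm (s n \<boxminus> l)) \<longlonglongrightarrow> 0" using tendsto_mult_left[OF lim] by simp
    qed (use p l sc in auto)
    then have "p \<boxtimes> l = l" using limit_unique[OF sc(1) _ l _ lim] p l by simp
    moreover have "(\<lambda>n. nrm (s n \<boxminus> l \<boxtimes> p)) \<longlonglongrightarrow> 0"
    proof (rule tendsto_sandwich[of "\<lambda>_. 0" _ _ "\<lambda>n. nrm (s n \<boxminus> l) * nrm p"])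
      have "nrm (s n \<boxminus> l \<boxtimes> p) \<le> nrm (s n \<boxminus> l) * nrm p" for n
        using mult_sub(2)[OF p(1) sc(1) l, of n] nrm_mult[of "s n \<boxminus> l" p] p l sc by simp
      then show "\<forall>\<^sub>F n in sequentially. nrm (s n \<boxminus> l \<boxtimes> p) \<le> nrm (s n \<boxminus> l) * nrm p" by simp
      show "(\<lambda>n. nrm (s n \<boxminus> l) * nrm p) \<longlonglongrightarrow> 0" using tendsto_mult_right[OF lim] by simp
    qed (use p l sc in auto)
    then have "l \<boxtimes> p = l" using limit_unique[OF sc(1) _ l _ lim] p l by simp
    ultimately show ?thesis using l lim cc by blast
  qed
  then show ?thesis
    using star mult p
    by unfold_locales
      (auto simp: cc add_assoc scale_add add_scale scale_scale zero_scale mult_assoc mult_add add_mult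
        scale_mult mult_scale star_add star_scale star_mult nrm_add nrm_scale nrm_mult nrm_star
        intro: add_comm nrm_eq)
qed

text \<open>Hence on the corner the enveloping norm of A is at most that of the corner itself, which
  makes the canonical map between the completions contractive.\<close>

lemma cstar_seminorm_corner:
  assumes "p \<in> carrier A" "p \<boxtimes> p = p" "cstar_seminorm A \<sigma>"
  shows "cstar_seminorm (corner A p) \<sigma>"
  using assms(3) by (auto simp: cstar_seminorm_def corner_carrier[OF assms(1,2)])

text \<open>With \<open>a = p - ep\<close> one has \<open>p - pep = a\<^sup>* a = p a\<close>.\<close>

lemma cstar_seminorm_compression:
  assumes p: "p \<in> carrier A" "p \<boxtimes> p = p" "sstar A p = p"
    and e: "e \<in> carrier A" "e \<boxtimes> e = e" "sstar A e = e"
    and \<sigma>: "cstar_seminorm A \<sigma>"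
  shows "\<sigma> (p \<boxminus> p \<boxtimes> e \<boxtimes> p) \<le> 1"
proof -
  note \<sigma>' = \<sigma>[unfolded cstar_seminorm_def]
  define x a where "x = p \<boxtimes> (e \<boxtimes> p)" and "a = p \<boxminus> e \<boxtimes> p"
  have x: "x \<in> carrier A" and a: "a \<in> carrier A" using p e by (simp_all add: x_def a_def)
  have "sstar A a \<boxtimes> a = p \<boxminus> x"
  proof -
    have ee: "e \<boxtimes> (e \<boxtimes> p) = e \<boxtimes> p" using p e by (simp flip: mult_assoc)
    have sa: "sstar A a = p \<boxminus> p \<boxtimes> e" using p e by (simp add: a_def star_add star_scale star_mult)
    have "sstar A a \<boxtimes> a = (p \<boxminus> x) \<boxminus> (x \<boxminus> x)"
      unfolding sa unfolding a_def using p e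
      by (simp add: mult_add add_mult mult_scale scale_mult mult_assoc scale_add scale_scale add_assoc ee flip: x_def)
    also have "\<dots> = p \<boxminus> x"
      using zero_scale[of x "p \<boxminus> x"] p x by (simp add: sub_self scale_scale add_comm[of "p \<boxminus> x"])
    finally show ?thesis .
  qed
  moreover have "p \<boxtimes> a = p \<boxminus> x" using p e by (simp add: a_def x_def mult_add mult_scale)
  \<comment> \<open>\<sigma> p = \<sigma> (p* p) = (\<sigma> p)^2, so the value is 0 or 1.\<close>
  moreover have "\<sigma> p \<le> 1"
  proof -
    have "(\<sigma> p)\<^sup>2 = \<sigma> p" using \<sigma>' p by metis
    then have "\<sigma> p = 0 \<or> \<sigma> p = 1" by (simp add: power2_eq_square)
    then show ?thesis by auto
  qed
  \<comment> \<open>The two expressions for p - x give (\<sigma> a)^2 = \<sigma> (p a) \<le>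
    \<sigma> a, so \<sigma> a is at most 1 and with it \<sigma> (p - x).\<close>
  ultimately have "(\<sigma> a)\<^sup>2 = \<sigma> (p \<boxminus> x)" "\<sigma> (p \<boxminus> x) \<le> 1 * \<sigma> a"
    using \<sigma>' p a mult_right_mono[of "\<sigma> p" 1 "\<sigma> a"] by (metis, smt (verit, best))
  then have "(\<sigma> a)\<^sup>2 \<le> \<sigma> a" by simp
  then have "\<sigma> a \<le> 1"
    using \<sigma>' a by (cases "\<sigma> a = 0") (auto simp: power2_eq_square mult_le_cancel_right1 dest: spec)
  then have "\<sigma> (p \<boxminus> x) \<le> 1" using \<open>\<sigma> (p \<boxminus> x) \<le> 1 * \<sigma> a\<close> by simp
  then show ?thesis using p e by (simp add: x_def mult_assoc)
qed

text \<open>A star-character \<open>\<psi>\<close> of the corner that is negative on \<open>x = pep\<close> takes the value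
  \<open>1 + t > 1\<close> on \<open>z = p - x\<close>, whereas \<open>z\<close> has norm at most \<open>1\<close> in \<open>pC\<^sup>*(A)p\<close>. Hence
  \<open>d = p - z / (1 + t)\<close> is invertible there by the Neumann series, but \<open>\<psi> d = 0\<close>.\<close>

theorem corner_envelope_not_iso:
  assumes p: "p \<in> carrier A" "p \<boxtimes> p = p" "sstar A p = p"
    and e: "e \<in> carrier A" "e \<boxtimes> e = e" "sstar A e = e"
    and \<psi>_add: "\<And>x y. x \<in> carrier (corner A p) \<Longrightarrow> y \<in> carrier (corner A p) \<Longrightarrow> \<psi> (x \<boxplus> y) = \<psi> x + \<psi> y"
    and \<psi>_scale: "\<And>c x. x \<in> carrier (corner A p) \<Longrightarrow> \<psi> (c \<odot> x) = c * \<psi> x"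
    and \<psi>_mult: "\<And>x y. x \<in> carrier (corner A p) \<Longrightarrow> y \<in> carrier (corner A p) \<Longrightarrow> \<psi> (x \<boxtimes> y) = \<psi> x * \<psi> y"
    and \<psi>_star: "\<And>x. x \<in> carrier (corner A p) \<Longrightarrow> \<psi> (sstar A x) = cnj (\<psi> x)"
    and \<psi>_p: "\<psi> p = 1"
    and \<psi>_neg: "\<psi> (p \<boxtimes> e \<boxtimes> p) = complex_of_real (- t)" "0 < t"
  shows "\<not> star_iso (env_cstar (corner A p)) (corner (env_cstar A) (env_embed A p)) (env_incl (corner A p) A)"
proof
  define H where "H = corner A p"
  define \<Phi> where "\<Phi> = env_incl H A"
  assume "star_iso (env_cstar (corner A p)) (corner (env_cstar A) (env_embed A p)) (env_incl (corner A p) A)"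
  then have bij: "bij_betw \<Phi> (carrier (env_cstar H)) (carrier (corner (env_cstar A) (env_embed A p)))"
    and hom: "\<And>X Y. X \<in> carrier (env_cstar H) \<Longrightarrow> Y \<in> carrier (env_cstar H) \<Longrightarrow>
       \<Phi> (smult (env_cstar H) X Y) = smult (env_cstar A) (\<Phi> X) (\<Phi> Y)"
    by (simp_all add: star_iso_def H_def \<Phi>_def)
  interpret H: banach_star_alg H nrm unfolding H_def by (rule corner_banach[OF p])
  have Hops: "sadd H = sadd A" "smult H = smult A" "sscale H = sscale A" "sstar H = sstar A"
    by (simp_all add: H_def)
  have cc: "x \<in> carrier H \<longleftrightarrow> x \<in> carrier A \<and> p \<boxtimes> x = x \<and> x \<boxtimes> p = x" for x
    unfolding H_def by (rule corner_carrier[OF p(1,2)])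
  \<comment> \<open>Seminorms on A restrict to the corner, whose supremum therefore runs over at
    least as many.\<close>
  have le: "env_norm A x \<le> env_norm H x" if "x \<in> carrier H" for x
    using that cstar_seminorm_corner[OF p(1,2)] unfolding H_def[symmetric]
    by (intro env_norm_least H.env_norm_upper) auto
  have cauchy: "s \<in> env_cauchy A" if s: "s \<in> env_cauchy H" for s
  proof -
    have c: "s n \<in> carrier H" for n using s by (rule H.env_cauchy_carrier)
    have "env_dist A (s m) (s n) \<le> env_dist H (s m) (s n)" for m n
      unfolding env_dist_def using le[of "s m \<boxminus> s n"] c H.add_closed H.scale_closed by (simp add: Hops)
    moreover have "\<exists>N. \<forall>m\<ge>N. \<forall>n\<ge>N. env_dist H (s m) (s n) < e" if "0 < e" for e
      using s that unfolding env_cauchy_def by blast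
    ultimately have "\<exists>N. \<forall>m\<ge>N. \<forall>n\<ge>N. env_dist A (s m) (s n) < e" if "0 < e" for e
      using that by (meson le_less_trans)
    moreover have "range s \<subseteq> carrier A" using c cc by blast
    ultimately show ?thesis by (simp add: env_cauchy_def)
  qed
  \<comment> \<open>\<open>env_incl\<close> uses a chosen Cauchy representative of its argument; as
    the norm of A is the smaller one, that representative converges to x in A as well.\<close>
  have \<Phi>_class: "\<Phi> (env_class H (\<lambda>n. x)) = env_class A (\<lambda>n. x)" if x: "x \<in> carrier H" for x
  proof -
    let ?s = "env_rep (env_class H (\<lambda>n. x))"
    have s: "?s \<in> env_cauchy H" "(\<lambda>n. env_dist H x (?s n)) \<longlonglongrightarrow> 0"
      using H.env_rep_class[of "\<lambda>n. x"] x by simp_all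
    have sc: "?s n \<in> carrier H" for n using s by (intro H.env_cauchy_carrier)
    have "(\<lambda>n. env_dist A x (?s n)) \<longlonglongrightarrow> 0"
    proof (rule tendsto_sandwich[OF _ _ tendsto_const s(2)])
      have "env_dist A x (?s n) \<le> env_dist H x (?s n)" for n
        unfolding env_dist_def using le[of "x \<boxminus> ?s n"] x sc H.add_closed H.scale_closed by (simp add: Hops)
      then show "\<forall>\<^sub>F n in sequentially. env_dist A x (?s n) \<le> env_dist H x (?s n)" by simp
    qed (use sc x cc in auto)
    then show ?thesis
      using env_class_eq_iff[of "\<lambda>n. x" ?s] cauchy[OF s(1)] x cc by (simp add: \<Phi>_def env_incl_def)
  qed

  define z where "z = p \<boxminus> p \<boxtimes> e \<boxtimes> p"
  define r where "r = 1 / (1 + t)"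
  define d where "d = p \<boxminus> complex_of_real r \<odot> z"
  have r: "0 \<le> r" "r < 1" "r * (1 + t) = 1" using \<psi>_neg(2) by (simp_all add: r_def)
  have pH: "p \<in> carrier H" using p cc by simp
  have xH: "p \<boxtimes> e \<boxtimes> p \<in> carrier H"
    unfolding H_def corner_def using e by auto
  have zH: "z \<in> carrier H" using H.add_closed[OF pH H.scale_closed[OF xH, of "-1"]] by (simp add: Hops z_def)
  have dH: "d \<in> carrier H"
    using H.add_closed[OF pH H.scale_closed[OF H.scale_closed[OF zH], of "-1"]] by (simp add: Hops d_def)
  have \<psi>z: "\<psi> z = complex_of_real (1 + t)"
    using pH xH H.scale_closed[OF xH, of "-1"] by (simp add: z_def \<psi>_add \<psi>_scale \<psi>_p \<psi>_neg Hops flip: H_def)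
  have \<psi>d: "\<psi> d = 0"
  proof -
    have "\<psi> d = 1 - complex_of_real (r * (1 + t))"
      using pH zH H.scale_closed[OF H.scale_closed[OF zH], of "-1" "complex_of_real r"] H.scale_closed[OF zH]
      by (simp add: d_def \<psi>_add \<psi>_scale \<psi>_p \<psi>z Hops flip: H_def)
    then show ?thesis by (simp only: r(3)) simp
  qed
  \<comment> \<open>Powers of z, with p as zeroth power since p is the unit of the corner.\<close>
  define zp where "zp = rec_nat p (\<lambda>_ w. z \<boxtimes> w)"
  have zp: "zp 0 = p" "zp (Suc n) = z \<boxtimes> zp n" for n by (simp_all add: zp_def)
  have zpH: "zp n \<in> carrier H" for n
    by (induction n) (use pH zH H.mult_closed in \<open>auto simp: zp Hops\<close>)
  have inA: "x \<in> carrier A" if "x \<in> carrier H" for x using that cc by blast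
  have zpN: "env_norm A (zp n) \<le> 1" for n
  proof (induction n)
    case 0
    show ?case unfolding zp
    proof (rule env_norm_least)
      fix \<sigma> assume "cstar_seminorm A \<sigma>"
      then have "(\<sigma> p)\<^sup>2 = \<sigma> p" using p unfolding cstar_seminorm_def by metis
      then have "\<sigma> p = 0 \<or> \<sigma> p = 1" by (simp add: power2_eq_square)
      then show "\<sigma> p \<le> 1" by auto
    qed
  next
    case (Suc n)
    have "env_norm A (zp (Suc n)) \<le> env_norm A z * env_norm A (zp n)"
      unfolding zp using env_norm_mult inA zH zpH by blast
    also have "\<dots> \<le> 1 * 1"
    proof (rule mult_mono)
      show "env_norm A z \<le> 1"
        unfolding z_def by (intro env_norm_least cstar_seminorm_compression p e)
    qed (use Suc inA zH zpH in auto)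
    finally show ?case by simp
  qed
  \<comment> \<open>Partial sums of the Neumann series for the inverse of d = p - r z.\<close>
  define y where "y = rec_nat p (\<lambda>n w. w \<boxplus> complex_of_real (r ^ Suc n) \<odot> zp (Suc n))"
  have y: "y 0 = p" "y (Suc n) = y n \<boxplus> complex_of_real (r ^ Suc n) \<odot> zp (Suc n)" for n
    by (simp_all add: y_def)
  have yH: "y n \<in> carrier H" for n
    by (induction n) (use pH zpH H.add_closed H.scale_closed in \<open>auto simp: y Hops simp del: power_Suc of_real_power\<close>)
  \<comment> \<open>Telescoping leaves a single error term, whose enveloping norm is at most
    r^(n+1).\<close>
  have dy: "d \<boxtimes> y n = p \<boxminus> complex_of_real (r ^ Suc n) \<odot> zp (Suc n)" for n
  proof -
    have dzp: "d \<boxtimes> zp n = zp n \<boxminus> complex_of_real r \<odot> zp (Suc n)" for n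
    proof -
      have "p \<boxtimes> zp n = zp n" using zpH cc by blast
      then show ?thesis
        using inA[OF zH] inA[OF zpH] p by (simp add: d_def zp(2) add_mult scale_mult)
    qed
    show ?thesis
    proof (induction n)
      case 0
      then show ?case using dzp[of 0] by (simp add: y zp)
    next
      case (Suc n)
      have c1: "zp (Suc n) \<in> carrier A" and c2: "zp (Suc (Suc n)) \<in> carrier A" using inA zpH by auto
      have "d \<boxtimes> y (Suc n) = (p \<boxminus> complex_of_real (r ^ Suc n) \<odot> zp (Suc n))
          \<boxplus> complex_of_real (r ^ Suc n) \<odot> (zp (Suc n) \<boxminus> complex_of_real r \<odot> zp (Suc (Suc n)))"
        using inA[OF dH] inA[OF yH] c1
        by (simp only: y(2) mult_add mult_scale scale_closed Suc dzp)
      also have "\<dots> = p \<boxminus> complex_of_real (r ^ Suc (Suc n)) \<odot> zp (Suc (Suc n))"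
      proof -
        define u v where "u = zp (Suc n)" and "v = zp (Suc (Suc n))"
        have uv: "u \<in> carrier A" "v \<in> carrier A" using c1 c2 by (simp_all add: u_def v_def)
        obtain L where L: "\<And>a b c d e f a' b' c' d' e' f'. L (a, b, c, d, e, f) \<boxplus> L (a', b', c', d', e', f') =
           L (a + a', b + b', c + c', d + d', e + e', f + f')"
          "\<And>s a b c d e f. s \<odot> L (a, b, c, d, e, f) = L (s * a, s * b, s * c, s * d, s * e, s * f)"
          "p = L (1, 0, 0, 0, 0, 0)" "u = L (0, 1, 0, 0, 0, 0)" "v = L (0, 0, 1, 0, 0, 0)"
          by (rule linear_coordinates[OF p(1) uv uv(2) uv(2) uv(2)]) (rule that)
        show ?thesis unfolding u_def[symmetric] v_def[symmetric] L(3-5) by (simp add: L(1,2) mult_ac)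
      qed
      finally show ?case .
    qed
  qed
  have ycauchy: "y \<in> env_cauchy A"
  proof (rule env_cauchy_geometric[OF _ r(1,2)])
    show "y n \<in> carrier A" for n using inA yH by blast
    show "env_dist A (y (Suc n)) (y n) \<le> r ^ n" for n
    proof -
      define v where "v = zp (Suc n)"
      have v: "v \<in> carrier A" "y n \<in> carrier A" using inA zpH yH by (simp_all add: v_def)
      have "y (Suc n) \<boxminus> y n = complex_of_real (r ^ Suc n) \<odot> v"
      proof -
        define w where "w = y n"
        have w: "w \<in> carrier A" using v by (simp add: w_def)
        obtain L where L: "\<And>a b c d e f a' b' c' d' e' f'. L (a, b, c, d, e, f) \<boxplus> L (a', b', c', d', e', f') =
           L (a + a', b + b', c + c', d + d', e + e', f + f')"
          "\<And>s a b c d e f. s \<odot> L (a, b, c, d, e, f) = L (s * a, s * b, s * c, s * d, s * e, s * f)"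
          "w = L (1, 0, 0, 0, 0, 0)" "v = L (0, 1, 0, 0, 0, 0)"
          by (rule linear_coordinates[OF w v(1) v(1) v(1) v(1) v(1)]) (rule that)
        show ?thesis unfolding y(2) v_def[symmetric] w_def[symmetric] L(3,4) by (simp add: L(1,2))
      qed
      then have "env_dist A (y (Suc n)) (y n) \<le> cmod (complex_of_real (r ^ Suc n)) * env_norm A v"
        unfolding env_dist_def using env_norm_scale[OF v(1)] by simp
      also have "\<dots> \<le> r ^ Suc n * 1"
        using zpN[of "Suc n"] v r by (intro mult_mono) (auto simp: v_def norm_mult norm_power)
      also have "\<dots> \<le> r ^ n" using r by (simp add: mult_left_le_one_le)
      finally show ?thesis .
    qed
  qed
  define P Y where "P = env_embed A p" and "Y = env_class A y"
  have YP: "Y \<in> carrier (corner (env_cstar A) P)"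
  proof -
    have "smult (env_cstar A) (smult (env_cstar A) P Y) P = Y"
      unfolding P_def Y_def env_embed_def
      using ycauchy p yH cc by (simp add: env_cstar_mult env_cauchy_mult)
    then show ?thesis
      unfolding corner_def using env_class_in_carrier[OF ycauchy] by (auto simp: Y_def image_iff intro!: bexI)
  qed
  \<comment> \<open>Surjectivity enters here: the sum of the series, an element of the corner of the
    completion of A, is the image of some X in the enveloping algebra of the corner.\<close>
  then obtain X where X: "X \<in> carrier (env_cstar H)" "\<Phi> X = Y"
    using bij unfolding P_def bij_betw_def by (metis imageE)
  then obtain s where s: "s \<in> env_cauchy H" "X = env_class H s" by (auto simp: env_cstar_def)
  define D where "D = env_class H (\<lambda>n. d)"
  have dc: "(\<lambda>n. d) \<in> env_cauchy H" using dH by simp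
  have D: "D \<in> carrier (env_cstar H)" unfolding D_def by (rule H.env_class_in_carrier[OF dc])
  have DX: "smult (env_cstar H) D X = env_class H (\<lambda>n. d \<boxtimes> s n)"
    unfolding D_def s(2) using H.env_cstar_mult[OF dc s(1)] by (simp add: Hops)
  have dsc: "(\<lambda>n. d \<boxtimes> s n) \<in> env_cauchy H" using H.env_cauchy_mult[OF dc s(1)] by (simp add: Hops)
  have "\<Phi> (smult (env_cstar H) D X) = smult (env_cstar A) (env_class A (\<lambda>n. d)) (env_class A y)"
    using hom[OF D X(1)] X(2) \<Phi>_class[OF dH] by (simp add: D_def Y_def)
  also have "\<dots> = env_class A (\<lambda>n. d \<boxtimes> y n)"
    using env_cstar_mult[OF _ ycauchy] inA dH by simp
  also have "\<dots> = env_class A (\<lambda>n. p)"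
  proof -
    have "(\<lambda>n. env_dist A (d \<boxtimes> y n) p) \<longlonglongrightarrow> 0"
    proof (rule tendsto_sandwich[of "\<lambda>_. 0" _ _ "\<lambda>n. r ^ Suc n"])
      show "(\<lambda>n. r ^ Suc n) \<longlonglongrightarrow> 0" using r by (intro LIMSEQ_Suc LIMSEQ_power_zero) auto
      have "env_dist A (d \<boxtimes> y n) p \<le> r ^ Suc n" for n
      proof -
        define v where "v = zp (Suc n)"
        have v: "v \<in> carrier A" using inA zpH by (simp add: v_def)
        obtain L where L: "\<And>a b c d e f a' b' c' d' e' f'. L (a, b, c, d, e, f) \<boxplus> L (a', b', c', d', e', f') =
           L (a + a', b + b', c + c', d + d', e + e', f + f')"
          "\<And>s a b c d e f. s \<odot> L (a, b, c, d, e, f) = L (s * a, s * b, s * c, s * d, s * e, s * f)"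
          "p = L (1, 0, 0, 0, 0, 0)" "v = L (0, 1, 0, 0, 0, 0)"
          by (rule linear_coordinates[OF p(1) v v v v v]) (rule that)
        have "d \<boxtimes> y n \<boxminus> p = complex_of_real (- (r ^ Suc n)) \<odot> v"
          unfolding dy v_def[symmetric] L(3,4) by (simp add: L(1,2))
        then have "env_dist A (d \<boxtimes> y n) p \<le> cmod (complex_of_real (- (r ^ Suc n))) * env_norm A v"
          unfolding env_dist_def by (simp only: env_norm_scale[OF v])
        also have "\<dots> \<le> r ^ Suc n * 1"
          using zpN[of "Suc n"] v r by (intro mult_mono) (auto simp: v_def norm_mult norm_power)
        finally show ?thesis by simp
      qed
      then show "\<forall>\<^sub>F n in sequentially. env_dist A (d \<boxtimes> y n) p \<le> r ^ Suc n" by simp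
    qed (use inA dH yH p in auto)
    then show ?thesis
      using env_class_eq_iff[OF env_cauchy_mult[OF _ ycauchy], of "\<lambda>n. d" "\<lambda>n. p"] inA dH p by simp
  qed
  also have "\<dots> = \<Phi> (env_class H (\<lambda>n. p))" using \<Phi>_class[OF pH] by simp
  \<comment> \<open>Injectivity turns the equation between images into D X = p inside the enveloping
    algebra of the corner.\<close>
  finally have "smult (env_cstar H) D X = env_class H (\<lambda>n. p)"
    using bij DX H.env_class_in_carrier[OF dsc] H.env_class_in_carrier[of "\<lambda>n. p"] pH
    unfolding bij_betw_def by (auto dest: inj_onD)
  then have lim: "(\<lambda>n. env_dist H (d \<boxtimes> s n) p) \<longlonglongrightarrow> 0"
    using H.env_class_eq_iff[OF dsc, of "\<lambda>n. p"] DX pH by simp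
  \<comment> \<open>A star-character is a homomorphism into the complex numbers, so its modulus is a
    C*-seminorm. It kills d, which keeps every d s n at distance at least 1 from p.\<close>
  have \<sigma>: "cstar_seminorm H (\<lambda>x. cmod (\<psi> x))"
    unfolding cstar_seminorm_def Hops
    using \<psi>_add \<psi>_scale \<psi>_mult \<psi>_star H.star_closed
    by (auto simp: norm_triangle_ineq norm_mult power2_eq_square Hops simp flip: H_def)
  have "1 \<le> env_dist H (d \<boxtimes> s n) p" for n
  proof -
    have sn: "s n \<in> carrier H" using s by (intro H.env_cauchy_carrier)
    have c: "d \<boxtimes> s n \<in> carrier H" "(-1) \<odot> p \<in> carrier H" "d \<boxtimes> s n \<boxminus> p \<in> carrier H"
      using H.mult_closed[OF dH sn] H.scale_closed[OF pH] H.add_closed by (simp_all add: Hops)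
    have "\<psi> (d \<boxtimes> s n \<boxminus> p) = -1"
      using c sn dH pH by (simp add: \<psi>_add \<psi>_scale \<psi>_mult \<psi>d \<psi>_p flip: H_def)
    then show ?thesis
      using H.env_norm_upper[OF \<sigma> c(3)] by (simp add: env_dist_def Hops)
  qed
  then have "1 \<le> (0::real)" by (intro LIMSEQ_le_const[OF lim]) auto
  then show False by simp
qed

end

lemma cnj_measurable [measurable]: "cnj \<in> borel \<rightarrow>\<^sub>M borel"
  by (intro borel_measurable_continuous_onI continuous_intros)

section \<open>The convolution algebra of a unimodular measurable group\<close>

text \<open>Unimodularity is recorded as invariance under inversion; together with left invariance
  it yields right invariance. Joint measurability of the product is what Fubini needs for
  convolutions.\<close>

locale unimodular_group = group G + sigma_finite_measure M
  for G :: "('g, 'm) monoid_scheme" (structure) and M :: "'g measure" +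
  assumes space_M: "space M = carrier G"
    and mult_measurable: "(\<lambda>(x, y). x \<otimes> y) \<in> M \<Otimes>\<^sub>M M \<rightarrow>\<^sub>M M"
    and inv_measurable: "(\<lambda>x. inv x) \<in> M \<rightarrow>\<^sub>M M"
    and distr_left: "\<And>x. x \<in> carrier G \<Longrightarrow> distr M M (\<lambda>y. x \<otimes> y) = M"
    and distr_inv: "distr M M (\<lambda>x. inv x) = M"
begin

lemma mult_measurable' [measurable (raw)]:
  "f \<in> N \<rightarrow>\<^sub>M M \<Longrightarrow> g \<in> N \<rightarrow>\<^sub>M M \<Longrightarrow> (\<lambda>x. f x \<otimes> g x) \<in> N \<rightarrow>\<^sub>M M"
  using measurable_compose[OF measurable_Pair mult_measurable, of f N g] by simp

lemma inv_measurable' [measurable (raw)]: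
  "f \<in> N \<rightarrow>\<^sub>M M \<Longrightarrow> (\<lambda>x. inv (f x)) \<in> N \<rightarrow>\<^sub>M M"
  by (rule measurable_compose[OF _ inv_measurable])

lemma const_measurable [measurable]: "x \<in> carrier G \<Longrightarrow> (\<lambda>_. x) \<in> N \<rightarrow>\<^sub>M M"
  by (simp add: space_M)

lemma AE_left:
  assumes "AE y in M. P y" "x \<in> carrier G"
  shows "AE y in M. P (x \<otimes> y)"
proof (rule AE_distrD[where f = "\<lambda>y. x \<otimes> y" and M' = M and P = P])
  show "(\<lambda>y. x \<otimes> y) \<in> M \<rightarrow>\<^sub>M M" using assms(2) by measurable
  show "AE y in distr M M (\<lambda>y. x \<otimes> y). P y" unfolding distr_left[OF assms(2)] by (rule assms(1))
qed

lemma AE_inv: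
  assumes "AE y in M. P y"
  shows "AE y in M. P (inv y)"
proof (rule AE_distrD[OF inv_measurable])
  show "AE y in distr M M (\<lambda>y. inv y). P y" unfolding distr_inv by (rule assms)
qed

lemma integral_left:
  fixes f :: "'g \<Rightarrow> 'b :: {banach, second_countable_topology}"
  assumes "f \<in> borel_measurable M" "x \<in> carrier G"
  shows "(\<integral>y. f (x \<otimes> y) \<partial>M) = (\<integral>y. f y \<partial>M)"
  using integral_distr[of "\<lambda>y. x \<otimes> y" M M f] assms distr_left by simp

lemma integrable_left:
  fixes f :: "'g \<Rightarrow> 'b :: {banach, second_countable_topology}"
  assumes "integrable M f" "x \<in> carrier G"
  shows "integrable M (\<lambda>y. f (x \<otimes> y))"
  using integrable_distr[of "\<lambda>y. x \<otimes> y" M M f] assms distr_left by simp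

lemma integral_inv:
  fixes f :: "'g \<Rightarrow> 'b :: {banach, second_countable_topology}"
  assumes "f \<in> borel_measurable M"
  shows "(\<integral>y. f (inv y) \<partial>M) = (\<integral>y. f y \<partial>M)"
  using integral_distr[of "\<lambda>y. inv y" M M f] assms distr_inv by simp

lemma integrable_inv:
  fixes f :: "'g \<Rightarrow> 'b :: {banach, second_countable_topology}"
  assumes "integrable M f"
  shows "integrable M (\<lambda>y. f (inv y))"
  using integrable_distr[of "\<lambda>y. inv y" M M f] assms distr_inv by simp

abbreviation conv :: "('g \<Rightarrow> complex) \<Rightarrow> ('g \<Rightarrow> complex) \<Rightarrow> 'g \<Rightarrow> complex" where
  "conv \<equiv> convolution G M"

sublocale pair_sigma_finite M M ..

text \<open>Integrating over x first, left invariance removes the translation by y from the inner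
  integral, and what remains is a product of two L^1 norms.\<close>

lemma conv_kernel_integrable:
  fixes f g :: "'g \<Rightarrow> complex"
  assumes f: "integrable M f" and g: "integrable M g"
  shows "integrable (M \<Otimes>\<^sub>M M) (\<lambda>(y, x). f y * g (inv y \<otimes> x))"
    and "(\<integral>y. \<integral>x. cmod (f y * g (inv y \<otimes> x)) \<partial>M \<partial>M) = (\<integral>y. cmod (f y) \<partial>M) * (\<integral>x. cmod (g x) \<partial>M)"
proof -
  have [measurable]: "f \<in> borel_measurable M" "g \<in> borel_measurable M" using f g by auto
  have inner: "(\<integral>x. cmod (f y * g (inv y \<otimes> x)) \<partial>M) = cmod (f y) * (\<integral>x. cmod (g x) \<partial>M)"
    if "y \<in> space M" for y
    using integral_left[of "\<lambda>x. cmod (g x)" "inv y"] that by (simp add: norm_mult space_M)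
  show "integrable (M \<Otimes>\<^sub>M M) (\<lambda>(y, x). f y * g (inv y \<otimes> x))"
  proof (rule Fubini_integrable)
    show "integrable M (\<lambda>y. \<integral>x. cmod (case (y, x) of (y, x) \<Rightarrow> f y * g (inv y \<otimes> x)) \<partial>M)"
      using inner f by (subst Bochner_Integration.integrable_cong[OF refl,
         where g = "\<lambda>y. cmod (f y) * (\<integral>x. cmod (g x) \<partial>M)"]) auto
    show "AE y in M. integrable M (\<lambda>x. case (y, x) of (y, x) \<Rightarrow> f y * g (inv y \<otimes> x))"
      using AE_space by eventually_elim (simp add: space_M integrable_left g)
  qed measurable
  have "(\<integral>y. \<integral>x. cmod (f y * g (inv y \<otimes> x)) \<partial>M \<partial>M) = (\<integral>y. cmod (f y) * (\<integral>x. cmod (g x) \<partial>M) \<partial>M)"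
    by (rule Bochner_Integration.integral_cong[OF refl inner])
  then show "(\<integral>y. \<integral>x. cmod (f y * g (inv y \<otimes> x)) \<partial>M \<partial>M) = (\<integral>y. cmod (f y) \<partial>M) * (\<integral>x. cmod (g x) \<partial>M)"
    by simp
qed

lemma conv_AE_integrable:
  fixes f g :: "'g \<Rightarrow> complex"
  assumes "integrable M f" "integrable M g"
  shows "AE x in M. integrable M (\<lambda>y. f y * g (inv y \<otimes> x))"
  using AE_integrable_snd[OF conv_kernel_integrable(1)[OF assms]] .

lemma conv_integrable:
  assumes "integrable M f" "integrable M g"
  shows "integrable M (conv f g)"
  unfolding convolution_def[abs_def] using integrable_snd[OF conv_kernel_integrable(1)[OF assms]] .

lemma conv_norm:
  assumes f: "integrable M f" and g: "integrable M g"
  shows "(\<integral>x. cmod (conv f g x) \<partial>M) \<le> (\<integral>y. cmod (f y) \<partial>M) * (\<integral>x. cmod (g x) \<partial>M)"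
proof -
  have k: "integrable (M \<Otimes>\<^sub>M M) (\<lambda>(y, x). cmod (f y * g (inv y \<otimes> x)))"
    using integrable_norm[OF conv_kernel_integrable(1)[OF f g]] by (simp add: split_beta')
  have "(\<integral>x. cmod (conv f g x) \<partial>M) \<le> (\<integral>x. \<integral>y. cmod (f y * g (inv y \<otimes> x)) \<partial>M \<partial>M)"
  proof (rule integral_mono)
    show "integrable M (\<lambda>x. cmod (conv f g x))" using conv_integrable[OF f g] by simp
    show "integrable M (\<lambda>x. \<integral>y. cmod (f y * g (inv y \<otimes> x)) \<partial>M)" by (rule integrable_snd[OF k])
    show "cmod (conv f g x) \<le> (\<integral>y. cmod (f y * g (inv y \<otimes> x)) \<partial>M)" for x
      unfolding convolution_def by (rule integral_norm_bound)
  qed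
  also have "\<dots> = (\<integral>y. \<integral>x. cmod (f y * g (inv y \<otimes> x)) \<partial>M \<partial>M)"
    by (rule Fubini_integral[OF k])
  finally show ?thesis by (simp only: conv_kernel_integrable(2)[OF f g])
qed

text \<open>The triple kernel is absolutely integrable over ((z, y), x), so for almost every x the
  two inner integrations may be exchanged; this is the source of the exceptional set.\<close>

lemma conv_assoc:
  assumes f: "integrable M f" and g: "integrable M g" and h: "integrable M h"
  shows "AE x in M. conv (conv f g) h x = conv f (conv g h) x"
proof -
  have [measurable]: "f \<in> borel_measurable M" "g \<in> borel_measurable M" "h \<in> borel_measurable M"
    using f g h by auto
  interpret P: pair_sigma_finite "M \<Otimes>\<^sub>M M" M ..
  let ?K = "\<lambda>(p, x). (case p of (z, y) \<Rightarrow> f z * g (inv z \<otimes> y)) * h (inv (snd p) \<otimes> x)"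
  have K: "integrable ((M \<Otimes>\<^sub>M M) \<Otimes>\<^sub>M M) ?K"
  proof (rule P.Fubini_integrable)
    let ?L = "\<lambda>p. \<integral>x. cmod (?K (p, x)) \<partial>M"
    let ?R = "\<lambda>p. cmod (case p of (z, y) \<Rightarrow> f z * g (inv z \<otimes> y)) * (\<integral>x. cmod (h x) \<partial>M)"
    have eq: "?L p = ?R p"
      if "p \<in> space (M \<Otimes>\<^sub>M M)" for p
    proof -
      have "snd p \<in> carrier G" using that by (auto simp: space_pair_measure space_M)
      then show ?thesis
        using integral_left[of "\<lambda>x. cmod (h x)" "inv (snd p)"] by (simp add: norm_mult)
    qed
    have "integrable (M \<Otimes>\<^sub>M M) ?R"
      using integrable_norm[OF conv_kernel_integrable(1)[OF f g]] by simp
    then show "integrable (M \<Otimes>\<^sub>M M) ?L"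
      using Bochner_Integration.integrable_cong[of "M \<Otimes>\<^sub>M M" "M \<Otimes>\<^sub>M M" ?L ?R, OF refl eq] by blast
    show "AE p in M \<Otimes>\<^sub>M M. integrable M (\<lambda>x. ?K (p, x))"
      using AE_space by eventually_elim
        (auto simp: space_pair_measure space_M intro!: integrable_mult_right integrable_left h)
  qed measurable
  have "AE x in M. integrable (M \<Otimes>\<^sub>M M) (\<lambda>p. (case p of (z, y) \<Rightarrow> f z * g (inv z \<otimes> y)) * h (inv (snd p) \<otimes> x))"
    using P.AE_integrable_snd[OF K] .
  then show ?thesis
    using AE_space
  proof eventually_elim
    case (elim x)
    then have x: "x \<in> carrier G" by (simp add: space_M)
    have k: "integrable (M \<Otimes>\<^sub>M M) (\<lambda>(z, y). f z * g (inv z \<otimes> y) * h (inv y \<otimes> x))"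
      using elim(1) by (simp add: split_beta')
    have "conv (conv f g) h x = (\<integral>y. \<integral>z. f z * g (inv z \<otimes> y) * h (inv y \<otimes> x) \<partial>M \<partial>M)"
      by (simp add: convolution_def)
    also have "\<dots> = (\<integral>z. \<integral>y. f z * g (inv z \<otimes> y) * h (inv y \<otimes> x) \<partial>M \<partial>M)"
      by (rule Fubini_integral[OF k])
    also have "\<dots> = (\<integral>z. f z * (\<integral>y. g y * h (inv y \<otimes> (inv z \<otimes> x)) \<partial>M) \<partial>M)"
    proof (rule Bochner_Integration.integral_cong[OF refl])
      fix z assume "z \<in> space M"
      then have z: "z \<in> carrier G" by (simp add: space_M)
      \<comment> \<open>Translating the inner variable, y \<mapsto> z^(-1) y, recovers the kernel of
        the other bracketing.\<close>
      have "(\<integral>y. g y * h (inv y \<otimes> (inv z \<otimes> x)) \<partial>M) = (\<integral>y. g (inv z \<otimes> y) * h (inv (inv z \<otimes> y) \<otimes> (inv z \<otimes> x)) \<partial>M)"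
        using x z by (intro integral_left[symmetric, of "\<lambda>y. g y * h (inv y \<otimes> (inv z \<otimes> x))"]) auto
      also have "\<dots> = (\<integral>y. g (inv z \<otimes> y) * h (inv y \<otimes> x) \<partial>M)"
      proof (rule Bochner_Integration.integral_cong[OF refl])
        fix y assume "y \<in> space M"
        then have y: "y \<in> carrier G" by (simp add: space_M)
        have "inv (inv z \<otimes> y) \<otimes> (inv z \<otimes> x) = inv y \<otimes> x"
          using x y z by (simp add: inv_mult_group m_assoc inv_solve_left' flip: m_assoc[of z "inv z" x])
        then show "g (inv z \<otimes> y) * h (inv (inv z \<otimes> y) \<otimes> (inv z \<otimes> x)) = g (inv z \<otimes> y) * h (inv y \<otimes> x)" by simp
      qed
      finally show "(\<integral>y. f z * g (inv z \<otimes> y) * h (inv y \<otimes> x) \<partial>M) = f z * (\<integral>y. g y * h (inv y \<otimes> (inv z \<otimes> x)) \<partial>M)"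
        by (simp add: mult.assoc)
    qed
    also have "\<dots> = conv f (conv g h) x" by (simp add: convolution_def)
    finally show ?case .
  qed
qed

lemma conv_add_right:
  assumes f: "integrable M f" and g: "integrable M g" and h: "integrable M h"
  shows "AE x in M. conv f (\<lambda>y. g y + h y) x = conv f g x + conv f h x"
  using conv_AE_integrable[OF f g] conv_AE_integrable[OF f h]
  by eventually_elim (simp add: convolution_def distrib_left)

lemma conv_add_left:
  assumes f: "integrable M f" and g: "integrable M g" and h: "integrable M h"
  shows "AE x in M. conv (\<lambda>y. f y + g y) h x = conv f h x + conv g h x"
  using conv_AE_integrable[OF f h] conv_AE_integrable[OF g h]
  by eventually_elim (simp add: convolution_def distrib_right)

text \<open>The substitution y \<mapsto> x y in the convolution of the adjoints proves it at every
  point, without an exceptional set.\<close>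

lemma conv_star:
  assumes [measurable]: "f \<in> borel_measurable M" "g \<in> borel_measurable M" and x: "x \<in> carrier G"
  shows "cnj (conv f g (inv x)) = conv (\<lambda>x. cnj (g (inv x))) (\<lambda>x. cnj (f (inv x))) x"
proof -
  let ?h = "\<lambda>y. cnj (g (inv y)) * cnj (f (inv (inv y \<otimes> x)))"
  have "conv (\<lambda>x. cnj (g (inv x))) (\<lambda>x. cnj (f (inv x))) x = (\<integral>y. ?h y \<partial>M)"
    by (simp add: convolution_def)
  also have "\<dots> = (\<integral>y. ?h (x \<otimes> y) \<partial>M)"
  proof (rule integral_left[symmetric, OF _ x])
    show "?h \<in> borel_measurable M" using x by measurable
  qed
  also have "\<dots> = (\<integral>y. cnj (f y * g (inv y \<otimes> inv x)) \<partial>M)"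
  proof (rule Bochner_Integration.integral_cong[OF refl])
    fix y assume "y \<in> space M"
    then have y: "y \<in> carrier G" by (simp add: space_M)
    have "inv (inv (x \<otimes> y) \<otimes> x) = y" using x y by (simp add: inv_mult_group m_assoc)
    then show "?h (x \<otimes> y) = cnj (f y * g (inv y \<otimes> inv x))" using x y by (simp add: inv_mult_group)
  qed
  also have "\<dots> = cnj (conv f g (inv x))"
    unfolding convolution_def by (rule Bochner_Integration.integral_cnj)
  finally show ?thesis by simp
qed

text \<open>Riesz-Fischer: the increments are absolutely summable at almost every point, the limit
  is the telescoped pointwise sum, and the distance to it is bounded by a tail of the given
  series.\<close>

lemma L1_complete:
  assumes g: "\<And>n. integrable M (g n)" and sum: "summable (\<lambda>n. \<integral>x. cmod (g (Suc n) x - g n x) \<partial>M)"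
  shows "\<exists>l. integrable M l \<and> (\<lambda>n. \<integral>x. cmod (g n x - l x) \<partial>M) \<longlonglongrightarrow> 0"
proof -
  define d where "d = (\<lambda>n x. g (Suc n) x - g n x)"
  have d: "integrable M (d n)" for n using g by (simp add: d_def)
  have [measurable]: "d n \<in> borel_measurable M" for n using d by auto
  have sum': "summable (\<lambda>n. \<integral>x. cmod (d n x) \<partial>M)" using sum by (simp add: d_def)
  have "(\<integral>\<^sup>+x. (\<Sum>n. ennreal (cmod (d n x))) \<partial>M) = (\<Sum>n. \<integral>\<^sup>+x. ennreal (cmod (d n x)) \<partial>M)"
    by (rule nn_integral_suminf) measurable
  also have "\<dots> = (\<Sum>n. ennreal (\<integral>x. cmod (d n x) \<partial>M))"
    using d by (intro suminf_cong nn_integral_eq_integral) auto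
  also have "\<dots> = ennreal (\<Sum>n. \<integral>x. cmod (d n x) \<partial>M)"
    using sum' by (intro suminf_ennreal2) auto
  finally have "(\<integral>\<^sup>+x. (\<Sum>n. ennreal (cmod (d n x))) \<partial>M) \<noteq> \<infinity>" by simp
  then have "AE x in M. (\<Sum>n. ennreal (cmod (d n x))) \<noteq> \<infinity>"
    by (intro nn_integral_PInf_AE) auto
  then have AEs: "AE x in M. summable (\<lambda>n. cmod (d n x))"
    by eventually_elim (auto intro: summable_suminf_not_top)
  define l where "l = (\<lambda>x. g 0 x + (\<Sum>n. d n x))"
  have l: "integrable M l" unfolding l_def using integrable_suminf[OF d AEs sum'] g by simp
  have bound: "(\<integral>x. cmod (g n x - l x) \<partial>M) \<le> (\<Sum>i. \<integral>x. cmod (d (i + n) x) \<partial>M)" for n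
  proof -
    have AEs': "AE x in M. summable (\<lambda>i. cmod (d (i + n) x))"
      using AEs by eventually_elim (rule summable_ignore_initial_segment)
    have sumn: "summable (\<lambda>i. \<integral>x. cmod (d (i + n) x) \<partial>M)"
      by (rule summable_ignore_initial_segment[OF sum'])
    have "(\<integral>x. cmod (g n x - l x) \<partial>M) \<le> (\<integral>x. (\<Sum>i. cmod (d (i + n) x)) \<partial>M)"
    proof (rule integral_mono_AE)
      show "integrable M (\<lambda>x. cmod (g n x - l x))" using g l by simp
      show "integrable M (\<lambda>x. \<Sum>i. cmod (d (i + n) x))"
        by (rule integrable_suminf) (use d AEs' sumn in auto)
      show "AE x in M. cmod (g n x - l x) \<le> (\<Sum>i. cmod (d (i + n) x))"
        using AEs AEs'
      proof eventually_elim
        case (elim x)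
        have s: "summable (\<lambda>i. d i x)" using elim(1) by (rule summable_norm_cancel)
        have "(\<Sum>i<n. d i x) = g n x - g 0 x" unfolding d_def by (rule sum_lessThan_telescope)
        then have "g n x - l x = - (\<Sum>i. d (i + n) x)"
          using suminf_split_initial_segment[OF s, of n] by (simp add: l_def)
        then show ?case using summable_norm[OF elim(2)] by simp
      qed
    qed
    also have "\<dots> = (\<Sum>i. \<integral>x. cmod (d (i + n) x) \<partial>M)"
      by (rule integral_suminf) (use d AEs' sumn in auto)
    finally show ?thesis .
  qed
  have "(\<lambda>n. \<Sum>i. \<integral>x. cmod (d (i + n) x) \<partial>M) \<longlonglongrightarrow> 0"
    by (rule suminf_exist_split2[OF sum'])
  then have "(\<lambda>n. \<integral>x. cmod (g n x - l x) \<partial>M) \<longlonglongrightarrow> 0"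
    by (rule tendsto_sandwich[OF _ _ tendsto_const, rotated 2]) (use bound in auto)
  then show ?thesis using l by blast
qed

end

text \<open>\<open>\<mu>\<close> is a measure on a \<open>\<sigma>\<close>-algebra between that of \<open>M\<close> and its completion. Its \<open>L\<^sup>1\<close>-algebra
  is that of \<open>M\<close>, but the multiplication need not be jointly measurable for it.\<close>

locale unimodular_extension = unimodular_group G M
  for G :: "('g, 'm) monoid_scheme" (structure) and M :: "'g measure" +
  fixes \<mu> :: "'g measure"
  assumes space_\<mu>: "space \<mu> = carrier G"
    and sets_le: "sets M \<subseteq> sets \<mu>"
    and emeasure_\<mu>: "\<And>E. E \<in> sets M \<Longrightarrow> emeasure \<mu> E = emeasure M E"
    and sets_completion: "sets \<mu> \<subseteq> sets (completion M)"
    and translate_measurable: "\<And>x. x \<in> carrier G \<Longrightarrow> (\<lambda>y. inv y \<otimes> x) \<in> \<mu> \<rightarrow>\<^sub>M \<mu>"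
    and modular: "\<And>x. x \<in> carrier G \<Longrightarrow> modular_function G \<mu> x = 1"
begin

lemma id_measurable: "(\<lambda>x. x) \<in> \<mu> \<rightarrow>\<^sub>M M"
  using sets_le sets.sets_into_space[of _ M] by (intro measurableI) (auto simp: space_\<mu> space_M Int_absorb2)

text \<open>Presenting M as the image of \<mu> under the identity lets the change of variables
  formula identify the two integrals of M-measurable functions.\<close>

lemma distr_id_M: "distr \<mu> M (\<lambda>x. x) = M"
proof (rule measure_eqI)
  fix E assume "E \<in> sets (distr \<mu> M (\<lambda>x. x))"
  then have E: "E \<in> sets M" by simp
  then have "E \<inter> carrier G = E" using sets.sets_into_space[of E M] space_M by auto
  then show "emeasure (distr \<mu> M (\<lambda>x. x)) E = emeasure M E"
    using emeasure_distr[OF id_measurable E] emeasure_\<mu>[OF E] by (simp add: space_\<mu>)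
qed simp

lemma measurable_\<mu>: "f \<in> borel_measurable M \<Longrightarrow> f \<in> borel_measurable \<mu>"
  by (rule measurable_compose[OF id_measurable])

lemma integral_\<mu>:
  fixes f :: "'g \<Rightarrow> 'b :: {banach, second_countable_topology}"
  assumes "f \<in> borel_measurable M"
  shows "(\<integral>x. f x \<partial>\<mu>) = (\<integral>x. f x \<partial>M)"
  using integral_distr[OF id_measurable assms] by (simp add: distr_id_M)

lemma integrable_\<mu>:
  fixes f :: "'g \<Rightarrow> 'b :: {banach, second_countable_topology}"
  assumes "f \<in> borel_measurable M"
  shows "integrable \<mu> f \<longleftrightarrow> integrable M f"
  using integrable_distr_eq[OF id_measurable assms] by (simp add: distr_id_M)

text \<open>A \<mu>-null set lies in the completion of M, so it is a set S of M together with part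
  of an M-null set; S has measure at most that of the whole, so it is M-null too.\<close>

lemma AE_\<mu>: "(AE x in \<mu>. P x) \<longleftrightarrow> (AE x in M. P x)"
proof
  assume "AE x in M. P x"
  then obtain N where N: "{x \<in> space M. \<not> P x} \<subseteq> N" "N \<in> null_sets M"
    by (auto simp: eventually_ae_filter)
  then have "N \<in> null_sets \<mu>" using sets_le emeasure_\<mu> by (auto simp: null_sets_def)
  then show "AE x in \<mu>. P x" using N(1) by (intro AE_I') (auto simp: space_\<mu> space_M)
next
  assume "AE x in \<mu>. P x"
  then obtain N where N: "{x \<in> space \<mu>. \<not> P x} \<subseteq> N" "N \<in> null_sets \<mu>"
    by (auto simp: eventually_ae_filter)
  then have "N \<in> sets (completion M)" using sets_completion by auto
  then obtain S N' N0 where S: "N = S \<union> N'" "N' \<subseteq> N0" "N0 \<in> null_sets M" "S \<in> sets M"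
    by (rule sets_completionE) (rule that)
  have "emeasure \<mu> S \<le> emeasure \<mu> N" using S N by (intro emeasure_mono) auto
  then have "S \<in> null_sets M" using N S emeasure_\<mu>[OF S(4)] by (auto simp: null_sets_def)
  then have "S \<union> N0 \<in> null_sets M" using S(3) by (rule null_sets.Un)
  moreover have "{x \<in> space M. \<not> P x} \<subseteq> S \<union> N0" using N(1) S by (auto simp: space_\<mu> space_M)
  ultimately show "AE x in M. P x" by (rule AE_I')
qed

text \<open>Passing to an M-measurable function brings every class within reach of Fubini. Real and
  imaginary parts are replaced separately.\<close>

lemma measurable_representative:
  fixes f :: "'g \<Rightarrow> complex"
  assumes f: "integrable \<mu> f"
  obtains g where "integrable M g" "AE x in M. f x = g x"
proof -
  have c: "u \<in> borel_measurable (completion M)" if "u \<in> borel_measurable \<mu>" for u :: "'g \<Rightarrow> real"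
    using that sets_completion by (auto simp: measurable_def space_\<mu> space_M)
  obtain u where u: "u \<in> borel_measurable M" "AE x in M. Re (f x) = u x"
    using completion_ex_borel_measurable_real[OF c[of "\<lambda>x. Re (f x)"]] f by auto
  obtain v where v: "v \<in> borel_measurable M" "AE x in M. Im (f x) = v x"
    using completion_ex_borel_measurable_real[OF c[of "\<lambda>x. Im (f x)"]] f by auto
  define g where "g = (\<lambda>x. complex_of_real (u x) + \<i> * complex_of_real (v x))"
  have g: "g \<in> borel_measurable M" unfolding g_def using u(1) v(1) by measurable
  have eq: "AE x in M. f x = g x"
    using u(2) v(2) by eventually_elim (simp add: g_def complex_eq_iff)
  have "integrable \<mu> g"
    using f g eq by (subst integrable_cong_AE[of _ _ f]) (auto simp: AE_\<mu> measurable_\<mu>)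
  then show thesis using that[of g] eq g integrable_\<mu>[OF g] by blast
qed

section \<open>The L^1 algebra as a Banach star-algebra\<close>

abbreviation cls :: "('g \<Rightarrow> complex) \<Rightarrow> ('g \<Rightarrow> complex) set" where
  "cls \<equiv> L1_class \<mu>"

abbreviation L1_norm :: "('g \<Rightarrow> complex) set \<Rightarrow> real" where
  "L1_norm F \<equiv> (\<integral>x. cmod (L1_rep F x) \<partial>\<mu>)"

lemma L1_class_cong: "AE x in M. f x = g x \<Longrightarrow> cls f = cls g"
proof -
  assume "AE x in M. f x = g x"
  then have "(AE x in M. f x = h x) \<longleftrightarrow> (AE x in M. g x = h x)" for h
    by (auto elim: AE_mp)
  then show "cls f = cls g" by (simp add: L1_class_def AE_\<mu>)
qed

lemma L1_rep_class:
  assumes "integrable M f"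
  shows "integrable \<mu> (L1_rep (cls f))" "AE x in M. L1_rep (cls f) x = f x"
proof -
  have "L1_rep (cls f) \<in> cls f"
    unfolding L1_rep_def
    by (rule someI[where P = "\<lambda>g. g \<in> cls f" and x = f]) (use assms in \<open>simp add: L1_class_def integrable_\<mu>\<close>)
  then show "integrable \<mu> (L1_rep (cls f))" "AE x in M. L1_rep (cls f) x = f x"
    by (auto simp: L1_class_def AE_\<mu>)
qed

lemma L1_class_eq_iff:
  assumes "integrable M f" "integrable M g"
  shows "cls f = cls g \<longleftrightarrow> (AE x in M. f x = g x)"
proof
  assume "cls f = cls g"
  then have "g \<in> cls f" using assms by (simp add: L1_class_def integrable_\<mu>)
  then show "AE x in M. f x = g x" by (simp add: L1_class_def AE_\<mu>)
qed (rule L1_class_cong)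

lemma L1_carrier: "F \<in> carrier (L1_algebra G \<mu>) \<longleftrightarrow> (\<exists>f. integrable M f \<and> F = cls f)"
proof
  assume "F \<in> carrier (L1_algebra G \<mu>)"
  then obtain f where f: "integrable \<mu> f" "F = cls f" by (auto simp: L1_algebra_def)
  obtain g where "integrable M g" "AE x in M. f x = g x" by (rule measurable_representative[OF f(1)]) (rule that)
  then show "\<exists>f. integrable M f \<and> F = cls f" using f(2) L1_class_cong by blast
qed (auto simp: L1_algebra_def integrable_\<mu>)

lemma L1_add:
  assumes "integrable M f" "integrable M g"
  shows "sadd (L1_algebra G \<mu>) (cls f) (cls g) = cls (\<lambda>x. f x + g x)"
proof -
  have "AE x in M. L1_rep (cls f) x + L1_rep (cls g) x = f x + g x"
    using L1_rep_class(2)[OF assms(1)] L1_rep_class(2)[OF assms(2)] by eventually_elim simp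
  then show ?thesis by (simp add: L1_algebra_def L1_class_cong)
qed

text \<open>The chosen representatives are only known to be \<mu>-measurable and to agree with f and
  g almost everywhere. For fixed x the exceptional null set is carried along by inversion and left
  translation, so the convolution integrals agree at every x.\<close>

lemma L1_mult:
  assumes f: "integrable M f" and g: "integrable M g"
  shows "smult (L1_algebra G \<mu>) (cls f) (cls g) = cls (conv f g)"
proof -
  let ?f = "L1_rep (cls f)" and ?g = "L1_rep (cls g)"
  have "convolution G \<mu> ?f ?g x = conv f g x" if "x \<in> space M" for x
  proof -
    have x: "x \<in> carrier G" using that by (simp add: space_M)
    have fm [measurable]: "f \<in> borel_measurable M" and gm [measurable]: "g \<in> borel_measurable M"
      using f g by auto
    have m: "(\<lambda>y. f y * g (inv y \<otimes> x)) \<in> borel_measurable M" using x by measurable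
    have "AE y in M. ?g (inv y) = g (inv y)" by (rule AE_inv[OF L1_rep_class(2)[OF g]])
    then have "AE y in M. ?g (inv (inv x \<otimes> y)) = g (inv (inv x \<otimes> y))"
      using AE_left[of "\<lambda>y. ?g (inv y) = g (inv y)" "inv x"] x by simp
    then have "AE y in M. ?g (inv y \<otimes> x) = g (inv y \<otimes> x)"
      using AE_space by eventually_elim (use x in \<open>simp add: space_M inv_mult_group\<close>)
    with L1_rep_class(2)[OF f] have "AE y in M. ?f y * ?g (inv y \<otimes> x) = f y * g (inv y \<otimes> x)"
      by eventually_elim simp
    moreover have "(\<lambda>y. ?f y * ?g (inv y \<otimes> x)) \<in> borel_measurable \<mu>"
      using L1_rep_class(1)[OF f] measurable_compose[OF translate_measurable[OF x], of ?g borel]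
        L1_rep_class(1)[OF g] by auto
    ultimately have "convolution G \<mu> ?f ?g x = (\<integral>y. f y * g (inv y \<otimes> x) \<partial>\<mu>)"
      unfolding convolution_def by (intro integral_cong_AE) (simp_all add: AE_\<mu> measurable_\<mu>[OF m])
    then show ?thesis using integral_\<mu>[OF m] by (simp add: convolution_def)
  qed
  then have "AE x in M. convolution G \<mu> ?f ?g x = conv f g x" by (rule AE_I2)
  then show ?thesis by (simp add: L1_algebra_def L1_class_cong)
qed

lemma L1_scale:
  assumes "integrable M f"
  shows "sscale (L1_algebra G \<mu>) c (cls f) = cls (\<lambda>x. c * f x)"
proof -
  have "AE x in M. c * L1_rep (cls f) x = c * f x"
    using L1_rep_class(2)[OF assms(1)] by eventually_elim simp
  then show ?thesis by (simp add: L1_algebra_def L1_class_cong)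
qed

lemma L1_star:
  assumes "integrable M f"
  shows "sstar (L1_algebra G \<mu>) (cls f) = cls (\<lambda>x. cnj (f (inv x)))"
proof -
  let ?r = "L1_rep (cls f)"
  have "AE x in M. ?r (inv x) = f (inv x)" using AE_inv[OF L1_rep_class(2)[OF assms]] .
  then have "AE x in M. complex_of_real (modular_function G \<mu> (inv x)) * cnj (?r (inv x)) = cnj (f (inv x))"
    using AE_space by eventually_elim (simp add: space_M modular)
  then show ?thesis by (simp add: L1_algebra_def L1_class_cong)
qed

lemma L1_norm_class:
  assumes "integrable M f"
  shows "L1_norm (cls f) = (\<integral>x. cmod (f x) \<partial>M)"
proof -
  have fm: "(\<lambda>x. cmod (f x)) \<in> borel_measurable M" using assms by auto
  have "AE x in M. cmod (L1_rep (cls f) x) = cmod (f x)"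
    using L1_rep_class(2)[OF assms] by eventually_elim simp
  then have "L1_norm (cls f) = (\<integral>x. cmod (f x) \<partial>\<mu>)"
    using L1_rep_class(1)[OF assms] measurable_\<mu>[OF fm] by (intro integral_cong_AE) (auto simp: AE_\<mu>)
  then show ?thesis using integral_\<mu>[OF fm] by simp
qed

lemma L1_banach: "banach_star_alg (L1_algebra G \<mu>) L1_norm"
proof -
  let ?A = "L1_algebra G \<mu>"
  have car: "cls f \<in> carrier ?A" if "integrable M f" for f using that L1_carrier by blast
  note ops = L1_add L1_mult L1_scale L1_star L1_norm_class conv_integrable integrable_inv car
  have star_int: "integrable M (\<lambda>x. cnj (f (inv x)))" if "integrable M f" for f :: "'g \<Rightarrow> complex"
    using integrable_inv[OF that] by simp
  show ?thesis
  proof unfold_locales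
    fix F K assume "F \<in> carrier ?A" "K \<in> carrier ?A"
    then obtain f k where f: "integrable M f" "F = cls f" and k: "integrable M k" "K = cls k"
      using L1_carrier by auto
    show "sadd ?A F K \<in> carrier ?A" "smult ?A F K \<in> carrier ?A" using f k by (auto simp: ops)
    show "sadd ?A F K = sadd ?A K F" using f k by (simp add: ops add.commute)
    show "sscale ?A c (sadd ?A F K) = sadd ?A (sscale ?A c F) (sscale ?A c K)" for c
      using f k by (simp add: ops distrib_left)
    show "sadd ?A (sscale ?A 0 F) K = K" using f k by (simp add: ops)
    show "smult ?A (sscale ?A c F) K = sscale ?A c (smult ?A F K)" for c
    proof -
      have "conv (\<lambda>x. c * f x) k = (\<lambda>x. c * conv f k x)" by (simp add: convolution_def[abs_def] mult.assoc)
      then show ?thesis using f k by (simp add: ops)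
    qed
    show "smult ?A F (sscale ?A c K) = sscale ?A c (smult ?A F K)" for c
    proof -
      have "conv f (\<lambda>x. c * k x) = (\<lambda>x. c * conv f k x)"
        by (simp add: convolution_def[abs_def] mult.left_commute)
      then show ?thesis using f k by (simp add: ops)
    qed
    show "sstar ?A (sadd ?A F K) = sadd ?A (sstar ?A F) (sstar ?A K)"
      using f k star_int by (simp add: ops)
    show "sstar ?A (smult ?A F K) = smult ?A (sstar ?A K) (sstar ?A F)"
    proof -
      have "AE x in M. cnj (conv f k (inv x)) = conv (\<lambda>x. cnj (k (inv x))) (\<lambda>x. cnj (f (inv x))) x"
        using AE_space by eventually_elim (use f k in \<open>simp add: space_M conv_star\<close>)
      then show ?thesis using f k star_int by (simp add: ops L1_class_eq_iff)
    qed
    show "L1_norm (sadd ?A F K) \<le> L1_norm F + L1_norm K"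
    proof -
      have "(\<integral>x. cmod (f x + k x) \<partial>M) \<le> (\<integral>x. cmod (f x) + cmod (k x) \<partial>M)"
        using f k by (intro integral_mono) (auto intro: norm_triangle_ineq)
      then show ?thesis using f k by (simp add: ops)
    qed
    show "L1_norm (smult ?A F K) \<le> L1_norm F * L1_norm K"
      using f k conv_norm by (simp add: ops)
    assume "L1_norm (sadd ?A F (sscale ?A (- 1) K)) = 0"
    then have "(\<integral>x. cmod (f x - k x) \<partial>M) = 0" using f k by (simp add: ops)
    then have "AE x in M. cmod (f x - k x) = 0"
      using f k by (subst (asm) integral_nonneg_eq_0_iff_AE) auto
    then show "F = K" using f k by (simp add: L1_class_eq_iff)
  next
    fix F K L assume "F \<in> carrier ?A" "K \<in> carrier ?A" "L \<in> carrier ?A"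
    then obtain f k l where f: "integrable M f" "F = cls f" and k: "integrable M k" "K = cls k"
      and l: "integrable M l" "L = cls l" using L1_carrier by auto
    show "sadd ?A (sadd ?A F K) L = sadd ?A F (sadd ?A K L)" using f k l by (simp add: ops add.assoc)
    show "smult ?A (smult ?A F K) L = smult ?A F (smult ?A K L)"
      using f k l conv_assoc by (simp add: ops L1_class_eq_iff)
    show "smult ?A F (sadd ?A K L) = sadd ?A (smult ?A F K) (smult ?A F L)"
      using f k l conv_add_right by (simp add: ops L1_class_eq_iff)
    show "smult ?A (sadd ?A F K) L = sadd ?A (smult ?A F L) (smult ?A K L)"
      using f k l conv_add_left by (simp add: ops L1_class_eq_iff)
  next
    fix F assume "F \<in> carrier ?A"
    then obtain f where f: "integrable M f" "F = cls f" using L1_carrier by auto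
    show "sscale ?A c F \<in> carrier ?A" for c using f by (auto simp: ops)
    show "sstar ?A F \<in> carrier ?A" using f star_int by (auto simp: ops)
    show "sscale ?A (c + d) F = sadd ?A (sscale ?A c F) (sscale ?A d F)" for c d
      using f by (simp add: ops distrib_right)
    show "sscale ?A c (sscale ?A d F) = sscale ?A (c * d) F" for c d
      using f by (simp add: ops mult.assoc)
    show "sscale ?A 1 F = F" using f by (simp add: ops)
    show "sstar ?A (sstar ?A F) = F"
    proof -
      have "AE x in M. f (inv (inv x)) = f x"
        using AE_space by eventually_elim (simp add: space_M)
      then show ?thesis
        using f star_int integrable_inv[OF integrable_inv[OF f(1)]] by (simp add: ops L1_class_eq_iff)
    qed
    show "sstar ?A (sscale ?A c F) = sscale ?A (cnj c) (sstar ?A F)" for c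
      using f star_int by (simp add: ops)
    show "0 \<le> L1_norm F" by simp
    show "L1_norm (sscale ?A c F) = cmod c * L1_norm F" for c
      using f by (simp add: ops norm_mult)
    show "L1_norm (sstar ?A F) = L1_norm F"
      using f star_int integral_inv[of "\<lambda>x. cmod (f x)"] by (simp add: ops)
  next
    fix s assume s: "\<And>n. s n \<in> carrier ?A"
      and sum: "summable (\<lambda>n. L1_norm (sadd ?A (s (Suc n)) (sscale ?A (- 1) (s n))))"
    have "\<forall>n. \<exists>f. integrable M f \<and> s n = cls f" using s L1_carrier by blast
    from choice[OF this] obtain g where g: "\<And>n. integrable M (g n)" "\<And>n. s n = cls (g n)" by blast
    have "\<exists>l. integrable M l \<and> (\<lambda>n. \<integral>x. cmod (g n x - l x) \<partial>M) \<longlonglongrightarrow> 0"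
      using sum g by (intro L1_complete) (simp_all add: ops)
    then obtain l where l: "integrable M l" "(\<lambda>n. \<integral>x. cmod (g n x - l x) \<partial>M) \<longlonglongrightarrow> 0" by blast
    then have "(\<lambda>n. L1_norm (sadd ?A (s n) (sscale ?A (- 1) (cls l)))) \<longlonglongrightarrow> 0"
      using g by (simp add: ops)
    then show "\<exists>l\<in>carrier ?A. (\<lambda>n. L1_norm (sadd ?A (s n) (sscale ?A (- 1) l))) \<longlonglongrightarrow> 0"
      using car[OF l(1)] by blast
  qed
qed

end

section \<open>Haar measure on a non-archimedean group with a Gelfand pair\<close>

lemma (in group) subgroup_mult_iff:
  assumes K: "subgroup K G" "k \<in> K" and x: "x \<in> carrier G"
  shows "k \<otimes> x \<in> K \<longleftrightarrow> x \<in> K" "x \<otimes> k \<in> K \<longleftrightarrow> x \<in> K"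
proof -
  have k: "k \<in> carrier G" using K by (rule subgroup.mem_carrier)
  have e: "inv k \<otimes> (k \<otimes> x) = x" "x \<otimes> k \<otimes> inv k = x"
    using k x by (simp_all add: m_assoc) (simp flip: m_assoc)
  have i: "inv k \<in> K" using K by (simp add: subgroup.m_inv_closed)
  show "k \<otimes> x \<in> K \<longleftrightarrow> x \<in> K"
    using subgroup.m_closed[OF K(1) i, of "k \<otimes> x"] subgroup.m_closed[OF K, of x] unfolding e by blast
  show "x \<otimes> k \<in> K \<longleftrightarrow> x \<in> K"
    using subgroup.m_closed[OF K(1) _ i, of "x \<otimes> k"] subgroup.m_closed[OF K(1) _ K(2), of x] unfolding e by blast
qed

lemma (in group) l_coset_eq:
  assumes "E \<subseteq> carrier G" "x \<in> carrier G"
  shows "x <# E = {y \<in> carrier G. inv x \<otimes> y \<in> E}"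
proof (intro equalityI subsetI)
  fix y assume "y \<in> x <# E"
  then obtain e where "e \<in> E" "y = x \<otimes> e" by (auto simp: l_coset_def)
  then show "y \<in> {y \<in> carrier G. inv x \<otimes> y \<in> E}" using assms by (auto simp flip: m_assoc)
next
  fix y assume "y \<in> {y \<in> carrier G. inv x \<otimes> y \<in> E}"
  then have "inv x \<otimes> y \<in> E" "y = x \<otimes> (inv x \<otimes> y)" using assms by (auto simp flip: m_assoc)
  then show "y \<in> x <# E" by (auto simp: l_coset_def)
qed

lemma (in group) r_coset_eq:
  assumes "E \<subseteq> carrier G" "x \<in> carrier G"
  shows "E #> x = {y \<in> carrier G. y \<otimes> inv x \<in> E}"
proof (intro equalityI subsetI)
  fix y assume "y \<in> E #> x"
  then obtain e where "e \<in> E" "y = e \<otimes> x" by (auto simp: r_coset_def)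
  then show "y \<in> {y \<in> carrier G. y \<otimes> inv x \<in> E}" using assms by (auto simp: m_assoc)
next
  fix y assume "y \<in> {y \<in> carrier G. y \<otimes> inv x \<in> E}"
  then have "y \<otimes> inv x \<in> E" "y = (y \<otimes> inv x) \<otimes> x" using assms by (auto simp: m_assoc)
  then show "y \<in> E #> x" by (auto simp: r_coset_def)
qed

lemma (in group) l_coset_mem_eq:
  assumes K: "subgroup K G" and x: "x \<in> carrier G" and z: "z \<in> x <# K"
  shows "x <# K = z <# K" "z \<in> carrier G"
proof -
  have sub: "K \<subseteq> carrier G" using K by (rule subgroup.subset)
  have zc: "z \<in> carrier G" and k: "inv x \<otimes> z \<in> K" using z l_coset_eq[OF sub x] by auto
  have "inv x \<otimes> w \<in> K \<longleftrightarrow> inv z \<otimes> w \<in> K" if w: "w \<in> carrier G" for w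
  proof -
    have "inv x \<otimes> w = (inv x \<otimes> z) \<otimes> (inv z \<otimes> w)"
      using x zc w by (simp add: m_assoc) (simp flip: m_assoc)
    then show ?thesis using subgroup_mult_iff(1)[OF K k, of "inv z \<otimes> w"] zc w by simp
  qed
  then show "x <# K = z <# K" "z \<in> carrier G" using l_coset_eq[OF sub] x zc by auto
qed

text \<open>Total disconnectedness enters as a neighbourhood basis of open subgroups at the
  identity: left invariant measures can then be compared by counting cosets.\<close>

locale nonarch_group = group G for G :: "('g, 'm) monoid_scheme" (structure) +
  fixes T :: "'g topology"
  assumes topspace_T: "topspace T = carrier G"
    and mult_open: "\<And>U x y. openin T U \<Longrightarrow> x \<in> carrier G \<Longrightarrow> y \<in> carrier G \<Longrightarrow> x \<otimes> y \<in> U \<Longrightarrow>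
      \<exists>V W. openin T V \<and> openin T W \<and> x \<in> V \<and> y \<in> W \<and> (\<forall>v\<in>V. \<forall>w\<in>W. v \<otimes> w \<in> U)"
    and inv_open: "\<And>U. openin T U \<Longrightarrow> openin T {x \<in> carrier G. inv x \<in> U}"
    and second_countable_T: "second_countable T"
    and open_subgroup: "\<And>U. openin T U \<Longrightarrow> \<one> \<in> U \<Longrightarrow> \<exists>K. subgroup K G \<and> openin T K \<and> K \<subseteq> U"
begin

lemma open_carrier: "openin T U \<Longrightarrow> U \<subseteq> carrier G"
  using openin_subset topspace_T by blast

lemma left_open:
  assumes U: "openin T U" and x: "x \<in> carrier G"
  shows "openin T {y \<in> carrier G. x \<otimes> y \<in> U}"
proof (subst openin_subopen, safe)
  fix y assume y: "y \<in> carrier G" "x \<otimes> y \<in> U"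
  obtain V W where "openin T V" "openin T W" "x \<in> V" "y \<in> W" "\<forall>v\<in>V. \<forall>w\<in>W. v \<otimes> w \<in> U"
    using mult_open[OF U x y] by blast
  then show "\<exists>W. openin T W \<and> y \<in> W \<and> W \<subseteq> {y \<in> carrier G. x \<otimes> y \<in> U}"
    using open_carrier by (intro exI[of _ W]) auto
qed

lemma right_open:
  assumes U: "openin T U" and x: "x \<in> carrier G"
  shows "openin T {y \<in> carrier G. y \<otimes> x \<in> U}"
proof (subst openin_subopen, safe)
  fix y assume y: "y \<in> carrier G" "y \<otimes> x \<in> U"
  obtain V W where "openin T V" "openin T W" "y \<in> V" "x \<in> W" "\<forall>v\<in>V. \<forall>w\<in>W. v \<otimes> w \<in> U"
    using mult_open[OF U y(1) x y(2)] by blast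
  then show "\<exists>V. openin T V \<and> y \<in> V \<and> V \<subseteq> {y \<in> carrier G. y \<otimes> x \<in> U}"
    using open_carrier by (intro exI[of _ V]) auto
qed

lemma coset_open:
  assumes "openin T U" "x \<in> carrier G"
  shows "openin T (x <# U)"
  using left_open[of U "inv x"] l_coset_eq[of U x] open_carrier assms by simp

lemma countable_base:
  obtains B where "countable B" "\<And>V. V \<in> B \<Longrightarrow> openin T V"
    "\<And>U x. openin T U \<Longrightarrow> x \<in> U \<Longrightarrow> \<exists>V\<in>B. x \<in> V \<and> V \<subseteq> U"
proof -
  from second_countable_T obtain B where "countable B \<and> (\<forall>V\<in>B. openin T V) \<and>
      (\<forall>U x. openin T U \<and> x \<in> U \<longrightarrow> (\<exists>V\<in>B. x \<in> V \<and> V \<subseteq> U))"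
    unfolding second_countable_def by (rule exE)
  then show thesis using that[of B] by simp
qed

text \<open>Each coset is open and so contains a nonempty basic set, any point of which determines
  the coset.\<close>

lemma countable_cosets:
  assumes K: "subgroup K G" "openin T K"
  shows "countable ((\<lambda>x. x <# K) ` carrier G)"
proof -
  obtain B where B: "countable B" "\<And>U x. openin T U \<Longrightarrow> x \<in> U \<Longrightarrow> \<exists>V\<in>B. x \<in> V \<and> V \<subseteq> U"
    by (rule countable_base) (rule that)
  have "(\<lambda>x. x <# K) ` carrier G \<subseteq> (\<lambda>V. (SOME v. v \<in> V) <# K) ` B"
  proof safe
    fix x assume x: "x \<in> carrier G"
    have "x \<in> x <# K"
      using x subgroup.one_closed[OF K(1)] by (simp add: l_coset_eq subgroup.subset[OF K(1)])
    then obtain V where V: "V \<in> B" "x \<in> V" "V \<subseteq> x <# K" using B(2)[OF coset_open[OF K(2) x]] by blast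
    have "(SOME v. v \<in> V) \<in> V" using V(2) by (rule someI[where P = "\<lambda>v. v \<in> V"])
    then have "x <# K = (SOME v. v \<in> V) <# K" using V l_coset_mem_eq[OF K(1) x] by blast
    then show "x <# K \<in> (\<lambda>V. (SOME v. v \<in> V) <# K) ` B" using V(1) by blast
  qed
  then show ?thesis using B(1) by (meson countable_image countable_subset)
qed

text \<open>A generator of the Borel sets that is stable under intersection: two cosets are disjoint
  or meet in a coset of the intersection of their subgroups. The bound K \<subseteq> \<Gamma> makes
  each measure computable from that of \<Gamma> by an index.\<close>

definition coset_generator :: "'g set \<Rightarrow> 'g set set" where
  "coset_generator \<Gamma> = insert {} {x <# K | x K. x \<in> carrier G \<and> subgroup K G \<and> openin T K \<and> K \<subseteq> \<Gamma>}"

lemma Int_stable_coset_generator: "Int_stable (coset_generator \<Gamma>)"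
  unfolding Int_stable_def
proof (intro ballI)
  fix A B assume A: "A \<in> coset_generator \<Gamma>" and B: "B \<in> coset_generator \<Gamma>"
  show "A \<inter> B \<in> coset_generator \<Gamma>"
  proof (cases "A \<inter> B = {}")
    case False
    then obtain z where z: "z \<in> A" "z \<in> B" by blast
    obtain x K where K: "x \<in> carrier G" "subgroup K G" "openin T K" "K \<subseteq> \<Gamma>" "A = x <# K"
      using A z by (auto simp: coset_generator_def)
    obtain y L where L: "y \<in> carrier G" "subgroup L G" "openin T L" "B = y <# L"
      using B z by (auto simp: coset_generator_def)
    have zc: "z \<in> carrier G" using l_coset_mem_eq(2)[OF K(2,1)] z K by blast
    have "A \<inter> B = (z <# K) \<inter> (z <# L)"
      using l_coset_mem_eq(1)[OF K(2,1), of z] l_coset_mem_eq(1)[OF L(2,1), of z] z K L by simp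
    also have "\<dots> = z <# (K \<inter> L)"
      using zc subgroup.subset[OF K(2)] subgroup.subset[OF L(2)] by (auto simp: l_coset_eq Int_absorb1 le_infI1)
    finally show ?thesis
      unfolding coset_generator_def using zc K L subgroups_Inter_pair[OF K(2) L(2)] openin_Int by blast
  qed (simp add: coset_generator_def)
qed

lemma sigma_sets_coset_generator:
  assumes \<Gamma>: "subgroup \<Gamma> G" "openin T \<Gamma>"
  shows "sigma_sets (carrier G) {U. openin T U} = sigma_sets (carrier G) (coset_generator \<Gamma>)"
proof (rule sigma_sets_eqI)
  fix A assume "A \<in> coset_generator \<Gamma>"
  then have "openin T A" by (auto simp: coset_generator_def intro: coset_open)
  then show "A \<in> sigma_sets (carrier G) {U. openin T U}" by (auto intro: sigma_sets.Basic)
next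
  fix U assume "U \<in> {U. openin T U}"
  then have U: "openin T U" by simp
  obtain B where B: "countable B" "\<And>U x. openin T U \<Longrightarrow> x \<in> U \<Longrightarrow> \<exists>V\<in>B. x \<in> V \<and> V \<subseteq> U"
    by (rule countable_base) (rule that)
  \<comment> \<open>For each basic set that fits into a coset inside U one such coset is picked, so
    U is a countable union of cosets.\<close>
  define P where "P = (\<lambda>V C. C \<in> coset_generator \<Gamma> \<and> V \<subseteq> C \<and> C \<subseteq> U)"
  define c where "c = (\<lambda>V. SOME C. P V C)"
  have c: "P V (c V)" if "\<exists>C. P V C" for V unfolding c_def using that by (rule someI_ex)
  have "U = \<Union>(c ` {V \<in> B. \<exists>C. P V C})"
  proof (intro equalityI subsetI)
    fix x assume x: "x \<in> U"
    then have xc: "x \<in> carrier G" using open_carrier[OF U] by blast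
    have "openin T ({y \<in> carrier G. x \<otimes> y \<in> U} \<inter> \<Gamma>)" by (intro openin_Int left_open U xc \<Gamma>)
    moreover have "\<one> \<in> {y \<in> carrier G. x \<otimes> y \<in> U} \<inter> \<Gamma>" using x xc subgroup.one_closed[OF \<Gamma>(1)] by simp
    ultimately obtain K where K: "subgroup K G" "openin T K" "K \<subseteq> {y \<in> carrier G. x \<otimes> y \<in> U} \<inter> \<Gamma>"
      using open_subgroup by blast
    have C: "x <# K \<in> coset_generator \<Gamma>" "x <# K \<subseteq> U" "x \<in> x <# K"
      using K xc subgroup.one_closed[OF K(1)]
      by (auto simp: coset_generator_def l_coset_def) (metis r_one)
    obtain V where V: "V \<in> B" "x \<in> V" "V \<subseteq> x <# K" using B(2)[OF coset_open[OF K(2) xc] C(3)] by blast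
    have "\<exists>C. P V C" using C V unfolding P_def by blast
    moreover have "x \<in> c V" using c[OF \<open>\<exists>C. P V C\<close>] V(2) unfolding P_def by blast
    ultimately show "x \<in> \<Union>(c ` {V \<in> B. \<exists>C. P V C})" using V(1) by blast
  next
    fix x assume "x \<in> \<Union>(c ` {V \<in> B. \<exists>C. P V C})"
    then show "x \<in> U" using c unfolding P_def by blast
  qed
  moreover have "\<Union>(c ` {V \<in> B. \<exists>C. P V C}) \<in> sigma_sets (carrier G) (coset_generator \<Gamma>)"
  proof (rule sigma_sets_UNION)
    show "countable (c ` {V \<in> B. \<exists>C. P V C})" using B(1) by simp
    fix C assume "C \<in> c ` {V \<in> B. \<exists>C. P V C}"
    then show "C \<in> sigma_sets (carrier G) (coset_generator \<Gamma>)"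
      using c unfolding P_def by (auto intro!: sigma_sets.Basic)
  qed
  ultimately show "U \<in> sigma_sets (carrier G) (coset_generator \<Gamma>)" by simp
qed

end

locale haar_gelfand = nonarch_group G T for G :: "('g, 'm) monoid_scheme" (structure) and T +
  fixes M :: "'g measure" and \<Gamma> :: "'g set"
  assumes space_M: "space M = carrier G"
    and sets_M: "sets M = sigma_sets (carrier G) {U. openin T U}"
    and left_inv: "\<And>x E. x \<in> carrier G \<Longrightarrow> E \<in> sets M \<Longrightarrow> emeasure M (x <# E) = emeasure M E"
    and \<Gamma>: "subgroup \<Gamma> G" "openin T \<Gamma>" "emeasure M \<Gamma> = 1"
    and gelfand: "\<And>x. x \<in> carrier G \<Longrightarrow> \<exists>k1\<in>\<Gamma>. \<exists>k2\<in>\<Gamma>. inv x = k1 \<otimes> x \<otimes> k2"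
begin

lemma open_sets: "openin T U \<Longrightarrow> U \<in> sets M"
  unfolding sets_M by (auto intro: sigma_sets.Basic)

lemma sets_carrier: "E \<in> sets M \<Longrightarrow> E \<subseteq> carrier G"
  using sets.sets_into_space space_M by blast

lemma measurable_open:
  assumes "f \<in> space N \<rightarrow> carrier G" "\<And>U. openin T U \<Longrightarrow> f -` U \<inter> space N \<in> sets N"
  shows "f \<in> N \<rightarrow>\<^sub>M M"
  by (rule measurable_sigma_sets[OF sets_M _ assms(1)]) (use assms(2) open_carrier in auto)

text \<open>Second countability turns the preimage of an open set into a countable union of basic
  rectangles, and these lie in the product \<sigma>-algebra.\<close>

lemma mult_measurable: "(\<lambda>(x, y). x \<otimes> y) \<in> M \<Otimes>\<^sub>M M \<rightarrow>\<^sub>M M"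
proof (rule measurable_open)
  fix U assume U: "openin T U"
  obtain B where B: "countable B" "\<And>V. V \<in> B \<Longrightarrow> openin T V"
      "\<And>U x. openin T U \<Longrightarrow> x \<in> U \<Longrightarrow> \<exists>V\<in>B. x \<in> V \<and> V \<subseteq> U"
    by (rule countable_base) (rule that)
  define R where "R = {(V, W) \<in> B \<times> B. \<forall>v\<in>V. \<forall>w\<in>W. v \<otimes> w \<in> U}"
  have "(\<lambda>(x, y). x \<otimes> y) -` U \<inter> space (M \<Otimes>\<^sub>M M) = (\<Union>(V, W)\<in>R. V \<times> W)"
  proof (intro equalityI subsetI)
    fix p assume "p \<in> (\<lambda>(x, y). x \<otimes> y) -` U \<inter> space (M \<Otimes>\<^sub>M M)"
    then obtain x y where p: "p = (x, y)" "x \<in> carrier G" "y \<in> carrier G" "x \<otimes> y \<in> U"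
      by (auto simp: space_pair_measure space_M)
    obtain V W where VW: "openin T V" "openin T W" "x \<in> V" "y \<in> W" "\<forall>v\<in>V. \<forall>w\<in>W. v \<otimes> w \<in> U"
      using mult_open[OF U p(2-4)] by blast
    obtain V' W' where "V' \<in> B" "x \<in> V'" "V' \<subseteq> V" "W' \<in> B" "y \<in> W'" "W' \<subseteq> W"
      using B(3)[OF VW(1,3)] B(3)[OF VW(2,4)] by blast
    then have "(V', W') \<in> R" "p \<in> V' \<times> W'" using VW p by (auto simp: R_def)
    then show "p \<in> (\<Union>(V, W)\<in>R. V \<times> W)" by blast
  next
    fix p assume "p \<in> (\<Union>(V, W)\<in>R. V \<times> W)"
    then show "p \<in> (\<lambda>(x, y). x \<otimes> y) -` U \<inter> space (M \<Otimes>\<^sub>M M)"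
      using B(2) open_carrier by (fastforce simp: R_def space_pair_measure space_M)
  qed
  moreover have "(\<Union>(V, W)\<in>R. V \<times> W) \<in> sets (M \<Otimes>\<^sub>M M)"
  proof (rule sets.countable_UN'')
    show "countable R" unfolding R_def using B(1) by (auto intro: countable_subset[of _ "B \<times> B"])
    show "(case p of (V, W) \<Rightarrow> V \<times> W) \<in> sets (M \<Otimes>\<^sub>M M)" if "p \<in> R" for p
      using that B(2) open_sets by (auto simp: R_def)
  qed
  ultimately show "(\<lambda>(x, y). x \<otimes> y) -` U \<inter> space (M \<Otimes>\<^sub>M M) \<in> sets (M \<Otimes>\<^sub>M M)" by simp
qed (auto simp: space_pair_measure space_M)

lemma inv_measurable: "(\<lambda>x. inv x) \<in> M \<rightarrow>\<^sub>M M"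
proof (rule measurable_open)
  fix U assume "openin T U"
  then have "{x \<in> carrier G. inv x \<in> U} \<in> sets M" by (intro open_sets inv_open)
  then show "(\<lambda>x. inv x) -` U \<inter> space M \<in> sets M" by (simp add: space_M vimage_def Int_def conj_commute)
qed (auto simp: space_M)

lemma left_measurable: "x \<in> carrier G \<Longrightarrow> (\<lambda>y. x \<otimes> y) \<in> M \<rightarrow>\<^sub>M M"
  using measurable_compose[OF measurable_Pair1' mult_measurable, of x] by (simp add: space_M)

lemma right_measurable: "x \<in> carrier G \<Longrightarrow> (\<lambda>y. y \<otimes> x) \<in> M \<rightarrow>\<^sub>M M"
  using measurable_compose[OF measurable_Pair2' mult_measurable, of x] by (simp add: space_M)

lemma coset_sets:
  assumes "E \<in> sets M" "x \<in> carrier G"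
  shows "x <# E \<in> sets M"
  using measurable_sets[OF left_measurable[of "inv x"] assms(1)] assms sets_carrier[OF assms(1)]
  by (simp add: l_coset_eq space_M vimage_def Int_def conj_commute)

definition left_invariant :: "'g measure \<Rightarrow> bool" where
  "left_invariant \<nu> \<longleftrightarrow> sets \<nu> = sets M \<and>
     (\<forall>x\<in>carrier G. \<forall>E\<in>sets M. emeasure \<nu> (x <# E) = emeasure \<nu> E)"

lemma left_invariant_M: "left_invariant M"
  using left_inv by (simp add: left_invariant_def)

text \<open>\<Gamma> is the disjoint union of countably many translates of K. The index is written
  as a counting measure so that it may be infinite.\<close>

lemma open_subgroup_index:
  assumes K: "subgroup K G" "openin T K" "K \<subseteq> \<Gamma>"
    and "left_invariant \<nu>"
  defines "\<C> \<equiv> (\<lambda>x. x <# K) ` \<Gamma>"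
  shows "emeasure \<nu> \<Gamma> = emeasure \<nu> K * emeasure (count_space \<C>) \<C>"
proof -
  have \<nu>: "sets \<nu> = sets M" "\<And>x E. x \<in> carrier G \<Longrightarrow> E \<in> sets M \<Longrightarrow> emeasure \<nu> (x <# E) = emeasure \<nu> E"
    using assms(4) by (auto simp: left_invariant_def)
  have \<Gamma>c: "\<Gamma> \<subseteq> carrier G" using \<Gamma>(1) by (rule subgroup.subset)
  have cnt: "countable \<C>"
    using countable_cosets[OF K(1,2)] \<Gamma>c unfolding \<C>_def by (meson countable_subset image_mono)
  have un: "(\<Union>X\<in>\<C>. X) = \<Gamma>"
  proof -
    have "x <# K \<subseteq> \<Gamma>" if "x \<in> \<Gamma>" for x
      using that K(3) subgroup.m_closed[OF \<Gamma>(1)] by (auto simp: l_coset_def)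
    moreover have "x \<in> x <# K" if "x \<in> \<Gamma>" for x
      using that \<Gamma>c subgroup.one_closed[OF K(1)] by (force simp: l_coset_def)
    ultimately show ?thesis by (auto simp: \<C>_def)
  qed
  have disj: "disjoint_family_on (\<lambda>X. X) \<C>"
    unfolding disjoint_family_on_def
  proof (intro ballI impI)
    fix X Y assume XY: "X \<in> \<C>" "Y \<in> \<C>" "X \<noteq> Y"
    then obtain x y where "x \<in> carrier G" "X = x <# K" "y \<in> carrier G" "Y = y <# K"
      using \<Gamma>c by (auto simp: \<C>_def)
    then show "X \<inter> Y = {}" using XY(3) l_coset_mem_eq(1)[OF K(1)] by blast
  qed
  have X: "X \<in> sets M \<and> emeasure \<nu> X = emeasure \<nu> K" if "X \<in> \<C>" for X
    using that \<nu>(2) open_sets[OF K(2)] coset_sets \<Gamma>c by (auto simp: \<C>_def)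
  have "emeasure \<nu> \<Gamma> = emeasure \<nu> (\<Union>X\<in>\<C>. X)" by (simp only: un)
  also have "\<dots> = (\<integral>\<^sup>+X. emeasure \<nu> X \<partial>count_space \<C>)"
    by (rule emeasure_UN_countable[OF _ cnt disj]) (use X \<nu>(1) in auto)
  also have "\<dots> = (\<integral>\<^sup>+X. emeasure \<nu> K \<partial>count_space \<C>)"
    using X by (intro nn_integral_cong) auto
  also have "\<dots> = emeasure \<nu> K * emeasure (count_space \<C>) \<C>" by simp
  finally show ?thesis .
qed

text \<open>The same index relates K to \<Gamma> for both measures. As M gives \<Gamma> measure 1,
  the index times the M-measure of K is 1, and it cancels without a division in the extended
  reals.\<close>

lemma open_subgroup_ratio:
  assumes K: "subgroup K G" "openin T K" "K \<subseteq> \<Gamma>"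
    and "left_invariant \<nu>"
  shows "emeasure \<nu> K = emeasure \<nu> \<Gamma> * emeasure M K"
proof -
  let ?n = "emeasure (count_space ((\<lambda>x. x <# K) ` \<Gamma>)) ((\<lambda>x. x <# K) ` \<Gamma>)"
  have "emeasure M K * ?n = 1"
    unfolding open_subgroup_index[OF K left_invariant_M, symmetric] by (rule \<Gamma>(3))
  then have "emeasure \<nu> K * ?n * emeasure M K = emeasure \<nu> K"
    by (simp only: mult.assoc mult.commute[of ?n] mult_1_right)
  then show ?thesis unfolding open_subgroup_index[OF K assms(4)] by (rule sym)
qed

lemma open_subgroup_nonzero:
  assumes K: "subgroup K G" "openin T K" "K \<subseteq> \<Gamma>"
  shows "emeasure M K \<noteq> 0"
proof
  assume "emeasure M K = 0"
  then have "emeasure M \<Gamma> = 0" unfolding open_subgroup_index[OF K left_invariant_M] by simp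
  then show False using \<Gamma>(3) by simp
qed

lemma \<Gamma>_cosets:
  obtains A :: "nat \<Rightarrow> 'g set" where "range A \<subseteq> (\<lambda>x. x <# \<Gamma>) ` carrier G" "\<Union>(range A) = carrier G"
proof -
  let ?C = "(\<lambda>x. x <# \<Gamma>) ` carrier G"
  have C: "countable ?C" "?C \<noteq> {}" using countable_cosets[OF \<Gamma>(1,2)] by auto
  have "\<Union>?C = carrier G"
  proof -
    have "x <# \<Gamma> \<subseteq> carrier G" if "x \<in> carrier G" for x
      using that subgroup.subset[OF \<Gamma>(1)] l_coset_eq by auto
    moreover have "x \<in> x <# \<Gamma>" if "x \<in> carrier G" for x
      using that subgroup.one_closed[OF \<Gamma>(1)] by (force simp: l_coset_def)
    ultimately show ?thesis by auto
  qed
  then show thesis using that[of "from_nat_into ?C"] range_from_nat_into[OF C(2,1)] by simp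
qed

text \<open>The two measures agree on the intersection-stable generator by the index formula, and
  countably many cosets of \<Gamma>, all of finite measure, exhaust the group.\<close>

lemma left_invariant_unique:
  assumes "left_invariant \<nu>"
    and fin: "emeasure \<nu> \<Gamma> \<noteq> \<infinity>"
  shows "\<nu> = scale_measure (emeasure \<nu> \<Gamma>) M"
proof -
  have \<nu>: "sets \<nu> = sets M" "\<And>x E. x \<in> carrier G \<Longrightarrow> E \<in> sets M \<Longrightarrow> emeasure \<nu> (x <# E) = emeasure \<nu> E"
    using assms(1) by (auto simp: left_invariant_def)
  have P: "X \<subseteq> carrier G" if "X \<in> coset_generator \<Gamma>" for X
    using that coset_open open_carrier by (auto simp: coset_generator_def)
  obtain A :: "nat \<Rightarrow> 'g set" where A: "range A \<subseteq> (\<lambda>x. x <# \<Gamma>) ` carrier G" "\<Union>(range A) = carrier G"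
    by (rule \<Gamma>_cosets) (rule that)
  show ?thesis
  proof (rule measure_eqI_generator_eq[OF Int_stable_coset_generator[of \<Gamma>]])
    show "coset_generator \<Gamma> \<subseteq> Pow (carrier G)" using P by blast
    show "sets \<nu> = sigma_sets (carrier G) (coset_generator \<Gamma>)"
      "sets (scale_measure (emeasure \<nu> \<Gamma>) M) = sigma_sets (carrier G) (coset_generator \<Gamma>)"
      using \<nu>(1) sets_M sigma_sets_coset_generator[OF \<Gamma>(1,2)] by simp_all
    show "range A \<subseteq> coset_generator \<Gamma>" using A(1) \<Gamma> by (auto simp: coset_generator_def)
    show "\<Union>(range A) = carrier G" by (rule A(2))
    show "emeasure \<nu> (A i) \<noteq> \<infinity>" for i
    proof -
      obtain x where "x \<in> carrier G" "A i = x <# \<Gamma>" using A(1) by blast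
      then show ?thesis using \<nu>(2) fin open_sets[OF \<Gamma>(2)] by simp
    qed
    fix X assume "X \<in> coset_generator \<Gamma>"
    then consider "X = {}" | x K where "X = x <# K" "x \<in> carrier G" "subgroup K G" "openin T K" "K \<subseteq> \<Gamma>"
      by (auto simp: coset_generator_def)
    then show "emeasure \<nu> X = emeasure (scale_measure (emeasure \<nu> \<Gamma>) M) X"
    proof cases
      case 2
      have "emeasure \<nu> X = emeasure \<nu> K" unfolding 2(1) by (rule \<nu>(2)[OF 2(2) open_sets[OF 2(4)]])
      also have "\<dots> = emeasure \<nu> \<Gamma> * emeasure M K" by (rule open_subgroup_ratio[OF 2(3-5) assms(1)])
      also have "emeasure M K = emeasure M X" unfolding 2(1) by (rule left_inv[OF 2(2) open_sets[OF 2(4)], symmetric])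
      finally show ?thesis by simp
    qed simp
  qed
qed

section \<open>Right translates and the modular function\<close>

definition rtrans :: "'g \<Rightarrow> 'g measure" where
  "rtrans g = distr M M (\<lambda>y. y \<otimes> g)"

lemma emeasure_rtrans:
  assumes "g \<in> carrier G" "E \<in> sets M"
  shows "emeasure (rtrans g) E = emeasure M {y \<in> carrier G. y \<otimes> g \<in> E}"
  using emeasure_distr[OF right_measurable[OF assms(1)] assms(2)]
  by (simp add: rtrans_def space_M vimage_def Int_def conj_commute)

lemma right_sets:
  assumes "g \<in> carrier G" "E \<in> sets M"
  shows "{y \<in> carrier G. y \<otimes> g \<in> E} \<in> sets M"
  using measurable_sets[OF right_measurable[OF assms(1)] assms(2)]
  by (simp add: space_M vimage_def Int_def conj_commute)

text \<open>A right translate of M is again left invariant, so uniqueness makes it a multiple of M;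
  the factor, its value on \<Gamma>, is the modular function at the inverse of g.\<close>

lemma rtrans_eq:
  assumes g: "g \<in> carrier G"
  shows "rtrans g = scale_measure (emeasure (rtrans g) \<Gamma>) M"
proof (rule left_invariant_unique)
  have "emeasure (rtrans g) (x <# E) = emeasure (rtrans g) E" if x: "x \<in> carrier G" and E: "E \<in> sets M" for x E
  proof -
    have "{y \<in> carrier G. y \<otimes> g \<in> x <# E} = x <# {y \<in> carrier G. y \<otimes> g \<in> E}"
      using x g sets_carrier[OF E] by (auto simp: l_coset_eq m_assoc)
    then show ?thesis
      using left_inv[OF x right_sets[OF g E]] emeasure_rtrans[OF g] E coset_sets[OF E x] by simp
  qed
  then show inv: "left_invariant (rtrans g)" by (simp add: left_invariant_def rtrans_def)
  \<comment> \<open>Uniqueness needs \<Gamma> to have finite translated measure. A small open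
    subgroup K with g K g^(-1) \<subseteq> \<Gamma> has its translate inside the coset g^(-1)
    \<Gamma> of measure 1; since K itself has nonzero measure, the factor is finite.\<close>
  define U where "U = {k \<in> carrier G. g \<otimes> k \<in> {y \<in> carrier G. y \<otimes> inv g \<in> \<Gamma>}} \<inter> \<Gamma>"
  have "openin T U" unfolding U_def using g by (intro openin_Int left_open right_open \<Gamma>) auto
  moreover have "\<one> \<in> U" unfolding U_def using g subgroup.one_closed[OF \<Gamma>(1)] by simp
  ultimately obtain K where K: "subgroup K G" "openin T K" "K \<subseteq> U" using open_subgroup by blast
  have K\<Gamma>: "K \<subseteq> \<Gamma>" using K(3) by (auto simp: U_def)
  have "{y \<in> carrier G. y \<otimes> g \<in> K} \<subseteq> inv g <# \<Gamma>"
  proof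
    fix y assume y: "y \<in> {y \<in> carrier G. y \<otimes> g \<in> K}"
    then have "g \<otimes> (y \<otimes> g) \<otimes> inv g \<in> \<Gamma>" using K(3) by (auto simp: U_def)
    moreover have "g \<otimes> (y \<otimes> g) \<otimes> inv g = g \<otimes> y" using y g by (simp add: m_assoc)
    ultimately show "y \<in> inv g <# \<Gamma>" using y g by (simp add: l_coset_eq subgroup.subset[OF \<Gamma>(1)])
  qed
  then have "emeasure M {y \<in> carrier G. y \<otimes> g \<in> K} \<le> emeasure M (inv g <# \<Gamma>)"
    using coset_sets[OF open_sets[OF \<Gamma>(2)]] g by (intro emeasure_mono) auto
  also have "\<dots> = 1" using left_inv[of "inv g" \<Gamma>] open_sets[OF \<Gamma>(2)] g \<Gamma>(3) by simp
  finally have "emeasure (rtrans g) K \<noteq> \<infinity>"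
    using emeasure_rtrans[OF g open_sets[OF K(2)]] by (auto simp: top_unique)
  then have "emeasure (rtrans g) \<Gamma> * emeasure M K \<noteq> \<infinity>"
    using open_subgroup_ratio[OF K(1,2) K\<Gamma> inv] by simp
  then show "emeasure (rtrans g) \<Gamma> \<noteq> \<infinity>"
    using open_subgroup_nonzero[OF K(1,2) K\<Gamma>] ennreal_top_mult[of "emeasure M K"]
    unfolding infinity_ennreal_def by metis
qed

lemma rtrans_\<Gamma>_mult:
  assumes g: "g \<in> carrier G" and h: "h \<in> carrier G"
  shows "emeasure (rtrans (g \<otimes> h)) \<Gamma> = emeasure (rtrans g) \<Gamma> * emeasure (rtrans h) \<Gamma>"
proof -
  have \<Gamma>m: "\<Gamma> \<in> sets M" using \<Gamma>(2) by (rule open_sets)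
  have "emeasure (rtrans (g \<otimes> h)) \<Gamma> = emeasure M {y \<in> carrier G. y \<otimes> (g \<otimes> h) \<in> \<Gamma>}"
    using emeasure_rtrans[OF _ \<Gamma>m] g h by simp
  also have "{y \<in> carrier G. y \<otimes> (g \<otimes> h) \<in> \<Gamma>} = {y \<in> carrier G. y \<otimes> g \<in> {z \<in> carrier G. z \<otimes> h \<in> \<Gamma>}}"
    using g h by (auto simp: m_assoc)
  also have "emeasure M \<dots> = emeasure (rtrans g) {z \<in> carrier G. z \<otimes> h \<in> \<Gamma>}"
    using emeasure_rtrans[OF g right_sets[OF h \<Gamma>m]] by simp
  also have "\<dots> = emeasure (rtrans g) \<Gamma> * emeasure M {z \<in> carrier G. z \<otimes> h \<in> \<Gamma>}"
    by (subst rtrans_eq[OF g]) simp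
  also have "emeasure M {z \<in> carrier G. z \<otimes> h \<in> \<Gamma>} = emeasure (rtrans h) \<Gamma>"
    using emeasure_rtrans[OF h \<Gamma>m] by simp
  finally show ?thesis .
qed

lemma rtrans_\<Gamma>:
  assumes k: "k \<in> \<Gamma>"
  shows "emeasure (rtrans k) \<Gamma> = 1"
proof -
  have kc: "k \<in> carrier G" using subgroup.mem_carrier[OF \<Gamma>(1) k] .
  have "{y \<in> carrier G. y \<otimes> k \<in> \<Gamma>} = \<Gamma>"
    using subgroup_mult_iff(2)[OF \<Gamma>(1) k] subgroup.subset[OF \<Gamma>(1)] by auto
  then show ?thesis using emeasure_rtrans[OF kc open_sets[OF \<Gamma>(2)]] \<Gamma>(3) by simp
qed

text \<open>The modular function takes the same value at \<open>x\<close> and \<open>x\<^sup>-\<^sup>1 \<in> \<Gamma>x\<Gamma>\<close>.\<close>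

lemma right_invariant:
  assumes x: "x \<in> carrier G"
  shows "rtrans x = M"
proof -
  let ?c = "\<lambda>x. emeasure (rtrans x) \<Gamma>"
  obtain k1 k2 where k: "k1 \<in> \<Gamma>" "k2 \<in> \<Gamma>" "inv x = k1 \<otimes> x \<otimes> k2" using gelfand[OF x] by blast
  then have kc: "k1 \<in> carrier G" "k2 \<in> carrier G" using subgroup.mem_carrier[OF \<Gamma>(1)] by auto
  have "?c (inv x) = ?c x" unfolding k(3) using x kc k by (simp add: rtrans_\<Gamma>_mult rtrans_\<Gamma>)
  moreover have "?c (inv x) * ?c x = 1"
    using rtrans_\<Gamma>_mult[of "inv x" x] rtrans_\<Gamma>[OF subgroup.one_closed[OF \<Gamma>(1)]] x by simp
  ultimately have cc: "?c x * ?c x = 1" by simp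
  have "?c x = 1"
  proof (cases "?c x")
    case (real r)
    then have "ennreal (r * r) = ennreal 1" using cc by (simp add: ennreal_mult)
    then have "r * r = 1" using real(1) by (subst (asm) ennreal_inj) auto
    then have "r = 1" using real(1) by (simp add: square_eq_1_iff)
    then show ?thesis using real by simp
  qed (use cc in simp)
  then show ?thesis using rtrans_eq[OF x] by (simp add: scale_measure_1)
qed

text \<open>The image of M under inversion is left invariant because M is right invariant, and it
  gives \<Gamma> the same measure 1, so it equals M.\<close>

lemma unimodular: "unimodular_group G M"
proof -
  obtain A :: "nat \<Rightarrow> 'g set" where A: "range A \<subseteq> (\<lambda>x. x <# \<Gamma>) ` carrier G" "\<Union>(range A) = carrier G"
    by (rule \<Gamma>_cosets) (rule that)
  have A1: "A i \<in> sets M \<and> emeasure M (A i) = 1" for i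
  proof -
    obtain x where "x \<in> carrier G" "A i = x <# \<Gamma>" using A(1) by blast
    then show ?thesis using left_inv[of x \<Gamma>] coset_sets[of \<Gamma> x] open_sets[OF \<Gamma>(2)] \<Gamma>(3) by simp
  qed
  have sf: "sigma_finite_measure M"
    by standard (use A A1 space_M in \<open>intro exI[of _ "range A"], auto\<close>)
  have left: "distr M M (\<lambda>y. x \<otimes> y) = M" if x: "x \<in> carrier G" for x
  proof (rule measure_eqI)
    fix E assume "E \<in> sets (distr M M (\<lambda>y. x \<otimes> y))"
    then have E: "E \<in> sets M" by simp
    have "(\<lambda>y. x \<otimes> y) -` E \<inter> space M = inv x <# E"
      using x sets_carrier[OF E] by (auto simp: l_coset_eq space_M)
    then show "emeasure (distr M M (\<lambda>y. x \<otimes> y)) E = emeasure M E"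
      using emeasure_distr[OF left_measurable[OF x] E] left_inv[OF _ E, of "inv x"] x by simp
  qed simp
  have inv: "distr M M (\<lambda>x. inv x) = M"
  proof -
    let ?\<nu> = "distr M M (\<lambda>x. inv x)"
    have \<nu>: "emeasure ?\<nu> E = emeasure M {y \<in> carrier G. inv y \<in> E}" if "E \<in> sets M" for E
      using emeasure_distr[OF inv_measurable that] by (simp add: space_M vimage_def Int_def conj_commute)
    have inv_sets: "{y \<in> carrier G. inv y \<in> E} \<in> sets M" if "E \<in> sets M" for E
      using measurable_sets[OF inv_measurable that] by (simp add: space_M vimage_def Int_def conj_commute)
    have "emeasure ?\<nu> (x <# E) = emeasure ?\<nu> E" if x: "x \<in> carrier G" and E: "E \<in> sets M" for x E
    proof -
      have "{y \<in> carrier G. inv y \<in> x <# E} = {y \<in> carrier G. y \<otimes> x \<in> {y \<in> carrier G. inv y \<in> E}}"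
        using x sets_carrier[OF E] by (auto simp: l_coset_eq inv_mult_group)
      then have "emeasure ?\<nu> (x <# E) = emeasure (rtrans x) {y \<in> carrier G. inv y \<in> E}"
        using emeasure_rtrans[OF x inv_sets[OF E]] \<nu>[OF coset_sets[OF E x]] by simp
      then show ?thesis using right_invariant[OF x] \<nu>[OF E] by simp
    qed
    moreover have "emeasure ?\<nu> \<Gamma> = 1"
    proof -
      have "{y \<in> carrier G. inv y \<in> \<Gamma>} = \<Gamma>"
        using subgroup.m_inv_closed[OF \<Gamma>(1)] subgroup.subset[OF \<Gamma>(1)] by (auto, metis inv_inv)
      then show ?thesis using \<nu>[OF open_sets[OF \<Gamma>(2)]] \<Gamma>(3) by simp
    qed
    ultimately show ?thesis using left_invariant_unique[of ?\<nu>] by (simp add: scale_measure_1 left_invariant_def)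
  qed
  show ?thesis
    using sf left inv mult_measurable inv_measurable space_M is_group
    by (simp add: unimodular_group_def unimodular_group_axioms_def)
qed

end

section \<open>Haar measures for a possibly different topology\<close>

text \<open>\<^const>\<open>Qp_top\<close> is never unfolded: the locale \<^locale>\<open>Metric_space\<close> requires a distance that is symmetric
  and nonnegative on the whole type, and that of \<^const>\<open>Qp_top\<close> is junk outside the field. The proof works for
  every topology on the field. Transposition is a homeomorphism, so the \<open>\<sigma>\<close>-algebra of the Haar measure is
  invariant under right translations and inversion; it contains \<open>\<Gamma>\<close>, hence all sets that are open in the
  valuation topology, and by Lusin's theorem the Borel sets of the latter are all of it up to null sets.\<close>

lemma (in group) haar_left_sets:
  assumes h: "haar_measure G PT \<mu>" and x: "x \<in> carrier G" and E: "E \<in> sets \<mu>"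
  shows "{y \<in> carrier G. x \<otimes> y \<in> E} \<in> sets \<mu>"
proof -
  have sp: "space \<mu> = carrier G" and nz: "emeasure \<mu> (carrier G) \<noteq> 0"
    and inv: "\<And>x E. x \<in> carrier G \<Longrightarrow> E \<in> sets \<mu> \<Longrightarrow> emeasure \<mu> (x <# E) = emeasure \<mu> E"
    using h unfolding haar_measure_def by blast+
  have *: "{y \<in> carrier G. x \<otimes> y \<in> F} \<in> sets \<mu>" if F: "F \<in> sets \<mu>" "emeasure \<mu> F \<noteq> 0" for F
  proof -
    have "F \<subseteq> carrier G" using sets.sets_into_space[OF F(1)] sp by simp
    then have "{y \<in> carrier G. x \<otimes> y \<in> F} = inv x <# F" using x by (simp add: l_coset_eq)
    moreover have "emeasure \<mu> (inv x <# F) \<noteq> 0" using inv[of "inv x" F] F x by simp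
    ultimately show ?thesis using emeasure_notin_sets by metis
  qed
  show ?thesis
  proof (cases "emeasure \<mu> E = 0")
    case True
    let ?F = "carrier G - E"
    have F: "?F \<in> sets \<mu>" using sets.compl_sets[OF E] sp by simp
    have Esub: "E \<subseteq> carrier G" using sets.sets_into_space[OF E] sp by simp
    then have "emeasure \<mu> (carrier G) = emeasure \<mu> E + emeasure \<mu> ?F"
      using plus_emeasure[OF E F] by (simp add: Un_absorb1)
    then have "emeasure \<mu> ?F \<noteq> 0" using nz True by auto
    then have "space \<mu> - {y \<in> carrier G. x \<otimes> y \<in> ?F} \<in> sets \<mu>" using *[OF F] by (rule_tac sets.compl_sets)
    moreover have "space \<mu> - {y \<in> carrier G. x \<otimes> y \<in> ?F} = {y \<in> carrier G. x \<otimes> y \<in> E}"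
      using x sp by auto
    ultimately show ?thesis by simp
  qed (use * E in simp)
qed

text \<open>An open set is a union of translates of measurable neighbourhoods of \<one>; second
  countability cuts this union down to a countable one.\<close>

lemma (in nonarch_group) open_sets_generated:
  assumes sp: "space \<mu> = carrier G"
    and left: "\<And>x E. x \<in> carrier G \<Longrightarrow> E \<in> sets \<mu> \<Longrightarrow> {y \<in> carrier G. x \<otimes> y \<in> E} \<in> sets \<mu>"
    and base: "\<And>U. openin T U \<Longrightarrow> \<one> \<in> U \<Longrightarrow> \<exists>F. openin T F \<and> F \<in> sets \<mu> \<and> \<one> \<in> F \<and> F \<subseteq> U"
    and U: "openin T U"
  shows "U \<in> sets \<mu>"
proof -
  obtain B where B: "countable B" "\<And>U x. openin T U \<Longrightarrow> x \<in> U \<Longrightarrow> \<exists>V\<in>B. x \<in> V \<and> V \<subseteq> U"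
    by (rule countable_base) (rule that)
  define P where "P = (\<lambda>V C. C \<in> sets \<mu> \<and> V \<subseteq> C \<and> C \<subseteq> U)"
  define c where "c = (\<lambda>V. SOME C. P V C)"
  have c: "P V (c V)" if "\<exists>C. P V C" for V unfolding c_def using that by (rule someI_ex)
  have "U = \<Union>(c ` {V \<in> B. \<exists>C. P V C})"
  proof (intro equalityI subsetI)
    fix x assume x: "x \<in> U"
    then have xc: "x \<in> carrier G" using open_carrier[OF U] by blast
    obtain F where F: "openin T F" "F \<in> sets \<mu>" "\<one> \<in> F" "F \<subseteq> {y \<in> carrier G. x \<otimes> y \<in> U}"
      using base[OF left_open[OF U xc]] x xc by auto
    let ?C = "{y \<in> carrier G. inv x \<otimes> y \<in> F}"
    have C: "?C \<in> sets \<mu>" "openin T ?C" "x \<in> ?C" using left[of "inv x" F] left_open[OF F(1), of "inv x"] F xc by auto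
    have "?C \<subseteq> U"
    proof
      fix y assume "y \<in> ?C"
      then have "y \<in> carrier G" "x \<otimes> (inv x \<otimes> y) \<in> U" using F(4) by auto
      then show "y \<in> U" using xc by (simp flip: m_assoc)
    qed
    obtain V where V: "V \<in> B" "x \<in> V" "V \<subseteq> ?C" using B(2)[OF C(2,3)] by blast
    have ex: "\<exists>C. P V C" using C V \<open>?C \<subseteq> U\<close> unfolding P_def by blast
    have "x \<in> c V" using c[OF ex] V(2) unfolding P_def by blast
    then show "x \<in> \<Union>(c ` {V \<in> B. \<exists>C. P V C})" using V(1) ex by blast
  next
    fix x assume "x \<in> \<Union>(c ` {V \<in> B. \<exists>C. P V C})"
    then show "x \<in> U" using c unfolding P_def by blast
  qed
  moreover have "\<Union>(c ` {V \<in> B. \<exists>C. P V C}) \<in> sets \<mu>"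
    using B(1) c unfolding P_def by (intro sets.countable_UN'') auto
  ultimately show ?thesis by simp
qed

text \<open>\<open>T\<close> will be the valuation topology, \<open>PT\<close> is the topology for
  which \<mu> is a Haar measure. They are related through the \<sigma>-algebra of \<mu> alone, which
  contains the \<open>T\<close>-open sets and is stable under right translation and
  inversion.\<close>

locale radon_extension = nonarch_group G T for G :: "('g, 'm) monoid_scheme" (structure) and T +
  fixes PT :: "'g topology" and \<mu> :: "'g measure" and \<Gamma> :: "'g set"
  assumes haar: "haar_measure G PT \<mu>"
    and Hausdorff: "Hausdorff_space T"
    and \<Gamma>: "subgroup \<Gamma> G" "openin T \<Gamma>" "emeasure \<mu> \<Gamma> = 1"
    and gelfand: "\<And>x. x \<in> carrier G \<Longrightarrow> \<exists>k1\<in>\<Gamma>. \<exists>k2\<in>\<Gamma>. inv x = k1 \<otimes> x \<otimes> k2"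
    and right_sets_\<mu>: "\<And>x E. x \<in> carrier G \<Longrightarrow> E \<in> sets \<mu> \<Longrightarrow> {y \<in> carrier G. y \<otimes> x \<in> E} \<in> sets \<mu>"
    and inv_sets_\<mu>: "\<And>E. E \<in> sets \<mu> \<Longrightarrow> {y \<in> carrier G. inv y \<in> E} \<in> sets \<mu>"
    and open_sets_\<mu>: "\<And>U. openin T U \<Longrightarrow> U \<in> sets \<mu>"
begin

lemma space_\<mu>: "space \<mu> = carrier G" and sets_\<mu>: "sets \<mu> = sigma_sets (carrier G) {U. openin PT U}"
  and left_inv_\<mu>: "\<And>x E. x \<in> carrier G \<Longrightarrow> E \<in> sets \<mu> \<Longrightarrow> emeasure \<mu> (x <# E) = emeasure \<mu> E"
  and outer: "\<And>E. E \<in> sets \<mu> \<Longrightarrow> emeasure \<mu> E = (INF U\<in>{U. openin PT U \<and> E \<subseteq> U}. emeasure \<mu> U)"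
  and inner: "\<And>U. openin PT U \<Longrightarrow> emeasure \<mu> U = (SUP K\<in>{K. compactin PT K \<and> K \<subseteq> U}. emeasure \<mu> K)"
  using haar unfolding haar_measure_def by blast+

lemma PT_sets: "openin PT U \<Longrightarrow> U \<in> sets \<mu>"
  unfolding sets_\<mu> by (auto intro: sigma_sets.Basic)

text \<open>The restriction of \<mu> to the Borel sets of \<open>T\<close>, written as an image
  measure under the identity.\<close>

definition M :: "'g measure" where
  "M = distr \<mu> (sigma (carrier G) {U. openin T U}) (\<lambda>x. x)"

lemma space_M: "space M = carrier G" and sets_M: "sets M = sigma_sets (carrier G) {U. openin T U}"
  using open_carrier by (auto simp: M_def intro!: space_measure_of sets_measure_of)

lemma sets_le: "sets M \<subseteq> sets \<mu>"
  unfolding sets_M using sets.sigma_sets_subset[of "{U. openin T U}" \<mu>] open_sets_\<mu> by (auto simp: space_\<mu>)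

lemma emeasure_M: "E \<in> sets M \<Longrightarrow> emeasure M E = emeasure \<mu> E"
proof -
  assume E: "E \<in> sets M"
  have "(\<lambda>x. x) \<in> \<mu> \<rightarrow>\<^sub>M sigma (carrier G) {U. openin T U}"
    using open_carrier by (intro measurable_measure_of) (auto simp: space_\<mu> Int_absorb2 open_sets_\<mu>)
  moreover have "E \<in> sets (sigma (carrier G) {U. openin T U})" using E by (simp add: M_def)
  moreover have "E \<inter> carrier G = E" using sets.sets_into_space[OF E] by (auto simp: space_M)
  ultimately show ?thesis using emeasure_distr[of "\<lambda>x. x" \<mu> _ E] by (simp add: M_def space_\<mu>)
qed

sublocale haar: haar_gelfand G T M \<Gamma>
proof (intro haar_gelfand.intro haar_gelfand_axioms.intro)
  show "nonarch_group G T" by (rule nonarch_group_axioms)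
  show "space M = carrier G" by (rule space_M)
  show "sets M = sigma_sets (carrier G) {U. openin T U}" by (rule sets_M)
  show "subgroup \<Gamma> G" "openin T \<Gamma>" by (rule \<Gamma>)+
  have "\<Gamma> \<in> sets M" unfolding sets_M using \<Gamma>(2) by (auto intro: sigma_sets.Basic)
  then show "emeasure M \<Gamma> = 1" using \<Gamma>(3) by (simp add: emeasure_M)
  show "\<And>x. x \<in> carrier G \<Longrightarrow> \<exists>k1\<in>\<Gamma>. \<exists>k2\<in>\<Gamma>. inv x = k1 \<otimes> x \<otimes> k2" by (rule gelfand)
  fix x E assume x: "x \<in> carrier G" and E: "E \<in> sets M"
  have "x <# E \<in> sets M"
  proof -
    have "x <# E = (\<lambda>y. inv x \<otimes> y) -` E \<inter> space M"
      using x sets.sets_into_space[OF E] by (auto simp: l_coset_eq space_M)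
    moreover have "(\<lambda>y. inv x \<otimes> y) \<in> M \<rightarrow>\<^sub>M M"
    proof (rule measurable_sigma_sets[OF sets_M])
      fix U assume "U \<in> {U. openin T U}"
      then have "openin T {y \<in> carrier G. inv x \<otimes> y \<in> U}" using x by (intro left_open) auto
      then show "(\<lambda>y. inv x \<otimes> y) -` U \<inter> space M \<in> sets M"
        unfolding sets_M by (auto simp: space_M vimage_def Int_def conj_commute intro: sigma_sets.Basic)
    qed (use open_carrier x in \<open>auto simp: space_M\<close>)
    ultimately show ?thesis using E by (metis measurable_sets)
  qed
  then show "emeasure M (x <# E) = emeasure M E"
    using left_inv_\<mu>[OF x] E sets_le by (simp add: emeasure_M subset_iff)
qed

text \<open>E is approximated by an open U, the rest U - E by an open O', and U from inside by a
  compact K, with a third of the error each. Removing the open O' from K keeps it compact although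
  \<open>PT\<close> need not be Hausdorff.\<close>

lemma compact_approximation:
  assumes E: "E \<in> sets \<mu>" and fin: "emeasure \<mu> E \<noteq> \<infinity>" and e: "0 < e"
  obtains C where "compactin PT C" "C \<in> sets \<mu>" "C \<subseteq> E" "emeasure \<mu> (E - C) < ennreal e"
proof -
  have outer_approx: "\<exists>U. openin PT U \<and> F \<subseteq> U \<and> emeasure \<mu> U \<noteq> \<infinity> \<and> emeasure \<mu> (U - F) < ennreal r"
    if F: "F \<in> sets \<mu>" "emeasure \<mu> F \<noteq> \<infinity>" and r: "0 < r" for F r
  proof -
    have "emeasure \<mu> F < emeasure \<mu> F + ennreal r"
      using F(2) r by (simp add: ennreal_add_left_cancel_less[of _ 0, simplified] top.not_eq_extremum)
    then obtain U where U: "openin PT U" "F \<subseteq> U" "emeasure \<mu> U < emeasure \<mu> F + ennreal r"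
      unfolding outer[OF F(1)] INF_less_iff by auto
    have "emeasure \<mu> U = emeasure \<mu> F + emeasure \<mu> (U - F)"
      using plus_emeasure[OF F(1), of "U - F"] PT_sets[OF U(1)] F(1) U(2) by (simp add: Un_absorb1)
    then have "emeasure \<mu> (U - F) < ennreal r" using U(3) F(2) by (simp add: ennreal_add_left_cancel_less)
    moreover have "emeasure \<mu> U \<noteq> \<infinity>" using U(3) by auto
    ultimately show ?thesis using U by blast
  qed
  \<comment> \<open>Without the Hausdorff property a compact set may fail to be measurable. It then
    has \<open>emeasure\<close> 0 and respects the bound \<open>le\<close> trivially, so the
    supremum is approached by measurable compact sets.\<close>
  have inner_approx: "\<exists>K. compactin PT K \<and> K \<in> sets \<mu> \<and> K \<subseteq> U \<and> emeasure \<mu> (U - K) < ennreal r"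
    if U: "openin PT U" "emeasure \<mu> U \<noteq> \<infinity>" and r: "0 < r" for U r
  proof (rule ccontr)
    assume no: "\<not> ?thesis"
    have Us: "U \<in> sets \<mu>" using U(1) by (rule PT_sets)
    have m: "emeasure \<mu> U = ennreal (measure \<mu> U)" using U(2) by (simp add: emeasure_eq_ennreal_measure)
    have le: "emeasure \<mu> K \<le> ennreal (measure \<mu> U - r)" if K: "compactin PT K" "K \<subseteq> U" for K
    proof (cases "K \<in> sets \<mu>")
      case True
      have "ennreal r \<le> emeasure \<mu> (U - K)" using no K True by (auto simp: not_less)
      moreover have fK: "emeasure \<mu> K \<noteq> \<infinity>" using emeasure_mono[OF K(2) Us] U(2) by (auto simp: top_unique)
      ultimately have "ennreal r + emeasure \<mu> K \<le> emeasure \<mu> (U - K) + emeasure \<mu> K" by (intro add_right_mono)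
      also have "\<dots> = emeasure \<mu> U"
        using plus_emeasure[OF True, of "U - K"] Us True K(2) by (simp add: Un_absorb1 add.commute)
      finally have "ennreal (r + measure \<mu> K) \<le> ennreal (measure \<mu> U)"
        using fK r m by (simp add: emeasure_eq_ennreal_measure ennreal_plus)
      then have "r + measure \<mu> K \<le> measure \<mu> U" by (subst (asm) ennreal_le_iff) auto
      then have "measure \<mu> K \<le> measure \<mu> U - r" by simp
      then show ?thesis using fK by (simp add: emeasure_eq_ennreal_measure ennreal_leI)
    qed (simp add: emeasure_notin_sets)
    \<comment> \<open>The empty set as candidate for K shows r \<le> \<open>measure \<mu> U\<close>,
      so the real difference in the bound is not cut off at 0.\<close>
    have "ennreal r \<le> emeasure \<mu> (U - {})"
    proof (rule ccontr)
      assume "\<not> ennreal r \<le> emeasure \<mu> (U - {})"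
      then show False using no by (auto simp: not_le dest!: spec[of _ "{}"])
    qed
    then have rm: "r \<le> measure \<mu> U" using r m by (simp add: ennreal_le_iff)
    have "emeasure \<mu> U \<le> ennreal (measure \<mu> U - r)"
      unfolding inner[OF U(1)] by (rule SUP_least) (use le in auto)
    then have "measure \<mu> U \<le> measure \<mu> U - r" unfolding m using rm by (simp add: ennreal_le_iff)
    then show False using r by simp
  qed
  have e3: "0 < e / 3" using e by simp
  obtain U where U: "openin PT U" "E \<subseteq> U" "emeasure \<mu> U \<noteq> \<infinity>" "emeasure \<mu> (U - E) < ennreal (e / 3)"
    using outer_approx[OF E fin e3] by blast
  have Us: "U \<in> sets \<mu>" using U(1) by (rule PT_sets)
  have UE: "U - E \<in> sets \<mu>" using Us E by auto
  have "emeasure \<mu> (U - E) \<noteq> \<infinity>" using U(4) by auto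
  then obtain O' where O': "openin PT O'" "U - E \<subseteq> O'" "emeasure \<mu> (O' - (U - E)) < ennreal (e / 3)"
    using outer_approx[OF UE _ e3] by blast
  have Os: "O' \<in> sets \<mu>" using O'(1) by (rule PT_sets)
  obtain K where K: "compactin PT K" "K \<in> sets \<mu>" "K \<subseteq> U" "emeasure \<mu> (U - K) < ennreal (e / 3)"
    using inner_approx[OF U(1,3) e3] by blast
  define C where "C = (topspace PT - O') \<inter> K"
  have Kt: "K \<subseteq> topspace PT" using K(1) by (simp add: compactin_def)
  have C': "C = K - O'" using Kt by (auto simp: C_def)
  show thesis
  proof (rule that[of C])
    show "compactin PT C" unfolding C_def by (intro closed_Int_compactin K(1)) (use O'(1) in auto)
    show "C \<in> sets \<mu>" unfolding C' using K Os by auto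
    show "C \<subseteq> E" unfolding C' using K(3) O'(2) by auto
    have "emeasure \<mu> (E - C) \<le> emeasure \<mu> ((U - K) \<union> ((O' - (U - E)) \<union> (U - E)))"
      using U(2) Us K(2) Os UE unfolding C' by (intro emeasure_mono) auto
    also have "\<dots> \<le> emeasure \<mu> (U - K) + emeasure \<mu> ((O' - (U - E)) \<union> (U - E))"
      using Us K(2) Os UE by (intro emeasure_subadditive) auto
    also have "\<dots> \<le> emeasure \<mu> (U - K) + (emeasure \<mu> (O' - (U - E)) + emeasure \<mu> (U - E))"
      using Os UE by (intro add_left_mono emeasure_subadditive) auto
    also have "\<dots> < ennreal (e / 3) + (ennreal (e / 3) + ennreal (e / 3))"
      using K(4) O'(3) U(4) by (intro add_strict_mono)
    also have "\<dots> = ennreal e" using e by (simp flip: ennreal_plus)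
    finally show "emeasure \<mu> (E - C) < ennreal e" .
  qed
qed

text \<open>Lusin's theorem for the identity map from \<open>PT\<close> to the second countable topology \<open>T\<close>: outside a
  set of small measure it is continuous.\<close>

lemma lusin_identity:
  assumes A: "A \<in> sets \<mu>" "emeasure \<mu> A \<noteq> \<infinity>" and e: "0 < e"
  obtains W where "W \<in> sets \<mu>" "emeasure \<mu> W \<le> ennreal e"
    "\<And>V. openin T V \<Longrightarrow> \<exists>U. openin PT U \<and> V \<inter> (A - W) = U \<inter> (A - W)"
proof -
  obtain B where B: "countable B" "\<And>V. V \<in> B \<Longrightarrow> openin T V"
      "\<And>U x. openin T U \<Longrightarrow> x \<in> U \<Longrightarrow> \<exists>V\<in>B. x \<in> V \<and> V \<subseteq> U"
    by (rule countable_base) (rule that)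
  \<comment> \<open>The empty set is added so that a nonempty set is enumerated.\<close>
  define b where "b = from_nat_into (insert {} B)"
  have range_b: "range b = insert {} B" unfolding b_def using B(1) by (intro range_from_nat_into) auto
  have bo: "openin T (b i)" for i using B(2) range_b by (metis insertE openin_empty rangeI)
  have "\<exists>U. openin PT U \<and> b i \<inter> A \<subseteq> U \<and> emeasure \<mu> (U - b i \<inter> A) < ennreal (e * (1/2) ^ Suc i)" for i
  proof -
    have F: "b i \<inter> A \<in> sets \<mu>" using A open_sets_\<mu>[OF bo] by auto
    have fin: "emeasure \<mu> (b i \<inter> A) \<noteq> \<infinity>" using emeasure_mono[of "b i \<inter> A" A \<mu>] A by (auto simp: top_unique)
    have "emeasure \<mu> (b i \<inter> A) < emeasure \<mu> (b i \<inter> A) + ennreal (e * (1/2) ^ Suc i)"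
      using fin e by (simp add: ennreal_add_left_cancel_less[of _ 0, simplified] top.not_eq_extremum)
    then obtain U where U: "openin PT U" "b i \<inter> A \<subseteq> U" "emeasure \<mu> U < emeasure \<mu> (b i \<inter> A) + ennreal (e * (1/2) ^ Suc i)"
      unfolding outer[OF F] INF_less_iff by auto
    have "emeasure \<mu> U = emeasure \<mu> (b i \<inter> A) + emeasure \<mu> (U - b i \<inter> A)"
      using plus_emeasure[OF F, of "U - b i \<inter> A"] PT_sets[OF U(1)] F U(2) by (simp add: Un_absorb1)
    then have "emeasure \<mu> (U - b i \<inter> A) < ennreal (e * (1/2) ^ Suc i)"
      using U(3) fin by (simp add: ennreal_add_left_cancel_less)
    then show ?thesis using U by blast
  qed
  then obtain u where u: "\<And>i. openin PT (u i)" "\<And>i. b i \<inter> A \<subseteq> u i"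
    "\<And>i. emeasure \<mu> (u i - b i \<inter> A) < ennreal (e * (1/2) ^ Suc i)" by metis
  \<comment> \<open>Off W each basic set agrees on A with a \<open>PT\<close>-open set; the errors
    are bounded by a geometric series with sum e.\<close>
  define W where "W = (\<Union>i. u i - b i \<inter> A)"
  have us: "u i - b i \<inter> A \<in> sets \<mu>" for i using PT_sets[OF u(1)] A open_sets_\<mu>[OF bo] by auto
  show thesis
  proof (rule that[of W])
    show "W \<in> sets \<mu>" unfolding W_def using us by auto
    have "emeasure \<mu> W \<le> (\<Sum>i. emeasure \<mu> (u i - b i \<inter> A))"
      unfolding W_def using us by (intro emeasure_subadditive_countably) auto
    also have "\<dots> \<le> (\<Sum>i. ennreal (e * (1/2) ^ Suc i))"
      using u(3) by (intro suminf_le) (auto intro: less_imp_le)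
    also have "\<dots> = ennreal (\<Sum>i. e * (1/2) ^ Suc i)"
      using e sums_mult[OF power_half_series, of e] by (intro suminf_ennreal2) (auto simp: sums_iff simp del: power_Suc)
    also have "(\<Sum>i. e * (1/2) ^ Suc i) = e"
      using sums_unique[OF sums_mult[OF power_half_series, of e]] by simp
    finally show "emeasure \<mu> W \<le> ennreal e" .
    fix V assume V: "openin T V"
    define I where "I = {i. b i \<subseteq> V}"
    have "V = (\<Union>i\<in>I. b i)"
    proof (intro equalityI subsetI)
      fix x assume "x \<in> V"
      then obtain V' where "V' \<in> B" "x \<in> V'" "V' \<subseteq> V" using B(3)[OF V] by blast
      moreover obtain i where "b i = V'" using range_b \<open>V' \<in> B\<close> by (metis insertI2 imageE)
      ultimately show "x \<in> (\<Union>i\<in>I. b i)" by (auto simp: I_def)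
    qed (auto simp: I_def)
    moreover have "b i \<inter> (A - W) = u i \<inter> (A - W)" for i using u(2)[of i] by (auto simp: W_def)
    ultimately have "V \<inter> (A - W) = (\<Union>i\<in>I. u i) \<inter> (A - W)" by blast
    moreover have "openin PT (\<Union>i\<in>I. u i)" using u(1) by (intro openin_Union) auto
    ultimately show "\<exists>U. openin PT U \<and> V \<inter> (A - W) = U \<inter> (A - W)" by blast
  qed
qed

text \<open>On C the identity is continuous from \<open>PT\<close> to \<open>T\<close>, so
  \<open>PT\<close>-compact subsets of C are \<open>T\<close>-compact, hence \<open>T\<close>-closed
  and in M. This settles the traces of \<open>PT\<close>-open sets, and induction over the
  \<sigma>-algebra gives all others.\<close>

lemma compact_trace:
  assumes C: "compactin PT C" "C \<subseteq> carrier G"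
    and cont: "\<And>V. openin T V \<Longrightarrow> \<exists>U. openin PT U \<and> V \<inter> C = U \<inter> C"
    and E: "E \<in> sets \<mu>"
  shows "C \<in> sets M" "E \<inter> C \<in> sets M"
proof -
  have compact_sets: "D \<in> sets M" if D: "compactin PT D" "D \<subseteq> C" for D
  proof -
    have Dt: "D \<subseteq> topspace PT" using D(1) by (simp add: compactin_def)
    have "continuous_map (subtopology PT D) T (\<lambda>x. x)"
      unfolding continuous_map_def
    proof (intro conjI allI impI)
      show "(\<lambda>x. x) \<in> topspace (subtopology PT D) \<rightarrow> topspace T" using D(2) C(2) by (auto simp: topspace_T)
      fix V assume "openin T V"
      then obtain U where "openin PT U" "V \<inter> C = U \<inter> C" using cont by blast
      then show "openin (subtopology PT D) {x \<in> topspace (subtopology PT D). x \<in> V}"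
        using D(2) Dt unfolding openin_subtopology by (intro exI[of _ U]) auto
    qed
    moreover have "compactin (subtopology PT D) D" using D(1) by (simp add: compactin_subtopology)
    ultimately have "compactin T D" using image_compactin[of "subtopology PT D" D T "\<lambda>x. x"] by simp
    then have "closedin T D" using Hausdorff compactin_imp_closedin by blast
    then have "openin T (carrier G - D)" by (simp add: closedin_def topspace_T)
    then have "carrier G - D \<in> sets M" by (rule haar.open_sets)
    then have "space M - (carrier G - D) \<in> sets M" by (rule sets.compl_sets)
    moreover have "space M - (carrier G - D) = D" using D(2) C(2) by (auto simp: space_M)
    ultimately show ?thesis by simp
  qed
  show CM: "C \<in> sets M" by (rule compact_sets[OF C(1) order_refl])
  from E have "E \<in> sigma_sets (carrier G) {U. openin PT U}" by (simp add: sets_\<mu>)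
  then show "E \<inter> C \<in> sets M"
  proof induction
    case (Basic U)
    then have U: "openin PT U" by simp
    have "compactin PT ((topspace PT - U) \<inter> C)" using U C(1) by (intro closed_Int_compactin) auto
    then have "(topspace PT - U) \<inter> C \<in> sets M" by (intro compact_sets) auto
    then have "C - (topspace PT - U) \<inter> C \<in> sets M" using CM by auto
    moreover have "C - (topspace PT - U) \<inter> C = U \<inter> C" using C(1) by (auto simp: compactin_def)
    ultimately show ?case by simp
  next
    case (Compl E)
    have "(carrier G - E) \<inter> C = C - E \<inter> C" using C(2) by auto
    then show ?case using Compl CM by auto
  next
    case (Union F)
    have "(\<Union>i. F i \<inter> C) \<in> sets M" using Union by (intro sets.countable_UN) auto
    moreover have "\<Union> (range F) \<inter> C = (\<Union>i. F i \<inter> C)" by auto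
    ultimately show ?case by (simp only:)
  qed simp
qed

text \<open>Inside a set A of finite measure, countably many compact sets as in
  \<open>compact_trace\<close> exhaust A up to a null set, and each meets E in a set of M. Cosets of
  \<Gamma> then glue the pieces.\<close>

lemma sets_completion_M: "sets \<mu> \<subseteq> sets (completion M)"
proof
  fix E assume E: "E \<in> sets \<mu>"
  have local: "E \<inter> A \<in> sets (completion M)" if A: "A \<in> sets M" "emeasure \<mu> A \<noteq> \<infinity>" for A
  proof -
    have A\<mu>: "A \<in> sets \<mu>" using A sets_le by blast
    have Ac: "A \<subseteq> carrier G" using sets.sets_into_space[OF A(1)] by (simp add: space_M)
    have "\<exists>C\<in>sets M. C \<subseteq> A \<and> E \<inter> C \<in> sets M \<and> emeasure \<mu> (A - C) \<le> ennreal (1 / real (Suc n))" for n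
    proof -
      define e where "e = 1 / real (Suc n) / 2"
      have e: "0 < e" by (simp add: e_def)
      obtain W where W: "W \<in> sets \<mu>" "emeasure \<mu> W \<le> ennreal e"
        "\<And>V. openin T V \<Longrightarrow> \<exists>U. openin PT U \<and> V \<inter> (A - W) = U \<inter> (A - W)"
        by (rule lusin_identity[OF A\<mu> A(2) e]) (rule that)
      have AW: "A - W \<in> sets \<mu>" using A\<mu> W(1) by auto
      have "emeasure \<mu> (A - W) \<noteq> \<infinity>" using emeasure_mono[of "A - W" A \<mu>] A\<mu> A(2) by (auto simp: top_unique)
      then obtain C where C: "compactin PT C" "C \<in> sets \<mu>" "C \<subseteq> A - W" "emeasure \<mu> (A - W - C) < ennreal e"
        using compact_approximation[OF AW _ e] by blast
      have cont: "\<exists>U. openin PT U \<and> V \<inter> C = U \<inter> C" if V: "openin T V" for V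
      proof -
        obtain U where U: "openin PT U" "V \<inter> (A - W) = U \<inter> (A - W)" using W(3)[OF V] by blast
        then have "V \<inter> C = U \<inter> C" using C(3) by blast
        then show ?thesis using U(1) by blast
      qed
      have Cc: "C \<subseteq> carrier G" using C(3) Ac by blast
      note tr = compact_trace[OF C(1) Cc cont E]
      have "emeasure \<mu> (A - C) \<le> emeasure \<mu> (W \<union> (A - W - C))"
        using W(1) AW C(2) by (intro emeasure_mono) auto
      also have "\<dots> \<le> emeasure \<mu> W + emeasure \<mu> (A - W - C)"
        using W(1) AW C(2) by (intro emeasure_subadditive) auto
      also have "\<dots> \<le> ennreal e + ennreal e" using W(2) C(4) by (intro add_mono) auto
      also have "\<dots> = ennreal (e + e)" using e by (intro ennreal_plus[symmetric]) auto
      also have "e + e = 1 / real (Suc n)" unfolding e_def by (rule field_sum_of_halves)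
      finally have "emeasure \<mu> (A - C) \<le> ennreal (1 / real (Suc n))" .
      then show ?thesis using tr C(3) by blast
    qed
    then obtain c where c: "\<And>n. c n \<in> sets M" "\<And>n. c n \<subseteq> A" "\<And>n. E \<inter> c n \<in> sets M"
      "\<And>n. emeasure \<mu> (A - c n) \<le> ennreal (1 / real (Suc n))" by metis
    define Z where "Z = A - (\<Union>n. c n)"
    have Z: "Z \<in> sets M" unfolding Z_def using A(1) c(1) by auto
    have "emeasure \<mu> Z \<le> ennreal (1 / real (Suc n))" for n
    proof -
      have "A - c n \<in> sets \<mu>" using A(1) c(1)[of n] sets_le by blast
      then have "emeasure \<mu> Z \<le> emeasure \<mu> (A - c n)" unfolding Z_def by (intro emeasure_mono) auto
      then show ?thesis using c(4)[of n] by simp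
    qed
    moreover have "(\<lambda>n. ennreal (1 / real (Suc n))) \<longlonglongrightarrow> ennreal 0"
      using LIMSEQ_inverse_real_of_nat by (intro tendsto_ennrealI) (simp add: inverse_eq_divide)
    ultimately have "emeasure \<mu> Z \<le> ennreal 0" by (intro LIMSEQ_le_const) auto
    then have "Z \<in> null_sets M" using Z emeasure_M[OF Z] by (simp add: null_sets_def)
    moreover have "E \<inter> A = (\<Union>n. E \<inter> c n) \<union> (E \<inter> Z)" using c(2) by (auto simp: Z_def)
    moreover have "(\<Union>n. E \<inter> c n) \<in> sets M" using c(3) by (intro sets.countable_UN) auto
    ultimately show ?thesis by (intro sets_completionI[of _ "\<Union>n. E \<inter> c n" "E \<inter> Z" Z]) auto
  qed
  obtain A :: "nat \<Rightarrow> 'g set" where A: "range A \<subseteq> (\<lambda>x. x <# \<Gamma>) ` carrier G" "\<Union>(range A) = carrier G"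
    by (rule haar.\<Gamma>_cosets) (rule that)
  have "E \<inter> A i \<in> sets (completion M)" for i
  proof (rule local)
    obtain x where x: "x \<in> carrier G" "A i = x <# \<Gamma>" using A(1) by blast
    show "A i \<in> sets M" using x coset_open[OF \<Gamma>(2)] haar.open_sets by simp
    show "emeasure \<mu> (A i) \<noteq> \<infinity>" using x left_inv_\<mu>[OF x(1) open_sets_\<mu>[OF \<Gamma>(2)]] \<Gamma>(3) by simp
  qed
  then have "(\<Union>i. E \<inter> A i) \<in> sets (completion M)" by (intro sets.countable_UN) auto
  moreover have "(\<Union>i. E \<inter> A i) = E" using A(2) sets.sets_into_space[OF E] by (auto simp: space_\<mu>)
  ultimately show "E \<in> sets (completion M)" by (simp only:)
qed

text \<open>Right invariance passes from M to \<mu> by squeezing E between a set of M and its union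
  with a null set. The value of the modular function is pinned down by \<Gamma>, whose measure is
  1.\<close>

lemma unimodular_extension: "unimodular_extension G M \<mu>"
proof -
  interpret unimodular_group G M by (rule haar.unimodular)
  show ?thesis
  proof unfold_locales
    show "space \<mu> = carrier G" by (rule space_\<mu>)
    show "sets M \<subseteq> sets \<mu>" by (rule sets_le)
    show "\<And>E. E \<in> sets M \<Longrightarrow> emeasure \<mu> E = emeasure M E" by (simp add: emeasure_M)
    show "sets \<mu> \<subseteq> sets (completion M)" by (rule sets_completion_M)
    fix x assume x: "x \<in> carrier G"
    show "(\<lambda>y. inv y \<otimes> x) \<in> \<mu> \<rightarrow>\<^sub>M \<mu>"
    proof (rule measurableI)
      fix E assume "E \<in> sets \<mu>"
      then have "{y \<in> carrier G. inv y \<in> {y \<in> carrier G. y \<otimes> x \<in> E}} \<in> sets \<mu>"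
        using x by (intro inv_sets_\<mu> right_sets_\<mu>)
      moreover have "{y \<in> carrier G. inv y \<in> {y \<in> carrier G. y \<otimes> x \<in> E}} = (\<lambda>y. inv y \<otimes> x) -` E \<inter> space \<mu>"
        by (auto simp: space_\<mu>)
      ultimately show "(\<lambda>y. inv y \<otimes> x) -` E \<inter> space \<mu> \<in> sets \<mu>" by simp
    qed (use x in \<open>simp add: space_\<mu>\<close>)
    have ix: "inv x \<in> carrier G" using x by simp
    have right_M: "emeasure \<mu> {y \<in> carrier G. y \<otimes> inv x \<in> S} = emeasure \<mu> S" if S: "S \<in> sets M" for S
      using haar.emeasure_rtrans[OF ix S] haar.right_invariant[OF ix] S haar.right_sets[OF ix S]
      by (simp add: emeasure_M)
    have right: "emeasure \<mu> (E #> x) = emeasure \<mu> E" if E: "E \<in> sets \<mu>" for E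
    proof -
      have Ec: "E \<subseteq> carrier G" using sets.sets_into_space[OF E] by (simp add: space_\<mu>)
      have "E \<in> sets (completion M)" using E sets_completion_M by blast
      then obtain S N N0 where S: "E = S \<union> N" "N \<subseteq> N0" "N0 \<in> null_sets M" "S \<in> sets M"
        by (rule sets_completionE) (rule that)
      have N0: "N0 \<in> sets M" "N0 \<in> sets \<mu>" "emeasure \<mu> N0 = 0" using S(3) sets_le emeasure_M[of N0] by (auto simp: null_sets_def)
      have S\<mu>: "S \<in> sets \<mu>" using S(4) sets_le by blast
      let ?t = "\<lambda>F. {y \<in> carrier G. y \<otimes> inv x \<in> F}"
      note ts = right_sets_\<mu>[OF ix]
      have "emeasure \<mu> (?t E) = emeasure \<mu> S"
      proof (rule antisym)
        have "emeasure \<mu> (?t E) \<le> emeasure \<mu> (?t S \<union> ?t N0)"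
          using S ts[OF S\<mu>] ts[OF N0(2)] by (intro emeasure_mono) auto
        also have "\<dots> \<le> emeasure \<mu> (?t S) + emeasure \<mu> (?t N0)"
          by (intro emeasure_subadditive ts S\<mu> N0)
        also have "\<dots> = emeasure \<mu> S" using right_M[OF S(4)] right_M[OF N0(1)] N0 by simp
        finally show "emeasure \<mu> (?t E) \<le> emeasure \<mu> S" .
        have "emeasure \<mu> (?t S) \<le> emeasure \<mu> (?t E)" using S(1) ts[OF E] by (intro emeasure_mono) auto
        then show "emeasure \<mu> S \<le> emeasure \<mu> (?t E)" using right_M[OF S(4)] by simp
      qed
      moreover have "emeasure \<mu> E = emeasure \<mu> S"
      proof (rule antisym)
        have "emeasure \<mu> E \<le> emeasure \<mu> (S \<union> N0)" using S S\<mu> N0 by (intro emeasure_mono) auto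
        also have "\<dots> \<le> emeasure \<mu> S + emeasure \<mu> N0" by (intro emeasure_subadditive S\<mu> N0)
        finally show "emeasure \<mu> E \<le> emeasure \<mu> S" using N0 by simp
        show "emeasure \<mu> S \<le> emeasure \<mu> E" using S(1) E by (intro emeasure_mono) auto
      qed
      ultimately show ?thesis using Ec x by (simp add: r_coset_eq)
    qed
    show "modular_function G \<mu> x = 1"
      unfolding modular_function_def
    proof (rule the_equality)
      show r1: "\<forall>E\<in>sets \<mu>. emeasure \<mu> (E #> x) = ennreal 1 * emeasure \<mu> E" using right by simp
      fix r assume "\<forall>E\<in>sets \<mu>. emeasure \<mu> (E #> x) = ennreal r * emeasure \<mu> E"
      then have "ennreal r * emeasure \<mu> \<Gamma> = ennreal 1 * emeasure \<mu> \<Gamma>" using r1 open_sets_\<mu>[OF \<Gamma>(2)] by metis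
      then show "r = 1" using \<Gamma>(3) by simp
    qed
  qed
qed

end

section \<open>A non-positive character of a Hecke algebra\<close>

text \<open>\<open>\<epsilon>\<close> abstracts the sign \<open>(-1)\<^sup>m\<close>, where \<open>q\<^sup>m\<close> is the norm of the first column of a
  matrix; \<open>iwasawa\<close> makes \<open>f \<mapsto> \<integral> f \<epsilon>\<close> multiplicative on right \<open>\<Gamma>\<close>-invariant functions, and
  \<open>gelfand\<close> makes it a star-character. \<open>\<Gamma>'\<close> supplies the projection \<open>e\<close> with \<open>pep\<close> sent to a
  negative number.\<close>

locale sign_character = unimodular_extension G M \<mu>
  for G :: "('g, 'm) monoid_scheme" (structure) and M \<mu> :: "'g measure" +
  fixes \<Gamma> \<Gamma>' :: "'g set" and \<epsilon> :: "'g \<Rightarrow> real"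
  assumes \<Gamma>: "subgroup \<Gamma> G" "\<Gamma> \<in> sets M" "emeasure M \<Gamma> = 1"
    and \<Gamma>': "subgroup \<Gamma>' G" "\<Gamma>' \<in> sets M" "emeasure M \<Gamma>' \<noteq> 0" "emeasure M \<Gamma>' \<noteq> \<infinity>"
    and \<epsilon>_measurable [measurable]: "\<epsilon> \<in> borel_measurable M"
    and \<epsilon>_bound: "\<And>x. \<bar>\<epsilon> x\<bar> \<le> 1"
    and \<epsilon>_left: "\<And>k x. k \<in> \<Gamma> \<Longrightarrow> x \<in> carrier G \<Longrightarrow> \<epsilon> (k \<otimes> x) = \<epsilon> x"
    and \<epsilon>_one: "\<epsilon> \<one> = 1"
    and iwasawa: "\<And>x. x \<in> carrier G \<Longrightarrow> \<exists>k\<in>\<Gamma>. \<forall>y\<in>carrier G. \<epsilon> (y \<otimes> x) = \<epsilon> x * \<epsilon> (y \<otimes> k)"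
    and gelfand: "\<And>x. x \<in> carrier G \<Longrightarrow> \<exists>k1\<in>\<Gamma>. \<exists>k2\<in>\<Gamma>. inv x = k1 \<otimes> x \<otimes> k2"
    and negative: "(\<integral>x. indicator \<Gamma> x * (\<integral>y. indicator \<Gamma>' y * \<epsilon> (y \<otimes> x) \<partial>M) \<partial>M) < 0"
begin

lemma indicator_complex:
  assumes "K \<in> sets M" "emeasure M K \<noteq> \<infinity>"
  shows "integrable M (indicator K :: 'g \<Rightarrow> complex)"
    "(\<integral>x. indicator K x \<partial>M) = complex_of_real (measure M K)"
proof -
  have eq: "(indicator K :: 'g \<Rightarrow> complex) = (\<lambda>x. complex_of_real (indicator K x))"
    by (auto simp: indicator_def)
  have "integrable M (indicator K :: 'g \<Rightarrow> real)"
    using assms by (simp add: integrable_indicator_iff top.not_eq_extremum)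
  then show "integrable M (indicator K :: 'g \<Rightarrow> complex)" unfolding eq by simp
  show "(\<integral>x. indicator K x \<partial>M) = complex_of_real (measure M K)"
    unfolding eq using sets.sets_into_space[OF assms(1)] by (simp add: Int_absorb2)
qed

lemma \<Gamma>_carrier: "k \<in> \<Gamma> \<Longrightarrow> k \<in> carrier G"
  using subgroup.mem_carrier[OF \<Gamma>(1)] .

lemma integral_right:
  fixes f :: "'g \<Rightarrow> complex"
  assumes [measurable]: "f \<in> borel_measurable M" and x: "x \<in> carrier G"
  shows "(\<integral>y. f (y \<otimes> x) \<partial>M) = (\<integral>y. f y \<partial>M)"
proof -
  have m1: "(\<lambda>y. f (y \<otimes> x)) \<in> borel_measurable M" using x by measurable
  have m2: "(\<lambda>y. f (inv y)) \<in> borel_measurable M" by measurable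
  have "(\<integral>y. f (y \<otimes> x) \<partial>M) = (\<integral>y. f (inv y \<otimes> x) \<partial>M)"
    using integral_inv[OF m1] by simp
  also have "\<dots> = (\<integral>y. f (inv (inv x \<otimes> y)) \<partial>M)"
    using x by (intro Bochner_Integration.integral_cong[OF refl]) (simp add: space_M inv_mult_group)
  also have "\<dots> = (\<integral>y. f (inv y) \<partial>M)" using integral_left[OF m2, of "inv x"] x by simp
  also have "\<dots> = (\<integral>y. f y \<partial>M)" by (rule integral_inv) simp
  finally show ?thesis .
qed

lemma integrable_bounded_mult:
  fixes f :: "'a \<Rightarrow> complex" and u :: "'a \<Rightarrow> real"
  assumes "integrable N f" "u \<in> borel_measurable N" "\<And>x. \<bar>u x\<bar> \<le> 1"
  shows "integrable N (\<lambda>x. f x * complex_of_real (u x))"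
proof (rule Bochner_Integration.integrable_bound[OF assms(1)])
  show "(\<lambda>x. f x * complex_of_real (u x)) \<in> borel_measurable N" using assms(1,2) by measurable
  show "AE x in N. norm (f x * complex_of_real (u x)) \<le> norm (f x)"
    using assms(3) by (auto simp: norm_mult mult_left_le)
qed

definition \<psi> :: "('g \<Rightarrow> complex) \<Rightarrow> complex" where
  "\<psi> f = (\<integral>x. f x * complex_of_real (\<epsilon> x) \<partial>M)"

text \<open>Fubini and the substitution x \<mapsto> y x move the translation from g to
  \<epsilon>.\<close>

lemma \<psi>_conv:
  assumes f: "integrable M f" and g: "integrable M g"
  shows "\<psi> (conv f g) = (\<integral>x. g x * (\<integral>y. f y * complex_of_real (\<epsilon> (y \<otimes> x)) \<partial>M) \<partial>M)"
proof -
  have [measurable]: "f \<in> borel_measurable M" "g \<in> borel_measurable M" using f g by auto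
  have k1: "integrable (M \<Otimes>\<^sub>M M) (\<lambda>(y, x). f y * g (inv y \<otimes> x) * complex_of_real (\<epsilon> x))"
    using integrable_bounded_mult[OF conv_kernel_integrable(1)[OF f g], of "\<lambda>p. \<epsilon> (snd p)"] \<epsilon>_bound
    by (simp add: split_beta')
  have k2: "integrable (M \<Otimes>\<^sub>M M) (\<lambda>(y, x). f y * g x * complex_of_real (\<epsilon> (y \<otimes> x)))"
  proof -
    have "integrable (M \<Otimes>\<^sub>M M) (\<lambda>(y, x). f y * g x)"
    proof (rule Fubini_integrable)
      show "integrable M (\<lambda>y. \<integral>x. cmod (case (y, x) of (y, x) \<Rightarrow> f y * g x) \<partial>M)"
        using f by (simp add: norm_mult)
    qed (use g in \<open>auto, measurable\<close>)
    moreover have "(\<lambda>p. \<epsilon> (fst p \<otimes> snd p)) \<in> borel_measurable (M \<Otimes>\<^sub>M M)" by measurable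
    ultimately show ?thesis
      using integrable_bounded_mult[of "M \<Otimes>\<^sub>M M" "\<lambda>(y, x). f y * g x" "\<lambda>p. \<epsilon> (fst p \<otimes> snd p)"] \<epsilon>_bound
      by (simp add: split_beta')
  qed
  have "\<psi> (conv f g) = (\<integral>x. \<integral>y. f y * g (inv y \<otimes> x) * complex_of_real (\<epsilon> x) \<partial>M \<partial>M)"
    by (simp add: \<psi>_def convolution_def)
  also have "\<dots> = (\<integral>y. \<integral>x. f y * g (inv y \<otimes> x) * complex_of_real (\<epsilon> x) \<partial>M \<partial>M)"
    by (rule Fubini_integral[OF k1])
  also have "\<dots> = (\<integral>y. \<integral>x. f y * g x * complex_of_real (\<epsilon> (y \<otimes> x)) \<partial>M \<partial>M)"
  proof (rule Bochner_Integration.integral_cong[OF refl])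
    fix y assume "y \<in> space M"
    then have y: "y \<in> carrier G" by (simp add: space_M)
    have "(\<lambda>x. f y * g (inv y \<otimes> x) * complex_of_real (\<epsilon> x)) \<in> borel_measurable M" using y by measurable
    from integral_left[OF this y, symmetric]
    have "(\<integral>x. f y * g (inv y \<otimes> x) * complex_of_real (\<epsilon> x) \<partial>M)
      = (\<integral>x. f y * g (inv y \<otimes> (y \<otimes> x)) * complex_of_real (\<epsilon> (y \<otimes> x)) \<partial>M)" .
    also have "\<dots> = (\<integral>x. f y * g x * complex_of_real (\<epsilon> (y \<otimes> x)) \<partial>M)"
      using y by (intro Bochner_Integration.integral_cong[OF refl]) (simp add: space_M flip: m_assoc)
    finally show "(\<integral>x. f y * g (inv y \<otimes> x) * complex_of_real (\<epsilon> x) \<partial>M) =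
       (\<integral>x. f y * g x * complex_of_real (\<epsilon> (y \<otimes> x)) \<partial>M)" .
  qed
  also have "\<dots> = (\<integral>x. \<integral>y. f y * g x * complex_of_real (\<epsilon> (y \<otimes> x)) \<partial>M \<partial>M)"
    by (rule Fubini_integral[OF k2, symmetric])
  also have "\<dots> = (\<integral>x. g x * (\<integral>y. f y * complex_of_real (\<epsilon> (y \<otimes> x)) \<partial>M) \<partial>M)"
    by (simp add: mult.assoc mult.left_commute[of _ "g _"])
  finally show ?thesis .
qed

text \<open>By \<open>iwasawa\<close> the integral of f against \<epsilon> (y x) depends on x
  through the factor \<epsilon> x and an element k of \<Gamma>; the latter is absorbed by right
  invariance of f and of the measure.\<close>

lemma \<psi>_conv_mult:
  assumes f: "integrable M f" and g: "integrable M g"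
    and inv: "\<And>x k. x \<in> carrier G \<Longrightarrow> k \<in> \<Gamma> \<Longrightarrow> f (x \<otimes> k) = f x"
  shows "\<psi> (conv f g) = \<psi> f * \<psi> g"
proof -
  have [measurable]: "f \<in> borel_measurable M" using f by auto
  have "(\<integral>y. f y * complex_of_real (\<epsilon> (y \<otimes> x)) \<partial>M) = complex_of_real (\<epsilon> x) * \<psi> f" if x: "x \<in> carrier G" for x
  proof -
    obtain k where k: "k \<in> \<Gamma>" "\<And>y. y \<in> carrier G \<Longrightarrow> \<epsilon> (y \<otimes> x) = \<epsilon> x * \<epsilon> (y \<otimes> k)"
      using iwasawa[OF x] by blast
    have "(\<integral>y. f y * complex_of_real (\<epsilon> (y \<otimes> x)) \<partial>M)
      = (\<integral>y. complex_of_real (\<epsilon> x) * (f (y \<otimes> k) * complex_of_real (\<epsilon> (y \<otimes> k))) \<partial>M)"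
      using k inv by (intro Bochner_Integration.integral_cong[OF refl]) (simp add: space_M)
    also have "\<dots> = complex_of_real (\<epsilon> x) * (\<integral>y. f (y \<otimes> k) * complex_of_real (\<epsilon> (y \<otimes> k)) \<partial>M)" by simp
    also have "(\<integral>y. f (y \<otimes> k) * complex_of_real (\<epsilon> (y \<otimes> k)) \<partial>M) = \<psi> f"
      unfolding \<psi>_def using integral_right[of "\<lambda>y. f y * complex_of_real (\<epsilon> y)" k] k \<Gamma>_carrier by simp
    finally show ?thesis .
  qed
  then have "\<psi> (conv f g) = (\<integral>x. \<psi> f * (g x * complex_of_real (\<epsilon> x)) \<partial>M)"
    unfolding \<psi>_conv[OF f g]
    by (intro Bochner_Integration.integral_cong[OF refl]) (simp add: space_M mult_ac)
  also have "\<dots> = \<psi> f * \<psi> g" by (simp add: \<psi>_def)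
  finally show ?thesis .
qed

abbreviation unit_fun :: "'g \<Rightarrow> complex" where "unit_fun \<equiv> indicator \<Gamma>"

lemma unit_integrable: "integrable M unit_fun"
  using \<Gamma> by (intro indicator_complex) simp_all

text \<open>Left convolution with p is invisible to \<psi> since \<epsilon> is left
  \<Gamma>-invariant. It serves to drop the outer p from pep.\<close>

lemma \<psi>_unit_conv:
  assumes g: "integrable M g"
  shows "\<psi> (conv unit_fun g) = \<psi> g"
proof -
  have "(\<integral>y. unit_fun y * complex_of_real (\<epsilon> (y \<otimes> x)) \<partial>M) = complex_of_real (\<epsilon> x)"
    if x: "x \<in> carrier G" for x
  proof -
    have "(\<integral>y. unit_fun y * complex_of_real (\<epsilon> (y \<otimes> x)) \<partial>M) = (\<integral>y. unit_fun y * complex_of_real (\<epsilon> x) \<partial>M)"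
      using x by (intro Bochner_Integration.integral_cong[OF refl]) (auto simp: indicator_def \<epsilon>_left)
    also have "\<dots> = complex_of_real (\<epsilon> x)"
      using \<Gamma> indicator_complex(2)[OF \<Gamma>(2)] by (simp add: measure_def)
    finally show ?thesis .
  qed
  then show ?thesis
    unfolding \<psi>_conv[OF unit_integrable g] unfolding \<psi>_def
    by (intro Bochner_Integration.integral_cong[OF refl]) (simp add: space_M)
qed

lemma conv_indicator_subgroup:
  assumes K: "subgroup K G" "K \<in> sets M" "emeasure M K \<noteq> \<infinity>" and x: "x \<in> carrier G"
  shows "conv (indicator K) (indicator K) x = complex_of_real (measure M K) * indicator K x"
proof -
  have "indicator K y * indicator K (inv y \<otimes> x) = (indicator K x * indicator K y :: complex)"
    if y: "y \<in> carrier G" for y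
  proof (cases "y \<in> K")
    case True
    then have "inv y \<otimes> x \<in> K \<longleftrightarrow> x \<in> K"
      using K x by (simp add: subgroup_mult_iff subgroup.m_inv_closed)
    then show ?thesis using True by (simp add: indicator_def)
  qed simp
  then have "conv (indicator K) (indicator K) x = (\<integral>y. indicator K x * indicator K y \<partial>M)"
    unfolding convolution_def by (intro Bochner_Integration.integral_cong[OF refl]) (simp add: space_M)
  also have "\<dots> = complex_of_real (measure M K) * indicator K x"
    using indicator_complex(2)[OF K(2,3)] by simp
  finally show ?thesis .
qed

text \<open>The convolution integrals themselves serve as representative: they are bi-invariant at
  every point and not merely almost everywhere, so later translations meet no null sets.\<close>

lemma corner_representative:
  assumes "F \<in> carrier (hecke_L1 G \<Gamma> \<mu>)"
  obtains f where "integrable M f" "F = cls f"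
    "\<And>x k. x \<in> carrier G \<Longrightarrow> k \<in> \<Gamma> \<Longrightarrow> f (x \<otimes> k) = f x"
    "\<And>x k. x \<in> carrier G \<Longrightarrow> k \<in> \<Gamma> \<Longrightarrow> f (k \<otimes> x) = f x"
proof -
  obtain h where h: "integrable M h"
    "F = smult (L1_algebra G \<mu>) (smult (L1_algebra G \<mu>) (cls unit_fun) (cls h)) (cls unit_fun)"
    using assms by (auto simp: hecke_L1_def corner_def hecke_proj_def L1_carrier)
  have [measurable]: "h \<in> borel_measurable M" using h by auto
  define g where "g = conv unit_fun h"
  define f where "f = conv g unit_fun"
  have g: "integrable M g" unfolding g_def by (intro conv_integrable unit_integrable h)
  then have f: "integrable M f" unfolding f_def by (intro conv_integrable unit_integrable)
  have [measurable]: "g \<in> borel_measurable M" using g by auto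
  have ind: "indicator \<Gamma> (x \<otimes> k) = (indicator \<Gamma> x :: complex)" "indicator \<Gamma> (k \<otimes> x) = (indicator \<Gamma> x :: complex)"
    if "x \<in> carrier G" "k \<in> \<Gamma>" for x k
    using that \<Gamma>(1) by (simp_all add: indicator_def subgroup_mult_iff)
  have \<Gamma>_meas [measurable]: "\<Gamma> \<in> sets M" by (rule \<Gamma>(2))
  have left: "conv u v (k \<otimes> x) = conv u v x"
    if u: "\<And>y. y \<in> carrier G \<Longrightarrow> u (k \<otimes> y) = u y" and k: "k \<in> \<Gamma>" and x: "x \<in> carrier G"
      and [measurable]: "u \<in> borel_measurable M" "v \<in> borel_measurable M" for u v k x
  proof -
    have kc: "k \<in> carrier G" using k by (rule \<Gamma>_carrier)
    have "(\<lambda>y. u y * v (inv y \<otimes> (k \<otimes> x))) \<in> borel_measurable M" using x kc by measurable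
    from integral_left[OF this kc]
    have "conv u v (k \<otimes> x) = (\<integral>y. u (k \<otimes> y) * v (inv (k \<otimes> y) \<otimes> (k \<otimes> x)) \<partial>M)"
      unfolding convolution_def by simp
    also have "\<dots> = conv u v x"
      unfolding convolution_def
    proof (rule Bochner_Integration.integral_cong[OF refl])
      fix y assume "y \<in> space M"
      then have y: "y \<in> carrier G" by (simp add: space_M)
      have "inv (k \<otimes> y) \<otimes> (k \<otimes> x) = inv y \<otimes> (inv k \<otimes> k) \<otimes> x"
        using x y kc by (simp only: inv_mult_group m_assoc inv_closed m_closed)
      also have "\<dots> = inv y \<otimes> x" using x y kc by simp
      finally show "u (k \<otimes> y) * v (inv (k \<otimes> y) \<otimes> (k \<otimes> x)) = u y * v (inv y \<otimes> x)"
        using u y by simp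
    qed
    finally show ?thesis .
  qed
  have unit_m: "unit_fun \<in> borel_measurable M" by measurable
  show thesis
  proof (rule that[OF f])
    show "F = cls f" using h g by (simp add: L1_mult unit_integrable conv_integrable f_def g_def)
    fix x k assume x: "x \<in> carrier G" and k: "k \<in> \<Gamma>"
    show "f (x \<otimes> k) = f x"
      unfolding f_def convolution_def
      using x k by (intro Bochner_Integration.integral_cong[OF refl]) (simp add: space_M ind \<Gamma>_carrier flip: m_assoc)
    have "g (k \<otimes> y) = g y" if "y \<in> carrier G" for y
      unfolding g_def using that k by (intro left unit_m) (auto simp: ind)
    then show "f (k \<otimes> x) = f x"
      unfolding f_def using x k by (intro left unit_m) auto
  qed
qed

theorem not_star_iso:
  "\<not> star_iso (env_cstar (hecke_L1 G \<Gamma> \<mu>)) (cstar_corner G \<Gamma> \<mu>) (canonical_surjection G \<Gamma> \<mu>)"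
proof -
  let ?A = "L1_algebra G \<mu>"
  interpret L1: banach_star_alg ?A L1_norm by (rule L1_banach)
  define p where "p = cls unit_fun"
  define m where "m = measure M \<Gamma>'"
  have m: "0 < m" using \<Gamma>' by (simp add: m_def zero_less_measure_iff emeasure_eq_ennreal_measure top.not_eq_extremum)
  define e where "e = cls (\<lambda>x. complex_of_real (1 / m) * indicator \<Gamma>' x)"
  have \<Gamma>'_int: "integrable M (indicator \<Gamma>' :: 'g \<Rightarrow> complex)"
    using \<Gamma>' by (intro indicator_complex)
  then have e_int: "integrable M (\<lambda>x. complex_of_real (1 / m) * indicator \<Gamma>' x)" by (rule integrable_mult_right)
  have star_ind: "AE x in M. cnj (indicator K (inv x)) = (indicator K x :: complex)" if "subgroup K G" for K
  proof -
    have "inv x \<in> K \<longleftrightarrow> x \<in> K" if "x \<in> carrier G" for x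
      using that \<open>subgroup K G\<close> by (metis inv_inv subgroup.m_inv_closed)
    note inv_iff = this
    show ?thesis using AE_space by eventually_elim (simp add: space_M indicator_def inv_iff)
  qed
  have p: "p \<in> carrier ?A" "smult ?A p p = p" "sstar ?A p = p"
  proof -
    show "p \<in> carrier ?A" using unit_integrable L1_carrier p_def by blast
    have "AE x in M. conv unit_fun unit_fun x = unit_fun x"
      using AE_space by eventually_elim
        (use conv_indicator_subgroup[OF \<Gamma>(1,2)] \<Gamma>(3) in \<open>simp add: space_M measure_def\<close>)
    then show "smult ?A p p = p"
      unfolding p_def using unit_integrable by (simp add: L1_mult L1_class_eq_iff conv_integrable)
    show "sstar ?A p = p"
      unfolding p_def using unit_integrable star_ind[OF \<Gamma>(1)] integrable_inv[OF unit_integrable]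
      by (simp add: L1_star L1_class_eq_iff)
  qed
  have e: "e \<in> carrier ?A" "smult ?A e e = e" "sstar ?A e = e"
  proof -
    let ?i = "indicator \<Gamma>' :: 'g \<Rightarrow> complex"
    have ee: "e = sscale ?A (complex_of_real (1 / m)) (cls ?i)"
      unfolding e_def using \<Gamma>'_int by (simp add: L1_scale)
    have i: "cls ?i \<in> carrier ?A" using \<Gamma>'_int L1_carrier by blast
    have "AE x in M. conv ?i ?i x = complex_of_real m * ?i x"
      using AE_space by eventually_elim (simp add: conv_indicator_subgroup[OF \<Gamma>'(1,2,4)] space_M m_def)
    then have ii: "smult ?A (cls ?i) (cls ?i) = sscale ?A (complex_of_real m) (cls ?i)"
      using \<Gamma>'_int by (simp add: L1_mult L1_scale L1_class_eq_iff conv_integrable)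
    have si: "sstar ?A (cls ?i) = cls ?i"
      using \<Gamma>'_int star_ind[OF \<Gamma>'(1)] integrable_inv[OF \<Gamma>'_int] by (simp add: L1_star L1_class_eq_iff)
    show "e \<in> carrier ?A" "smult ?A e e = e" "sstar ?A e = e"
      unfolding ee using i m
      by (simp_all add: L1.scale_mult L1.mult_scale L1.scale_scale L1.star_scale ii si)
  qed
  define X where "X = (\<lambda>F. \<integral>x. L1_rep F x * complex_of_real (\<epsilon> x) \<partial>\<mu>)"
  have X: "X (cls f) = \<psi> f" if f: "integrable M f" for f
  proof -
    have m: "(\<lambda>x. f x * complex_of_real (\<epsilon> x)) \<in> borel_measurable M" using f by auto
    have "AE x in M. L1_rep (cls f) x * complex_of_real (\<epsilon> x) = f x * complex_of_real (\<epsilon> x)"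
      using L1_rep_class(2)[OF f] by eventually_elim simp
    then have "X (cls f) = (\<integral>x. f x * complex_of_real (\<epsilon> x) \<partial>\<mu>)"
      unfolding X_def using L1_rep_class(1)[OF f] measurable_\<mu>[OF \<epsilon>_measurable] measurable_\<mu>[OF m]
      by (intro integral_cong_AE) (auto simp: AE_\<mu>)
    then show ?thesis unfolding \<psi>_def integral_\<mu>[OF m] .
  qed
  have \<psi>_int: "integrable M (\<lambda>x. f x * complex_of_real (\<epsilon> x))" if "integrable M f" for f
    using integrable_bounded_mult[OF that \<epsilon>_measurable] \<epsilon>_bound by blast
  have H: "hecke_L1 G \<Gamma> \<mu> = corner ?A p" by (simp add: hecke_L1_def p_def hecke_proj_def)
  note cr = corner_representative[unfolded H]
  \<comment> \<open>After the outer p is dropped, \<open>\<psi>_conv\<close> expresses the value on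
    ep as 1 / m times the integral assumed to be negative.\<close>
  have neg: "\<exists>t>0. X (smult ?A (smult ?A p e) p) = complex_of_real (- t)"
  proof -
    let ?e = "\<lambda>x. complex_of_real (1 / m) * indicator \<Gamma>' x"
    let ?J = "\<integral>x. indicator \<Gamma> x * (\<integral>y. indicator \<Gamma>' y * \<epsilon> (y \<otimes> x) \<partial>M) \<partial>M"
    have "X (smult ?A (smult ?A p e) p) = X (smult ?A p (smult ?A e p))"
      using p e by (simp add: L1.mult_assoc)
    also have "\<dots> = \<psi> (conv unit_fun (conv ?e unit_fun))"
      unfolding p_def e_def by (simp only: L1_mult unit_integrable e_int conv_integrable X)
    also have "\<dots> = \<psi> (conv ?e unit_fun)"
      by (intro \<psi>_unit_conv conv_integrable e_int unit_integrable)
    also have "\<dots> = (\<integral>x. unit_fun x * (\<integral>y. ?e y * complex_of_real (\<epsilon> (y \<otimes> x)) \<partial>M) \<partial>M)"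
      by (rule \<psi>_conv[OF e_int unit_integrable])
    also have "\<dots> = (\<integral>x. complex_of_real (1 / m * (indicator \<Gamma> x * (\<integral>y. indicator \<Gamma>' y * \<epsilon> (y \<otimes> x) \<partial>M))) \<partial>M)"
    proof (rule Bochner_Integration.integral_cong[OF refl])
      fix x
      have "(\<integral>y. ?e y * complex_of_real (\<epsilon> (y \<otimes> x)) \<partial>M)
        = (\<integral>y. complex_of_real (1 / m * (indicator \<Gamma>' y * \<epsilon> (y \<otimes> x))) \<partial>M)"
        by (intro Bochner_Integration.integral_cong[OF refl]) (simp add: indicator_def)
      also have "\<dots> = complex_of_real (1 / m * (\<integral>y. indicator \<Gamma>' y * \<epsilon> (y \<otimes> x) \<partial>M))"
        by (simp only: integral_complex_of_real integral_mult_right_zero)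
      finally show "unit_fun x * (\<integral>y. ?e y * complex_of_real (\<epsilon> (y \<otimes> x)) \<partial>M) =
        complex_of_real (1 / m * (indicator \<Gamma> x * (\<integral>y. indicator \<Gamma>' y * \<epsilon> (y \<otimes> x) \<partial>M)))"
        by (simp add: indicator_def)
    qed
    also have "\<dots> = complex_of_real (- (- ?J / m))"
      by (simp only: integral_complex_of_real integral_mult_right_zero) simp
    finally show ?thesis using negative m by (intro exI[of _ "- ?J / m"]) (simp add: divide_neg_pos)
  qed
  then obtain t where t: "X (smult ?A (smult ?A p e) p) = complex_of_real (- t)" "0 < t" by blast
  have "\<not> star_iso (env_cstar (corner ?A p)) (corner (env_cstar ?A) (env_embed ?A p)) (env_incl (corner ?A p) ?A)"
  proof (rule L1.corner_envelope_not_iso[where \<psi> = X, OF p e _ _ _ _ _ t])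
    fix F K assume F: "F \<in> carrier (corner ?A p)" and K: "K \<in> carrier (corner ?A p)"
    obtain f where f: "integrable M f" "F = cls f" "\<And>x k. x \<in> carrier G \<Longrightarrow> k \<in> \<Gamma> \<Longrightarrow> f (x \<otimes> k) = f x"
      by (rule cr[OF F]) (rule that)
    obtain k where k: "integrable M k" "K = cls k" by (rule cr[OF K]) (rule that)
    show "X (sadd ?A F K) = X F + X K"
      unfolding f(2) k(2) using f(1) k(1) \<psi>_int
      by (simp add: L1_add X) (simp add: \<psi>_def distrib_right)
    show "X (smult ?A F K) = X F * X K"
      unfolding f(2) k(2) using f(1) k(1) \<psi>_conv_mult[OF f(1) k(1) f(3)]
      by (simp add: L1_mult X conv_integrable)
  next
    fix F assume F: "F \<in> carrier (corner ?A p)"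
    obtain f where f: "integrable M f" "F = cls f" and
      inv: "\<And>x k. x \<in> carrier G \<Longrightarrow> k \<in> \<Gamma> \<Longrightarrow> f (x \<otimes> k) = f x"
        "\<And>x k. x \<in> carrier G \<Longrightarrow> k \<in> \<Gamma> \<Longrightarrow> f (k \<otimes> x) = f x"
      by (rule cr[OF F]) (rule that)
    show "X (sscale ?A c F) = c * X F" for c
      unfolding f(2) using f(1) by (simp add: L1_scale X) (simp add: \<psi>_def mult.assoc)
    \<comment> \<open>Bi-invariance together with x^(-1) in \<Gamma> x \<Gamma> makes f symmetric;
      as \<epsilon> is real, the character respects the star.\<close>
    have sym: "f (inv x) = f x" if x: "x \<in> carrier G" for x
    proof -
      obtain k1 k2 where k: "k1 \<in> \<Gamma>" "k2 \<in> \<Gamma>" "inv x = k1 \<otimes> x \<otimes> k2" using gelfand[OF x] by blast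
      then show ?thesis using x inv \<Gamma>_carrier by simp
    qed
    have "X (sstar ?A F) = \<psi> (\<lambda>x. cnj (f (inv x)))"
      unfolding f(2) using f(1) integrable_inv[OF f(1)] by (simp add: L1_star X)
    also have "\<dots> = (\<integral>x. cnj (f x * complex_of_real (\<epsilon> x)) \<partial>M)"
      unfolding \<psi>_def by (intro Bochner_Integration.integral_cong[OF refl]) (simp add: space_M sym)
    also have "\<dots> = cnj (X F)" unfolding f(2) using f(1) by (simp only: Bochner_Integration.integral_cnj X \<psi>_def)
    finally show "X (sstar ?A F) = cnj (X F)" .
  next
    have "X p = \<psi> unit_fun" unfolding p_def by (rule X[OF unit_integrable])
    also have "\<dots> = (\<integral>x. unit_fun x \<partial>M)"
      unfolding \<psi>_def
    proof (rule Bochner_Integration.integral_cong[OF refl])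
      fix x assume "x \<in> space M"
      then show "unit_fun x * complex_of_real (\<epsilon> x) = unit_fun x"
        using \<epsilon>_left[of x "\<one>"] \<epsilon>_one \<Gamma>_carrier by (cases "x \<in> \<Gamma>") auto
    qed
    also have "\<dots> = 1" using \<Gamma> indicator_complex(2)[OF \<Gamma>(2)] by (simp add: measure_def)
    finally show "X p = 1" .
  qed
  then show ?thesis
    by (simp add: H cstar_corner_def canonical_surjection_def group_cstar_def p_def hecke_proj_def)
qed

end

section \<open>The \<open>q\<close>-adic absolute value\<close>

text \<open>Frees the definition from lowest terms: cross multiplication gives the same difference
  of multiplicities for every fraction.\<close>

lemma padic_abs_frac:
  assumes q: "prime q" and ab: "a \<noteq> 0" "b \<noteq> 0"
  shows "padic_abs q (of_int a / of_int b)
    = real q powi (int (multiplicity (int q) b) - int (multiplicity (int q) a))"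
proof -
  let ?x = "of_int a / of_int b :: rat"
  obtain n d where nd: "quotient_of ?x = (n, d)" by (cases "quotient_of ?x")
  have d: "d > 0" using quotient_of_denom_pos[OF nd] .
  have x: "?x = of_int n / of_int d" using quotient_of_div[OF nd] .
  then have "(of_int a * of_int d :: rat) = of_int n * of_int b" using ab d by (simp add: field_simps)
  then have e: "a * d = n * b" by (metis of_int_eq_iff of_int_mult)
  have n: "n \<noteq> 0" using e ab d by auto
  have p: "prime_elem (int q)" using q by simp
  have "multiplicity (int q) (a * d) = multiplicity (int q) (n * b)" using e by simp
  then have "multiplicity (int q) a + multiplicity (int q) d = multiplicity (int q) n + multiplicity (int q) b"
    using p ab d n by (simp add: prime_elem_multiplicity_mult_distrib)
  then have "int (multiplicity (int q) d) - int (multiplicity (int q) n)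
      = int (multiplicity (int q) b) - int (multiplicity (int q) a)" by simp
  then show ?thesis using ab nd by (simp add: padic_abs_def)
qed

lemma rat_frac:
  obtains a b :: int where "(x::rat) = of_int a / of_int b" "b \<noteq> 0"
proof -
  obtain n d where "quotient_of x = (n, d)" by (cases "quotient_of x")
  then show thesis using that[of n d] quotient_of_div quotient_of_denom_pos by fastforce
qed

lemma padic_abs_zero [simp]: "padic_abs q 0 = 0"
  by (simp add: padic_abs_def)

lemma padic_abs_powi:
  assumes "x \<noteq> 0"
  obtains k :: int where "padic_abs q x = real q powi k"
  using assms by (simp add: padic_abs_def)

lemma padic_abs_pos:
  assumes "prime q" "x \<noteq> 0"
  shows "0 < padic_abs q x"
  using assms prime_gt_0_nat by (simp add: padic_abs_def zero_less_power_int)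

lemma padic_abs_nonneg: "prime q \<Longrightarrow> 0 \<le> padic_abs q x"
  using padic_abs_pos[of q x] by (cases "x = 0") auto

lemma padic_abs_eq_0: "prime q \<Longrightarrow> padic_abs q x = 0 \<longleftrightarrow> x = 0"
  using padic_abs_pos[of q x] by (cases "x = 0") auto

lemma padic_abs_mult:
  assumes q: "prime q"
  shows "padic_abs q (x * y) = padic_abs q x * padic_abs q y"
proof (cases "x = 0 \<or> y = 0")
  case False
  obtain a b where x: "x = of_int a / of_int b" "b \<noteq> 0" by (rule rat_frac)
  obtain c d where y: "y = of_int c / of_int d" "d \<noteq> 0" by (rule rat_frac)
  have ac: "a \<noteq> 0" "c \<noteq> 0" using False x y by auto
  have p: "prime_elem (int q)" using q by simp
  have q0: "real q \<noteq> 0" using q by auto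
  have "x * y = of_int (a * c) / of_int (b * d)" using x y by simp
  then have "padic_abs q (x * y) = real q powi (int (multiplicity (int q) (b * d)) - int (multiplicity (int q) (a * c)))"
    using padic_abs_frac[OF q, of "a * c" "b * d"] ac x y by simp
  also have "\<dots> = real q powi ((int (multiplicity (int q) b) - int (multiplicity (int q) a))
     + (int (multiplicity (int q) d) - int (multiplicity (int q) c)))"
    using ac x y p by (simp add: prime_elem_multiplicity_mult_distrib algebra_simps)
  also have "\<dots> = padic_abs q x * padic_abs q y"
    using padic_abs_frac[OF q, of a b] padic_abs_frac[OF q, of c d] ac x y q0 by (simp add: power_int_add)
  finally show ?thesis .
qed auto

lemma padic_abs_one: "prime q \<Longrightarrow> padic_abs q 1 = 1"
  using padic_abs_frac[of q 1 1] by simp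

lemma padic_abs_minus: "prime q \<Longrightarrow> padic_abs q (- x) = padic_abs q x"
proof -
  assume q: "prime q"
  have "padic_abs q (-1) * padic_abs q (-1) = 1"
    using padic_abs_mult[OF q, of "-1" "-1"] padic_abs_one[OF q] by simp
  then have "padic_abs q (-1) = 1" using padic_abs_nonneg[OF q, of "-1"] by (simp add: square_eq_1_iff)
  then show ?thesis using padic_abs_mult[OF q, of "-1" x] by simp
qed

lemma padic_abs_inverse:
  assumes q: "prime q"
  shows "padic_abs q (inverse x) = inverse (padic_abs q x)"
proof (cases "x = 0")
  case False
  then have "padic_abs q x * padic_abs q (inverse x) = 1"
    using padic_abs_mult[OF q, of x "inverse x"] padic_abs_one[OF q] by simp
  then show ?thesis by (simp add: inverse_unique)
qed simp

lemma padic_abs_prime: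
  assumes q: "prime q"
  shows "padic_abs q (of_nat q) = 1 / real q"
proof -
  have "multiplicity (int q) (int q) = 1" using q by (intro multiplicity_self) auto
  then show ?thesis
    using padic_abs_frac[OF q, of "int q" 1] prime_gt_0_nat[OF q]
    by (simp add: power_int_minus inverse_eq_divide)
qed

text \<open>Over a common denominator the claim becomes that a power of q dividing both numerators
  divides their sum.\<close>

lemma padic_abs_add:
  assumes q: "prime q"
  shows "padic_abs q (x + y) \<le> max (padic_abs q x) (padic_abs q y)"
proof -
  have *: "padic_abs q (x + y) \<le> padic_abs q y"
    if xy: "x \<noteq> 0" "y \<noteq> 0" "x + y \<noteq> 0" "padic_abs q x \<le> padic_abs q y" for x y
  proof -
    obtain a0 b where x: "x = of_int a0 / of_int b" "b \<noteq> 0" by (rule rat_frac)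
    obtain c0 d where y: "y = of_int c0 / of_int d" "d \<noteq> 0" by (rule rat_frac)
    define a c n where "a = a0 * d" and "c = c0 * b" and "n = b * d"
    have n: "n \<noteq> 0" and xa: "x = of_int a / of_int n" and yc: "y = of_int c / of_int n"
      and s: "x + y = of_int (a + c) / of_int n"
      using x y by (simp_all add: a_def c_def n_def field_simps)
    have ac: "a \<noteq> 0" "c \<noteq> 0" "a + c \<noteq> 0" using xy xa yc s n by auto
    have q1: "1 < real q" using prime_gt_1_nat[OF q] by simp
    have le: "multiplicity (int q) c \<le> multiplicity (int q) a"
    proof (rule ccontr)
      assume "\<not> ?thesis"
      then have "padic_abs q y < padic_abs q x"
        unfolding xa yc padic_abs_frac[OF q ac(1) n] padic_abs_frac[OF q ac(2) n]
        using q1 by (intro power_int_strict_increasing) auto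
      then show False using xy(4) by simp
    qed
    have "int q ^ multiplicity (int q) c dvd a + c"
      using le by (intro dvd_add multiplicity_dvd multiplicity_dvd') auto
    then have "multiplicity (int q) c \<le> multiplicity (int q) (a + c)"
      using ac q by (intro multiplicity_geI) auto
    moreover have "padic_abs q (x + y) = real q powi (int (multiplicity (int q) n) - int (multiplicity (int q) (a + c)))"
      unfolding s by (rule padic_abs_frac[OF q ac(3) n])
    moreover have "padic_abs q y = real q powi (int (multiplicity (int q) n) - int (multiplicity (int q) c))"
      unfolding yc by (rule padic_abs_frac[OF q ac(2) n])
    ultimately show ?thesis using q1 by (simp add: power_int_increasing)
  qed
  show ?thesis
  proof (cases "x = 0 \<or> y = 0 \<or> x + y = 0")
    case True
    then show ?thesis using padic_abs_nonneg[OF q] by (auto simp: le_max_iff_disj)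
  next
    case False
    then show ?thesis using *[of x y] *[of y x] by (cases "padic_abs q x \<le> padic_abs q y") (auto simp: add.commute)
  qed
qed

lemma padic_abs_diff:
  assumes q: "prime q"
  shows "\<bar>padic_abs q x - padic_abs q y\<bar> \<le> padic_abs q (x - y)"
proof -
  have "padic_abs q x \<le> padic_abs q (x - y) + padic_abs q y" for x y
    using padic_abs_add[OF q, of "x - y" y] padic_abs_nonneg[OF q, of y] padic_abs_nonneg[OF q, of "x - y"] by simp
  from this[of x y] this[of y x] show ?thesis using padic_abs_minus[OF q, of "x - y"] by simp
qed

section \<open>The field of \<open>q\<close>-adic numbers\<close>

locale padic =
  fixes q :: nat
  assumes q: "prime q"
begin

abbreviation av :: "rat \<Rightarrow> real" where "av \<equiv> padic_abs q"
abbreviation CR :: "(nat \<Rightarrow> rat) ring" where "CR \<equiv> padic_cauchy_ring q"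

lemma q_gt_1: "1 < real q" using prime_gt_1_nat[OF q] by simp

lemmas av_simps [simp] = padic_abs_nonneg[OF q] padic_abs_eq_0[OF q] padic_abs_mult[OF q] padic_abs_one[OF q]
  padic_abs_minus[OF q] padic_abs_inverse[OF q]

lemma CR_simps [simp]: "carrier CR = padic_cauchy q" "mult CR s t = (\<lambda>n. s n * t n)"
  "one CR = (\<lambda>n. 1)" "zero CR = (\<lambda>n. 0)" "add CR s t = (\<lambda>n. s n + t n)"
  by (simp_all add: padic_cauchy_ring_def)

lemma cauchyD:
  "s \<in> padic_cauchy q \<Longrightarrow> 0 < e \<Longrightarrow> \<exists>N. \<forall>m\<ge>N. \<forall>n\<ge>N. av (s m - s n) < e"
  by (simp add: padic_cauchy_def)

lemma cauchy_bounded: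
  assumes "s \<in> padic_cauchy q"
  obtains B N where "0 < B" "\<And>n. n \<ge> N \<Longrightarrow> av (s n) \<le> B"
proof -
  obtain N where N: "\<And>m n. m \<ge> N \<Longrightarrow> n \<ge> N \<Longrightarrow> av (s m - s n) < 1"
    using cauchyD[OF assms zero_less_one] by blast
  show thesis
  proof (rule that[of "1 + av (s N)" N])
    show "0 < 1 + av (s N)" by (simp add: add_pos_nonneg)
    show "av (s n) \<le> 1 + av (s N)" if "n \<ge> N" for n
      using N[OF that order_refl] padic_abs_diff[OF q, of "s n" "s N"] by simp
  qed
qed

lemma cauchy_const [simp]: "(\<lambda>n. r) \<in> padic_cauchy q"
  by (simp add: padic_cauchy_def)

lemma cauchy_add [simp]:
  assumes s: "s \<in> padic_cauchy q" and t: "t \<in> padic_cauchy q"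
  shows "(\<lambda>n. s n + t n) \<in> padic_cauchy q"
  unfolding padic_cauchy_def
proof (intro CollectI allI impI)
  fix e :: real assume e: "0 < e"
  obtain M where M: "\<forall>m\<ge>M. \<forall>n\<ge>M. av (s m - s n) < e" using cauchyD[OF s e] by blast
  obtain N where N: "\<forall>m\<ge>N. \<forall>n\<ge>N. av (t m - t n) < e" using cauchyD[OF t e] by blast
  have "av (s m + t m - (s n + t n)) < e" if "m \<ge> max M N" "n \<ge> max M N" for m n
  proof -
    have "av (s m + t m - (s n + t n)) \<le> max (av (s m - s n)) (av (t m - t n))"
      using padic_abs_add[OF q, of "s m - s n" "t m - t n"] by (simp add: algebra_simps)
    also have "\<dots> < e" using M N that by simp
    finally show ?thesis .
  qed
  then show "\<exists>N. \<forall>m\<ge>N. \<forall>n\<ge>N. av (s m + t m - (s n + t n)) < e" by blast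
qed

lemma cauchy_mult [simp]:
  assumes s: "s \<in> padic_cauchy q" and t: "t \<in> padic_cauchy q"
  shows "(\<lambda>n. s n * t n) \<in> padic_cauchy q"
  unfolding padic_cauchy_def
proof (intro CollectI allI impI)
  fix e :: real assume e: "0 < e"
  obtain B M1 where B: "0 < B" "\<And>n. n \<ge> M1 \<Longrightarrow> av (s n) \<le> B" by (rule cauchy_bounded[OF s]) (rule that)
  obtain C N1 where C: "0 < C" "\<And>n. n \<ge> N1 \<Longrightarrow> av (t n) \<le> C" by (rule cauchy_bounded[OF t]) (rule that)
  obtain M where M: "\<forall>m\<ge>M. \<forall>n\<ge>M. av (s m - s n) < e / C" using cauchyD[OF s, of "e / C"] e C by auto
  obtain N where N: "\<forall>m\<ge>N. \<forall>n\<ge>N. av (t m - t n) < e / B" using cauchyD[OF t, of "e / B"] e B by auto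
  define K where "K = max (max M N) (max M1 N1)"
  have "av (s m * t m - s n * t n) < e" if mn: "m \<ge> K" "n \<ge> K" for m n
  proof -
    have "av (s m * t m - s n * t n) \<le> max (av (s m * (t m - t n))) (av ((s m - s n) * t n))"
      using padic_abs_add[OF q, of "s m * (t m - t n)" "(s m - s n) * t n"] by (simp add: algebra_simps)
    also have "\<dots> < e"
    proof -
      have "av (s m) * av (t m - t n) \<le> B * av (t m - t n)" using B mn by (intro mult_right_mono) (auto simp: K_def)
      also have "\<dots> < B * (e / B)" using N mn B by (intro mult_strict_left_mono) (auto simp: K_def)
      finally have 1: "av (s m) * av (t m - t n) < e" using B by simp
      have "av (s m - s n) * av (t n) \<le> av (s m - s n) * C" using C mn by (intro mult_left_mono) (auto simp: K_def)
      also have "\<dots> < e / C * C" using M mn C by (intro mult_strict_right_mono) (auto simp: K_def)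
      finally have "av (s m - s n) * av (t n) < e" using C by simp
      with 1 show ?thesis by simp
    qed
    finally show ?thesis .
  qed
  then show "\<exists>N. \<forall>m\<ge>N. \<forall>n\<ge>N. av (s m * t m - s n * t n) < e" by blast
qed

lemma cauchy_uminus [simp]: "s \<in> padic_cauchy q \<Longrightarrow> (\<lambda>n. - s n) \<in> padic_cauchy q"
  using cauchy_mult[OF cauchy_const[of "-1"]] by simp

lemma CR_cring: "cring CR"
proof (rule cringI)
  show "abelian_group CR"
    by (rule abelian_groupI) (auto simp: add.assoc add.commute intro!: bexI[of _ "\<lambda>n. - _ n"])
  show "Group.comm_monoid CR"
    by (rule comm_monoidI) (auto simp: mult.assoc mult.commute)
qed (auto simp: distrib_right)

sublocale CR: cring CR by (rule CR_cring)

lemma CR_uminus: "s \<in> padic_cauchy q \<Longrightarrow> a_inv CR s = (\<lambda>n. - s n)"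
  by (rule CR.minus_equality) simp_all

lemma null_cauchy:
  assumes "s \<in> padic_null q"
  shows "s \<in> padic_cauchy q"
  unfolding padic_cauchy_def
proof (intro CollectI allI impI)
  fix e :: real assume "0 < e"
  then obtain N where N: "\<And>n. n \<ge> N \<Longrightarrow> av (s n) < e"
    using assms LIMSEQ_D[of "\<lambda>n. av (s n)" 0 e] by (auto simp: padic_null_def)
  have "av (s m - s n) < e" if "m \<ge> N" "n \<ge> N" for m n
    using padic_abs_add[OF q, of "s m" "- s n"] N[OF that(1)] N[OF that(2)] by simp
  then show "\<exists>N. \<forall>m\<ge>N. \<forall>n\<ge>N. av (s m - s n) < e" by blast
qed

lemma null_mult:
  assumes s: "s \<in> padic_null q" and t: "t \<in> padic_cauchy q"
  shows "(\<lambda>n. t n * s n) \<in> padic_null q"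
proof -
  obtain C N where C: "0 < C" "\<And>n. n \<ge> N \<Longrightarrow> av (t n) \<le> C" by (rule cauchy_bounded[OF t]) (rule that)
  have "(\<lambda>n. C * av (s n)) \<longlonglongrightarrow> 0" using s tendsto_mult_left[of "\<lambda>n. av (s n)" 0 sequentially C] by (simp add: padic_null_def)
  then have "(\<lambda>n. av (t n * s n)) \<longlonglongrightarrow> 0"
    by (rule tendsto_sandwich[OF _ _ tendsto_const, rotated 2])
      (use C in \<open>auto intro!: eventually_sequentiallyI[of N] mult_right_mono\<close>)
  then show ?thesis by (simp add: padic_null_def)
qed

lemma null_ideal: "ideal (padic_null q) CR"
proof (rule idealI)
  show "subgroup (padic_null q) (add_monoid CR)"
  proof (rule group.subgroupI)
    show "group (add_monoid CR)" by (rule CR.a_group)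
    show "padic_null q \<subseteq> carrier (add_monoid CR)" using null_cauchy by auto
    show "padic_null q \<noteq> {}" by (auto simp: padic_null_def intro!: exI[of _ "\<lambda>n. 0"])
    fix s assume s: "s \<in> padic_null q"
    then have "inv\<^bsub>add_monoid CR\<^esub> s = (\<lambda>n. - s n)"
      using CR_uminus[OF null_cauchy[OF s]] by (simp add: a_inv_def)
    then show "inv\<^bsub>add_monoid CR\<^esub> s \<in> padic_null q" using s by (simp add: padic_null_def)
    fix t assume t: "t \<in> padic_null q"
    have "(\<lambda>n. av (s n) + av (t n)) \<longlonglongrightarrow> 0"
      using s t tendsto_add[of "\<lambda>n. av (s n)" 0 sequentially "\<lambda>n. av (t n)" 0] by (simp add: padic_null_def)
    moreover have "av (s n + t n) \<le> av (s n) + av (t n)" for n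
      by (rule order_trans[OF padic_abs_add[OF q]]) (simp add: max_def)
    ultimately have "(\<lambda>n. av (s n + t n)) \<longlonglongrightarrow> 0"
      by (intro tendsto_sandwich[of "\<lambda>_. 0" "\<lambda>n. av (s n + t n)" sequentially "\<lambda>n. av (s n) + av (t n)"]) auto
    then show "s \<otimes>\<^bsub>add_monoid CR\<^esub> t \<in> padic_null q" by (simp add: padic_null_def)
  qed
qed (use null_mult in \<open>auto simp: CR.ring_axioms mult.commute\<close>)

sublocale null: ideal "padic_null q" CR by (rule null_ideal)

section \<open>Classes of Cauchy sequences and their absolute value\<close>

definition cls :: "(nat \<Rightarrow> rat) \<Rightarrow> (nat \<Rightarrow> rat) set" where
  "cls s = padic_null q +>\<^bsub>CR\<^esub> s"

lemma Qp_carrier: "x \<in> carrier (Qp q) \<longleftrightarrow> (\<exists>s. s \<in> padic_cauchy q \<and> x = cls s)"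
  by (auto simp: Qp_def FactRing_def A_RCOSETS_def' cls_def)

lemma cls_closed: "s \<in> padic_cauchy q \<Longrightarrow> cls s \<in> carrier (Qp q)"
  using Qp_carrier by blast

lemma cls_hom: "cls \<in> ring_hom CR (Qp q)"
  using null.rcos_ring_hom unfolding cls_def[abs_def] Qp_def .

lemma cls_mult: "s \<in> padic_cauchy q \<Longrightarrow> t \<in> padic_cauchy q \<Longrightarrow> cls s \<otimes>\<^bsub>Qp q\<^esub> cls t = cls (\<lambda>n. s n * t n)"
  using ring_hom_mult[OF cls_hom, of s t] by simp

lemma cls_add: "s \<in> padic_cauchy q \<Longrightarrow> t \<in> padic_cauchy q \<Longrightarrow> cls s \<oplus>\<^bsub>Qp q\<^esub> cls t = cls (\<lambda>n. s n + t n)"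
  using ring_hom_add[OF cls_hom, of s t] by simp

lemma cls_one: "\<one>\<^bsub>Qp q\<^esub> = cls (\<lambda>n. 1)"
  using ring_hom_one[OF cls_hom] by simp

lemma Qp_cring: "cring (Qp q)"
  unfolding Qp_def by (rule null.quotient_is_cring[OF CR_cring])

sublocale Qp: cring "Qp q" by (rule Qp_cring)

lemma cls_zero: "\<zero>\<^bsub>Qp q\<^esub> = cls (\<lambda>n. 0)"
proof -
  have "cls (\<lambda>n. 0) \<oplus>\<^bsub>Qp q\<^esub> cls (\<lambda>n. 0) = cls (\<lambda>n. 0)" by (simp add: cls_add)
  then show ?thesis using Qp_carrier cauchy_const by (metis Qp.add.l_cancel_one)
qed

lemma cls_uminus:
  assumes s: "s \<in> padic_cauchy q"
  shows "\<ominus>\<^bsub>Qp q\<^esub> cls s = cls (\<lambda>n. - s n)"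
  by (rule Qp.minus_equality) (use s in \<open>simp_all add: cls_add cls_zero cls_closed\<close>)

lemma cls_minus:
  "s \<in> padic_cauchy q \<Longrightarrow> t \<in> padic_cauchy q \<Longrightarrow> cls s \<ominus>\<^bsub>Qp q\<^esub> cls t = cls (\<lambda>n. s n - t n)"
  by (simp add: a_minus_def cls_uminus cls_add)

lemma cls_mem: "t \<in> cls s \<Longrightarrow> (\<lambda>n. t n - s n) \<in> padic_null q"
  by (auto simp: cls_def a_r_coset_def')

lemma cls_self: "s \<in> cls s"
proof -
  have "(\<lambda>n. 0) \<in> padic_null q" by (simp add: padic_null_def)
  then show ?thesis by (force simp: cls_def a_r_coset_def')
qed

lemma cls_eq_zero: "s \<in> padic_null q \<Longrightarrow> cls s = \<zero>\<^bsub>Qp q\<^esub>"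
  unfolding cls_def Qp_def using null.a_rcos_const[of s] by (simp add: FactRing_def)

abbreviation qabs :: "(nat \<Rightarrow> rat) set \<Rightarrow> real" where "qabs \<equiv> Qp_abs q"

text \<open>Justifies the definite description in \<open>Qp_abs\<close>: the absolute values
  converge by the triangle inequality, and members of one class differ by null sequences.\<close>

lemma qabs_lim:
  assumes s: "s \<in> padic_cauchy q"
  shows "(\<lambda>n. av (s n)) \<longlonglongrightarrow> qabs (cls s)"
proof -
  have "Cauchy (\<lambda>n. av (s n))"
  proof (rule metric_CauchyI)
    fix e :: real assume "0 < e"
    then obtain N where N: "\<forall>m\<ge>N. \<forall>n\<ge>N. av (s m - s n) < e" using cauchyD[OF s] by blast
    have "dist (av (s m)) (av (s n)) < e" if "m \<ge> N" "n \<ge> N" for m n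
      using N that padic_abs_diff[OF q, of "s m" "s n"] unfolding dist_real_def by fastforce
    then show "\<exists>N. \<forall>m\<ge>N. \<forall>n\<ge>N. dist (av (s m)) (av (s n)) < e" by blast
  qed
  then obtain L where L: "(\<lambda>n. av (s n)) \<longlonglongrightarrow> L" using convergent_eq_Cauchy by blast
  have all: "(\<lambda>n. av (t n)) \<longlonglongrightarrow> L" if t: "t \<in> cls s" for t
  proof -
    have "(\<lambda>n. av (t n - s n)) \<longlonglongrightarrow> 0" using cls_mem[OF t] by (simp add: padic_null_def)
    then have "(\<lambda>n. av (t n) - av (s n)) \<longlonglongrightarrow> 0"
      by (rule Lim_null_comparison[rotated]) (use padic_abs_diff[OF q] in auto)
    from tendsto_add[OF this L] show ?thesis by simp
  qed
  have "qabs (cls s) = L"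
    unfolding Qp_abs_def
  proof (rule the_equality)
    fix r assume "\<forall>t\<in>cls s. (\<lambda>n. av (t n)) \<longlonglongrightarrow> r"
    then show "r = L" using LIMSEQ_unique[OF _ L] cls_self by blast
  qed (use all in blast)
  then show ?thesis using L by simp
qed

lemma qabs_nonneg:
  assumes "x \<in> carrier (Qp q)"
  shows "0 \<le> qabs x"
proof -
  obtain s where s: "s \<in> padic_cauchy q" "x = cls s" using assms Qp_carrier by blast
  show ?thesis unfolding s by (rule LIMSEQ_le_const[OF qabs_lim[OF s(1)]]) simp
qed

lemma qabs_eq_0:
  assumes "x \<in> carrier (Qp q)"
  shows "qabs x = 0 \<longleftrightarrow> x = \<zero>\<^bsub>Qp q\<^esub>"
proof -
  obtain s where s: "s \<in> padic_cauchy q" "x = cls s" using assms Qp_carrier by blast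
  have "x = \<zero>\<^bsub>Qp q\<^esub>" if "qabs x = 0"
    using qabs_lim[OF s(1)] that s by (intro cls_eq_zero[of s, folded s(2)]) (simp add: padic_null_def)
  moreover have "qabs \<zero>\<^bsub>Qp q\<^esub> = 0"
    using LIMSEQ_unique[OF qabs_lim[OF cauchy_const[of 0]]] by (simp add: cls_zero)
  ultimately show ?thesis by blast
qed

lemma qabs_mult:
  assumes "x \<in> carrier (Qp q)" "y \<in> carrier (Qp q)"
  shows "qabs (x \<otimes>\<^bsub>Qp q\<^esub> y) = qabs x * qabs y"
proof -
  obtain s where s: "s \<in> padic_cauchy q" "x = cls s" using assms Qp_carrier by blast
  obtain t where t: "t \<in> padic_cauchy q" "y = cls t" using assms Qp_carrier by blast
  have "(\<lambda>n. av (s n * t n)) \<longlonglongrightarrow> qabs x * qabs y"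
    using tendsto_mult[OF qabs_lim[OF s(1)] qabs_lim[OF t(1)]] s t by simp
  then show ?thesis
    using LIMSEQ_unique[OF qabs_lim[OF cauchy_mult[OF s(1) t(1)]]] s t by (simp add: cls_mult)
qed

lemma qabs_add:
  assumes "x \<in> carrier (Qp q)" "y \<in> carrier (Qp q)"
  shows "qabs (x \<oplus>\<^bsub>Qp q\<^esub> y) \<le> max (qabs x) (qabs y)"
proof -
  obtain s where s: "s \<in> padic_cauchy q" "x = cls s" using assms Qp_carrier by blast
  obtain t where t: "t \<in> padic_cauchy q" "y = cls t" using assms Qp_carrier by blast
  have "qabs (cls (\<lambda>n. s n + t n)) \<le> max (qabs x) (qabs y)"
  proof (rule LIMSEQ_le)
    show "(\<lambda>n. av (s n + t n)) \<longlonglongrightarrow> qabs (cls (\<lambda>n. s n + t n))" by (rule qabs_lim) (simp add: s t)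
    show "(\<lambda>n. max (av (s n)) (av (t n))) \<longlonglongrightarrow> max (qabs x) (qabs y)"
      using tendsto_max[OF qabs_lim[OF s(1)] qabs_lim[OF t(1)]] s t by simp
  qed (use padic_abs_add[OF q] in auto)
  then show ?thesis using s t by (simp add: cls_add)
qed

text \<open>For a nonzero class the ultrametric inequality freezes the absolute value: terms that
  exceed L / 2 and differ by less than L / 2 all have the same size. So the value group stays that
  of the rationals, and the terms are eventually invertible.\<close>

lemma qabs_eventually:
  assumes s: "s \<in> padic_cauchy q" and nz: "cls s \<noteq> \<zero>\<^bsub>Qp q\<^esub>"
  shows "\<exists>N. \<forall>n\<ge>N. av (s n) = qabs (cls s)"
proof -
  define L where "L = qabs (cls s)"
  have x: "cls s \<in> carrier (Qp q)" using s Qp_carrier by blast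
  have L: "0 < L" using qabs_nonneg[OF x] qabs_eq_0[OF x] nz by (simp add: L_def)
  have lim: "(\<lambda>n. av (s n)) \<longlonglongrightarrow> L" using qabs_lim[OF s] by (simp add: L_def)
  obtain M where M: "\<And>n. n \<ge> M \<Longrightarrow> L / 2 < av (s n)"
  proof -
    have "eventually (\<lambda>n. L / 2 < av (s n)) sequentially" using order_tendstoD(1)[OF lim, of "L / 2"] L by simp
    then show thesis using that by (auto simp: eventually_sequentially)
  qed
  obtain N where N: "\<forall>m\<ge>N. \<forall>n\<ge>N. av (s m - s n) < L / 2" using cauchyD[OF s, of "L / 2"] L by auto
  have le: "av (s m) \<le> av (s n)" if "m \<ge> max M N" "n \<ge> max M N" for m n
    using padic_abs_add[OF q, of "s m - s n" "s n"] N[rule_format, of m n] M[of n] that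
    by (simp add: max_def split: if_splits)
  have const: "av (s n) = av (s (max M N))" if "n \<ge> max M N" for n
    using le[of n "max M N"] le[of "max M N" n] that by (simp add: order_antisym)
  have "(\<lambda>n. av (s n)) \<longlonglongrightarrow> av (s (max M N))"
    by (rule tendsto_eventually, rule eventually_sequentiallyI[of "max M N"], rule const)
  then have "av (s (max M N)) = L" using LIMSEQ_unique[OF lim] by simp
  note eq = this
  show ?thesis
  proof (intro exI[of _ "max M N"] allI impI)
    fix n assume "max M N \<le> n"
    then show "av (s n) = qabs (cls s)" using trans[OF const eq] unfolding L_def by blast
  qed
qed

lemma qabs_values:
  assumes "x \<in> carrier (Qp q)" "x \<noteq> \<zero>\<^bsub>Qp q\<^esub>"
  shows "\<exists>k::int. qabs x = real q powi k"
proof -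
  obtain s where s: "s \<in> padic_cauchy q" "x = cls s" using assms Qp_carrier by blast
  obtain N where N: "av (s N) = qabs x" using qabs_eventually[of s] s assms by auto
  have "s N \<noteq> 0" using N qabs_eq_0[OF assms(1)] assms(2) by auto
  then show ?thesis using N padic_abs_powi[of "s N" q] by metis
qed

lemma Qp_one_not_zero: "\<one>\<^bsub>Qp q\<^esub> \<noteq> \<zero>\<^bsub>Qp q\<^esub>"
proof -
  have "qabs \<one>\<^bsub>Qp q\<^esub> = 1"
    using LIMSEQ_unique[OF qabs_lim[OF cauchy_const[of 1]]] by (simp add: cls_one)
  then show ?thesis using qabs_eq_0[OF Qp.zero_closed] by auto
qed

text \<open>Termwise inverses work from N on. Earlier terms may vanish, and the default
  \<open>inverse 0 = 0\<close> is harmless there because classes depend on tails.\<close>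

lemma Qp_inverse:
  assumes "x \<in> carrier (Qp q)" "x \<noteq> \<zero>\<^bsub>Qp q\<^esub>"
  shows "\<exists>y\<in>carrier (Qp q). x \<otimes>\<^bsub>Qp q\<^esub> y = \<one>\<^bsub>Qp q\<^esub>"
proof -
  obtain s where s: "s \<in> padic_cauchy q" "x = cls s" using assms Qp_carrier by blast
  define L where "L = qabs x"
  have L: "0 < L" using qabs_nonneg[OF assms(1)] qabs_eq_0[OF assms(1)] assms(2) by (simp add: L_def)
  obtain N where N: "\<And>n. n \<ge> N \<Longrightarrow> av (s n) = L" using qabs_eventually[of s] s assms by (auto simp: L_def)
  have nz: "s n \<noteq> 0" if "n \<ge> N" for n using N[OF that] L by auto
  define t where "t = (\<lambda>n. inverse (s n))"
  have t: "t \<in> padic_cauchy q"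
    unfolding padic_cauchy_def
  proof (intro CollectI allI impI)
    fix e :: real assume e: "0 < e"
    obtain M where M: "\<forall>m\<ge>M. \<forall>n\<ge>M. av (s m - s n) < e * (L * L)" using cauchyD[OF s(1), of "e * (L * L)"] e L by auto
    have "av (t m - t n) < e" if mn: "m \<ge> max M N" "n \<ge> max M N" for m n
    proof -
      have "t m - t n = (s n - s m) * (inverse (s m) * inverse (s n))"
        unfolding t_def using nz mn by (simp add: field_simps)
      then have "av (t m - t n) = av (s n - s m) * (inverse L * inverse L)"
        using N mn by simp
      also have "\<dots> < e * (L * L) * (inverse L * inverse L)"
        using M mn L by (intro mult_strict_right_mono) auto
      also have "\<dots> = e" using L by (simp add: field_simps)
      finally show ?thesis .
    qed
    then show "\<exists>N. \<forall>m\<ge>N. \<forall>n\<ge>N. av (t m - t n) < e" by blast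
  qed
  have "(\<lambda>n. s n * t n - 1) \<in> padic_null q"
    unfolding padic_null_def
  proof (intro CollectI tendsto_eventually)
    show "\<forall>\<^sub>F n in sequentially. av (s n * t n - 1) = 0"
      by (rule eventually_sequentiallyI[of N]) (use nz in \<open>simp add: t_def\<close>)
  qed
  note null = this
  have ct: "cls t \<in> carrier (Qp q)" using t by (rule cls_closed)
  have "x \<otimes>\<^bsub>Qp q\<^esub> cls t = cls (\<lambda>n. (s n * t n - 1) + 1)" using s t by (simp add: cls_mult)
  also have "\<dots> = cls (\<lambda>n. s n * t n - 1) \<oplus>\<^bsub>Qp q\<^esub> cls (\<lambda>n. 1)"
    by (rule cls_add[OF null_cauchy[OF null] cauchy_const, symmetric])
  also have "\<dots> = \<one>\<^bsub>Qp q\<^esub>" by (simp add: cls_eq_zero[OF null] flip: cls_one)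
  finally have "x \<otimes>\<^bsub>Qp q\<^esub> cls t = \<one>\<^bsub>Qp q\<^esub>" .
  then show ?thesis using ct by blast
qed

lemma Qp_field: "field (Qp q)"
proof (rule Qp.cring_fieldI)
  show "Units (Qp q) = carrier (Qp q) - {\<zero>\<^bsub>Qp q\<^esub>}"
  proof
    show "Units (Qp q) \<subseteq> carrier (Qp q) - {\<zero>\<^bsub>Qp q\<^esub>}"
      using Qp_one_not_zero by (auto simp: Units_def)
    show "carrier (Qp q) - {\<zero>\<^bsub>Qp q\<^esub>} \<subseteq> Units (Qp q)"
    proof
      fix x assume "x \<in> carrier (Qp q) - {\<zero>\<^bsub>Qp q\<^esub>}"
      then have x: "x \<in> carrier (Qp q)" "x \<noteq> \<zero>\<^bsub>Qp q\<^esub>" by simp_all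
      then obtain y where y: "y \<in> carrier (Qp q)" "x \<otimes>\<^bsub>Qp q\<^esub> y = \<one>\<^bsub>Qp q\<^esub>" using Qp_inverse by blast
      then have "y \<otimes>\<^bsub>Qp q\<^esub> x = \<one>\<^bsub>Qp q\<^esub>" using x Qp.m_comm by simp
      then show "x \<in> Units (Qp q)" using x(1) y unfolding Units_def by blast
    qed
  qed
qed

lemma Qp_uniformizer: "\<exists>x\<in>carrier (Qp q). qabs x = 1 / real q"
proof
  show "cls (\<lambda>n. of_nat q) \<in> carrier (Qp q)" using Qp_carrier cauchy_const by blast
  show "qabs (cls (\<lambda>n. of_nat q)) = 1 / real q"
    using LIMSEQ_unique[OF qabs_lim[OF cauchy_const[of "of_nat q"]]] by (simp add: padic_abs_prime[OF q])
qed

lemma Qp_separable: "\<exists>D. countable D \<and> D \<subseteq> carrier (Qp q) \<and>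
  (\<forall>x\<in>carrier (Qp q). \<forall>e>0. \<exists>d\<in>D. qabs (x \<ominus>\<^bsub>Qp q\<^esub> d) < e)"
proof (intro exI conjI ballI allI impI)
  let ?D = "range (\<lambda>r. cls (\<lambda>n. r))"
  show "countable ?D" by simp
  show "?D \<subseteq> carrier (Qp q)" using cls_closed cauchy_const by blast
  fix x and e :: real assume "x \<in> carrier (Qp q)" and e: "0 < e"
  then obtain s where s: "s \<in> padic_cauchy q" "x = cls s" using Qp_carrier by blast
  obtain N where N: "\<forall>m\<ge>N. \<forall>n\<ge>N. av (s m - s n) < e / 2" using cauchyD[OF s(1), of "e / 2"] e by auto
  let ?t = "\<lambda>n. s n + - s N"
  have "qabs (cls ?t) \<le> e / 2"
  proof (rule LIMSEQ_le_const2[OF qabs_lim[OF cauchy_add[OF s(1) cauchy_const]]])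
    show "\<exists>M. \<forall>n\<ge>M. av (s n + - s N) \<le> e / 2" using N by (auto intro!: exI[of _ N] less_imp_le)
  qed
  then have "qabs (x \<ominus>\<^bsub>Qp q\<^esub> cls (\<lambda>n. s N)) < e" using e s by (simp add: cls_minus)
  then show "\<exists>d\<in>?D. qabs (x \<ominus>\<^bsub>Qp q\<^esub> d) < e" by blast
qed

end

section \<open>\<open>SL\<^sub>2\<close> over a discretely valued field\<close>

text \<open>The properties of the field on which the group theory rests: a discrete valuation with
  value group generated by Q, separability, and 2 \<noteq> 0. The last separates 1 from -1 in
  \<open>near_scalar\<close>.\<close>

locale valued_field = field R for R (structure) +
  fixes av :: "'a \<Rightarrow> real" and Q :: real
  assumes av_nonneg [simp]: "\<And>x. x \<in> carrier R \<Longrightarrow> 0 \<le> av x"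
    and av_eq_0: "\<And>x. x \<in> carrier R \<Longrightarrow> av x = 0 \<longleftrightarrow> x = \<zero>"
    and av_mult: "\<And>x y. x \<in> carrier R \<Longrightarrow> y \<in> carrier R \<Longrightarrow> av (x \<otimes> y) = av x * av y"
    and av_add: "\<And>x y. x \<in> carrier R \<Longrightarrow> y \<in> carrier R \<Longrightarrow> av (x \<oplus> y) \<le> max (av x) (av y)"
    and Q_gt_1: "1 < Q"
    and av_values: "\<And>x. x \<in> carrier R \<Longrightarrow> x \<noteq> \<zero> \<Longrightarrow> \<exists>k::int. av x = Q powi k"
    and two: "\<one> \<oplus> \<one> \<noteq> \<zero>"
    and uniformizer: "\<exists>x\<in>carrier R. av x = 1 / Q"
    and separable: "\<exists>D. countable D \<and> D \<subseteq> carrier R \<and> (\<forall>x\<in>carrier R. \<forall>e>0. \<exists>d\<in>D. av (x \<ominus> d) < e)"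
begin

lemma av_zero [simp]: "av \<zero> = 0" by (simp add: av_eq_0)

lemma av_one [simp]: "av \<one> = 1"
  using av_mult[of \<one> \<one>] av_eq_0[of \<one>] one_not_zero by simp

lemma av_uminus [simp]:
  assumes x: "x \<in> carrier R"
  shows "av (\<ominus> x) = av x"
proof -
  have "av (\<ominus> \<one>) * av (\<ominus> \<one>) = 1" using av_mult[of "\<ominus> \<one>" "\<ominus> \<one>"] by (simp add: l_minus)
  then have "av (\<ominus> \<one>) = 1 \<or> av (\<ominus> \<one>) = -1" by (simp add: square_eq_1_iff)
  moreover have "0 \<le> av (\<ominus> \<one>)" by simp
  ultimately have "av (\<ominus> \<one>) = 1" by linarith
  then show ?thesis using av_mult[of "\<ominus> \<one>" x] x by (simp add: l_minus)
qed

lemma av_minus: "x \<in> carrier R \<Longrightarrow> y \<in> carrier R \<Longrightarrow> av (x \<ominus> y) \<le> max (av x) (av y)"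
  using av_add[of x "\<ominus> y"] by (simp add: a_minus_def)

lemma inv_facts:
  assumes "x \<in> carrier R" "x \<noteq> \<zero>"
  shows "inv x \<in> carrier R" "x \<otimes> inv x = \<one>" "av (inv x) = 1 / av x" "av x \<noteq> 0" "0 < av x"
proof -
  have "x \<in> Units R" using assms field_Units by simp
  then show i: "inv x \<in> carrier R" "x \<otimes> inv x = \<one>" by simp_all
  show "av x \<noteq> 0" using assms av_eq_0 by simp
  then show "0 < av x" using av_nonneg[OF assms(1)] by simp
  show "av (inv x) = 1 / av x" using av_mult[OF assms(1) i(1)] i(2) \<open>av x \<noteq> 0\<close> by (simp add: field_simps)
qed

lemma av_add_le: "x \<in> carrier R \<Longrightarrow> y \<in> carrier R \<Longrightarrow> av x \<le> B \<Longrightarrow> av y \<le> B \<Longrightarrow> av (x \<oplus> y) \<le> B"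
  using av_add[of x y] by simp

lemma av_add_less: "x \<in> carrier R \<Longrightarrow> y \<in> carrier R \<Longrightarrow> av x < B \<Longrightarrow> av y < B \<Longrightarrow> av (x \<oplus> y) < B"
  using av_add[of x y] by simp

lemma av_add_eq:
  assumes "x \<in> carrier R" "y \<in> carrier R" "av x < av y"
  shows "av (x \<oplus> y) = av y"
proof (rule antisym)
  show "av (x \<oplus> y) \<le> av y" using av_add[of x y] assms by simp
  have "y = (x \<oplus> y) \<ominus> x" using assms by algebra
  then have "av y \<le> max (av (x \<oplus> y)) (av x)" using av_minus[of "x \<oplus> y" x] assms by simp
  then show "av y \<le> av (x \<oplus> y)" using assms(3) by simp
qed

lemma av_less_one:
  assumes "x \<in> carrier R" "av x < 1"
  shows "av x \<le> 1 / Q"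
proof (cases "x = \<zero>")
  case False
  then obtain k :: int where k: "av x = Q powi k" using av_values assms by blast
  have "k < 0"
  proof (rule ccontr)
    assume "\<not> k < 0"
    then have "1 \<le> Q powi k" using Q_gt_1 by (simp add: one_le_power_int)
    then show False using k assms by simp
  qed
  then have "Q powi k \<le> Q powi (-1)" using Q_gt_1 by (intro power_int_increasing) auto
  then show ?thesis using k by (simp add: power_int_minus inverse_eq_divide)
qed (use Q_gt_1 in simp)

abbreviation S where "S \<equiv> SL2 R"

lemma SL2_carrier: "(a, b, c, d) \<in> carrier S \<longleftrightarrow>
  a \<in> carrier R \<and> b \<in> carrier R \<and> c \<in> carrier R \<and> d \<in> carrier R \<and> a \<otimes> d \<ominus> b \<otimes> c = \<one>"
  by (simp add: SL2_def)

lemma SL2_mult: "(a, b, c, d) \<otimes>\<^bsub>S\<^esub> (a', b', c', d') =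
  (a \<otimes> a' \<oplus> b \<otimes> c', a \<otimes> b' \<oplus> b \<otimes> d', c \<otimes> a' \<oplus> d \<otimes> c', c \<otimes> b' \<oplus> d \<otimes> d')"
  by (simp add: SL2_def)

lemma SL2_one: "\<one>\<^bsub>S\<^esub> = (\<one>, \<zero>, \<zero>, \<one>)"
  by (simp add: SL2_def)

lemma SL2_cases:
  assumes "g \<in> carrier S"
  obtains a b c d where "g = (a, b, c, d)" "a \<in> carrier R" "b \<in> carrier R" "c \<in> carrier R" "d \<in> carrier R"
    "a \<otimes> d \<ominus> b \<otimes> c = \<one>"
  using assms by (cases g) (auto simp: SL2_carrier)

lemma SL2_mult_closed:
  assumes "g \<in> carrier S" "h \<in> carrier S"
  shows "g \<otimes>\<^bsub>S\<^esub> h \<in> carrier S"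
proof -
  obtain a b c d where g: "g = (a, b, c, d)" and gc: "a \<in> carrier R" "b \<in> carrier R" "c \<in> carrier R" "d \<in> carrier R"
    and gd: "a \<otimes> d \<ominus> b \<otimes> c = \<one>" using assms(1) by (rule SL2_cases)
  obtain a' b' c' d' where h: "h = (a', b', c', d')" and
    hc: "a' \<in> carrier R" "b' \<in> carrier R" "c' \<in> carrier R" "d' \<in> carrier R"
    and hd: "a' \<otimes> d' \<ominus> b' \<otimes> c' = \<one>" using assms(2) by (rule SL2_cases)
  have "(a \<otimes> a' \<oplus> b \<otimes> c') \<otimes> (c \<otimes> b' \<oplus> d \<otimes> d') \<ominus> (a \<otimes> b' \<oplus> b \<otimes> d') \<otimes> (c \<otimes> a' \<oplus> d \<otimes> c')
    = (a \<otimes> d \<ominus> b \<otimes> c) \<otimes> (a' \<otimes> d' \<ominus> b' \<otimes> c')" using gc hc by algebra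
  then show ?thesis using gc hc gd hd by (simp add: g h SL2_carrier SL2_mult)
qed

lemma SL2_inverse:
  assumes "(a, b, c, d) \<in> carrier S"
  shows "(d, \<ominus> b, \<ominus> c, a) \<in> carrier S" "(d, \<ominus> b, \<ominus> c, a) \<otimes>\<^bsub>S\<^esub> (a, b, c, d) = \<one>\<^bsub>S\<^esub>"
proof -
  have c: "a \<in> carrier R" "b \<in> carrier R" "c \<in> carrier R" "d \<in> carrier R" and det: "a \<otimes> d \<ominus> b \<otimes> c = \<one>"
    using assms by (auto simp: SL2_carrier)
  have "d \<otimes> a \<ominus> \<ominus> b \<otimes> \<ominus> c = a \<otimes> d \<ominus> b \<otimes> c" "d \<otimes> a \<oplus> \<ominus> b \<otimes> c = a \<otimes> d \<ominus> b \<otimes> c"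
    "\<ominus> c \<otimes> b \<oplus> a \<otimes> d = a \<otimes> d \<ominus> b \<otimes> c" "d \<otimes> b \<oplus> \<ominus> b \<otimes> d = \<zero>" "\<ominus> c \<otimes> a \<oplus> a \<otimes> c = \<zero>"
    using c by algebra+
  then show "(d, \<ominus> b, \<ominus> c, a) \<in> carrier S" "(d, \<ominus> b, \<ominus> c, a) \<otimes>\<^bsub>S\<^esub> (a, b, c, d) = \<one>\<^bsub>S\<^esub>"
    using c det by (simp_all add: SL2_carrier SL2_mult SL2_one)
qed

lemma SL2_group: "group S"
proof (rule groupI)
  show "\<one>\<^bsub>S\<^esub> \<in> carrier S" by (simp add: SL2_carrier SL2_one a_minus_def)
  fix x y z assume x: "x \<in> carrier S" and y: "y \<in> carrier S" and z: "z \<in> carrier S"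
  show "x \<otimes>\<^bsub>S\<^esub> y \<otimes>\<^bsub>S\<^esub> z = x \<otimes>\<^bsub>S\<^esub> (y \<otimes>\<^bsub>S\<^esub> z)"
  proof -
    have e: "(a \<otimes> a' \<oplus> b \<otimes> c') \<otimes> u \<oplus> (a \<otimes> b' \<oplus> b \<otimes> d') \<otimes> v = a \<otimes> (a' \<otimes> u \<oplus> b' \<otimes> v) \<oplus> b \<otimes> (c' \<otimes> u \<oplus> d' \<otimes> v)"
      if "a \<in> carrier R" "b \<in> carrier R" "a' \<in> carrier R" "b' \<in> carrier R" "c' \<in> carrier R" "d' \<in> carrier R"
        "u \<in> carrier R" "v \<in> carrier R" for a b a' b' c' d' u v
      using that by algebra
    show ?thesis
      by (rule SL2_cases[OF x], rule SL2_cases[OF y], rule SL2_cases[OF z]) (simp add: SL2_mult e)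
  qed
next
  fix x assume x: "x \<in> carrier S"
  show "\<one>\<^bsub>S\<^esub> \<otimes>\<^bsub>S\<^esub> x = x" by (rule SL2_cases[OF x]) (simp add: SL2_mult SL2_one)
  show "\<exists>y\<in>carrier S. y \<otimes>\<^bsub>S\<^esub> x = \<one>\<^bsub>S\<^esub>"
    by (rule SL2_cases[OF x]) (use x SL2_inverse in blast)
qed (rule SL2_mult_closed)

sublocale S: group S by (rule SL2_group)

lemma SL2_inv: "(a, b, c, d) \<in> carrier S \<Longrightarrow> inv\<^bsub>S\<^esub> (a, b, c, d) = (d, \<ominus> b, \<ominus> c, a)"
  using SL2_inverse by (intro S.inv_equality) auto

lemma av_dot:
  assumes "x \<in> carrier R" "y \<in> carrier R" "z \<in> carrier R" "w \<in> carrier R"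
    and "av x \<le> X" "av y \<le> Y" "av z \<le> Z" "av w \<le> W" "X * Y \<le> B" "Z * W \<le> B"
  shows "av (x \<otimes> y \<oplus> z \<otimes> w) \<le> B"
proof -
  have "av x * av y \<le> X * Y" "av z * av w \<le> Z * W"
    using assms(5-8) order_trans[OF av_nonneg[OF assms(1)] assms(5)] order_trans[OF av_nonneg[OF assms(3)] assms(7)]
      assms(1-4) by (auto intro!: mult_mono)
  then show ?thesis using assms by (intro av_add_le) (auto simp: av_mult)
qed

text \<open>The two maximal compact subgroups: the stabilisers of \<open>\<O>\<^sup>2\<close> and of the lattice spanned by
  \<open>\<varpi>\<^sup>-\<^sup>1e\<^sub>1\<close> and \<open>e\<^sub>2\<close>, for a uniformiser \<open>\<varpi>\<close>.\<close>

definition bounded_part :: "real \<Rightarrow> 'a mat2 set" where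
  "bounded_part B = {g \<in> carrier S. case g of (a, b, c, d) \<Rightarrow> av a \<le> 1 \<and> av b \<le> B \<and> av c \<le> 1 / B \<and> av d \<le> 1}"

lemma bounded_part_iff: "(a, b, c, d) \<in> bounded_part B \<longleftrightarrow>
  (a, b, c, d) \<in> carrier S \<and> av a \<le> 1 \<and> av b \<le> B \<and> av c \<le> 1 / B \<and> av d \<le> 1"
  by (simp add: bounded_part_def)

lemma bounded_part_subgroup:
  assumes B: "0 < B"
  shows "subgroup (bounded_part B) S"
proof (rule S.subgroupI)
  show "bounded_part B \<subseteq> carrier S" by (auto simp: bounded_part_def)
  have "\<one>\<^bsub>S\<^esub> \<in> bounded_part B" using B S.one_closed by (simp add: SL2_one bounded_part_iff)
  then show "bounded_part B \<noteq> {}" by auto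
  fix x assume x: "x \<in> bounded_part B"
  then have xc: "x \<in> carrier S" by (simp add: bounded_part_def)
  obtain a b c d where g: "x = (a, b, c, d)" and gc: "a \<in> carrier R" "b \<in> carrier R" "c \<in> carrier R" "d \<in> carrier R"
    using xc by (rule SL2_cases)
  show "inv\<^bsub>S\<^esub> x \<in> bounded_part B"
    using x xc SL2_inverse(1)[of a b c d] gc by (simp add: g SL2_inv bounded_part_iff)
  fix y assume y: "y \<in> bounded_part B"
  then have yc: "y \<in> carrier S" by (simp add: bounded_part_def)
  obtain a' b' c' d' where h: "y = (a', b', c', d')" and
    hc: "a' \<in> carrier R" "b' \<in> carrier R" "c' \<in> carrier R" "d' \<in> carrier R"
    using yc by (rule SL2_cases)
  have b: "av a \<le> 1" "av b \<le> B" "av c \<le> 1 / B" "av d \<le> 1" "av a' \<le> 1" "av b' \<le> B" "av c' \<le> 1 / B" "av d' \<le> 1"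
    using x y by (simp_all add: g h bounded_part_iff)
  have "av (a \<otimes> a' \<oplus> b \<otimes> c') \<le> 1" using B by (intro av_dot[OF gc(1) hc(1) gc(2) hc(3) b(1) b(5) b(2) b(7)]) simp_all
  moreover have "av (a \<otimes> b' \<oplus> b \<otimes> d') \<le> B" using B by (intro av_dot[OF gc(1) hc(2) gc(2) hc(4) b(1) b(6) b(2) b(8)]) simp_all
  moreover have "av (c \<otimes> a' \<oplus> d \<otimes> c') \<le> 1 / B" using B by (intro av_dot[OF gc(3) hc(1) gc(4) hc(3) b(3) b(5) b(4) b(7)]) simp_all
  moreover have "av (c \<otimes> b' \<oplus> d \<otimes> d') \<le> 1" using B by (intro av_dot[OF gc(3) hc(2) gc(4) hc(4) b(3) b(6) b(4) b(8)]) simp_all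
  ultimately show "x \<otimes>\<^bsub>S\<^esub> y \<in> bounded_part B"
    using SL2_mult_closed[OF xc yc] by (simp add: g h SL2_mult bounded_part_iff)
qed

abbreviation S0 where "S0 \<equiv> bounded_part 1"
abbreviation S1 where "S1 \<equiv> bounded_part Q"

lemma S0_subgroup: "subgroup S0 S" by (rule bounded_part_subgroup) simp
lemma S1_subgroup: "subgroup S1 S" using Q_gt_1 by (intro bounded_part_subgroup) simp

lemma S0_carrier: "k \<in> S0 \<Longrightarrow> k \<in> carrier S" by (simp add: bounded_part_def)
lemma S1_carrier: "k \<in> S1 \<Longrightarrow> k \<in> carrier S" by (simp add: bounded_part_def)

subsection \<open>The sign character\<close>

definition col_norm :: "'a mat2 \<Rightarrow> real" where
  "col_norm g = (case g of (a, b, c, d) \<Rightarrow> max (av a) (av c))"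

text \<open>On a power Q^m this is (-1)^m, and the norm of a first column of determinant 1 matrices
  is always such a power.\<close>

definition sg :: "real \<Rightarrow> real" where
  "sg r = (if \<exists>k::int. r = Q powi (2 * k) then 1 else -1)"

definition sign :: "'a mat2 \<Rightarrow> real" where
  "sign g = sg (col_norm g)"

lemma sg_powi: "sg (Q powi k) = (if even k then 1 else -1)"
proof -
  have "Q powi k = Q powi (2 * j) \<longleftrightarrow> k = 2 * j" for j
    using Q_gt_1 power_int_strict_increasing[of k "2 * j" Q] power_int_strict_increasing[of "2 * j" k Q]
    by (cases k "2 * j" rule: linorder_cases) auto
  then show ?thesis unfolding sg_def by (auto elim: evenE)
qed

lemma sg_mult: "sg (Q powi j * Q powi k) = sg (Q powi j) * sg (Q powi k)"
proof -
  have "Q powi j * Q powi k = Q powi (j + k)" using Q_gt_1 by (simp add: power_int_add)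
  then show ?thesis by (simp add: sg_powi)
qed

lemma sg_one: "sg 1 = 1" using sg_powi[of 0] by simp
lemma sg_inverse_Q: "sg (1 / Q) = -1" using sg_powi[of "-1"] by (simp add: power_int_minus inverse_eq_divide)

lemma col_norm_values:
  assumes "g \<in> carrier S"
  shows "\<exists>k::int. col_norm g = Q powi k"
proof -
  obtain a b c d where g: "g = (a, b, c, d)" and gc: "a \<in> carrier R" "b \<in> carrier R" "c \<in> carrier R" "d \<in> carrier R"
    and det: "a \<otimes> d \<ominus> b \<otimes> c = \<one>" using assms by (rule SL2_cases)
  have "max (av a) (av c) = av a \<and> a \<noteq> \<zero> \<or> max (av a) (av c) = av c \<and> c \<noteq> \<zero>"
  proof -
    have "a \<noteq> \<zero> \<or> c \<noteq> \<zero>" using det gc one_not_zero by (auto simp: a_minus_def)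
    then show ?thesis using gc inv_facts(5)[of a] inv_facts(5)[of c] by (auto simp: max_def av_eq_0)
  qed
  then show ?thesis using av_values gc unfolding g col_norm_def by auto
qed

lemma col_norm_pos: "g \<in> carrier S \<Longrightarrow> 0 < col_norm g"
  using col_norm_values[of g] Q_gt_1 by (auto simp: zero_less_power_int)

lemma col_norm_S0_le:
  assumes "k \<in> S0" "g \<in> carrier S"
  shows "col_norm (k \<otimes>\<^bsub>S\<^esub> g) \<le> col_norm g"
proof -
  obtain a b c d where g: "g = (a, b, c, d)" and gc: "a \<in> carrier R" "b \<in> carrier R" "c \<in> carrier R" "d \<in> carrier R"
    using assms(2) by (rule SL2_cases)
  obtain a' b' c' d' where k: "k = (a', b', c', d')" and
    kc: "a' \<in> carrier R" "b' \<in> carrier R" "c' \<in> carrier R" "d' \<in> carrier R"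
    using S0_carrier[OF assms(1)] by (rule SL2_cases)
  let ?m = "max (av a) (av c)"
  have b: "av a' \<le> 1" "av b' \<le> 1" "av c' \<le> 1" "av d' \<le> 1" using assms(1) by (simp_all add: k bounded_part_iff)
  have m: "av a \<le> ?m" "av c \<le> ?m" by simp_all
  have "av (a' \<otimes> a \<oplus> b' \<otimes> c) \<le> ?m" by (rule av_dot[OF kc(1) gc(1) kc(2) gc(3) b(1) m(1) b(2) m(2)]) simp_all
  moreover have "av (c' \<otimes> a \<oplus> d' \<otimes> c) \<le> ?m" by (rule av_dot[OF kc(3) gc(1) kc(4) gc(3) b(3) m(1) b(4) m(2)]) simp_all
  ultimately show ?thesis by (simp add: g k SL2_mult col_norm_def)
qed

lemma col_norm_S0:
  assumes k: "k \<in> S0" and g: "g \<in> carrier S"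
  shows "col_norm (k \<otimes>\<^bsub>S\<^esub> g) = col_norm g"
proof (rule antisym[OF col_norm_S0_le[OF assms]])
  have kc: "k \<in> carrier S" using k by (rule S0_carrier)
  have "inv\<^bsub>S\<^esub> k \<otimes>\<^bsub>S\<^esub> (k \<otimes>\<^bsub>S\<^esub> g) = g" using kc g by (simp flip: S.m_assoc)
  then show "col_norm g \<le> col_norm (k \<otimes>\<^bsub>S\<^esub> g)"
    using col_norm_S0_le[OF subgroup.m_inv_closed[OF S0_subgroup k], of "k \<otimes>\<^bsub>S\<^esub> g"] kc g by simp
qed

lemma sign_S0: "k \<in> S0 \<Longrightarrow> g \<in> carrier S \<Longrightarrow> sign (k \<otimes>\<^bsub>S\<^esub> g) = sign g"
  by (simp add: sign_def col_norm_S0)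

lemma col_norm_one: "col_norm \<one>\<^bsub>S\<^esub> = 1"
  by (simp add: SL2_one col_norm_def)

lemma sign_one: "sign \<one>\<^bsub>S\<^esub> = 1"
  by (simp add: sign_def col_norm_one sg_one)

text \<open>The first column of a product y x depends on x through its first column alone, and
  linearly.\<close>

lemma col_norm_scaled:
  assumes y: "y \<in> carrier S" and x: "(a, b, c, d) \<in> carrier S" and k: "(a', b', c', d') \<in> carrier S"
    and s: "s \<in> carrier R" "a = s \<otimes> a'" "c = s \<otimes> c'"
  shows "col_norm (y \<otimes>\<^bsub>S\<^esub> (a, b, c, d)) = av s * col_norm (y \<otimes>\<^bsub>S\<^esub> (a', b', c', d'))"
proof -
  obtain y1 y2 y3 y4 where y': "y = (y1, y2, y3, y4)" and
    yc: "y1 \<in> carrier R" "y2 \<in> carrier R" "y3 \<in> carrier R" "y4 \<in> carrier R"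
    using y by (rule SL2_cases)
  have kc: "a' \<in> carrier R" "b' \<in> carrier R" "c' \<in> carrier R" "d' \<in> carrier R" using k by (auto simp: SL2_carrier)
  have "y1 \<otimes> a \<oplus> y2 \<otimes> c = s \<otimes> (y1 \<otimes> a' \<oplus> y2 \<otimes> c')" "y3 \<otimes> a \<oplus> y4 \<otimes> c = s \<otimes> (y3 \<otimes> a' \<oplus> y4 \<otimes> c')"
    unfolding s(2,3) using s(1) yc kc by algebra+
  then show ?thesis
    using s(1) yc kc by (simp add: y' SL2_mult col_norm_def av_mult max_mult_distrib_left)
qed

lemma sign_scaled:
  assumes y: "y \<in> carrier S" and x: "(a, b, c, d) \<in> carrier S" and k: "(a', b', c', d') \<in> carrier S"
    and s: "s \<in> carrier R" "a = s \<otimes> a'" "c = s \<otimes> c'" "s \<noteq> \<zero>"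
  shows "sign (y \<otimes>\<^bsub>S\<^esub> (a, b, c, d)) = sg (av s) * sign (y \<otimes>\<^bsub>S\<^esub> (a', b', c', d'))"
proof -
  obtain i :: int where "av s = Q powi i" using av_values s by blast
  moreover obtain j :: int where "col_norm (y \<otimes>\<^bsub>S\<^esub> (a', b', c', d')) = Q powi j"
    using col_norm_values[OF SL2_mult_closed[OF y k]] by blast
  ultimately show ?thesis using col_norm_scaled[OF assms(1-6)] by (simp add: sign_def sg_mult)
qed

text \<open>The first column of x is s times a primitive column, which is the first column of some k
  in \<open>S0\<close>. As the sign of a product y x sees only that column of x, k may replace x up
  to the factor coming from s.\<close>

lemma iwasawa_SL2:
  assumes x: "x \<in> carrier S"
  shows "\<exists>k\<in>S0. \<forall>y\<in>carrier S. sign (y \<otimes>\<^bsub>S\<^esub> x) = sign x * sign (y \<otimes>\<^bsub>S\<^esub> k)"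
proof -
  obtain a b c d where g: "x = (a, b, c, d)" and gc: "a \<in> carrier R" "b \<in> carrier R" "c \<in> carrier R" "d \<in> carrier R"
    and det: "a \<otimes> d \<ominus> b \<otimes> c = \<one>" using x by (rule SL2_cases)
  have "\<exists>a' b' c' d' s. (a', b', c', d') \<in> S0 \<and> s \<in> carrier R \<and> a = s \<otimes> a' \<and> c = s \<otimes> c' \<and> s \<noteq> \<zero>"
  \<comment> \<open>The larger entry serves as s: dividing by it puts a 1 into the column, which is
    then easily completed to determinant 1.\<close>
  proof (cases "av c \<le> av a")
    case True
    have a: "a \<noteq> \<zero>"
    proof
      assume "a = \<zero>"
      then have "av c = 0" using True gc by (intro antisym) auto
      then have "c = \<zero>" using gc av_eq_0[of c] by simp
      then show False using det gc \<open>a = \<zero>\<close> one_not_zero by (simp add: a_minus_def)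
    qed
    note i = inv_facts[OF gc(1) a]
    have "(\<one>, \<zero>, c \<otimes> inv a, \<one>) \<in> S0"
      using i gc True by (simp add: bounded_part_iff SL2_carrier a_minus_def av_mult)
    moreover have "c = a \<otimes> (c \<otimes> inv a)"
    proof -
      have "a \<otimes> (c \<otimes> inv a) = c \<otimes> (a \<otimes> inv a)" using gc i(1) by algebra
      then show ?thesis using gc i(2) by simp
    qed
    ultimately show ?thesis using gc(1) a by (metis r_one)
  next
    case False
    then have c: "c \<noteq> \<zero>" using gc by auto
    note i = inv_facts[OF gc(3) c]
    have "(a \<otimes> inv c, \<ominus> \<one>, \<one>, \<zero>) \<in> S0"
      using i gc False by (simp add: bounded_part_iff SL2_carrier a_minus_def av_mult l_minus)
    moreover have "a = c \<otimes> (a \<otimes> inv c)"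
    proof -
      have "c \<otimes> (a \<otimes> inv c) = a \<otimes> (c \<otimes> inv c)" using gc i(1) by algebra
      then show ?thesis using gc i(2) by simp
    qed
    ultimately show ?thesis using gc(3) c by (metis r_one)
  qed
  then obtain a' b' c' d' s where k: "(a', b', c', d') \<in> S0" and
    s: "s \<in> carrier R" "a = s \<otimes> a'" "c = s \<otimes> c'" "s \<noteq> \<zero>" by blast
  have kS: "(a', b', c', d') \<in> carrier S" using k by (rule S0_carrier)
  have all: "sign (y \<otimes>\<^bsub>S\<^esub> x) = sg (av s) * sign (y \<otimes>\<^bsub>S\<^esub> (a', b', c', d'))" if "y \<in> carrier S" for y
    unfolding g using sign_scaled[OF that x[unfolded g] kS s] .
  have "sign (a', b', c', d') = 1" using sign_S0[OF k S.one_closed] kS by (simp add: sign_one)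
  then have "sign x = sg (av s)" using all[OF S.one_closed] x kS by simp
  then show ?thesis using all k by (intro bexI[of _ "(a', b', c', d')"]) auto
qed

text \<open>The Cartan decomposition, in the form needed: reduce to a diagonal matrix, which the Weyl
  element conjugates to its inverse.\<close>

lemma gelfand_SL2:
  assumes x: "x \<in> carrier S"
  shows "\<exists>k1\<in>S0. \<exists>k2\<in>S0. inv\<^bsub>S\<^esub> x = k1 \<otimes>\<^bsub>S\<^esub> x \<otimes>\<^bsub>S\<^esub> k2"
proof -
  define P where "P = (\<lambda>x. \<exists>k1\<in>S0. \<exists>k2\<in>S0. inv\<^bsub>S\<^esub> x = k1 \<otimes>\<^bsub>S\<^esub> x \<otimes>\<^bsub>S\<^esub> k2)"
  have P_conj: "P (k \<otimes>\<^bsub>S\<^esub> y \<otimes>\<^bsub>S\<^esub> l)" if k: "k \<in> S0" and l: "l \<in> S0" and y: "y \<in> carrier S" "P y" for k y l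
  proof -
    obtain k1 k2 where k12: "k1 \<in> S0" "k2 \<in> S0" "inv\<^bsub>S\<^esub> y = k1 \<otimes>\<^bsub>S\<^esub> y \<otimes>\<^bsub>S\<^esub> k2" using y(2) by (auto simp: P_def)
    note c = S0_carrier[OF k] S0_carrier[OF l] y(1) S0_carrier[OF k12(1)] S0_carrier[OF k12(2)]
    define m n where "m = inv\<^bsub>S\<^esub> l \<otimes>\<^bsub>S\<^esub> k1 \<otimes>\<^bsub>S\<^esub> inv\<^bsub>S\<^esub> k" and "n = inv\<^bsub>S\<^esub> l \<otimes>\<^bsub>S\<^esub> k2 \<otimes>\<^bsub>S\<^esub> inv\<^bsub>S\<^esub> k"
    have "m \<in> S0" "n \<in> S0" unfolding m_def n_def
      using k l k12 S0_subgroup by (auto intro!: subgroup.m_closed subgroup.m_inv_closed)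
    moreover have "inv\<^bsub>S\<^esub> (k \<otimes>\<^bsub>S\<^esub> y \<otimes>\<^bsub>S\<^esub> l) = m \<otimes>\<^bsub>S\<^esub> (k \<otimes>\<^bsub>S\<^esub> y \<otimes>\<^bsub>S\<^esub> l) \<otimes>\<^bsub>S\<^esub> n"
    proof -
      have cancel: "inv\<^bsub>S\<^esub> g \<otimes>\<^bsub>S\<^esub> (g \<otimes>\<^bsub>S\<^esub> h) = h" "g \<otimes>\<^bsub>S\<^esub> (inv\<^bsub>S\<^esub> g \<otimes>\<^bsub>S\<^esub> h) = h"
        if "g \<in> carrier S" "h \<in> carrier S" for g h
        using that by (simp_all flip: S.m_assoc)
      have "inv\<^bsub>S\<^esub> (k \<otimes>\<^bsub>S\<^esub> y \<otimes>\<^bsub>S\<^esub> l) = inv\<^bsub>S\<^esub> l \<otimes>\<^bsub>S\<^esub> (k1 \<otimes>\<^bsub>S\<^esub> y \<otimes>\<^bsub>S\<^esub> k2) \<otimes>\<^bsub>S\<^esub> inv\<^bsub>S\<^esub> k"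
        using c by (simp add: S.inv_mult_group S.m_assoc flip: k12(3))
      then show ?thesis using c by (simp add: m_def n_def S.m_assoc cancel)
    qed
    ultimately show ?thesis by (auto simp: P_def)
  qed
  define w where "w = (\<zero>, \<ominus> \<one>, \<one>, \<zero>)"
  have w: "w \<in> S0" by (simp add: w_def bounded_part_iff SL2_carrier a_minus_def)
  have wc: "w \<in> carrier S" using w by (rule S0_carrier)
  have iw: "inv\<^bsub>S\<^esub> w = (\<zero>, \<one>, \<ominus> \<one>, \<zero>)" using wc by (simp add: w_def SL2_inv)
  have winv: "inv\<^bsub>S\<^esub> w \<in> S0" by (rule subgroup.m_inv_closed[OF S0_subgroup w])
  \<comment> \<open>When a dominates b and c, elimination by unipotents in \<open>S0\<close> leads
    to a diagonal matrix; the entry d is fixed by the determinant.\<close>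
  have big: "P (a, b, c, d)" if x: "(a, b, c, d) \<in> carrier S" and m: "av b \<le> av a" "av c \<le> av a" and a: "a \<noteq> \<zero>" for a b c d
  proof -
    have gc: "a \<in> carrier R" "b \<in> carrier R" "c \<in> carrier R" "d \<in> carrier R"
      and det: "a \<otimes> d \<ominus> b \<otimes> c = \<one>" using x by (auto simp: SL2_carrier)
    note i = inv_facts[OF gc(1) a]
    define y where "y = (a, \<zero>, \<zero>, inv a)"
    have y: "y \<in> carrier S" using gc i by (simp add: y_def SL2_carrier a_minus_def)
    have "inv\<^bsub>S\<^esub> y = w \<otimes>\<^bsub>S\<^esub> y \<otimes>\<^bsub>S\<^esub> inv\<^bsub>S\<^esub> w"
      using y gc i by (simp add: iw) (simp add: y_def w_def SL2_inv SL2_mult l_minus r_minus)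
    then have "P y" unfolding P_def using w winv by blast
    moreover have "(\<one>, \<zero>, c \<otimes> inv a, \<one>) \<in> S0" "(\<one>, b \<otimes> inv a, \<zero>, \<one>) \<in> S0"
      using i gc m by (simp_all add: bounded_part_iff SL2_carrier a_minus_def av_mult)
    moreover have "(\<one>, \<zero>, c \<otimes> inv a, \<one>) \<otimes>\<^bsub>S\<^esub> y \<otimes>\<^bsub>S\<^esub> (\<one>, b \<otimes> inv a, \<zero>, \<one>) = (a, b, c, d)"
    proof -
      have "a \<otimes> (b \<otimes> inv a) = b \<otimes> (a \<otimes> inv a)" using gc i(1) by algebra
      then have e1: "a \<otimes> (b \<otimes> inv a) = b" using gc i(2) by simp
      have e2: "c \<otimes> inv a \<otimes> a = c" using gc i by (simp add: m_assoc m_comm[of "inv a"])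
      have "d = inv a \<otimes> (a \<otimes> d)" using gc i by (simp add: m_comm[of "inv a"] flip: m_assoc)
      also have "a \<otimes> d = \<one> \<oplus> b \<otimes> c" unfolding det[symmetric] using gc by algebra
      also have "inv a \<otimes> (\<one> \<oplus> b \<otimes> c) = c \<otimes> (b \<otimes> inv a) \<oplus> inv a" using gc i(1) by algebra
      finally have e3: "c \<otimes> (b \<otimes> inv a) \<oplus> inv a = d" by simp
      show ?thesis using gc i by (simp add: y_def SL2_mult e1 e2 e3)
    qed
    ultimately show ?thesis using P_conj y by metis
  qed
  obtain a b c d where g: "x = (a, b, c, d)" and gc: "a \<in> carrier R" "b \<in> carrier R" "c \<in> carrier R" "d \<in> carrier R"
    and det: "a \<otimes> d \<ominus> b \<otimes> c = \<one>" using x by (rule SL2_cases)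
  \<comment> \<open>An entry of maximal size is brought to the upper left corner by the Weyl element
    or its inverse, on the left, on the right or on both sides.\<close>
  define M where "M = Max {av a, av b, av c, av d}"
  have le: "av a \<le> M" "av b \<le> M" "av c \<le> M" "av d \<le> M" by (simp_all add: M_def)
  have M: "0 < M"
  proof (rule ccontr)
    assume "\<not> 0 < M"
    then have "a = \<zero>" "b = \<zero>" "c = \<zero>" "d = \<zero>" using le gc av_nonneg av_eq_0 by (metis antisym order_trans not_less)+
    then show False using det one_not_zero by (simp add: a_minus_def)
  qed
  have "M \<in> {av a, av b, av c, av d}" unfolding M_def by (rule Max_in) auto
  then consider "M = av a" | "M = av b" | "M = av c" | "M = av d" by blast
  then have "P x"
  proof cases
    case 1
    then show ?thesis unfolding g using le M x by (intro big) (auto simp: g)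
  next
    case 2
    have e: "x \<otimes>\<^bsub>S\<^esub> w = (b, \<ominus> a, d, \<ominus> c)" using gc by (simp add: g w_def SL2_mult r_minus)
    have "P (x \<otimes>\<^bsub>S\<^esub> w)" unfolding e
      using le M 2 gc SL2_mult_closed[OF x wc] by (intro big) (auto simp: e)
    from P_conj[OF subgroup.one_closed[OF S0_subgroup] winv _ this] show ?thesis
      using x wc by (simp add: S.m_assoc)
  next
    case 3
    have e: "inv\<^bsub>S\<^esub> w \<otimes>\<^bsub>S\<^esub> x = (c, d, \<ominus> a, \<ominus> b)" unfolding iw using gc by (simp add: g SL2_mult l_minus)
    have "P (inv\<^bsub>S\<^esub> w \<otimes>\<^bsub>S\<^esub> x)" unfolding e
      using le M 3 gc SL2_mult_closed[OF S0_carrier[OF winv] x] by (intro big) (auto simp: e)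
    from P_conj[OF w subgroup.one_closed[OF S0_subgroup] _ this] show ?thesis
      using x wc by (simp flip: S.m_assoc)
  next
    case 4
    have e: "inv\<^bsub>S\<^esub> w \<otimes>\<^bsub>S\<^esub> x \<otimes>\<^bsub>S\<^esub> w = (d, \<ominus> c, \<ominus> b, a)" unfolding iw using gc by (simp add: g w_def SL2_mult l_minus r_minus)
    have "P (inv\<^bsub>S\<^esub> w \<otimes>\<^bsub>S\<^esub> x \<otimes>\<^bsub>S\<^esub> w)" unfolding e
      using le M 4 gc SL2_mult_closed[OF SL2_mult_closed[OF S0_carrier[OF winv] x] wc] by (intro big) (auto simp: e)
    from P_conj[OF w winv _ this] have "P (w \<otimes>\<^bsub>S\<^esub> (inv\<^bsub>S\<^esub> w \<otimes>\<^bsub>S\<^esub> x \<otimes>\<^bsub>S\<^esub> w) \<otimes>\<^bsub>S\<^esub> inv\<^bsub>S\<^esub> w)"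
      using x wc by simp
    moreover have "w \<otimes>\<^bsub>S\<^esub> (inv\<^bsub>S\<^esub> w \<otimes>\<^bsub>S\<^esub> x \<otimes>\<^bsub>S\<^esub> w) \<otimes>\<^bsub>S\<^esub> inv\<^bsub>S\<^esub> w = x"
    proof -
      have "w \<otimes>\<^bsub>S\<^esub> (inv\<^bsub>S\<^esub> w \<otimes>\<^bsub>S\<^esub> x \<otimes>\<^bsub>S\<^esub> w) \<otimes>\<^bsub>S\<^esub> inv\<^bsub>S\<^esub> w = (w \<otimes>\<^bsub>S\<^esub> inv\<^bsub>S\<^esub> w) \<otimes>\<^bsub>S\<^esub> x \<otimes>\<^bsub>S\<^esub> (w \<otimes>\<^bsub>S\<^esub> inv\<^bsub>S\<^esub> w)"
        using x wc by (simp only: S.m_assoc S.m_closed S.inv_closed)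
      then show ?thesis using x wc by simp
    qed
    ultimately show ?thesis by simp
  qed
  then show ?thesis by (simp add: P_def)
qed

end

subsection \<open>The quotient \<open>PSL\<^sub>2\<close> and its valuation topology\<close>

context valued_field
begin

definition neg :: "'a mat2 \<Rightarrow> 'a mat2" where
  "neg g = (case g of (a, b, c, d) \<Rightarrow> (\<ominus> a, \<ominus> b, \<ominus> c, \<ominus> d))"

definition mone :: "'a mat2" where
  "mone = (\<ominus> \<one>, \<zero>, \<zero>, \<ominus> \<one>)"

lemma pm_one_eq: "pm_one R = {\<one>\<^bsub>S\<^esub>, mone}"
  by (simp add: pm_one_def SL2_one mone_def)

lemma mone_closed: "mone \<in> carrier S"
  by (simp add: mone_def SL2_carrier l_minus a_minus_def)

lemma mone_mult:
  assumes "g \<in> carrier S"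
  shows "mone \<otimes>\<^bsub>S\<^esub> g = neg g" "g \<otimes>\<^bsub>S\<^esub> mone = neg g"
  using assms by (auto elim!: SL2_cases simp: mone_def neg_def SL2_mult l_minus r_minus)

lemma neg_neg: "g \<in> carrier S \<Longrightarrow> neg (neg g) = g"
  by (auto elim!: SL2_cases simp: neg_def)

lemma neg_closed: "g \<in> carrier S \<Longrightarrow> neg g \<in> carrier S"
  using mone_mult(1) S.m_closed[OF mone_closed] by metis

lemma pm_one_normal: "pm_one R \<lhd> S"
proof -
  have mm: "mone \<otimes>\<^bsub>S\<^esub> mone = \<one>\<^bsub>S\<^esub>"
    using mone_mult(1)[OF mone_closed] by (simp add: neg_def mone_def SL2_one)
  have im: "inv\<^bsub>S\<^esub> mone = mone" using mm mone_closed by (intro S.inv_equality)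
  have "subgroup (pm_one R) S"
    by (rule S.subgroupI) (auto simp: pm_one_eq mone_closed mm im)
  moreover have "x \<otimes>\<^bsub>S\<^esub> h \<otimes>\<^bsub>S\<^esub> inv\<^bsub>S\<^esub> x \<in> pm_one R" if x: "x \<in> carrier S" and h: "h \<in> pm_one R" for x h
  proof -
    have "x \<otimes>\<^bsub>S\<^esub> mone \<otimes>\<^bsub>S\<^esub> inv\<^bsub>S\<^esub> x = mone \<otimes>\<^bsub>S\<^esub> x \<otimes>\<^bsub>S\<^esub> inv\<^bsub>S\<^esub> x" using x by (simp add: mone_mult)
    also have "\<dots> = mone" using x mone_closed by (simp add: S.m_assoc)
    finally show ?thesis using h x by (auto simp: pm_one_eq)
  qed
  ultimately show ?thesis using S.normal_inv_iff by blast
qed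

sublocale pm: normal "pm_one R" S by (rule pm_one_normal)

abbreviation P where "P \<equiv> PSL2 R"

definition \<pi> :: "'a mat2 \<Rightarrow> 'a mat2 set" where
  "\<pi> g = pm_one R #>\<^bsub>S\<^esub> g"

lemma \<pi>_eq: "g \<in> carrier S \<Longrightarrow> \<pi> g = {g, neg g}"
  by (auto simp: \<pi>_def r_coset_def pm_one_eq mone_mult)

lemma \<pi>_neg: "g \<in> carrier S \<Longrightarrow> \<pi> (neg g) = \<pi> g"
  by (auto simp: \<pi>_eq neg_closed neg_neg)

lemma \<pi>_eq_iff: "g \<in> carrier S \<Longrightarrow> h \<in> carrier S \<Longrightarrow> \<pi> g = \<pi> h \<longleftrightarrow> h = g \<or> h = neg g"
  using neg_neg[of g] neg_neg[of h] by (simp only: \<pi>_eq doubleton_eq_iff) metis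

lemma P_group: "group P"
  unfolding PSL2_def by (rule pm.factorgroup_is_group)

sublocale P: group P by (rule P_group)

lemma \<pi>_hom: "\<pi> \<in> hom S P"
  using pm.r_coset_hom_Mod unfolding PSL2_def \<pi>_def[abs_def] .

sublocale \<pi>: group_hom S P \<pi>
  using \<pi>_hom by unfold_locales

lemma P_carrier: "carrier P = \<pi> ` carrier S"
  by (auto simp: PSL2_def FactGroup_def RCOSETS_def \<pi>_def)

lemma \<pi>_subgroup: "subgroup K S \<Longrightarrow> subgroup (\<pi> ` K) P"
  by (rule \<pi>.subgroup_img_is_subgroup)

text \<open>For fixed e > 0 the ultrametric inequality makes this an equivalence relation on
  quadruples, which is why balls are open and congruence conditions define subgroups.\<close>

definition near :: "real \<Rightarrow> 'a mat2 \<Rightarrow> 'a mat2 \<Rightarrow> bool" where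
  "near e g h = (case g of (a, b, c, d) \<Rightarrow> case h of (a', b', c', d') \<Rightarrow>
     av (a' \<ominus> a) < e \<and> av (b' \<ominus> b) < e \<and> av (c' \<ominus> c) < e \<and> av (d' \<ominus> d) < e)"

abbreviation R4 where "R4 \<equiv> carrier R \<times> carrier R \<times> carrier R \<times> carrier R"

lemma S_R4: "g \<in> carrier S \<Longrightarrow> g \<in> R4"
  by (auto elim!: SL2_cases)

lemma av_sub_commute: "x \<in> carrier R \<Longrightarrow> y \<in> carrier R \<Longrightarrow> av (x \<ominus> y) = av (y \<ominus> x)"
proof -
  assume xy: "x \<in> carrier R" "y \<in> carrier R"
  have "x \<ominus> y = \<ominus> (y \<ominus> x)" using xy by algebra
  then show ?thesis using xy by simp
qed

lemma av_sub_trans: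
  assumes "x \<in> carrier R" "y \<in> carrier R" "z \<in> carrier R" "av (y \<ominus> x) < e" "av (z \<ominus> y) < e"
  shows "av (z \<ominus> x) < e"
proof -
  have "z \<ominus> x = (z \<ominus> y) \<oplus> (y \<ominus> x)" using assms(1-3) by algebra
  then show ?thesis using assms by (simp add: av_add_less)
qed

lemma near_refl: "g \<in> R4 \<Longrightarrow> 0 < e \<Longrightarrow> near e g g"
  by (auto simp: near_def a_minus_def r_neg)

lemma near_sym: "g \<in> R4 \<Longrightarrow> h \<in> R4 \<Longrightarrow> near e g h \<Longrightarrow> near e h g"
  by (auto simp: near_def av_sub_commute)

lemma near_trans: "f \<in> R4 \<Longrightarrow> g \<in> R4 \<Longrightarrow> h \<in> R4 \<Longrightarrow> near e f g \<Longrightarrow> near e g h \<Longrightarrow> near e f h"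
  by (auto simp: near_def intro: av_sub_trans)

lemma near_mono: "near e g h \<Longrightarrow> e \<le> e' \<Longrightarrow> near e' g h"
  by (auto simp: near_def)

lemma near_neg:
  assumes "g \<in> carrier S" "h \<in> carrier S" "near e g h"
  shows "near e (neg g) (neg h)"
proof -
  have e: "av (\<ominus> x \<ominus> \<ominus> y) = av (x \<ominus> y)" if "x \<in> carrier R" "y \<in> carrier R" for x y
  proof -
    have "\<ominus> x \<ominus> \<ominus> y = \<ominus> (x \<ominus> y)" using that by algebra
    then show ?thesis using that by simp
  qed
  show ?thesis using assms by (auto elim!: SL2_cases simp: near_def neg_def e)
qed

lemma near_inv:
  assumes "g \<in> carrier S" "h \<in> carrier S" "near e g h"
  shows "near e (inv\<^bsub>S\<^esub> g) (inv\<^bsub>S\<^esub> h)"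
proof -
  have e: "av (\<ominus> x \<ominus> \<ominus> y) = av (x \<ominus> y)" if "x \<in> carrier R" "y \<in> carrier R" for x y
  proof -
    have "\<ominus> x \<ominus> \<ominus> y = \<ominus> (x \<ominus> y)" using that by algebra
    then show ?thesis using that by simp
  qed
  obtain a b c d where g: "g = (a, b, c, d)" and gc: "a \<in> carrier R" "b \<in> carrier R" "c \<in> carrier R" "d \<in> carrier R"
    using assms(1) by (rule SL2_cases)
  obtain a' b' c' d' where h: "h = (a', b', c', d')" and
    hc: "a' \<in> carrier R" "b' \<in> carrier R" "c' \<in> carrier R" "d' \<in> carrier R"
    using assms(2) by (rule SL2_cases)
  show ?thesis using assms gc hc by (simp add: g h SL2_inv near_def e)
qed

lemma near_mult:
  assumes x: "x \<in> carrier S" and y: "y \<in> carrier S" and e: "0 < e"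
  obtains \<delta> where "0 < \<delta>" "\<And>v w. v \<in> carrier S \<Longrightarrow> w \<in> carrier S \<Longrightarrow> near \<delta> x v \<Longrightarrow> near \<delta> y w \<Longrightarrow>
    near e (x \<otimes>\<^bsub>S\<^esub> y) (v \<otimes>\<^bsub>S\<^esub> w)"
proof -
  obtain x1 x2 x3 x4 where x': "x = (x1, x2, x3, x4)" and
    xc: "x1 \<in> carrier R" "x2 \<in> carrier R" "x3 \<in> carrier R" "x4 \<in> carrier R"
    using x by (rule SL2_cases)
  obtain y1 y2 y3 y4 where y': "y = (y1, y2, y3, y4)" and
    yc: "y1 \<in> carrier R" "y2 \<in> carrier R" "y3 \<in> carrier R" "y4 \<in> carrier R"
    using y by (rule SL2_cases)
  define M where "M = 1 + (av x1 + av x2 + av x3 + av x4) + (av y1 + av y2 + av y3 + av y4)"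
  have M: "1 \<le> M" "av x1 \<le> M" "av x2 \<le> M" "av x3 \<le> M" "av x4 \<le> M" "av y1 \<le> M" "av y2 \<le> M" "av y3 \<le> M" "av y4 \<le> M"
    using xc[THEN av_nonneg] yc[THEN av_nonneg] unfolding M_def by linarith+
  define \<delta> where "\<delta> = min 1 (e / M)"
  have \<delta>: "0 < \<delta>" "\<delta> \<le> 1" "\<delta> * M \<le> e" using e M(1) by (auto simp: \<delta>_def min_def field_simps)
  have small: "av (p \<otimes> r) < e" if "p \<in> carrier R" "r \<in> carrier R" "av p < \<delta>" "av r \<le> M" for p r
  proof (cases "av r = 0")
    case False
    then have "0 < av r" using av_nonneg[OF that(2)] by linarith
    then have "av p * av r < \<delta> * av r" using that(3) by simp
    also have "\<dots> \<le> \<delta> * M" using \<delta>(1) that(4) by simp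
    finally show ?thesis using \<delta>(3) that by (simp add: av_mult)
  qed (use that e in \<open>simp add: av_mult\<close>)
  have bound: "av w \<le> M" if "w \<in> carrier R" "r \<in> carrier R" "av (w \<ominus> r) < \<delta>" "av r \<le> M" for w r
  proof -
    have "w = (w \<ominus> r) \<oplus> r" using that by algebra
    then show ?thesis using that \<delta>(2) M(1) av_add_le[of "w \<ominus> r" r M] by simp
  qed
  have entry: "av (v1 \<otimes> w1 \<oplus> v2 \<otimes> w2 \<ominus> (u1 \<otimes> r1 \<oplus> u2 \<otimes> r2)) < e"
    if c: "v1 \<in> carrier R" "w1 \<in> carrier R" "v2 \<in> carrier R" "w2 \<in> carrier R"
      "u1 \<in> carrier R" "r1 \<in> carrier R" "u2 \<in> carrier R" "r2 \<in> carrier R"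
      and m: "av u1 \<le> M" "av u2 \<le> M" "av r1 \<le> M" "av r2 \<le> M"
      and n: "av (v1 \<ominus> u1) < \<delta>" "av (v2 \<ominus> u2) < \<delta>" "av (w1 \<ominus> r1) < \<delta>" "av (w2 \<ominus> r2) < \<delta>"
    for v1 w1 v2 w2 u1 r1 u2 r2
  proof -
    have "v1 \<otimes> w1 \<oplus> v2 \<otimes> w2 \<ominus> (u1 \<otimes> r1 \<oplus> u2 \<otimes> r2)
      = ((v1 \<ominus> u1) \<otimes> w1 \<oplus> (v2 \<ominus> u2) \<otimes> w2) \<oplus> ((w1 \<ominus> r1) \<otimes> u1 \<oplus> (w2 \<ominus> r2) \<otimes> u2)"
      using c by algebra
    moreover have "av ((v1 \<ominus> u1) \<otimes> w1) < e" using c n m by (intro small bound[of w1 r1]) auto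
    moreover have "av ((v2 \<ominus> u2) \<otimes> w2) < e" using c n m by (intro small bound[of w2 r2]) auto
    moreover have "av ((w1 \<ominus> r1) \<otimes> u1) < e" "av ((w2 \<ominus> r2) \<otimes> u2) < e" using c n m by (auto intro!: small)
    ultimately show ?thesis using c by (simp add: av_add_less)
  qed
  show thesis
  proof (rule that[OF \<delta>(1)])
    fix v w assume v: "v \<in> carrier S" and w: "w \<in> carrier S" and n: "near \<delta> x v" "near \<delta> y w"
    obtain v1 v2 v3 v4 where v': "v = (v1, v2, v3, v4)" and
      vc: "v1 \<in> carrier R" "v2 \<in> carrier R" "v3 \<in> carrier R" "v4 \<in> carrier R"
      using v by (rule SL2_cases)
    obtain w1 w2 w3 w4 where w': "w = (w1, w2, w3, w4)" and
      wc: "w1 \<in> carrier R" "w2 \<in> carrier R" "w3 \<in> carrier R" "w4 \<in> carrier R"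
      using w by (rule SL2_cases)
    have n': "av (v1 \<ominus> x1) < \<delta>" "av (v2 \<ominus> x2) < \<delta>" "av (v3 \<ominus> x3) < \<delta>" "av (v4 \<ominus> x4) < \<delta>"
      "av (w1 \<ominus> y1) < \<delta>" "av (w2 \<ominus> y2) < \<delta>" "av (w3 \<ominus> y3) < \<delta>" "av (w4 \<ominus> y4) < \<delta>"
      using n by (simp_all add: near_def x' y' v' w')
    show "near e (x \<otimes>\<^bsub>S\<^esub> y) (v \<otimes>\<^bsub>S\<^esub> w)"
      unfolding x' y' v' w' SL2_mult near_def prod.case
      by (intro conjI entry xc yc vc wc M n')
  qed
qed

text \<open>The quotient of the entrywise topology, described on representatives. It is built from
  the valuation itself, independently of the topology of the Haar measure.\<close>

definition popen :: "'a mat2 set set \<Rightarrow> bool" where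
  "popen U \<longleftrightarrow> U \<subseteq> carrier P \<and>
     (\<forall>g\<in>carrier S. \<pi> g \<in> U \<longrightarrow> (\<exists>e>0. \<forall>h\<in>carrier S. near e g h \<longrightarrow> \<pi> h \<in> U))"

lemma istopology_popen: "istopology popen"
  unfolding istopology_def
proof (intro conjI allI impI)
  fix U V assume U: "popen U" and V: "popen V"
  show "popen (U \<inter> V)"
    unfolding popen_def
  proof (intro conjI ballI impI)
    show "U \<inter> V \<subseteq> carrier P" using U by (auto simp: popen_def)
    fix g assume g: "g \<in> carrier S" "\<pi> g \<in> U \<inter> V"
    obtain e1 where e1: "e1 > 0" "\<forall>h\<in>carrier S. near e1 g h \<longrightarrow> \<pi> h \<in> U" using U g unfolding popen_def by blast
    obtain e2 where e2: "e2 > 0" "\<forall>h\<in>carrier S. near e2 g h \<longrightarrow> \<pi> h \<in> V" using V g unfolding popen_def by blast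
    show "\<exists>e>0. \<forall>h\<in>carrier S. near e g h \<longrightarrow> \<pi> h \<in> U \<inter> V"
    proof (intro exI[of _ "min e1 e2"] conjI ballI impI)
      fix h assume h: "h \<in> carrier S" "near (min e1 e2) g h"
      then have "near e1 g h" "near e2 g h" by (auto intro: near_mono)
      then show "\<pi> h \<in> U \<inter> V" using h(1) e1(2) e2(2) by blast
    qed (use e1 e2 in simp)
  qed
next
  fix K assume "\<forall>U\<in>K. popen U"
  then show "popen (\<Union>K)" unfolding popen_def by (meson Union_iff Sup_least)
qed

definition Tp :: "'a mat2 set topology" where "Tp = topology popen"

lemma openin_Tp: "openin Tp U \<longleftrightarrow> popen U"
  by (simp add: Tp_def topology_inverse'[OF istopology_popen])

lemma popen_carrier: "popen (carrier P)"
  unfolding popen_def by (auto simp: P_carrier intro: exI[of _ 1])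

lemma topspace_Tp: "topspace Tp = carrier P"
proof
  show "topspace Tp \<subseteq> carrier P" unfolding topspace_def by (auto simp: openin_Tp popen_def)
  show "carrier P \<subseteq> topspace Tp" using popen_carrier openin_subset by (metis openin_Tp)
qed

text \<open>The centre r is any quadruple, not necessarily of determinant 1, so that centres can be
  taken from a countable dense set of quadruples.\<close>

definition ball :: "'a mat2 \<Rightarrow> real \<Rightarrow> 'a mat2 set set" where
  "ball r e = \<pi> ` {g \<in> carrier S. near e r g}"

lemma popen_ball:
  assumes r: "r \<in> R4"
  shows "popen (ball r e)"
  unfolding popen_def
proof (intro conjI ballI impI)
  show "ball r e \<subseteq> carrier P" by (auto simp: ball_def P_carrier)
  fix g assume g: "g \<in> carrier S" "\<pi> g \<in> ball r e"
  then obtain v where v: "v \<in> carrier S" "near e r v" "\<pi> g = \<pi> v" by (auto simp: ball_def)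
  \<comment> \<open>A nonempty ball has positive radius; since nearness is transitive, that radius
    works at each of its points.\<close>
  have e: "0 < e"
  proof -
    have "av (fst v \<ominus> fst r) < e" using v(2) by (auto simp: near_def split: prod.splits)
    moreover have "0 \<le> av (fst v \<ominus> fst r)" using S_R4[OF v(1)] r by (auto intro!: av_nonneg)
    ultimately show ?thesis by linarith
  qed
  have "\<pi> h \<in> ball r e" if h: "h \<in> carrier S" "near e g h" for h
  proof -
    have "v = g \<or> v = neg g" using \<pi>_eq_iff[OF g(1) v(1)] v(3) by blast
    then show ?thesis
    proof
      assume "v = g"
      then have "near e r h" using near_trans[OF r S_R4 S_R4, of g h] g h v by blast
      then show ?thesis using h by (auto simp: ball_def)
    next
      assume "v = neg g"
      then have "near e v (neg h)" using near_neg[OF g(1) h] by simp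
      then have "near e r (neg h)" using near_trans[OF r S_R4[OF v(1)] S_R4[OF neg_closed[OF h(1)]]] v by blast
      then have "\<pi> (neg h) \<in> ball r e" using neg_closed[OF h(1)] by (auto simp: ball_def)
      then show ?thesis using \<pi>_neg[OF h(1)] by simp
    qed
  qed
  then show "\<exists>e'>0. \<forall>h\<in>carrier S. near e' g h \<longrightarrow> \<pi> h \<in> ball r e" using e by blast
qed

lemma congruence_subgroup:
  assumes e: "0 < e" "e \<le> 1"
  shows "subgroup {g \<in> carrier S. near e \<one>\<^bsub>S\<^esub> g} S" (is "subgroup ?K S")
proof (rule S.subgroupI)
  show "?K \<subseteq> carrier S" by auto
  show "?K \<noteq> {}" using near_refl[OF S_R4[OF S.one_closed] e(1)] by blast
  fix g assume g: "g \<in> ?K"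
  then have "near e (inv\<^bsub>S\<^esub> \<one>\<^bsub>S\<^esub>) (inv\<^bsub>S\<^esub> g)" by (intro near_inv) auto
  then show "inv\<^bsub>S\<^esub> g \<in> ?K" using g by simp
  obtain a b c d where g': "g = (a, b, c, d)" and gc: "a \<in> carrier R" "b \<in> carrier R" "c \<in> carrier R" "d \<in> carrier R"
    using g by (auto elim!: SL2_cases)
  fix h assume h: "h \<in> ?K"
  obtain a' b' c' d' where h': "h = (a', b', c', d')" and
    hc: "a' \<in> carrier R" "b' \<in> carrier R" "c' \<in> carrier R" "d' \<in> carrier R"
    using h by (auto elim!: SL2_cases)
  have z: "x \<ominus> \<zero> = x" if "x \<in> carrier R" for x using that by (simp add: a_minus_def)
  have ng: "av (a \<ominus> \<one>) < e" "av b < e" "av c < e" "av (d \<ominus> \<one>) < e"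
    using g gc by (simp_all add: g' near_def SL2_one z)
  have nh: "av (a' \<ominus> \<one>) < e" "av b' < e" "av c' < e" "av (d' \<ominus> \<one>) < e"
    using h hc by (simp_all add: h' near_def SL2_one z)
  have one: "av x \<le> 1" if "x \<in> carrier R" "av (x \<ominus> \<one>) < e" for x
  proof -
    have "x = (x \<ominus> \<one>) \<oplus> \<one>" using that by algebra
    then show ?thesis using that e av_add_le[of "x \<ominus> \<one>" \<one> 1] by simp
  qed
  have prod: "av (x \<otimes> y) < e" if "x \<in> carrier R" "y \<in> carrier R" "av x < e" "av y \<le> 1" for x y
    using that mult_left_mono[of "av y" 1 "av x"] by (simp add: av_mult)
  have prod': "av (x \<otimes> y) < e" if "x \<in> carrier R" "y \<in> carrier R" "av x \<le> 1" "av y < e" for x y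
    using prod[of y x] that by (simp add: m_comm)
  have b1: "av a \<le> 1" "av d \<le> 1" "av a' \<le> 1" "av d' \<le> 1" "av b \<le> 1" "av c \<le> 1" "av b' \<le> 1" "av c' \<le> 1"
    using one gc hc ng nh e by auto
  have "av ((a \<ominus> \<one>) \<otimes> a' \<oplus> b \<otimes> c' \<oplus> (a' \<ominus> \<one>)) < e"
    using gc hc ng nh b1 by (intro av_add_less prod) auto
  moreover have "a \<otimes> a' \<oplus> b \<otimes> c' \<ominus> \<one> = (a \<ominus> \<one>) \<otimes> a' \<oplus> b \<otimes> c' \<oplus> (a' \<ominus> \<one>)" using gc hc by algebra
  moreover have "av (c \<otimes> b' \<oplus> (d \<ominus> \<one>) \<otimes> d' \<oplus> (d' \<ominus> \<one>)) < e"
    using gc hc ng nh b1 by (intro av_add_less prod) auto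
  moreover have "c \<otimes> b' \<oplus> d \<otimes> d' \<ominus> \<one> = c \<otimes> b' \<oplus> (d \<ominus> \<one>) \<otimes> d' \<oplus> (d' \<ominus> \<one>)" using gc hc by algebra
  moreover have "av (a \<otimes> b' \<oplus> b \<otimes> d') < e" using gc hc ng nh b1 by (intro av_add_less prod prod'[of a b']) auto
  moreover have "av (c \<otimes> a' \<oplus> d \<otimes> c') < e" using gc hc ng nh b1 by (intro av_add_less prod prod'[of d c']) auto
  ultimately have "near e \<one>\<^bsub>S\<^esub> (g \<otimes>\<^bsub>S\<^esub> h)" using gc hc by (simp add: g' h' SL2_one SL2_mult near_def z)
  then show "g \<otimes>\<^bsub>S\<^esub> h \<in> ?K" using g h by simp
qed

lemma Tp_second_countable: "second_countable Tp"
proof -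
  obtain D where D: "countable D" "D \<subseteq> carrier R" "\<And>x e. x \<in> carrier R \<Longrightarrow> 0 < e \<Longrightarrow> \<exists>d\<in>D. av (x \<ominus> d) < e"
    using separable by blast
  define B where "B = (\<lambda>(r, n). ball r (1 / real (Suc n))) ` ((D \<times> D \<times> D \<times> D) \<times> UNIV)"
  show ?thesis
    unfolding second_countable_def
  proof (intro exI[of _ B] conjI ballI allI impI)
    show "countable B" unfolding B_def using D(1) by (intro countable_image countable_SIGMA) auto
    show "openin Tp V" if "V \<in> B" for V
      using that D(2) unfolding B_def openin_Tp by (auto intro!: popen_ball)
    fix U x assume "openin Tp U \<and> x \<in> U"
    then have U: "popen U" and x: "x \<in> U" by (auto simp: openin_Tp)
    then obtain g where g: "g \<in> carrier S" "x = \<pi> g" by (auto simp: popen_def P_carrier)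
    obtain e where e: "0 < e" "\<forall>h\<in>carrier S. near e g h \<longrightarrow> \<pi> h \<in> U" using U x g unfolding popen_def by blast
    obtain n where n: "1 / real (Suc n) < e" using e(1) reals_Archimedean by (auto simp: inverse_eq_divide)
    let ?n = "1 / real (Suc n)"
    obtain a b c d where g': "g = (a, b, c, d)" and gc: "a \<in> carrier R" "b \<in> carrier R" "c \<in> carrier R" "d \<in> carrier R"
      using g(1) by (rule SL2_cases)
    obtain a' b' c' d' where r: "a' \<in> D" "b' \<in> D" "c' \<in> D" "d' \<in> D"
      "av (a \<ominus> a') < ?n" "av (b \<ominus> b') < ?n" "av (c \<ominus> c') < ?n" "av (d \<ominus> d') < ?n"
      using D(3)[OF gc(1), of ?n] D(3)[OF gc(2), of ?n] D(3)[OF gc(3), of ?n] D(3)[OF gc(4), of ?n] by auto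
    let ?r = "(a', b', c', d')"
    have rR: "?r \<in> R4" using r D(2) by auto
    have nr: "near ?n ?r g" using r by (simp add: near_def g')
    have "ball ?r ?n \<subseteq> U"
    proof
      fix y assume "y \<in> ball ?r ?n"
      then obtain h where h: "h \<in> carrier S" "near ?n ?r h" "y = \<pi> h" by (auto simp: ball_def)
      have "near ?n g h"
        using near_trans[OF S_R4[OF g(1)] rR S_R4[OF h(1)]] near_sym[OF rR S_R4[OF g(1)] nr] h(2) by blast
      then have "near e g h" by (rule near_mono) (use n in simp)
      then show "y \<in> U" using e(2) h by blast
    qed
    moreover have "x \<in> ball ?r ?n" using g nr by (auto simp: ball_def)
    moreover have "ball ?r ?n \<in> B"
      unfolding B_def using r by (intro image_eqI[of _ _ "(?r, n)"]) auto
    ultimately show "\<exists>V\<in>B. x \<in> V \<and> V \<subseteq> U" by blast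
  qed
qed

lemma popenD:
  assumes "popen U" "g \<in> carrier S" "\<pi> g \<in> U"
  obtains e where "0 < e" "\<And>h. h \<in> carrier S \<Longrightarrow> near e g h \<Longrightarrow> \<pi> h \<in> U"
  using assms unfolding popen_def by blast

sublocale nonarch: nonarch_group P Tp
proof unfold_locales
  show "topspace Tp = carrier P" by (rule topspace_Tp)
  show "second_countable Tp" by (rule Tp_second_countable)
  fix U assume "openin Tp U"
  then have U: "popen U" by (simp add: openin_Tp)
  show "openin Tp {x \<in> carrier P. inv\<^bsub>P\<^esub> x \<in> U}"
    unfolding openin_Tp popen_def
  proof (intro conjI ballI impI)
    fix g assume g: "g \<in> carrier S" "\<pi> g \<in> {x \<in> carrier P. inv\<^bsub>P\<^esub> x \<in> U}"
    then have "\<pi> (inv\<^bsub>S\<^esub> g) \<in> U" by simp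
    from popenD[OF U S.inv_closed[OF g(1)] this]
    obtain e where e: "0 < e" "\<And>h. h \<in> carrier S \<Longrightarrow> near e (inv\<^bsub>S\<^esub> g) h \<Longrightarrow> \<pi> h \<in> U" by blast
    have "inv\<^bsub>P\<^esub> (\<pi> h) \<in> U" if "h \<in> carrier S" "near e g h" for h
      using e(2)[OF _ near_inv[OF g(1) that]] that by simp
    then show "\<exists>e>0. \<forall>h\<in>carrier S. near e g h \<longrightarrow> \<pi> h \<in> {x \<in> carrier P. inv\<^bsub>P\<^esub> x \<in> U}"
      using e(1) by auto
  qed auto
  show "\<exists>V W. openin Tp V \<and> openin Tp W \<and> x \<in> V \<and> y \<in> W \<and> (\<forall>v\<in>V. \<forall>w\<in>W. v \<otimes>\<^bsub>P\<^esub> w \<in> U)"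
    if xy: "x \<in> carrier P" "y \<in> carrier P" "x \<otimes>\<^bsub>P\<^esub> y \<in> U" for x y
  proof -
    obtain g h where gh: "g \<in> carrier S" "x = \<pi> g" "h \<in> carrier S" "y = \<pi> h" using xy by (auto simp: P_carrier)
    have "\<pi> (g \<otimes>\<^bsub>S\<^esub> h) \<in> U" using xy gh by simp
    from popenD[OF U S.m_closed[OF gh(1,3)] this]
    obtain e where e: "0 < e" "\<And>k. k \<in> carrier S \<Longrightarrow> near e (g \<otimes>\<^bsub>S\<^esub> h) k \<Longrightarrow> \<pi> k \<in> U" by blast
    obtain \<delta> where \<delta>: "0 < \<delta>" "\<And>v w. v \<in> carrier S \<Longrightarrow> w \<in> carrier S \<Longrightarrow> near \<delta> g v \<Longrightarrow> near \<delta> h w \<Longrightarrow>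
        near e (g \<otimes>\<^bsub>S\<^esub> h) (v \<otimes>\<^bsub>S\<^esub> w)" by (rule near_mult[OF gh(1,3) e(1)]) (rule that)
    have "v \<otimes>\<^bsub>P\<^esub> w \<in> U" if vw: "v \<in> ball g \<delta>" "w \<in> ball h \<delta>" for v w
    proof -
      obtain v' w' where "v' \<in> carrier S" "near \<delta> g v'" "v = \<pi> v'" "w' \<in> carrier S" "near \<delta> h w'" "w = \<pi> w'"
        using vw by (auto simp: ball_def)
      then show ?thesis using e(2)[OF _ \<delta>(2)[of v' w']] by simp
    qed
    moreover have "x \<in> ball g \<delta>" "y \<in> ball h \<delta>"
      using gh near_refl[OF S_R4 \<delta>(1)] by (auto simp: ball_def)
    ultimately show ?thesis
      using popen_ball[OF S_R4[OF gh(1)]] popen_ball[OF S_R4[OF gh(3)]] unfolding openin_Tp by blast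
  qed
  show "\<exists>K. subgroup K P \<and> openin Tp K \<and> K \<subseteq> U" if one: "\<one>\<^bsub>P\<^esub> \<in> U"
  proof -
    have "\<pi> \<one>\<^bsub>S\<^esub> \<in> U" using one by simp
    from popenD[OF U S.one_closed this]
    obtain e where e: "0 < e" "\<And>k. k \<in> carrier S \<Longrightarrow> near e \<one>\<^bsub>S\<^esub> k \<Longrightarrow> \<pi> k \<in> U" by blast
    define e' where "e' = min e 1"
    have e': "0 < e'" "e' \<le> 1" "e' \<le> e" using e(1) by (auto simp: e'_def)
    have "subgroup (ball \<one>\<^bsub>S\<^esub> e') P" unfolding ball_def by (intro \<pi>_subgroup congruence_subgroup e')
    moreover have "ball \<one>\<^bsub>S\<^esub> e' \<subseteq> U" using e(2) near_mono[OF _ e'(3)] unfolding ball_def by blast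
    ultimately show ?thesis using popen_ball[OF S_R4[OF S.one_closed]] unfolding openin_Tp by blast
  qed
qed

text \<open>A point of the quotient is a pair, so g has to be separated from both h and -h.
  Ultrametric balls with a common point would make g near one of these two, so the balls of the
  separating radius are disjoint.\<close>

lemma Tp_Hausdorff: "Hausdorff_space Tp"
  unfolding Hausdorff_space_def
proof (intro allI impI)
  fix x y assume xy: "x \<in> topspace Tp \<and> y \<in> topspace Tp \<and> x \<noteq> y"
  then obtain g h where g: "g \<in> carrier S" "x = \<pi> g" and h: "h \<in> carrier S" "y = \<pi> h"
    unfolding topspace_Tp P_carrier by blast
  have sep: "\<exists>e>0. \<not> near e g k" if k: "k \<in> carrier S" "k \<noteq> g" for k
  proof (rule ccontr)
    assume all: "\<not> ?thesis"
    obtain a b c d where g': "g = (a, b, c, d)" and gc: "a \<in> carrier R" "b \<in> carrier R" "c \<in> carrier R" "d \<in> carrier R"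
      using g(1) by (rule SL2_cases)
    obtain a' b' c' d' where k': "k = (a', b', c', d')" and
      kc: "a' \<in> carrier R" "b' \<in> carrier R" "c' \<in> carrier R" "d' \<in> carrier R"
      using k(1) by (rule SL2_cases)
    have eq: "r = s" if "r \<in> carrier R" "s \<in> carrier R" "\<And>e. 0 < e \<Longrightarrow> av (r \<ominus> s) < e" for r s
    proof -
      have "av (r \<ominus> s) = 0" using that(3)[of "av (r \<ominus> s)"] av_nonneg[of "r \<ominus> s"] that(1,2) by fastforce
      then have "r \<ominus> s = \<zero>" using av_eq_0[of "r \<ominus> s"] that by simp
      moreover have "r = (r \<ominus> s) \<oplus> s" using that(1,2) by algebra
      ultimately show ?thesis using that by simp
    qed
    have "near e g k" if "0 < e" for e using all that by blast
    then have "a' = a" "b' = b" "c' = c" "d' = d" using gc kc by (auto simp: near_def g' k' intro!: eq)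
    then show False using k(2) g' k' by simp
  qed
  have "h \<noteq> g" "neg h \<noteq> g" using xy g h \<pi>_neg[OF h(1)] by auto
  then obtain e1 e2 where e: "e1 > 0" "\<not> near e1 g h" "e2 > 0" "\<not> near e2 g (neg h)"
    using sep[OF h(1)] sep[OF neg_closed[OF h(1)]] by blast
  define e where "e = min e1 e2"
  have e0: "0 < e" "\<not> near e g h" "\<not> near e g (neg h)" using e near_mono[of e g h e1] near_mono[of e g "neg h" e2]
    by (auto simp: e_def)
  have "disjnt (ball g e) (ball h e)"
    unfolding disjnt_def
  proof (rule equals0I)
    fix z assume "z \<in> ball g e \<inter> ball h e"
    then obtain v w where v: "v \<in> carrier S" "near e g v" "z = \<pi> v" and w: "w \<in> carrier S" "near e h w" "z = \<pi> w"
      by (auto simp: ball_def)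
    have "v = w \<or> v = neg w" using \<pi>_eq_iff[OF w(1) v(1)] v w by auto
    then show False
    proof
      assume "v = w"
      then show False using near_trans[OF S_R4[OF g(1)] S_R4[OF v(1)] S_R4[OF h(1)] v(2)]
          near_sym[OF S_R4[OF h(1)] S_R4[OF w(1)] w(2)] e0 by blast
    next
      assume vn: "v = neg w"
      have "near e (neg h) v" using near_neg[OF h(1) w(1,2)] vn by simp
      then show False using near_trans[OF S_R4[OF g(1)] S_R4[OF v(1)] S_R4[OF neg_closed[OF h(1)]] v(2)]
          near_sym[OF S_R4[OF neg_closed[OF h(1)]] S_R4[OF v(1)]] e0 by blast
    qed
  qed
  moreover have "x \<in> ball g e" "y \<in> ball h e"
    using g h near_refl[OF S_R4 e0(1)] by (auto simp: ball_def)
  ultimately show "\<exists>U V. openin Tp U \<and> openin Tp V \<and> x \<in> U \<and> y \<in> V \<and> disjnt U V"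
    using popen_ball[OF S_R4[OF g(1)]] popen_ball[OF S_R4[OF h(1)]] unfolding openin_Tp by blast
qed

end

subsection \<open>Quotient topologies on \<open>PSL\<^sub>2\<close>\<close>

context valued_field
begin

lemma P_mem:
  assumes "X \<in> carrier P" "z \<in> X"
  shows "z \<in> carrier S" "X = \<pi> z"
proof -
  obtain g where g: "g \<in> carrier S" "X = \<pi> g" using assms(1) by (auto simp: P_carrier)
  then have "z = g \<or> z = neg g" using assms(2) by (simp only: \<pi>_eq) blast
  then show "z \<in> carrier S" "X = \<pi> z" using g neg_closed \<pi>_neg by metis+
qed

lemma \<pi>_self: "g \<in> carrier S \<Longrightarrow> g \<in> \<pi> g"
  by (simp add: \<pi>_eq)

text \<open>Distinct cosets are disjoint, so U \<mapsto> \<Union>U respects intersections and the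
  predicate in \<open>PSL2_top\<close> does define a topology.\<close>

lemma openin_PSL2_top:
  "openin (PSL2_top R T) U \<longleftrightarrow> U \<subseteq> carrier P \<and> openin (SL2_top R T) (\<Union>U)"
proof -
  have "istopology (\<lambda>U. U \<subseteq> carrier P \<and> openin (SL2_top R T) (\<Union>U))"
    unfolding istopology_def
  proof (intro conjI allI impI)
    fix U V assume U: "U \<subseteq> carrier P \<and> openin (SL2_top R T) (\<Union>U)"
      and V: "V \<subseteq> carrier P \<and> openin (SL2_top R T) (\<Union>V)"
    then have "\<Union>(U \<inter> V) = \<Union>U \<inter> \<Union>V" using P_mem(2) by blast
    then show "openin (SL2_top R T) (\<Union>(U \<inter> V))" using U V by auto
    show "U \<inter> V \<subseteq> carrier P" using U by blast
  next
    fix K assume K: "\<forall>U\<in>K. U \<subseteq> carrier P \<and> openin (SL2_top R T) (\<Union>U)"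
    then show "\<Union>K \<subseteq> carrier P" by blast
    have "\<Union>(\<Union>K) = (\<Union>U\<in>K. \<Union>U)" by blast
    then show "openin (SL2_top R T) (\<Union>(\<Union>K))" using K by auto
  qed
  then show ?thesis by (simp add: PSL2_top_def topology_inverse')
qed

section \<open>Transposition and the sigma-algebra of the Haar measure\<close>

definition tr :: "'a mat2 \<Rightarrow> 'a mat2" where
  "tr g = (case g of (a, b, c, d) \<Rightarrow> (a, c, b, d))"

lemma tr_tr [simp]: "tr (tr g) = g"
  by (cases g) (simp add: tr_def)

lemma tr_closed: "g \<in> carrier S \<Longrightarrow> tr g \<in> carrier S"
  by (auto elim!: SL2_cases simp: tr_def SL2_carrier m_comm)

lemma tr_mult: "g \<in> carrier S \<Longrightarrow> h \<in> carrier S \<Longrightarrow> tr (g \<otimes>\<^bsub>S\<^esub> h) = tr h \<otimes>\<^bsub>S\<^esub> tr g"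
  by (auto elim!: SL2_cases simp: tr_def SL2_mult m_comm)

lemma tr_neg: "tr (neg g) = neg (tr g)"
  by (cases g) (simp add: tr_def neg_def)

lemma tr_\<pi>: "g \<in> carrier S \<Longrightarrow> tr ` \<pi> g = \<pi> (tr g)"
  by (simp add: \<pi>_eq tr_closed tr_neg)

text \<open>Transposition merely permutes coordinates, so it is continuous whatever the topology on
  the field, unlike maps that involve the field operations.\<close>

lemma continuous_tr: "continuous_map (SL2_top R T) (SL2_top R T) tr"
  unfolding SL2_top_def
proof (rule continuous_map_into_subtopology)
  let ?X = "prod_topology T (prod_topology T (prod_topology T T))"
  have "tr = (\<lambda>x. (fst x, fst (snd (snd x)), fst (snd x), snd (snd (snd x))))"
    by (auto simp: tr_def fun_eq_iff split: prod.split)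
  moreover have "continuous_map ?X ?X (\<lambda>x. (fst x, fst (snd (snd x)), fst (snd x), snd (snd (snd x))))"
    using continuous_map_fst[of T "prod_topology T (prod_topology T T)"]
      continuous_map_compose[OF continuous_map_snd continuous_map_fst, of T T "prod_topology T T"]
      continuous_map_compose[OF continuous_map_snd continuous_map_compose[OF continuous_map_snd continuous_map_fst], of T T T T]
      continuous_map_compose[OF continuous_map_snd continuous_map_compose[OF continuous_map_snd continuous_map_snd], of T T T T]
    by (intro continuous_map_pairedI) (simp_all add: comp_def)
  ultimately show "continuous_map (subtopology ?X (carrier S)) ?X tr"
    by (simp add: continuous_map_from_subtopology)
  show "tr \<in> topspace (subtopology ?X (carrier S)) \<rightarrow> carrier S" using tr_closed by auto
qed

lemma tr_P: "X \<in> carrier P \<Longrightarrow> tr ` X \<in> carrier P"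
  using tr_closed by (auto simp: P_carrier tr_\<pi>)

lemma tr_tr_P: "tr ` tr ` X = X"
  by (simp add: image_comp comp_def)

lemma tr_P_mult: "X \<in> carrier P \<Longrightarrow> Y \<in> carrier P \<Longrightarrow> tr ` (X \<otimes>\<^bsub>P\<^esub> Y) = (tr ` Y) \<otimes>\<^bsub>P\<^esub> (tr ` X)"
proof -
  assume "X \<in> carrier P" "Y \<in> carrier P"
  then obtain g h where "g \<in> carrier S" "X = \<pi> g" "h \<in> carrier S" "Y = \<pi> h" unfolding P_carrier by blast
  then show ?thesis by (simp add: tr_\<pi> tr_closed tr_mult flip: \<pi>.hom_mult)
qed

lemma PSL2_top_tr:
  assumes U: "openin (PSL2_top R T) U"
  shows "openin (PSL2_top R T) {X \<in> carrier P. tr ` X \<in> U}"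
proof -
  have UP: "U \<subseteq> carrier P" and o: "openin (SL2_top R T) (\<Union>U)" using U by (simp_all add: openin_PSL2_top)
  have "\<Union>{X \<in> carrier P. tr ` X \<in> U} = {z \<in> topspace (SL2_top R T). tr z \<in> \<Union>U}"
  proof (intro equalityI subsetI)
    fix z assume "z \<in> \<Union>{X \<in> carrier P. tr ` X \<in> U}"
    then have tz: "tr z \<in> \<Union>U" by blast
    then have "tr z \<in> topspace (SL2_top R T)" using openin_subset[OF o] by blast
    then have "tr (tr z) \<in> topspace (SL2_top R T)" using continuous_map_funspace[OF continuous_tr] by blast
    then show "z \<in> {z \<in> topspace (SL2_top R T). tr z \<in> \<Union>U}" using tz by simp
  next
    fix z assume z: "z \<in> {z \<in> topspace (SL2_top R T). tr z \<in> \<Union>U}"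
    then obtain X where X: "X \<in> U" "tr z \<in> X" by blast
    then have "z \<in> tr ` X" by (metis image_eqI tr_tr)
    moreover have "tr ` X \<in> carrier P" using X UP tr_P by blast
    moreover have "tr ` tr ` X \<in> U" unfolding tr_tr_P by (rule X(1))
    ultimately show "z \<in> \<Union>{X \<in> carrier P. tr ` X \<in> U}" by blast
  qed
  then show ?thesis
    using openin_continuous_map_preimage[OF continuous_tr o] by (simp add: openin_PSL2_top)
qed

lemma sigma_sets_tr:
  assumes "E \<in> sigma_sets (carrier P) {U. openin (PSL2_top R T) U}"
  shows "{X \<in> carrier P. tr ` X \<in> E} \<in> sigma_sets (carrier P) {U. openin (PSL2_top R T) U}"
  using assms
proof induction
  case (Basic U)
  then show ?case by (intro sigma_sets.Basic) (simp add: PSL2_top_tr)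
next
  case Empty
  then show ?case by (simp add: sigma_sets.Empty)
next
  case (Compl E)
  have "{X \<in> carrier P. tr ` X \<in> carrier P - E} = carrier P - {X \<in> carrier P. tr ` X \<in> E}"
    using tr_P by blast
  then show ?case using sigma_sets.Compl[OF Compl.IH] by simp
next
  case (Union E)
  have "{X \<in> carrier P. tr ` X \<in> \<Union>(range E)} = (\<Union>i. {X \<in> carrier P. tr ` X \<in> E i})" by blast
  then show ?case using sigma_sets.Union[OF Union.IH] by simp
qed

context
  fixes T :: "'a topology" and \<mu> :: "'a mat2 set measure"
  assumes haar: "haar_measure P (PSL2_top R T) \<mu>"
begin

lemma sets_tr: "E \<in> sets \<mu> \<Longrightarrow> {X \<in> carrier P. tr ` X \<in> E} \<in> sets \<mu>"
  using haar sigma_sets_tr[of E T] unfolding haar_measure_def by simp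

lemma sets_left: "x \<in> carrier P \<Longrightarrow> E \<in> sets \<mu> \<Longrightarrow> {y \<in> carrier P. x \<otimes>\<^bsub>P\<^esub> y \<in> E} \<in> sets \<mu>"
  by (rule P.haar_left_sets[OF haar])

text \<open>Transposition reverses products and thus turns left translations, which preserve the
  \<sigma>-algebra, into right ones.\<close>

lemma sets_right:
  assumes x: "x \<in> carrier P" and E: "E \<in> sets \<mu>"
  shows "{y \<in> carrier P. y \<otimes>\<^bsub>P\<^esub> x \<in> E} \<in> sets \<mu>"
proof -
  let ?F = "{y \<in> carrier P. tr ` x \<otimes>\<^bsub>P\<^esub> y \<in> {y \<in> carrier P. tr ` y \<in> E}}"
  have "{y \<in> carrier P. y \<otimes>\<^bsub>P\<^esub> x \<in> E} = {y \<in> carrier P. tr ` y \<in> ?F}"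
    using x by (intro Collect_cong conj_cong refl) (simp add: tr_P tr_P_mult tr_tr_P)
  then show ?thesis using sets_tr[OF sets_left[OF tr_P[OF x] sets_tr[OF E]]] by simp
qed

text \<open>The inverse of a matrix of determinant 1 is conjugate to its transpose by a fixed matrix.\<close>

lemma sets_inv:
  assumes E: "E \<in> sets \<mu>"
  shows "{y \<in> carrier P. inv\<^bsub>P\<^esub> y \<in> E} \<in> sets \<mu>"
proof -
  let ?w = "(\<zero>, \<ominus> \<one>, \<one>, \<zero>)"
  have w: "?w \<in> carrier S" by (simp add: SL2_carrier a_minus_def)
  have iw: "inv\<^bsub>S\<^esub> ?w = (\<zero>, \<one>, \<ominus> \<one>, \<zero>)" using w by (simp add: SL2_inv)
  have tr_inv: "inv\<^bsub>S\<^esub> g = inv\<^bsub>S\<^esub> ?w \<otimes>\<^bsub>S\<^esub> tr g \<otimes>\<^bsub>S\<^esub> ?w" if g: "g \<in> carrier S" for g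
  proof -
    obtain a b c d where g': "g = (a, b, c, d)" and gc: "a \<in> carrier R" "b \<in> carrier R" "c \<in> carrier R" "d \<in> carrier R"
      using g by (rule SL2_cases)
    show ?thesis unfolding iw using g gc by (simp add: g' SL2_inv tr_def SL2_mult l_minus r_minus)
  qed
  let ?W = "\<pi> ?w"
  define V where "V = inv\<^bsub>P\<^esub> ?W"
  have W: "?W \<in> carrier P" "V \<in> carrier P" using w by (simp_all add: V_def del: \<pi>.hom_inv)
  have inv: "inv\<^bsub>P\<^esub> y = V \<otimes>\<^bsub>P\<^esub> (tr ` y) \<otimes>\<^bsub>P\<^esub> ?W" if y: "y \<in> carrier P" for y
  proof -
    obtain g where g: "g \<in> carrier S" "y = \<pi> g" using y unfolding P_carrier by blast
    then have "inv\<^bsub>P\<^esub> y = \<pi> (inv\<^bsub>S\<^esub> ?w \<otimes>\<^bsub>S\<^esub> tr g \<otimes>\<^bsub>S\<^esub> ?w)"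
      using tr_inv[OF g(1)] by (simp only: \<pi>.hom_inv[symmetric])
    then show ?thesis using g w by (simp add: V_def tr_\<pi> tr_closed)
  qed
  let ?F = "{y \<in> carrier P. V \<otimes>\<^bsub>P\<^esub> y \<in> {y \<in> carrier P. y \<otimes>\<^bsub>P\<^esub> ?W \<in> E}}"
  have "{y \<in> carrier P. inv\<^bsub>P\<^esub> y \<in> E} = {y \<in> carrier P. tr ` y \<in> ?F}"
    using W by (intro Collect_cong conj_cong refl) (simp add: tr_P inv)
  then show ?thesis using sets_tr[OF sets_left[OF W(2) sets_right[OF W(1) E]]] by simp
qed

end

end

section \<open>Measurability of the valuation topology for the Haar measure\<close>

context valued_field
begin

lemma bounded_part_neg: "g \<in> bounded_part B \<Longrightarrow> neg g \<in> bounded_part B"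
  using neg_closed[of g] by (cases g) (auto simp: bounded_part_iff neg_def SL2_carrier)

lemma \<pi>_bounded_part: "g \<in> carrier S \<Longrightarrow> \<pi> g \<in> \<pi> ` bounded_part B \<longleftrightarrow> g \<in> bounded_part B"
proof
  assume g: "g \<in> carrier S" "\<pi> g \<in> \<pi> ` bounded_part B"
  then obtain h where h: "h \<in> bounded_part B" "\<pi> g = \<pi> h" by blast
  then have "h \<in> carrier S" by (simp add: bounded_part_def)
  then show "g \<in> bounded_part B" using \<pi>_eq_iff[of h g] g(1) h bounded_part_neg[OF h(1)] by metis
qed simp

lemma bounded_part_open:
  assumes B: "0 < B"
  shows "openin Tp (\<pi> ` bounded_part B)"
  unfolding openin_Tp popen_def
proof (intro conjI ballI impI)
  show "\<pi> ` bounded_part B \<subseteq> carrier P" by (auto simp: P_carrier bounded_part_def)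
  fix g assume g: "g \<in> carrier S" "\<pi> g \<in> \<pi> ` bounded_part B"
  then have gB: "g \<in> bounded_part B" by (simp add: \<pi>_bounded_part)
  define e where "e = min 1 (min B (1 / B))"
  have e: "0 < e" "e \<le> 1" "e \<le> B" "e \<le> 1 / B" using B by (auto simp: e_def)
  have "h \<in> bounded_part B" if h: "h \<in> carrier S" "near e g h" for h
  proof -
    have le: "av y \<le> r" if "x \<in> carrier R" "y \<in> carrier R" "av x \<le> r" "av (y \<ominus> x) < e" "e \<le> r" for x y r
    proof -
      have "y = (y \<ominus> x) \<oplus> x" using that by algebra
      then show ?thesis using that av_add_le[of "y \<ominus> x" x r] by simp
    qed
    obtain a b c d where g': "g = (a, b, c, d)" and gc: "a \<in> carrier R" "b \<in> carrier R" "c \<in> carrier R" "d \<in> carrier R"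
      using g(1) by (rule SL2_cases)
    obtain a' b' c' d' where h': "h = (a', b', c', d')" and
      hc: "a' \<in> carrier R" "b' \<in> carrier R" "c' \<in> carrier R" "d' \<in> carrier R"
      using h(1) by (rule SL2_cases)
    have n: "av (a' \<ominus> a) < e" "av (b' \<ominus> b) < e" "av (c' \<ominus> c) < e" "av (d' \<ominus> d) < e"
      using h(2) by (simp_all add: near_def g' h')
    have b: "av a \<le> 1" "av b \<le> B" "av c \<le> 1 / B" "av d \<le> 1" using gB by (simp_all add: g' bounded_part_iff)
    show ?thesis unfolding h' bounded_part_iff
      using le[OF gc(1) hc(1) b(1) n(1) e(2)] le[OF gc(2) hc(2) b(2) n(2) e(3)]
        le[OF gc(3) hc(3) b(3) n(3) e(4)] le[OF gc(4) hc(4) b(4) n(4) e(2)] h(1) h' by simp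
  qed
  then show "\<exists>e>0. \<forall>h\<in>carrier S. near e g h \<longrightarrow> \<pi> h \<in> \<pi> ` bounded_part B" using e(1) by blast
qed

lemma gelfand_PSL2:
  assumes "x \<in> carrier P"
  shows "\<exists>k1\<in>\<pi> ` S0. \<exists>k2\<in>\<pi> ` S0. inv\<^bsub>P\<^esub> x = k1 \<otimes>\<^bsub>P\<^esub> x \<otimes>\<^bsub>P\<^esub> k2"
proof -
  obtain g where g: "g \<in> carrier S" "x = \<pi> g" using assms unfolding P_carrier by blast
  obtain k1 k2 where k: "k1 \<in> S0" "k2 \<in> S0" "inv\<^bsub>S\<^esub> g = k1 \<otimes>\<^bsub>S\<^esub> g \<otimes>\<^bsub>S\<^esub> k2" using gelfand_SL2[OF g(1)] by blast
  have "inv\<^bsub>P\<^esub> x = \<pi> (k1 \<otimes>\<^bsub>S\<^esub> g \<otimes>\<^bsub>S\<^esub> k2)" using g k(3) by (simp flip: \<pi>.hom_inv)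
  also have "\<dots> = \<pi> k1 \<otimes>\<^bsub>P\<^esub> x \<otimes>\<^bsub>P\<^esub> \<pi> k2" using g k(1,2)[THEN S0_carrier] by simp
  finally show ?thesis using k by blast
qed

lemma av_pow: "x \<in> carrier R \<Longrightarrow> av (x [^] (n::nat)) = av x ^ n"
  by (induction n) (simp_all add: av_mult mult.commute)

lemma small_element:
  assumes "0 < e"
  obtains s where "s \<in> carrier R" "s \<noteq> \<zero>" "av s \<le> 1" "av s < e"
proof -
  obtain x where x: "x \<in> carrier R" "av x = 1 / Q" using uniformizer by blast
  obtain n where n: "(1 / Q) ^ n < e" using real_arch_pow_inv[OF assms, of "1 / Q"] Q_gt_1 by auto
  have "av (x [^] n) = (1 / Q) ^ n" using x by (simp add: av_pow)
  moreover have "(1 / Q) ^ n \<le> 1" "0 < (1 / Q) ^ n" using Q_gt_1 by (auto intro!: power_le_one)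
  ultimately have "x [^] n \<noteq> \<zero>" "av (x [^] n) \<le> 1" "av (x [^] n) < e" using n Q_gt_1 by (auto simp: av_zero)
  then show thesis using that[of "x [^] n"] x(1) by simp
qed

text \<open>Conjugation by A multiplies the lower left entry by s^(-2), conjugation by B the upper
  right one, and conjugation by C makes the upper right entry s^(-2) (d - a + b - c). Integrality of
  the three conjugates therefore bounds c, b and d - a.\<close>

lemma SL2_conj_bound:
  assumes g: "g = (a, b, c, d)" "(a, b, c, d) \<in> S0" and s: "s \<in> carrier R" "s \<noteq> \<zero>"
    and A: "A = (s, \<zero>, \<zero>, inv s)" and B: "B = (inv s, \<zero>, \<zero>, s)" and C: "C = (inv s, inv s, \<zero>, s)"
    and conj: "A \<otimes>\<^bsub>S\<^esub> g \<otimes>\<^bsub>S\<^esub> inv\<^bsub>S\<^esub> A \<in> S0" "B \<otimes>\<^bsub>S\<^esub> g \<otimes>\<^bsub>S\<^esub> inv\<^bsub>S\<^esub> B \<in> S0" "C \<otimes>\<^bsub>S\<^esub> g \<otimes>\<^bsub>S\<^esub> inv\<^bsub>S\<^esub> C \<in> S0"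
  shows "av b \<le> (av s)\<^sup>2" "av c \<le> (av s)\<^sup>2" "av (d \<ominus> a) \<le> (av s)\<^sup>2"
proof -
  note i = inv_facts[OF s]
  define t where "t = inv s"
  have t: "t \<in> carrier R" "s \<otimes> t = \<one>" "av t = 1 / av s" using i by (simp_all add: t_def)
  have gc: "a \<in> carrier R" "b \<in> carrier R" "c \<in> carrier R" "d \<in> carrier R"
    using g S0_carrier by (auto simp: SL2_carrier bounded_part_iff)
  have mem: "A \<in> carrier S" "B \<in> carrier S" "C \<in> carrier S"
    using s t by (simp_all add: A B C SL2_carrier a_minus_def m_comm flip: t_def)
  have le: "av x \<le> (av s)\<^sup>2" if "x \<in> carrier R" "av (x \<otimes> t \<otimes> t) \<le> 1" for x
    using that t i(5) by (simp add: av_mult divide_le_eq power2_eq_square)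
  have iA: "inv\<^bsub>S\<^esub> A = (t, \<zero>, \<zero>, s)" "inv\<^bsub>S\<^esub> B = (s, \<zero>, \<zero>, t)" "inv\<^bsub>S\<^esub> C = (s, \<ominus> t, \<zero>, t)"
    using mem s t by (simp_all add: A B C SL2_inv flip: t_def)
  have "\<exists>x y z. A \<otimes>\<^bsub>S\<^esub> g \<otimes>\<^bsub>S\<^esub> inv\<^bsub>S\<^esub> A = (x, y, c \<otimes> t \<otimes> t, z)"
    unfolding iA using gc s t by (simp add: A g SL2_mult m_comm m_assoc flip: t_def)
  then show c: "av c \<le> (av s)\<^sup>2" using conj(1) gc by (auto simp: bounded_part_iff intro!: le)
  have "\<exists>x y z. B \<otimes>\<^bsub>S\<^esub> g \<otimes>\<^bsub>S\<^esub> inv\<^bsub>S\<^esub> B = (x, b \<otimes> t \<otimes> t, y, z)"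
    unfolding iA using gc s t by (simp add: B g SL2_mult m_comm m_assoc flip: t_def)
  then show b: "av b \<le> (av s)\<^sup>2" using conj(2) gc by (auto simp: bounded_part_iff intro!: le)
  have e: "(t \<otimes> a \<oplus> t \<otimes> c) \<otimes> \<ominus> t \<oplus> (t \<otimes> b \<oplus> t \<otimes> d) \<otimes> t = ((d \<ominus> a) \<oplus> (b \<ominus> c)) \<otimes> t \<otimes> t" using gc t(1) by algebra
  have "\<exists>x y z. C \<otimes>\<^bsub>S\<^esub> g \<otimes>\<^bsub>S\<^esub> inv\<^bsub>S\<^esub> C = (x, ((d \<ominus> a) \<oplus> (b \<ominus> c)) \<otimes> t \<otimes> t, y, z)"
    unfolding iA e[symmetric] by (simp add: C g SL2_mult flip: t_def)
  then have "av ((d \<ominus> a) \<oplus> (b \<ominus> c)) \<le> (av s)\<^sup>2" using conj(3) gc by (auto simp: bounded_part_iff intro!: le)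
  moreover have "d \<ominus> a = ((d \<ominus> a) \<oplus> (b \<ominus> c)) \<oplus> (c \<ominus> b)" using gc by algebra
  moreover have "av (c \<ominus> b) \<le> (av s)\<^sup>2" using av_minus[OF gc(3,2)] b c by simp
  ultimately show "av (d \<ominus> a) \<le> (av s)\<^sup>2"
    using av_add_le[of "(d \<ominus> a) \<oplus> (b \<ominus> c)" "c \<ominus> b" "(av s)\<^sup>2"] gc by simp
qed

text \<open>By \<open>a\<^sup>2 - 1 = a (a - d) + b c\<close> the product of \<open>a - 1\<close> and \<open>a + 1\<close> is small, and their difference is \<open>2\<close>.\<close>

lemma near_scalar:
  assumes g: "(a, b, c, d) \<in> S0" and r: "r < e * av (\<one> \<oplus> \<one>)" "0 < e"
    and b: "av b \<le> r" and c: "av c \<le> r" and da: "av (d \<ominus> a) \<le> r"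
  shows "near e \<one>\<^bsub>S\<^esub> (a, b, c, d) \<or> near e \<one>\<^bsub>S\<^esub> (neg (a, b, c, d))"
proof -
  have gc: "a \<in> carrier R" "b \<in> carrier R" "c \<in> carrier R" "d \<in> carrier R" and det: "a \<otimes> d \<ominus> b \<otimes> c = \<one>"
    and le: "av a \<le> 1" "av b \<le> 1"
    using g by (auto simp: SL2_carrier bounded_part_iff)
  define t where "t = av (\<one> \<oplus> \<one>)"
  have t: "0 < t" "t \<le> 1" "r < e * t"
    using inv_facts(5)[OF _ two] av_add_le[of \<one> \<one> 1] r by (simp_all add: t_def)
  have re: "r < e" using t r(2) mult_left_le[of t e] by linarith
  have r0: "0 \<le> r" using b gc(2) av_nonneg by (meson order_trans)
  have "(a \<ominus> \<one>) \<otimes> (a \<oplus> \<one>) = \<ominus> (a \<otimes> (d \<ominus> a)) \<oplus> b \<otimes> c \<oplus> (a \<otimes> d \<ominus> b \<otimes> c \<ominus> \<one>)" using gc by algebra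
  also have "\<dots> = \<ominus> (a \<otimes> (d \<ominus> a)) \<oplus> b \<otimes> c" using gc unfolding det by (simp add: a_minus_def r_neg)
  finally have eq: "(a \<ominus> \<one>) \<otimes> (a \<oplus> \<one>) = \<ominus> (a \<otimes> (d \<ominus> a)) \<oplus> b \<otimes> c" .
  have "av (\<ominus> (a \<otimes> (d \<ominus> a)) \<oplus> b \<otimes> c) \<le> r"
  proof (rule av_add_le)
    show "av (\<ominus> (a \<otimes> (d \<ominus> a))) \<le> r" using gc le(1) da mult_mono[of "av a" 1 "av (d \<ominus> a)" r] by (simp add: av_mult)
    show "av (b \<otimes> c) \<le> r" using gc le(2) c mult_mono[of "av b" 1 "av c" r] by (simp add: av_mult)
  qed (use gc in auto)
  then have prod: "av (a \<ominus> \<one>) * av (a \<oplus> \<one>) \<le> r" using gc by (simp add: eq flip: av_mult)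
  have small: "x < e" if "x * y \<le> r" "t \<le> y" "0 \<le> x" for x y
  proof -
    have "x * t \<le> x * y" using that by (intro mult_left_mono) auto
    then have "x * t < e * t" using that t(3) by linarith
    then show ?thesis using t(1) by simp
  qed
  have near1: "near e \<one>\<^bsub>S\<^esub> (a', b', c', d')"
    if "a' \<in> carrier R" "b' \<in> carrier R" "c' \<in> carrier R" "d' \<in> carrier R"
      "av (a' \<ominus> \<one>) < e" "av b' \<le> r" "av c' \<le> r" "av (d' \<ominus> a') \<le> r" for a' b' c' d'
    using that re av_sub_trans[of \<one> a' d' e] by (simp add: near_def SL2_one a_minus_def)
  have "\<one> \<oplus> \<one> = (a \<oplus> \<one>) \<ominus> (a \<ominus> \<one>)" using gc by algebra
  then have "t \<le> max (av (a \<oplus> \<one>)) (av (a \<ominus> \<one>))" using av_minus[of "a \<oplus> \<one>" "a \<ominus> \<one>"] gc by (simp add: t_def)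
  then consider "t \<le> av (a \<oplus> \<one>)" | "t \<le> av (a \<ominus> \<one>)" by linarith
  then show ?thesis
  proof cases
    case 1
    then have "av (a \<ominus> \<one>) < e" using small[OF prod] gc by simp
    then show ?thesis using near1[OF gc] b c da by simp
  next
    case 2
    then have "av (a \<oplus> \<one>) < e" using small[of "av (a \<oplus> \<one>)" "av (a \<ominus> \<one>)"] prod gc by (simp add: mult.commute)
    moreover have "\<ominus> a \<ominus> \<one> = \<ominus> (a \<oplus> \<one>)" "\<ominus> d \<ominus> \<ominus> a = \<ominus> (d \<ominus> a)" using gc by algebra+
    ultimately show ?thesis using near1[of "\<ominus> a" "\<ominus> b" "\<ominus> c" "\<ominus> d"] b c da gc by (simp add: neg_def)
  qed
qed

context
  fixes T :: "'a topology" and \<mu> :: "'a mat2 set measure"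
  assumes haar: "haar_measure P (PSL2_top R T) \<mu>" and \<mu>_\<Gamma>: "emeasure \<mu> (\<pi> ` S0) = 1"
begin

text \<open>The value 1 forces measurability, as sets outside the \<sigma>-algebra have
  \<open>emeasure\<close> 0.\<close>

lemma \<Gamma>_sets: "\<pi> ` S0 \<in> sets \<mu>"
  using emeasure_notin_sets[of "\<pi> ` S0" \<mu>] \<mu>_\<Gamma> by fastforce

text \<open>The normalisation makes \<Gamma> measurable, and translations make its conjugates so.
  Intersecting it with three of them leaves only matrices near 1 or -1, which gives arbitrarily
  small measurable neighbourhoods whatever the topology of the Haar measure is.\<close>

lemma Tp_base_sets:
  assumes U: "openin Tp U" "\<one>\<^bsub>P\<^esub> \<in> U"
  shows "\<exists>F. openin Tp F \<and> F \<in> sets \<mu> \<and> \<one>\<^bsub>P\<^esub> \<in> F \<and> F \<subseteq> U"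
proof -
  let ?\<Gamma> = "\<pi> ` S0"
  have "popen U" "\<pi> \<one>\<^bsub>S\<^esub> \<in> U" using U by (simp_all add: openin_Tp)
  from popenD[OF this(1) S.one_closed this(2)]
  obtain e where e: "0 < e" "\<And>h. h \<in> carrier S \<Longrightarrow> near e \<one>\<^bsub>S\<^esub> h \<Longrightarrow> \<pi> h \<in> U" by blast
  \<comment> \<open>The factor for 2 is the loss in \<open>near_scalar\<close>; the square of the
    size of s is below the bound as well because s is integral.\<close>
  have "0 < e * av (\<one> \<oplus> \<one>)" using e(1) inv_facts(5)[OF _ two] by simp
  then obtain s where s: "s \<in> carrier R" "s \<noteq> \<zero>" "av s \<le> 1" "av s < e * av (\<one> \<oplus> \<one>)" by (rule small_element)
  have s2: "(av s)\<^sup>2 < e * av (\<one> \<oplus> \<one>)"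
    using s(4) mult_left_le[OF s(3) av_nonneg[OF s(1)]] by (simp add: power2_eq_square)
  note i = inv_facts[OF s(1,2)]
  define A where "A = (s, \<zero>, \<zero>, inv s)"
  define B where "B = (inv s, \<zero>, \<zero>, s)"
  define C where "C = (inv s, inv s, \<zero>, s)"
  have mem: "A \<in> carrier S" "B \<in> carrier S" "C \<in> carrier S"
    using s i by (simp_all add: A_def B_def C_def SL2_carrier a_minus_def m_comm)
  define cj where "cj = (\<lambda>x. {y \<in> carrier P. x \<otimes>\<^bsub>P\<^esub> y \<otimes>\<^bsub>P\<^esub> inv\<^bsub>P\<^esub> x \<in> ?\<Gamma>})"
  have cj_eq: "cj x = {y \<in> carrier P. x \<otimes>\<^bsub>P\<^esub> y \<in> {z \<in> carrier P. z \<otimes>\<^bsub>P\<^esub> inv\<^bsub>P\<^esub> x \<in> ?\<Gamma>}}" if "x \<in> carrier P" for x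
    using that by (auto simp: cj_def)
  have \<Gamma>: "openin Tp ?\<Gamma>" by (rule bounded_part_open) simp
  have cj: "openin Tp (cj x)" "cj x \<in> sets \<mu>" "\<one>\<^bsub>P\<^esub> \<in> cj x" if x: "x \<in> carrier P" for x
  proof -
    show "openin Tp (cj x)" unfolding cj_eq[OF x]
      by (intro nonarch.left_open nonarch.right_open \<Gamma> x P.inv_closed)
    show "cj x \<in> sets \<mu>" unfolding cj_eq[OF x]
      by (intro sets_left[OF haar] sets_right[OF haar] \<Gamma>_sets x P.inv_closed)
    show "\<one>\<^bsub>P\<^esub> \<in> cj x" using x subgroup.one_closed[OF \<pi>_subgroup[OF S0_subgroup]] by (simp add: cj_def)
  qed
  define F where "F = ?\<Gamma> \<inter> cj (\<pi> A) \<inter> cj (\<pi> B) \<inter> cj (\<pi> C)"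
  have "F \<subseteq> U"
  proof
    fix X assume X: "X \<in> F"
    then obtain g where g: "g \<in> S0" "X = \<pi> g" unfolding F_def by blast
    have gS: "g \<in> carrier S" by (rule S0_carrier[OF g(1)])
    obtain a b c d where g': "g = (a, b, c, d)" by (cases g)
    have cjg: "x \<otimes>\<^bsub>S\<^esub> g \<otimes>\<^bsub>S\<^esub> inv\<^bsub>S\<^esub> x \<in> S0" if "x \<in> carrier S" "X \<in> cj (\<pi> x)" for x
    proof -
      have "\<pi> (x \<otimes>\<^bsub>S\<^esub> g \<otimes>\<^bsub>S\<^esub> inv\<^bsub>S\<^esub> x) \<in> ?\<Gamma>" using that gS by (simp add: cj_def g(2))
      then show ?thesis using that gS by (simp only: \<pi>_bounded_part S.m_closed S.inv_closed)
    qed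
    have gS0: "(a, b, c, d) \<in> S0" using g(1) g' by simp
    have c3: "A \<otimes>\<^bsub>S\<^esub> g \<otimes>\<^bsub>S\<^esub> inv\<^bsub>S\<^esub> A \<in> S0" "B \<otimes>\<^bsub>S\<^esub> g \<otimes>\<^bsub>S\<^esub> inv\<^bsub>S\<^esub> B \<in> S0" "C \<otimes>\<^bsub>S\<^esub> g \<otimes>\<^bsub>S\<^esub> inv\<^bsub>S\<^esub> C \<in> S0"
      using X mem by (auto simp: F_def intro!: cjg)
    note bd = SL2_conj_bound[OF g' gS0 s(1,2) A_def B_def C_def c3]
    from near_scalar[OF gS0 s2 e(1) bd] show "X \<in> U"
      using e(2)[OF gS] e(2)[OF neg_closed[OF gS]] \<pi>_neg[OF gS] g(2) g' by auto
  qed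
  moreover have "openin Tp F" "F \<in> sets \<mu>" "\<one>\<^bsub>P\<^esub> \<in> F"
    unfolding F_def using cj mem \<Gamma> \<Gamma>_sets subgroup.one_closed[OF \<pi>_subgroup[OF S0_subgroup]]
    by (auto intro!: openin_Int sets.Int)
  ultimately show ?thesis by blast
qed

lemma PSL2_radon_extension: "radon_extension P Tp (PSL2_top R T) \<mu> (\<pi> ` S0)"
proof (intro radon_extension.intro radon_extension_axioms.intro nonarch.nonarch_group_axioms)
  show "haar_measure P (PSL2_top R T) \<mu>" by (rule haar)
  show "Hausdorff_space Tp" by (rule Tp_Hausdorff)
  show "subgroup (\<pi> ` S0) P" by (rule \<pi>_subgroup[OF S0_subgroup])
  show "openin Tp (\<pi> ` S0)" by (rule bounded_part_open) simp
  show "emeasure \<mu> (\<pi> ` S0) = 1" by (rule \<mu>_\<Gamma>)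
  show "U \<in> sets \<mu>" if "openin Tp U" for U
    using haar by (intro nonarch.open_sets_generated[OF _ sets_left[OF haar] Tp_base_sets that])
      (simp_all add: haar_measure_def)
qed (fact gelfand_PSL2 sets_right[OF haar] sets_inv[OF haar])+

end

end

subsection \<open>The sign on \<open>PSL\<^sub>2\<close> and its integral\<close>

text \<open>Bounds the measures of the sets I and J below by a third; in the q-adic case the exact
  ratio is 1 / (q + 1), and a third suffices for the sign of the final integral.\<close>

lemma (in haar_gelfand) three_translates:
  assumes K: "subgroup K G" "K \<in> sets M" and J: "J \<in> sets M" "J \<subseteq> K" and x: "x \<in> K" "y \<in> K"
    and disj: "J \<inter> (x <# J) = {}" "J \<inter> (y <# J) = {}" "(x <# J) \<inter> (y <# J) = {}"
    and fin: "emeasure M K \<noteq> \<infinity>"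
  shows "3 * measure M J \<le> measure M K"
proof -
  have xc: "x \<in> carrier G" "y \<in> carrier G" using subgroup.mem_carrier[OF K(1)] x by auto
  have sub: "z <# J \<subseteq> K" if "z \<in> K" for z
    using that J(2) subgroup.m_closed[OF K(1)] by (auto simp: l_coset_def)
  have s: "x <# J \<in> sets M" "y <# J \<in> sets M" using J xc by (simp_all add: coset_sets)
  have "emeasure M (J \<union> (x <# J) \<union> (y <# J)) = emeasure M (J \<union> (x <# J)) + emeasure M (y <# J)"
    using J s disj by (intro plus_emeasure[symmetric]) auto
  also have "emeasure M (J \<union> (x <# J)) = emeasure M J + emeasure M (x <# J)"
    using J s disj by (intro plus_emeasure[symmetric]) auto
  also have "emeasure M J + emeasure M (x <# J) + emeasure M (y <# J) = (1 + 1 + 1) * emeasure M J"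
    unfolding distrib_right using left_inv[OF xc(1) J(1)] left_inv[OF xc(2) J(1)] by simp
  finally have "emeasure M (J \<union> (x <# J) \<union> (y <# J)) = 3 * emeasure M J" by simp
  moreover have "emeasure M (J \<union> (x <# J) \<union> (y <# J)) \<le> emeasure M K"
    using J sub x K by (intro emeasure_mono) auto
  ultimately have "3 * emeasure M J \<le> emeasure M K" by simp
  moreover have "emeasure M J \<noteq> \<infinity>" using emeasure_mono[OF J(2) K(2)] fin by (auto simp: top_unique)
  ultimately have "3 * ennreal (measure M J) \<le> ennreal (measure M K)" using fin by (simp add: emeasure_eq_ennreal_measure)
  then have "ennreal (3 * measure M J) \<le> ennreal (measure M K)" by (simp add: ennreal_mult)
  then show ?thesis by (simp add: ennreal_le_iff)
qed

context valued_field
begin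

text \<open>The sizes in the first column do not see the sign of the representative, so the choice
  is harmless. These pairs tell the translates of I and of J apart.\<close>

definition col :: "'a mat2 set \<Rightarrow> real \<times> real" where
  "col X = (case (SOME g. g \<in> X) of (a, b, c, d) \<Rightarrow> (av a, av c))"

lemma col_\<pi>:
  assumes "(a, b, c, d) \<in> carrier S"
  shows "col (\<pi> (a, b, c, d)) = (av a, av c)"
proof -
  have "(SOME g. g \<in> \<pi> (a, b, c, d)) \<in> \<pi> (a, b, c, d)" using \<pi>_self[OF assms] by (rule someI)
  then have "(SOME g. g \<in> \<pi> (a, b, c, d)) = (a, b, c, d) \<or> (SOME g. g \<in> \<pi> (a, b, c, d)) = (\<ominus> a, \<ominus> b, \<ominus> c, \<ominus> d)"
    using \<pi>_eq[OF assms] by (simp add: neg_def)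
  then show ?thesis using assms by (auto simp: col_def SL2_carrier)
qed

definition psign :: "'a mat2 set \<Rightarrow> real" where
  "psign X = sg (max (fst (col X)) (snd (col X)))"

lemma psign_\<pi>: "g \<in> carrier S \<Longrightarrow> psign (\<pi> g) = sign g"
  by (cases g) (simp add: psign_def col_\<pi> sign_def col_norm_def)

lemma psign_values: "psign X = 1 \<or> psign X = -1"
  by (simp add: psign_def sg_def)

text \<open>A perturbation below the size of the largest entry cannot change the maximum, by the
  ultrametric inequality. Hence the sign is locally constant and measurable.\<close>

lemma col_norm_near:
  assumes g: "g \<in> carrier S" and h: "h \<in> carrier S" and n: "near (col_norm g) g h"
  shows "col_norm h = col_norm g"
proof -
  obtain a b c d where g': "g = (a, b, c, d)" and gc: "a \<in> carrier R" "b \<in> carrier R" "c \<in> carrier R" "d \<in> carrier R"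
    using g by (rule SL2_cases)
  obtain a' b' c' d' where h': "h = (a', b', c', d')" and
    hc: "a' \<in> carrier R" "b' \<in> carrier R" "c' \<in> carrier R" "d' \<in> carrier R"
    using h by (rule SL2_cases)
  define e where "e = col_norm g"
  have e: "e = max (av a) (av c)" by (simp add: e_def g' col_norm_def)
  have n': "av (a' \<ominus> a) < e" "av (c' \<ominus> c) < e" using n by (simp_all add: near_def g' h' e_def)
  have s: "y = (y \<ominus> x) \<oplus> x" if "x \<in> carrier R" "y \<in> carrier R" for x y using that by algebra
  have "av y \<le> e \<and> (av x = e \<longrightarrow> av y = e)" if "x \<in> carrier R" "y \<in> carrier R" "av (y \<ominus> x) < e" "av x \<le> e" for x y
    using that s[OF that(1,2)] av_add_le[of "y \<ominus> x" x e] av_add_eq[of "y \<ominus> x" x] by simp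
  from this[OF gc(1) hc(1) n'(1)] this[OF gc(3) hc(3) n'(2)]
  have "max (av a') (av c') = e" unfolding e by (auto simp: max_def)
  then show ?thesis by (simp add: e_def h' col_norm_def)
qed

lemma psign_open: "openin Tp {X \<in> carrier P. psign X = 1}"
  unfolding openin_Tp popen_def
proof (intro conjI ballI impI)
  fix g assume g: "g \<in> carrier S" "\<pi> g \<in> {X \<in> carrier P. psign X = 1}"
  have "psign (\<pi> h) = 1" if "h \<in> carrier S" "near (col_norm g) g h" for h
    using g col_norm_near[OF g(1) that] that(1) by (simp add: psign_\<pi> sign_def)
  then show "\<exists>e>0. \<forall>h\<in>carrier S. near e g h \<longrightarrow> \<pi> h \<in> {X \<in> carrier P. psign X = 1}"
    using col_norm_pos[OF g(1)] by auto
qed auto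

lemma psign_left:
  assumes "k \<in> \<pi> ` S0" "x \<in> carrier P"
  shows "psign (k \<otimes>\<^bsub>P\<^esub> x) = psign x"
proof -
  obtain k0 g where k0: "k0 \<in> S0" "k = \<pi> k0" and g: "g \<in> carrier S" "x = \<pi> g"
    using assms unfolding P_carrier by blast
  have "psign (k \<otimes>\<^bsub>P\<^esub> x) = psign (\<pi> (k0 \<otimes>\<^bsub>S\<^esub> g))" using k0 g S0_carrier by simp
  then show ?thesis using k0 g S0_carrier by (simp add: psign_\<pi> sign_S0 del: \<pi>.hom_mult)
qed

lemma psign_one: "psign \<one>\<^bsub>P\<^esub> = 1"
  using psign_\<pi>[OF S.one_closed] by (simp add: sign_one)

lemma psign_iwasawa:
  assumes "x \<in> carrier P"
  shows "\<exists>k\<in>\<pi> ` S0. \<forall>y\<in>carrier P. psign (y \<otimes>\<^bsub>P\<^esub> x) = psign x * psign (y \<otimes>\<^bsub>P\<^esub> k)"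
proof -
  obtain g where g: "g \<in> carrier S" "x = \<pi> g" using assms unfolding P_carrier by blast
  obtain k where k: "k \<in> S0" "\<And>y. y \<in> carrier S \<Longrightarrow> sign (y \<otimes>\<^bsub>S\<^esub> g) = sign g * sign (y \<otimes>\<^bsub>S\<^esub> k)"
    using iwasawa_SL2[OF g(1)] by blast
  have "psign (\<pi> y \<otimes>\<^bsub>P\<^esub> x) = psign x * psign (\<pi> y \<otimes>\<^bsub>P\<^esub> \<pi> k)" if y: "y \<in> carrier S" for y
    using k(2)[OF y] y g S0_carrier[OF k(1)] by (simp add: psign_\<pi> flip: \<pi>.hom_mult)
  then show ?thesis using k(1) unfolding P_carrier by blast
qed

text \<open>The bounds on b and c let b c be a unit only if c has its maximal size 1 / Q, so a d - b
  c = 1 forces either a to be a unit or c to be that large; the two signs correspond to whether a is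
  a unit.\<close>

lemma sign_S1:
  assumes "(a, b, c, d) \<in> S1"
  shows "av a = 1 \<and> sign (a, b, c, d) = 1 \<or> av a \<le> 1 / Q \<and> av c = 1 / Q \<and> sign (a, b, c, d) = -1"
proof -
  have gc: "a \<in> carrier R" "b \<in> carrier R" "c \<in> carrier R" "d \<in> carrier R" and det: "a \<otimes> d \<ominus> b \<otimes> c = \<one>"
    and le: "av a \<le> 1" "av b \<le> Q" "av c \<le> 1 / Q" "av d \<le> 1"
    using assms by (auto simp: SL2_carrier bounded_part_iff)
  have Q: "1 / Q < 1" using Q_gt_1 by simp
  show ?thesis
  proof (cases "av a = 1")
    case True
    then have "col_norm (a, b, c, d) = 1" using le(3) Q by (simp add: col_norm_def max_def)
    then show ?thesis using True by (simp add: sign_def sg_one)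
  next
    case False
    then have a: "av a < 1" "av a \<le> 1 / Q" using le(1) av_less_one[OF gc(1)] by auto
    have "av c = 1 / Q"
    proof (rule ccontr)
      assume "av c \<noteq> 1 / Q"
      then have "av c < 1 / Q" using le(3) by simp
      then have "Q * av c < 1" using Q_gt_1 by (simp add: field_simps)
      moreover have "av b * av c \<le> Q * av c" using le(2) gc by (intro mult_right_mono) auto
      moreover have "av a * av d \<le> av a * 1" using le gc by (intro mult_left_mono) auto
      ultimately have "av (a \<otimes> d) < 1" "av (b \<otimes> c) < 1" using a gc by (simp_all add: av_mult)
      then have "av (a \<otimes> d \<ominus> b \<otimes> c) < 1" using av_minus[of "a \<otimes> d" "b \<otimes> c"] gc by simp
      then show False by (simp add: det)
    qed
    moreover from this have "col_norm (a, b, c, d) = 1 / Q" using a by (simp add: col_norm_def max_def)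
    ultimately show ?thesis using a by (simp add: sign_def sg_inverse_Q)
  qed
qed

lemma uniformizer_inv:
  obtains u v where "u \<in> carrier R" "v \<in> carrier R" "u \<otimes> v = \<one>" "v \<otimes> u = \<one>" "av u = 1 / Q" "av v = Q" "u \<noteq> \<zero>"
proof -
  obtain u where u: "u \<in> carrier R" "av u = 1 / Q" using uniformizer by blast
  then have "u \<noteq> \<zero>" using Q_gt_1 by auto
  then show thesis using that[of u "inv u"] u inv_facts[of u] m_comm[of u "inv u"] by simp
qed

text \<open>Outside \<open>S1\<close> the entry c of k is a unit. Scaling the first column by a
  uniformiser makes it the first column of some l in \<open>S1\<close>, and a scaling of odd
  valuation flips the sign.\<close>

lemma S0_not_S1:
  assumes k: "k \<in> S0" "k \<notin> S1"
  shows "\<exists>l\<in>S1. \<forall>y\<in>carrier S. sign (y \<otimes>\<^bsub>S\<^esub> k) = - sign (y \<otimes>\<^bsub>S\<^esub> l)"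
proof -
  obtain a b c d where k': "k = (a, b, c, d)" and kc: "a \<in> carrier R" "b \<in> carrier R" "c \<in> carrier R" "d \<in> carrier R"
    using S0_carrier[OF k(1)] by (rule SL2_cases)
  have le: "av a \<le> 1" "av b \<le> 1" "av c \<le> 1" "av d \<le> 1" using k(1) by (simp_all add: k' bounded_part_iff)
  have "\<not> av c \<le> 1 / Q" using k(2) k(1) le Q_gt_1 by (simp add: k' bounded_part_iff)
  then have c1: "av c = 1" using av_less_one[OF kc(3)] le(3) by fastforce
  obtain u v where u: "u \<in> carrier R" "v \<in> carrier R" "u \<otimes> v = \<one>" "v \<otimes> u = \<one>" "av u = 1 / Q" "av v = Q" "u \<noteq> \<zero>"
    by (rule uniformizer_inv)
  have c0: "c \<noteq> \<zero>" using c1 by auto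
  note i = inv_facts[OF kc(3) c0]
  define l where "l = (u \<otimes> a, \<ominus> (v \<otimes> inv c), u \<otimes> c, \<zero>)"
  have "v \<otimes> inv c \<otimes> (u \<otimes> c) = (v \<otimes> u) \<otimes> (c \<otimes> inv c)" using u i kc by algebra
  then have "v \<otimes> inv c \<otimes> (u \<otimes> c) = \<one>" using u i by simp
  then have l: "l \<in> carrier S" using u i kc by (simp add: l_def SL2_carrier a_minus_def l_minus)
  have "av a / Q \<le> 1" using le(1) Q_gt_1 by (simp add: divide_le_eq)
  then have lS1: "l \<in> S1" using l u i kc c1 by (simp add: l_def bounded_part_iff av_mult)
  have "sign (y \<otimes>\<^bsub>S\<^esub> k) = - sign (y \<otimes>\<^bsub>S\<^esub> l)" if "y \<in> carrier S" for y
    using sign_scaled[OF that l[unfolded l_def] S0_carrier[OF k(1), unfolded k'] u(1) refl refl u(7)]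
    by (simp add: k' l_def u(5) sg_inverse_Q)
  then show ?thesis using lS1 by blast
qed

text \<open>Exchanges the two maximal compact subgroups; it is conjugation by a matrix of determinant
  of odd valuation.\<close>

definition swap :: "'a \<Rightarrow> 'a \<Rightarrow> 'a mat2 \<Rightarrow> 'a mat2" where
  "swap u v g = (case g of (a, b, c, d) \<Rightarrow> (d, v \<otimes> c, u \<otimes> b, a))"

context
  fixes u v
  assumes u: "u \<in> carrier R" "v \<in> carrier R" "u \<otimes> v = \<one>" "v \<otimes> u = \<one>" "av u = 1 / Q" "av v = Q"
begin

lemma uv_cancel: "x \<in> carrier R \<Longrightarrow> u \<otimes> (v \<otimes> x) = x" "x \<in> carrier R \<Longrightarrow> v \<otimes> (u \<otimes> x) = x"
  using u by (simp_all flip: m_assoc)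

lemma uv_prod: "x \<in> carrier R \<Longrightarrow> y \<in> carrier R \<Longrightarrow> (v \<otimes> x) \<otimes> (u \<otimes> y) = x \<otimes> y"
  "x \<in> carrier R \<Longrightarrow> y \<in> carrier R \<Longrightarrow> (u \<otimes> x) \<otimes> (v \<otimes> y) = x \<otimes> y"
proof -
  have "(v \<otimes> x) \<otimes> (u \<otimes> y) = (u \<otimes> v) \<otimes> (x \<otimes> y)" "(u \<otimes> x) \<otimes> (v \<otimes> y) = (u \<otimes> v) \<otimes> (x \<otimes> y)"
    if "x \<in> carrier R" "y \<in> carrier R" using that u(1,2) by algebra+
  then show "x \<in> carrier R \<Longrightarrow> y \<in> carrier R \<Longrightarrow> (v \<otimes> x) \<otimes> (u \<otimes> y) = x \<otimes> y"
    "x \<in> carrier R \<Longrightarrow> y \<in> carrier R \<Longrightarrow> (u \<otimes> x) \<otimes> (v \<otimes> y) = x \<otimes> y" using u by simp_all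
qed

lemma swap_closed:
  assumes g: "g \<in> carrier S"
  shows "swap u v g \<in> carrier S"
proof -
  obtain a b c d where g': "g = (a, b, c, d)" and gc: "a \<in> carrier R" "b \<in> carrier R" "c \<in> carrier R" "d \<in> carrier R"
    and det: "a \<otimes> d \<ominus> b \<otimes> c = \<one>" using g by (rule SL2_cases)
  have "d \<otimes> a \<ominus> c \<otimes> b = a \<otimes> d \<ominus> b \<otimes> c" using gc by algebra
  then show ?thesis using gc u(1,2) det by (simp add: g' swap_def SL2_carrier uv_prod)
qed

lemma swap_mult:
  assumes g: "g \<in> carrier S" and h: "h \<in> carrier S"
  shows "swap u v (g \<otimes>\<^bsub>S\<^esub> h) = swap u v g \<otimes>\<^bsub>S\<^esub> swap u v h"
proof -
  obtain a b c d where g': "g = (a, b, c, d)" and gc: "a \<in> carrier R" "b \<in> carrier R" "c \<in> carrier R" "d \<in> carrier R"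
    using g by (rule SL2_cases)
  obtain a' b' c' d' where h': "h = (a', b', c', d')" and
    hc: "a' \<in> carrier R" "b' \<in> carrier R" "c' \<in> carrier R" "d' \<in> carrier R"
    using h by (rule SL2_cases)
  have "v \<otimes> (c \<otimes> a' \<oplus> d \<otimes> c') = d \<otimes> (v \<otimes> c') \<oplus> v \<otimes> c \<otimes> a'" "u \<otimes> (a \<otimes> b' \<oplus> b \<otimes> d') = u \<otimes> b \<otimes> d' \<oplus> a \<otimes> (u \<otimes> b')"
    using gc hc u(1,2) by algebra+
  then show ?thesis using gc hc u(1,2) by (simp add: g' h' swap_def SL2_mult uv_prod a_comm)
qed

lemma swap_neg: "g \<in> carrier S \<Longrightarrow> swap u v (neg g) = neg (swap u v g)"
  using u(1,2) by (auto elim!: SL2_cases simp: swap_def neg_def r_minus)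

lemma swap_\<pi>: "g \<in> carrier S \<Longrightarrow> swap u v ` \<pi> g = \<pi> (swap u v g)"
  by (simp add: \<pi>_eq swap_closed swap_neg)

lemma swap_S1: "S1 \<subseteq> swap u v ` S0"
proof
  fix g assume g: "g \<in> S1"
  obtain a b c d where g': "g = (a, b, c, d)" and gc: "a \<in> carrier R" "b \<in> carrier R" "c \<in> carrier R" "d \<in> carrier R"
    using S1_carrier[OF g] by (rule SL2_cases)
  have le: "av a \<le> 1" "av b \<le> Q" "av c \<le> 1 / Q" "av d \<le> 1" using g by (simp_all add: g' bounded_part_iff)
  have "Q * av c \<le> 1" using le(3) Q_gt_1 by (simp add: field_simps)
  moreover have "av b / Q \<le> 1" using le(2) Q_gt_1 by simp
  moreover have "(d, v \<otimes> c, u \<otimes> b, a) \<in> carrier S" using swap_closed[OF S1_carrier[OF g]] by (simp add: g' swap_def)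
  ultimately have "(d, v \<otimes> c, u \<otimes> b, a) \<in> S0" using le gc u by (simp add: bounded_part_iff av_mult)
  moreover have "swap u v (d, v \<otimes> c, u \<otimes> b, a) = g" using gc u by (simp add: swap_def g' uv_cancel)
  ultimately show "g \<in> swap u v ` S0" by (metis image_eqI)
qed

lemma swap_inter:
  assumes g: "g \<in> S0 \<inter> S1"
  shows "swap u v g \<in> S0 \<inter> S1"
proof -
  have gS: "g \<in> carrier S" using g S0_carrier by blast
  obtain a b c d where g': "g = (a, b, c, d)" and gc: "a \<in> carrier R" "b \<in> carrier R" "c \<in> carrier R" "d \<in> carrier R"
    using gS by (rule SL2_cases)
  have le: "av a \<le> 1" "av b \<le> 1" "av c \<le> 1 / Q" "av d \<le> 1" using g by (simp_all add: g' bounded_part_iff)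
  have "Q * av c \<le> 1" using le(3) Q_gt_1 by (simp add: field_simps)
  moreover have "av b / Q \<le> 1 / Q" "1 / Q \<le> 1" using le(2) Q_gt_1 by (auto simp: divide_right_mono)
  ultimately show ?thesis using le gc u swap_closed[OF gS] Q_gt_1 order_trans[OF le(3)] by (simp add: g' swap_def bounded_part_iff av_mult)
qed

end

end

section \<open>Measures of the maximal compact subgroups and the negative integral\<close>

context valued_field
begin

lemma translate_\<pi>:
  assumes "X \<in> \<pi> g <#\<^bsub>P\<^esub> Y" "Y \<subseteq> \<pi> ` K" "g \<in> carrier S" "K \<subseteq> carrier S"
  obtains h where "h \<in> K" "\<pi> h \<in> Y" "X = \<pi> (g \<otimes>\<^bsub>S\<^esub> h)"
  using assms by (fastforce simp: l_coset_def)

context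
  fixes M :: "'a mat2 set measure"
  assumes hg: "haar_gelfand P Tp M (\<pi> ` S0)"
begin

interpretation haar: haar_gelfand P Tp M "\<pi> ` S0" by (rule hg)

abbreviation "\<Gamma> \<equiv> \<pi> ` S0"
abbreviation "\<Gamma>' \<equiv> \<pi> ` S1"
abbreviation "I \<equiv> \<pi> ` (S0 \<inter> S1)"

lemma \<Gamma>'_open: "openin Tp \<Gamma>'" "subgroup \<Gamma>' P"
  using bounded_part_open[of Q] Q_gt_1 \<pi>_subgroup[OF S1_subgroup] by simp_all

lemma I_eq: "I = \<Gamma> \<inter> \<Gamma>'"
  using \<pi>_bounded_part S0_carrier by blast

lemma I_open: "openin Tp I" "subgroup I P" "I \<subseteq> \<Gamma>"
  unfolding I_eq using \<Gamma>'_open bounded_part_open[of 1] \<pi>_subgroup[OF S0_subgroup]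
  by (auto intro!: openin_Int P.subgroups_Inter_pair)

text \<open>An infinite index would make the measure of \<Gamma> infinite, as I has nonzero measure.
  The normalisation thus supplies a finiteness usually read off from the residue field.\<close>

lemma I_finite_index: "finite ((\<lambda>x. x <#\<^bsub>P\<^esub> I) ` \<Gamma>)"
proof (rule ccontr)
  assume "infinite ((\<lambda>x. x <#\<^bsub>P\<^esub> I) ` \<Gamma>)"
  then have "emeasure M \<Gamma> = emeasure M I * \<infinity>"
    using haar.open_subgroup_index[OF I_open(2,1,3) haar.left_invariant_M] by simp
  then show False
    using haar.open_subgroup_nonzero[OF I_open(2,1,3)] haar.\<Gamma>(3) by (simp add: ennreal_mult_eq_top_iff ennreal_mult_top)
qed

lemma I_sets: "I \<in> sets M" and \<Gamma>_sets_M: "\<Gamma> \<in> sets M" and \<Gamma>'_sets: "\<Gamma>' \<in> sets M"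
  using I_open(1) \<Gamma>'_open(1) haar.\<Gamma>(2) by (simp_all add: haar.open_sets)

lemma I_emeasure: "emeasure M I \<le> 1"
  using emeasure_mono[OF I_open(3) \<Gamma>_sets_M] haar.\<Gamma>(3) by simp

text \<open>Nonzero because \<Gamma>' contains I. For finiteness, \<open>swap\<close> carries the
  finite decomposition of \<Gamma> into cosets of I to a covering of \<Gamma>' by cosets of I: its
  image of \<open>S0\<close> contains \<open>S1\<close>, and it preserves their
  intersection.\<close>

lemma \<Gamma>'_emeasure: "emeasure M \<Gamma>' \<noteq> 0" "emeasure M \<Gamma>' \<noteq> \<infinity>"
proof -
  show "emeasure M \<Gamma>' \<noteq> 0"
    using haar.open_subgroup_nonzero[OF I_open(2,1,3)] emeasure_mono[of I \<Gamma>', OF _ \<Gamma>'_sets]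
    by (auto simp: I_eq)
  obtain u v where u: "u \<in> carrier R" "v \<in> carrier R" "u \<otimes> v = \<one>" "v \<otimes> u = \<one>" "av u = 1 / Q" "av v = Q" "u \<noteq> \<zero>"
    by (rule uniformizer_inv)
  obtain F where F: "F \<subseteq> \<Gamma>" "finite F" "(\<lambda>x. x <#\<^bsub>P\<^esub> I) ` \<Gamma> = (\<lambda>x. x <#\<^bsub>P\<^esub> I) ` F"
    using finite_subset_image[OF I_finite_index subset_refl] by metis
  have sF: "swap u v ` x \<in> carrier P" if "x \<in> F" for x
    using that F(1) S0_carrier swap_closed[OF u(1-6)] by (auto simp: swap_\<pi>[OF u(1-6)] P_carrier)
  have "\<Gamma>' \<subseteq> (\<Union>x\<in>F. (swap u v ` x) <#\<^bsub>P\<^esub> I)"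
  proof
    fix X assume "X \<in> \<Gamma>'"
    then obtain g where g: "g \<in> S0" "X = \<pi> (swap u v g)" using swap_S1[OF u(1-6)] by blast
    have "\<pi> g \<otimes>\<^bsub>P\<^esub> \<one>\<^bsub>P\<^esub> \<in> \<pi> g <#\<^bsub>P\<^esub> I"
      unfolding l_coset_def using subgroup.one_closed[OF I_open(2)] by blast
    then have "\<pi> g \<in> \<pi> g <#\<^bsub>P\<^esub> I" using S0_carrier[OF g(1)] by simp
    then obtain x where x: "x \<in> F" "\<pi> g \<in> x <#\<^bsub>P\<^esub> I" using F(3) g(1) by blast
    obtain h where h: "h \<in> S0" "x = \<pi> h" using x(1) F(1) by blast
    obtain i where i: "i \<in> S0 \<inter> S1" "\<pi> g = \<pi> (h \<otimes>\<^bsub>S\<^esub> i)"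
      by (rule translate_\<pi>[OF x(2)[unfolded h(2)] subset_refl S0_carrier[OF h(1)]]) (use S0_carrier in auto)
    have c: "g \<in> carrier S" "h \<in> carrier S" "i \<in> carrier S" using g h i S0_carrier by auto
    have "X = swap u v ` \<pi> g" using g c by (simp add: swap_\<pi>[OF u(1-6)])
    also have "\<dots> = \<pi> (swap u v h) \<otimes>\<^bsub>P\<^esub> \<pi> (swap u v i)"
      unfolding i(2) using c by (simp add: swap_\<pi>[OF u(1-6)] swap_mult[OF u(1-6)] swap_closed[OF u(1-6)] del: \<pi>.hom_mult flip: \<pi>.hom_mult)
    also have "\<dots> \<in> (swap u v ` x) <#\<^bsub>P\<^esub> I"
      using swap_inter[OF u(1-6) i(1)] c unfolding h(2) by (auto simp: swap_\<pi>[OF u(1-6)] l_coset_def)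
    finally show "X \<in> (\<Union>x\<in>F. (swap u v ` x) <#\<^bsub>P\<^esub> I)" using x(1) by blast
  qed
  then have "emeasure M \<Gamma>' \<le> emeasure M (\<Union>x\<in>F. (swap u v ` x) <#\<^bsub>P\<^esub> I)"
    using sF I_sets F(2) by (intro emeasure_mono sets.finite_UN) (auto intro: haar.coset_sets)
  also have "\<dots> \<le> (\<Sum>x\<in>F. emeasure M ((swap u v ` x) <#\<^bsub>P\<^esub> I))"
    using sF I_sets F(2) by (intro emeasure_subadditive_finite) (auto intro: haar.coset_sets)
  also have "\<dots> = (\<Sum>x\<in>F. emeasure M I)" using haar.left_inv[OF sF I_sets] by simp
  also have "\<dots> \<le> (\<Sum>x\<in>F. 1)" by (intro sum_mono I_emeasure)
  also have "\<dots> < \<infinity>" by (simp add: of_nat_less_top)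
  finally show "emeasure M \<Gamma>' \<noteq> \<infinity>" by simp
qed

text \<open>I and its two translates are separated by the first column modulo the maximal ideal,
  which gives the points [1:0], [1:1] and [0:1] of the projective line over the residue
  field.\<close>

lemma I_measure: "3 * measure M I \<le> 1"
proof -
  let ?x = "(\<one>, \<zero>, \<one>, \<one>)" and ?y = "(\<zero>, \<ominus> \<one>, \<one>, \<zero>)"
  have xy: "?x \<in> S0" "?y \<in> S0" by (simp_all add: bounded_part_iff SL2_carrier a_minus_def)
  note xyS = xy[THEN S0_carrier]
  have Q: "1 / Q < 1" using Q_gt_1 by simp
  have col_I: "\<exists>a b c d. h = (a, b, c, d) \<and> a \<in> carrier R \<and> b \<in> carrier R \<and> c \<in> carrier R \<and> d \<in> carrier R
      \<and> av a = 1 \<and> av c < 1" if h: "h \<in> S0 \<inter> S1" for h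
  proof -
    obtain a b c d where h': "h = (a, b, c, d)" and hc: "a \<in> carrier R" "b \<in> carrier R" "c \<in> carrier R" "d \<in> carrier R"
      and det: "a \<otimes> d \<ominus> b \<otimes> c = \<one>" by (rule SL2_cases[OF S0_carrier[OF IntD1[OF h]]])
    have le: "av a \<le> 1" "av b \<le> 1" "av c < 1" "av d \<le> 1" using h Q by (auto simp: h' bounded_part_iff)
    have "av a = 1"
    proof (rule ccontr)
      assume "av a \<noteq> 1"
      then have "av a < 1" using le by simp
      moreover have "av a * av d \<le> av a * 1" using le hc by (intro mult_left_mono) auto
      moreover have "av b * av c \<le> 1 * av c" using le hc by (intro mult_right_mono) auto
      ultimately have "av (a \<otimes> d) < 1" "av (b \<otimes> c) < 1" using le(3) hc by (simp_all add: av_mult)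
      then have "av (a \<otimes> d \<ominus> b \<otimes> c) < 1" using av_minus[of "a \<otimes> d" "b \<otimes> c"] hc by simp
      then show False by (simp add: det)
    qed
    then show ?thesis using h' hc le by blast
  qed
  have 1: "fst (col X) = 1 \<and> snd (col X) < 1" if X: "X \<in> I" for X
  proof -
    obtain h where h: "h \<in> S0 \<inter> S1" "X = \<pi> h" using X by blast
    then show ?thesis using col_I[OF h(1)] S0_carrier by (auto simp: col_\<pi>)
  qed
  have 2: "fst (col X) = 1 \<and> snd (col X) = 1" if X: "X \<in> \<pi> ?x <#\<^bsub>P\<^esub> I" for X
  proof -
    obtain h where h: "h \<in> S0 \<inter> S1" "X = \<pi> (?x \<otimes>\<^bsub>S\<^esub> h)"
      by (rule translate_\<pi>[OF X subset_refl xyS(1)]) (use S0_carrier in auto)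
    obtain a b c d where h': "h = (a, b, c, d)" "a \<in> carrier R" "b \<in> carrier R" "c \<in> carrier R" "d \<in> carrier R" "av a = 1" "av c < 1"
      using col_I[OF h(1)] by blast
    have "?x \<otimes>\<^bsub>S\<^esub> h \<in> carrier S" using xyS h S0_carrier by blast
    then have "col X = (av a, av (c \<oplus> a))" unfolding h(2) using h' by (simp add: SL2_mult col_\<pi> a_comm del: \<pi>.hom_mult)
    then show ?thesis using h' by (simp add: av_add_eq)
  qed
  have 3: "fst (col X) < 1" if X: "X \<in> \<pi> ?y <#\<^bsub>P\<^esub> I" for X
  proof -
    obtain h where h: "h \<in> S0 \<inter> S1" "X = \<pi> (?y \<otimes>\<^bsub>S\<^esub> h)"
      by (rule translate_\<pi>[OF X subset_refl xyS(2)]) (use S0_carrier in auto)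
    obtain a b c d where h': "h = (a, b, c, d)" "a \<in> carrier R" "b \<in> carrier R" "c \<in> carrier R" "d \<in> carrier R" "av a = 1" "av c < 1"
      using col_I[OF h(1)] by blast
    have "?y \<otimes>\<^bsub>S\<^esub> h \<in> carrier S" using xyS h S0_carrier by blast
    then have "col X = (av c, av a)" unfolding h(2) using h' by (simp add: SL2_mult col_\<pi> l_minus del: \<pi>.hom_mult)
    then show ?thesis using h' by simp
  qed
  have "3 * measure M I \<le> measure M \<Gamma>"
  proof (rule haar.three_translates[OF haar.\<Gamma>(1) \<Gamma>_sets_M I_sets I_open(3), of "\<pi> ?x" "\<pi> ?y"])
    show "I \<inter> (\<pi> ?x <#\<^bsub>P\<^esub> I) = {}" "I \<inter> (\<pi> ?y <#\<^bsub>P\<^esub> I) = {}" "(\<pi> ?x <#\<^bsub>P\<^esub> I) \<inter> (\<pi> ?y <#\<^bsub>P\<^esub> I) = {}"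
      using 1 2 3 by fastforce+
  qed (use xy haar.\<Gamma>(3) in auto)
  then show ?thesis using haar.\<Gamma>(3) by (simp add: measure_def)
qed

definition J :: "'a mat2 set set" where
  "J = {X \<in> \<Gamma>'. psign X = -1}"

lemma psign_measurable: "psign \<in> borel_measurable M"
proof -
  let ?A = "{X \<in> carrier P. psign X = 1}"
  have "psign X = 2 * indicator ?A X - 1" if "X \<in> space M" for X
    using that psign_values[of X] by (auto simp: haar.space_M indicator_def)
  moreover have m: "(\<lambda>X. 2 * indicator ?A X - 1 :: real) \<in> borel_measurable M"
    using haar.open_sets[OF psign_open] by (intro borel_measurable_diff borel_measurable_times borel_measurable_const borel_measurable_indicator)
  ultimately show ?thesis by (intro measurable_cong[THEN iffD2, OF _ m])
qed

lemma J_sets: "J \<in> sets M"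
proof -
  have "J = \<Gamma>' - {X \<in> carrier P. psign X = 1}"
  proof (intro equalityI subsetI)
    fix X assume "X \<in> \<Gamma>' - {X \<in> carrier P. psign X = 1}"
    then show "X \<in> J" using psign_values[of X] nonarch.open_carrier[OF \<Gamma>'_open(1)] unfolding J_def by blast
  next
    fix X assume "X \<in> J"
    then show "X \<in> \<Gamma>' - {X \<in> carrier P. psign X = 1}" by (simp add: J_def)
  qed
  then show ?thesis using haar.open_sets[OF psign_open] \<Gamma>'_sets by auto
qed

text \<open>The same argument for the other lattice: the column (a, v c) modulo the maximal ideal
  gives [0:1], [1:1] and [1:0] on J and its two translates.\<close>

lemma J_measure: "3 * measure M J \<le> measure M \<Gamma>'"
proof -
  obtain u v where u: "u \<in> carrier R" "v \<in> carrier R" "u \<otimes> v = \<one>" "v \<otimes> u = \<one>" "av u = 1 / Q" "av v = Q" "u \<noteq> \<zero>"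
    by (rule uniformizer_inv)
  let ?x = "(\<one>, v, \<zero>, \<one>)" and ?y = "(\<zero>, v, \<ominus> u, \<zero>)"
  have Q: "1 / Q < 1" using Q_gt_1 by simp
  have xy: "?x \<in> S1" "?y \<in> S1" using u Q_gt_1 by (simp_all add: bounded_part_iff SL2_carrier a_minus_def r_minus)
  note xyS = xy[THEN S1_carrier]
  have JS: "J \<subseteq> \<pi> ` {g \<in> S1. sign g = -1}" using S1_carrier by (auto simp: J_def psign_\<pi>)
  have S1s: "{g \<in> S1. sign g = -1} \<subseteq> carrier S" using S1_carrier by auto
  have col_J: "\<exists>a b c d. h = (a, b, c, d) \<and> a \<in> carrier R \<and> b \<in> carrier R \<and> c \<in> carrier R \<and> d \<in> carrier R
      \<and> av a \<le> 1 / Q \<and> av c = 1 / Q" if h: "h \<in> {g \<in> S1. sign g = -1}" for h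
  proof -
    obtain a b c d where h': "h = (a, b, c, d)" and hc: "a \<in> carrier R" "b \<in> carrier R" "c \<in> carrier R" "d \<in> carrier R"
      by (rule SL2_cases[OF subsetD[OF S1s h]])
    then show ?thesis using sign_S1[of a b c d] h by auto
  qed
  have 1: "fst (col X) < 1" if X: "X \<in> J" for X
  proof -
    obtain h where h: "h \<in> {g \<in> S1. sign g = -1}" "X = \<pi> h" using X JS by blast
    then show ?thesis using col_J[OF h(1)] S1_carrier Q by (auto simp: col_\<pi>)
  qed
  have 2: "fst (col X) = 1 \<and> snd (col X) = 1 / Q" if X: "X \<in> \<pi> ?x <#\<^bsub>P\<^esub> J" for X
  proof -
    obtain h where h: "h \<in> {g \<in> S1. sign g = -1}" "X = \<pi> (?x \<otimes>\<^bsub>S\<^esub> h)"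
      by (rule translate_\<pi>[OF X JS xyS(1) S1s])
    obtain a b c d where h': "h = (a, b, c, d)" "a \<in> carrier R" "b \<in> carrier R" "c \<in> carrier R" "d \<in> carrier R" "av a \<le> 1 / Q" "av c = 1 / Q"
      using col_J[OF h(1)] by blast
    have "?x \<otimes>\<^bsub>S\<^esub> h \<in> carrier S" using xyS h S1_carrier by blast
    then have "col X = (av (a \<oplus> v \<otimes> c), av c)" unfolding h(2) using h' u(2) by (simp add: SL2_mult col_\<pi> del: \<pi>.hom_mult)
    moreover have "av (v \<otimes> c) = 1" using u h' Q_gt_1 by (simp add: av_mult)
    ultimately show ?thesis using h' Q u(2) by (simp add: av_add_eq)
  qed
  have 3: "fst (col X) = 1 \<and> snd (col X) < 1 / Q" if X: "X \<in> \<pi> ?y <#\<^bsub>P\<^esub> J" for X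
  proof -
    obtain h where h: "h \<in> {g \<in> S1. sign g = -1}" "X = \<pi> (?y \<otimes>\<^bsub>S\<^esub> h)"
      by (rule translate_\<pi>[OF X JS xyS(2) S1s])
    obtain a b c d where h': "h = (a, b, c, d)" "a \<in> carrier R" "b \<in> carrier R" "c \<in> carrier R" "d \<in> carrier R" "av a \<le> 1 / Q" "av c = 1 / Q"
      using col_J[OF h(1)] by blast
    have "?y \<otimes>\<^bsub>S\<^esub> h \<in> carrier S" using xyS h S1_carrier by blast
    then have "col X = (av (v \<otimes> c), av (u \<otimes> a))" unfolding h(2) using h' u by (simp add: SL2_mult col_\<pi> l_minus del: \<pi>.hom_mult)
    moreover have "av (v \<otimes> c) = 1" using u h' Q_gt_1 by (simp add: av_mult)
    moreover have "av (u \<otimes> a) < 1 / Q" using u h' le_less_trans[OF h'(6) Q] Q_gt_1 divide_strict_right_mono[of "av a" 1 Q] by (simp add: av_mult)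
    ultimately show ?thesis by simp
  qed
  show ?thesis
  proof (rule haar.three_translates[OF \<Gamma>'_open(2) \<Gamma>'_sets J_sets, of "\<pi> ?x" "\<pi> ?y"])
    show "J \<inter> (\<pi> ?x <#\<^bsub>P\<^esub> J) = {}" "J \<inter> (\<pi> ?y <#\<^bsub>P\<^esub> J) = {}" "(\<pi> ?x <#\<^bsub>P\<^esub> J) \<inter> (\<pi> ?y <#\<^bsub>P\<^esub> J) = {}"
      using 1 2 3 by fastforce+
  qed (use xy \<Gamma>'_emeasure(2) in \<open>auto simp: J_def\<close>)
qed

lemma integral_right_psign:
  assumes k: "k \<in> \<Gamma>'"
  shows "(\<integral>y. indicator \<Gamma>' y * psign (y \<otimes>\<^bsub>P\<^esub> k) \<partial>M) = (\<integral>y. indicator \<Gamma>' y * psign y \<partial>M)"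
proof -
  have kc: "k \<in> carrier P" using k subgroup.mem_carrier[OF \<Gamma>'_open(2)] by blast
  have "(\<integral>y. indicator \<Gamma>' y * psign (y \<otimes>\<^bsub>P\<^esub> k) \<partial>M) = (\<integral>y. indicator \<Gamma>' (y \<otimes>\<^bsub>P\<^esub> k) * psign (y \<otimes>\<^bsub>P\<^esub> k) \<partial>M)"
    using P.subgroup_mult_iff(2)[OF \<Gamma>'_open(2) k]
    by (intro Bochner_Integration.integral_cong) (auto simp: haar.space_M indicator_def)
  also have "\<dots> = (\<integral>y. indicator \<Gamma>' y * psign y \<partial>distr M M (\<lambda>y. y \<otimes>\<^bsub>P\<^esub> k))"
    using psign_measurable \<Gamma>'_sets by (intro integral_distr[symmetric] haar.right_measurable kc borel_measurable_times borel_measurable_indicator)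
  also have "distr M M (\<lambda>y. y \<otimes>\<^bsub>P\<^esub> k) = M" using haar.right_invariant[OF kc] by (simp add: haar.rtrans_def)
  finally show ?thesis .
qed

text \<open>The inner integral is B for x in I and -B on the rest of \<Gamma>, where
  \<open>S0_not_S1\<close> trades x for an element of \<Gamma>' at the cost of a sign. The total is
  B (2 M(I) - 1): B is positive since J fills at most a third of \<Gamma>', and the bracket is
  negative since I fills at most a third of \<Gamma>.\<close>

lemma psign_negative: "(\<integral>x. indicator \<Gamma> x * (\<integral>y. indicator \<Gamma>' y * psign (y \<otimes>\<^bsub>P\<^esub> x) \<partial>M) \<partial>M) < 0"
proof -
  define B where "B = (\<integral>y. indicator \<Gamma>' y * psign y \<partial>M)"
  have fin: "emeasure M \<Gamma>' < \<infinity>" "emeasure M I < \<infinity>" "emeasure M \<Gamma> < \<infinity>"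
    using \<Gamma>'_emeasure(2) le_less_trans[OF I_emeasure] haar.\<Gamma>(3) by (auto simp: less_top)
  have finJ: "emeasure M J < \<infinity>"
    using emeasure_mono[of J \<Gamma>', OF _ \<Gamma>'_sets] fin(1) by (auto simp: J_def)
  have "B = (\<integral>y. indicator \<Gamma>' y - 2 * indicator J y \<partial>M)"
    unfolding B_def using psign_values by (intro Bochner_Integration.integral_cong) (force simp: J_def indicator_def)+
  also have "\<dots> = measure M \<Gamma>' - 2 * measure M J"
    using \<Gamma>'_sets J_sets fin finJ sets.sets_into_space by (subst Bochner_Integration.integral_diff) (auto simp: Int_absorb2)
  finally have B: "B = measure M \<Gamma>' - 2 * measure M J" .
  have "0 < measure M \<Gamma>'" using \<Gamma>'_emeasure by (simp add: measure_def enn2real_positive_iff less_top zero_less_iff_neq_zero)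
  then have B0: "0 < B" using J_measure B by simp
  have val: "(\<integral>y. indicator \<Gamma>' y * psign (y \<otimes>\<^bsub>P\<^esub> x) \<partial>M) = (if x \<in> I then B else - B)" if x: "x \<in> \<Gamma>" for x
  proof (cases "x \<in> I")
    case True
    then show ?thesis using integral_right_psign[of x] by (simp add: I_eq B_def)
  next
    case False
    obtain k where k: "k \<in> S0" "x = \<pi> k" using x by blast
    then have "k \<notin> S1" using False by blast
    then obtain l where l: "l \<in> S1" "\<And>y. y \<in> carrier S \<Longrightarrow> sign (y \<otimes>\<^bsub>S\<^esub> k) = - sign (y \<otimes>\<^bsub>S\<^esub> l)"
      using S0_not_S1[OF k(1)] by blast
    have "psign (y \<otimes>\<^bsub>P\<^esub> x) = - psign (y \<otimes>\<^bsub>P\<^esub> \<pi> l)" if y: "y \<in> carrier P" for y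
    proof -
      obtain g where g: "g \<in> carrier S" "y = \<pi> g" using y unfolding P_carrier by blast
      have "psign (\<pi> (g \<otimes>\<^bsub>S\<^esub> k)) = - psign (\<pi> (g \<otimes>\<^bsub>S\<^esub> l))"
        using l(2)[OF g(1)] g k l S0_carrier S1_carrier by (simp only: psign_\<pi> S.m_closed)
      then show ?thesis using g k l S0_carrier S1_carrier by simp
    qed
    then have "(\<integral>y. indicator \<Gamma>' y * psign (y \<otimes>\<^bsub>P\<^esub> x) \<partial>M) = (\<integral>y. - (indicator \<Gamma>' y * psign (y \<otimes>\<^bsub>P\<^esub> \<pi> l)) \<partial>M)"
      by (intro Bochner_Integration.integral_cong) (auto simp: haar.space_M)
    also have "\<dots> = - B" using integral_right_psign[of "\<pi> l"] l(1) by (simp add: B_def)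
    finally show ?thesis using False by simp
  qed
  have "(\<integral>x. indicator \<Gamma> x * (\<integral>y. indicator \<Gamma>' y * psign (y \<otimes>\<^bsub>P\<^esub> x) \<partial>M) \<partial>M)
    = (\<integral>x. 2 * B * indicator I x - B * indicator \<Gamma> x \<partial>M)"
    using val I_open(3) by (intro Bochner_Integration.integral_cong) (auto simp: indicator_def)
  also have "\<dots> = 2 * B * measure M I - B"
    using I_sets \<Gamma>_sets_M fin haar.\<Gamma>(3) sets.sets_into_space
    by (subst Bochner_Integration.integral_diff) (auto simp: Int_absorb2 measure_def)
  also have "\<dots> = B * (2 * measure M I - 1)" by (simp add: algebra_simps)
  also have "\<dots> < 0" using B0 I_measure by (intro mult_pos_neg) auto
  finally show ?thesis .
qed

end

end

theorem (in valued_field) PSL2_not_star_iso: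
  assumes haar: "haar_measure P (PSL2_top R T) \<mu>" and \<mu>: "emeasure \<mu> (\<pi> ` S0) = 1"
  shows "\<not> star_iso (env_cstar (hecke_L1 P (\<pi> ` S0) \<mu>)) (cstar_corner P (\<pi> ` S0) \<mu>)
    (canonical_surjection P (\<pi> ` S0) \<mu>)"
proof -
  interpret ext: radon_extension P Tp "PSL2_top R T" \<mu> "\<pi> ` S0" by (rule PSL2_radon_extension[OF assms])
  have hg: "haar_gelfand P Tp ext.M (\<pi> ` S0)" by (rule ext.haar.haar_gelfand_axioms)
  have "sign_character P ext.M \<mu> (\<pi> ` S0) (\<pi> ` S1) psign"
  proof (intro sign_character.intro ext.unimodular_extension sign_character_axioms.intro)
    show "\<bar>psign x\<bar> \<le> 1" for x using psign_values[of x] by auto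
  qed (fact ext.haar.\<Gamma> \<Gamma>_sets_M[OF hg] \<Gamma>'_open(2)[OF hg] \<Gamma>'_sets[OF hg] \<Gamma>'_emeasure[OF hg] psign_measurable[OF hg]
      psign_left psign_one psign_iwasawa gelfand_PSL2 psign_negative[OF hg])+
  then show ?thesis by (rule sign_character.not_star_iso)
qed

lemma (in padic) Qp_two: "\<one>\<^bsub>Qp q\<^esub> \<oplus>\<^bsub>Qp q\<^esub> \<one>\<^bsub>Qp q\<^esub> \<noteq> \<zero>\<^bsub>Qp q\<^esub>"
proof -
  have two: "\<one>\<^bsub>Qp q\<^esub> \<oplus>\<^bsub>Qp q\<^esub> \<one>\<^bsub>Qp q\<^esub> = cls (\<lambda>n. 2)" using cauchy_const[of 1] by (simp add: cls_one cls_add)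
  have "qabs (cls (\<lambda>n. 2)) = padic_abs q 2"
    using LIMSEQ_unique[OF qabs_lim[OF cauchy_const[of 2]]] by simp
  moreover have "padic_abs q 2 \<noteq> 0" using q_gt_1 by (simp add: padic_abs_def)
  ultimately show ?thesis using qabs_eq_0[OF Qp.zero_closed] unfolding two by auto
qed

lemma (in padic) Qp_valued_field: "valued_field (Qp q) qabs (real q)"
  using q_gt_1
  by (intro valued_field.intro Qp_field valued_field_axioms.intro qabs_nonneg qabs_eq_0 qabs_mult qabs_add
    qabs_values Qp_two Qp_uniformizer Qp_separable) simp_all

theorem theorem4:
  fixes q :: nat and \<mu> :: "(nat \<Rightarrow> rat) set mat2 set measure"
  assumes "prime q"
    and "haar_measure (PSL2_Qp q) (PSL2_Qp_top q) \<mu>"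
    and "emeasure \<mu> (PSL2_Zp q) = 1"
  shows "\<not> star_iso
            (env_cstar (hecke_L1 (PSL2_Qp q) (PSL2_Zp q) \<mu>))
            (cstar_corner (PSL2_Qp q) (PSL2_Zp q) \<mu>)
            (canonical_surjection (PSL2_Qp q) (PSL2_Zp q) \<mu>)"
proof -
  interpret padic q using assms(1) by unfold_locales
  interpret PSL: valued_field "Qp q" qabs "real q" by (rule Qp_valued_field)
  have "PSL2_Zp q = PSL.\<pi> ` PSL.S0"
  proof -
    have "SL2_Zp q = PSL.S0" by (auto simp: SL2_Zp_def Zp_def PSL.bounded_part_def SL2_def)
    then show ?thesis by (simp add: PSL2_Zp_def PSL.\<pi>_def[abs_def])
  qed
  then show ?thesis using PSL.PSL2_not_star_iso assms(2,3) by simp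
qed

end
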